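(* Let $N\ge5$, $\bar p<p<\min\{4,4^*\}$, $\mu>0$, and let $(a_k)_{k\in\mathbb{N}}$ be a sequence of positive numbers with $a_k\to0^+$ as $k\to+\infty$ and $\mu^{p\gamma_p-2}a_k^{p-2}<\tilde C(N,p)$ for every $k$. For each $k\in\mathbb{N}$ let $u_k\in A^r_{R_0}=\{u\in S_{a_k}\cap H^2_{rad}(\mathbb{R}^N):\|\Delta u\|_2<R_0(a_k,\mu)\}$ be a minimizer of $m_r(a_k,\mu)$, i.e. $E_\mu(u_k)=m_r(a_k,\mu)$. Then: (1) There exists a sequence $\{\varepsilon_k\}\subset\mathbb{R}^+$ with $\varepsilon_k\to0$ such that $-\frac{\mu^2a_k^2}{8}(1+\varepsilon_k)\le m_r(a_k,\mu)\le-\frac{\mu^2a_k^2}{8}$ for all $k\in\mathbb{N}$. (2) The corresponding Lagrange multiplier $\tilde\lambda_k$ satisfies $\tilde\lambda_k\to\left(-\frac{\mu^2}{4}\right)^-$ (convergence from below) as $k\to+\infty$. (3) $\frac{\|\Delta u_k\|_2^2}{\|u_k\|_2^2}\to\frac{\mu^2}{4}$ and $\frac{\|\nabla u_k\|_2^2}{\|u_k\|_2^2}\to\frac\mu2$ as $k\to+\infty$. (4) Let $v_k=\frac{u_k}{\|u_k\|_2}$. Then $v_k\to0$ in $L^q(\mathbb{R}^N)$ for any $q\in(2,4^* )$. Furthermore, $\int_{\mathbb{R}^N}\left(|\xi|^2-\frac\mu2\right)^2|(\mathcal{F}v_k)(\xi)|^2\,d\xi\to0$ as $k\to+\infty$,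 where $\mathcal{F}v_k$ is the Fourier transform of $v_k$.
   Context: All functions are real-valued. $H^2_{rad}(\mathbb{R}^N)$ is the subspace of radial functions of $H^2(\mathbb{R}^N)$. $4^*=\frac{2N}{N-4}$ (for $N\ge5$); $\bar p=2+\frac8N$; $\gamma_p=\frac{N(p-2)}{4p}$. $C_{N,p}>0$ is a fixed constant in the Gagliardo-Nirenberg inequality $\|u\|_p^p\le C_{N,p}^p\|u\|_2^{p(1-\gamma_p)}\|\Delta u\|_2^{p\gamma_p}$ for all $u\in H^2(\mathbb{R}^N)$, and $\tilde C(N,p)=\frac{p}{2(p\gamma_p-1)C_{N,p}^p}\big(\frac{p\gamma_p-2}{p\gamma_p-1}\big)^{p\gamma_p-2}$. $E_\mu(u)=\frac12\|\Delta u\|_2^2-\frac\mu2\|\nabla u\|_2^2-\frac1p\|u\|_p^p$ on $H^2(\mathbb{R}^N)$; $S_a=\{u\in H^2(\mathbb{R}^N):\|u\|_2^2=a^2\}$. For $a>0$ let $h(t)=\frac12t^2-\frac{\mu a}{2}t-\frac{C_{N,p}^p}{p}a^{p(1-\gamma_p)}t^{p\gamma_p}$, $t>0$. When $\mu^{p\gamma_p-2}a^{p-2}<\tilde C(N,p)$, $h$ has exactly two positive zeros $R_0(a,\mu)<R_1(a,\mu)$, and $h>0$ exactly between them. Then $m_r(a,\mu)=\inf\{E_\mu(u):u\in S_a\cap H^2_{rad}(\mathbb{R}^N),\ \|\Delta u\|_2<R_0(a,\mu)\}$. The corresponding Lagrange multiplier $\tilde\lambda_k$ is the real number such that $\Delta^2u_k+\mu\Delta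 u_k-\tilde\lambda_ku_k=|u_k|^{p-2}u_k$ in $\mathbb{R}^N$. The Fourier transform is normalized so that $\|v\|_2^2=(2\pi)^{-N}\int_{\mathbb{R}^N}|\mathcal{F}v|^2\,d\xi$. *)

theory Defs
  imports "HOL-Analysis.Analysis"
begin

text \<open>Elements of $L^p$ and $H^2$ are represented by Borel functions (not quotiented by a.e. equality);
  norms, weak derivatives, radiality and the Fourier transform do not distinguish a.e. equal functions.\<close>

definition Lspace :: "real \<Rightarrow> ('a::euclidean_space \<Rightarrow> 'b::real_normed_vector) set" where
  "Lspace p = {f \<in> borel_measurable lborel. integrable lborel (\<lambda>x. norm (f x) powr p)}"

definition Lnorm :: "real \<Rightarrow> ('a::euclidean_space \<Rightarrow> 'b::real_normed_vector) \<Rightarrow> real" where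
  "Lnorm p f = (LINT x|lborel. norm (f x) powr p) powr (1 / p)"

definition partial_deriv :: "'a::euclidean_space \<Rightarrow> ('a \<Rightarrow> real) \<Rightarrow> 'a \<Rightarrow> real" where
  "partial_deriv i f x = frechet_derivative f (at x) i"

primrec Ck :: "nat \<Rightarrow> ('a::euclidean_space \<Rightarrow> real) \<Rightarrow> bool" where
  "Ck 0 f \<longleftrightarrow> continuous_on UNIV f"
| "Ck (Suc k) f \<longleftrightarrow> (\<forall>x. f differentiable (at x)) \<and> (\<forall>i\<in>Basis. Ck k (partial_deriv i f))"

definition test_fun :: "('a::euclidean_space \<Rightarrow> real) \<Rightarrow> bool" where
  "test_fun \<phi> \<longleftrightarrow> (\<forall>k. Ck k \<phi>) \<and> compact (closure {x. \<phi> x \<noteq> 0})"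

definition locally_integrable :: "('a::euclidean_space \<Rightarrow> real) \<Rightarrow> bool" where
  "locally_integrable f \<longleftrightarrow> (\<forall>K. compact K \<longrightarrow> set_integrable lborel K f)"

definition has_weak_partial :: "('a::euclidean_space \<Rightarrow> real) \<Rightarrow> 'a \<Rightarrow> ('a \<Rightarrow> real) \<Rightarrow> bool" where
  "has_weak_partial u i g \<longleftrightarrow> locally_integrable u \<and> locally_integrable g \<and>
     (\<forall>\<phi>. test_fun \<phi> \<longrightarrow>
        (LINT x|lborel. u x * partial_deriv i \<phi> x) = - (LINT x|lborel. g x * \<phi> x))"

text \<open>Weak derivatives are unique up to null sets, so the choice below only selects a representative.\<close>

definition weak_partial :: "'a::euclidean_space \<Rightarrow> ('a \<Rightarrow> real) \<Rightarrow> 'a \<Rightarrow> real" where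
  "weak_partial i u = (SOME g. has_weak_partial u i g)"

definition weak_grad :: "('a::euclidean_space \<Rightarrow> real) \<Rightarrow> 'a \<Rightarrow> 'a" where
  "weak_grad u x = (\<Sum>i\<in>Basis. weak_partial i u x *\<^sub>R i)"

definition weak_laplacian :: "('a::euclidean_space \<Rightarrow> real) \<Rightarrow> 'a \<Rightarrow> real" where
  "weak_laplacian u x = (\<Sum>i\<in>Basis. weak_partial i (weak_partial i u) x)"

definition H2 :: "('a::euclidean_space \<Rightarrow> real) set" where
  "H2 = {u \<in> Lspace 2. \<exists>g h.
      (\<forall>i\<in>Basis. g i \<in> Lspace 2 \<and> has_weak_partial u i (g i)) \<and>
      (\<forall>i\<in>Basis. \<forall>j\<in>Basis. h i j \<in> Lspace 2 \<and> has_weak_partial (g i) j (h i j))}"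

definition H2_rad :: "('a::euclidean_space \<Rightarrow> real) set" where
  "H2_rad = {u \<in> H2. \<exists>f. AE x in lborel. u x = f (norm x)}"

definition crit_exp :: "nat \<Rightarrow> real" where
  "crit_exp N = 2 * real N / (real N - 4)"

definition p_bar :: "nat \<Rightarrow> real" where
  "p_bar N = 2 + 8 / real N"

definition gamma_exp :: "nat \<Rightarrow> real \<Rightarrow> real" where
  "gamma_exp N p = real N * (p - 2) / (4 * p)"

text \<open>The membership in $L^p$ is part of the inequality: its right-hand side is finite.\<close>

definition GN_constant :: "'a::euclidean_space itself \<Rightarrow> real \<Rightarrow> real \<Rightarrow> bool" where
  "GN_constant T p C \<longleftrightarrow> C > 0 \<and>
     (\<forall>u::'a \<Rightarrow> real. u \<in> H2 \<longrightarrow> u \<in> Lspace p \<and>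
        Lnorm p u powr p \<le> C powr p * Lnorm 2 u powr (p * (1 - gamma_exp DIM('a) p))
                             * Lnorm 2 (weak_laplacian u) powr (p * gamma_exp DIM('a) p))"

definition C_tilde :: "nat \<Rightarrow> real \<Rightarrow> real \<Rightarrow> real" where
  "C_tilde N p C = (let s = p * gamma_exp N p in
     p / (2 * (s - 1) * C powr p) * ((s - 2) / (s - 1)) powr (s - 2))"

definition energy :: "real \<Rightarrow> real \<Rightarrow> ('a::euclidean_space \<Rightarrow> real) \<Rightarrow> real" where
  "energy p \<mu> u = 1/2 * (Lnorm 2 (weak_laplacian u))\<^sup>2 - \<mu>/2 * (Lnorm 2 (weak_grad u))\<^sup>2
                    - 1/p * Lnorm p u powr p"

definition mass_sphere :: "real \<Rightarrow> ('a::euclidean_space \<Rightarrow> real) set" where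
  "mass_sphere a = {u \<in> H2. (Lnorm 2 u)\<^sup>2 = a\<^sup>2}"

definition h_fun :: "nat \<Rightarrow> real \<Rightarrow> real \<Rightarrow> real \<Rightarrow> real \<Rightarrow> real \<Rightarrow> real" where
  "h_fun N p C a \<mu> t = 1/2 * t\<^sup>2 - \<mu> * a / 2 * t
     - C powr p / p * a powr (p * (1 - gamma_exp N p)) * t powr (p * gamma_exp N p)"

definition R0 :: "nat \<Rightarrow> real \<Rightarrow> real \<Rightarrow> real \<Rightarrow> real \<Rightarrow> real" where
  "R0 N p C a \<mu> = (THE r. \<exists>r'. r < r' \<and> {t. t > 0 \<and> h_fun N p C a \<mu> t = 0} = {r, r'})"

definition A_rad :: "real \<Rightarrow> real \<Rightarrow> real \<Rightarrow> real \<Rightarrow> ('a::euclidean_space \<Rightarrow> real) set" where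
  "A_rad p C a \<mu> = {u \<in> mass_sphere a \<inter> H2_rad. Lnorm 2 (weak_laplacian u) < R0 DIM('a) p C a \<mu>}"

definition m_rad :: "'a::euclidean_space itself \<Rightarrow> real \<Rightarrow> real \<Rightarrow> real \<Rightarrow> real \<Rightarrow> real" where
  "m_rad T p C a \<mu> = (INF u\<in>(A_rad p C a \<mu> :: ('a \<Rightarrow> real) set). energy p \<mu> u)"

text \<open>Weak form of $\Delta^2 u + \mu \Delta u - \lambda u = |u|^{p-2} u$, tested against $H^2$.\<close>

definition solves_EL :: "real \<Rightarrow> real \<Rightarrow> real \<Rightarrow> ('a::euclidean_space \<Rightarrow> real) \<Rightarrow> bool" where
  "solves_EL p \<mu> l u \<longleftrightarrow> (\<forall>\<phi>\<in>H2.
      (LINT x|lborel. weak_laplacian u x * weak_laplacian \<phi> x)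
      - \<mu> * (LINT x|lborel. weak_grad u x \<bullet> weak_grad \<phi> x)
      - l * (LINT x|lborel. u x * \<phi> x)
      = (LINT x|lborel. \<bar>u x\<bar> powr (p - 2) * u x * \<phi> x))"

definition lagrange_multiplier :: "real \<Rightarrow> real \<Rightarrow> ('a::euclidean_space \<Rightarrow> real) \<Rightarrow> real" where
  "lagrange_multiplier p \<mu> u = (THE l. solves_EL p \<mu> l u)"

definition fourier_L1 :: "('a::euclidean_space \<Rightarrow> real) \<Rightarrow> 'a \<Rightarrow> complex" where
  "fourier_L1 f \<xi> = (LINT x|lborel. complex_of_real (f x) * cis (- (x \<bullet> \<xi>)))"

text \<open>The $L^2$ Fourier transform (Plancherel extension), as the $L^2$-limit of the transforms of the
  truncations of \<open>v\<close> to balls. Without a prefactor in \<open>fourier_L1\<close>, Plancherel reads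
  $\|v\|_2^2 = (2\pi)^{-N} \|\mathcal{F} v\|_2^2$.\<close>

definition fourier :: "('a::euclidean_space \<Rightarrow> real) \<Rightarrow> 'a \<Rightarrow> complex" where
  "fourier v = (SOME g. g \<in> Lspace 2 \<and>
     (\<lambda>n. Lnorm 2 (\<lambda>\<xi>. g \<xi> - fourier_L1 (\<lambda>x. indicator (cball 0 (real n)) x * v x) \<xi>))
        \<longlonglongrightarrow> 0)"

end

theory Submission
  imports Defs "HOL-Probability.Probability"
begin

text \<open>Since $\|\nabla u\|_2^2 = -\int u \Delta u$, completing the square gives
  $E_\mu(u) = \frac12 \|\Delta u + \frac\mu2 u\|_2^2 - \frac{\mu^2}{8} \|u\|_2^2 - \frac1p \|u\|_p^p$.
  Radial functions whose frequencies concentrate on the sphere $|\xi|^2 = \mu/2$ make the first term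
  arbitrarily small, and they lie in the admissible set because $\mu a < R_0(a,\mu)$; this is the upper bound for $m_r$.
  Conversely $R_0(a,\mu) \le \tau a$ with $\tau$ independent of $a$, so by Gagliardo--Nirenberg $\|u_k\|_p^p = O(a_k^p) = o(a_k^2)$.
  Hence $\|\Delta u_k + \frac\mu2 u_k\|_2^2 = o(a_k^2)$, and $m_r$, the Lagrange multiplier
  $(2 m_r - (1 - \frac2p) \|u_k\|_p^p)/a_k^2$ and the two quotients can be read off.

  By Plancherel the Fourier mass of $v_k$ concentrates on the null set $|\xi|^2 = \mu/2$. Therefore the
  heat evolutions of $v_k$ tend to $0$ uniformly, so $v_k \to 0$ in measure, and a weak-type Sobolev inequality
  upgrades this to convergence in $L^q$. The Euler--Lagrange equation holds for radial variations by
  minimality and for all variations by symmetric criticality.\<close>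

section \<open>Square-integrable functions\<close>

text \<open>Two features of the statement shape the argument. A minimizer competes only with radial
  functions, while \<open>solves_EL\<close> is tested against all of \<open>H2\<close>, so
  stationarity has to be transferred by symmetry. And weak derivatives and \<open>fourier\<close>
  are arbitrary representatives, so identities between them hold only almost everywhere; exact
  pointwise work is done on heat-smoothed functions. The heat kernel is the common tool: its
  transform is an explicit positive Gaussian, so inversion for it is a computation, and Plancherel,
  uniqueness of weak derivatives, the Sobolev bound and the vanishing of \<open>v\<close> follow by
  Fubini and limits. The constant \<tau> is \<mu> (s - 1) / (s - 2) with s = p \<gamma>_p;
  \<open>C_tilde\<close> is precisely the threshold below which h is positive at \<tau> a. The bound
  on the Laplacian is strict, hence inactive for small variations, so only the mass produces a
  multiplier. It lies strictly below -\<mu>^2/4 because 2 m_r \<le> -\<mu>^2 a^2 / 4 and the p-norm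
  of a minimizer is positive.\<close>

definition sq_integrable :: "('a::euclidean_space \<Rightarrow> 'b::euclidean_space) \<Rightarrow> bool" where
  "sq_integrable f \<longleftrightarrow> f \<in> borel_measurable borel \<and> integrable lborel (\<lambda>x. (norm (f x))\<^sup>2)"

text \<open>The squared L2 norm, for real, vector and complex values at once. The integral of a
  non-integrable function is 0, so a bound on \<open>sqnorm\<close> carries information only
  together with \<open>sq_integrable\<close>.\<close>

definition sqnorm :: "('a::euclidean_space \<Rightarrow> 'b::euclidean_space) \<Rightarrow> real" where
  "sqnorm f = (LINT x|lborel. (norm (f x))\<^sup>2)"

lemma norm_powr_2: "norm x powr 2 = (norm x)\<^sup>2"
  by (simp add: powr_numeral)

lemma Lspace_2_iff: "f \<in> Lspace 2 \<longleftrightarrow> sq_integrable f"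
  by (simp add: Lspace_def sq_integrable_def norm_powr_2)

lemma sqnorm_nonneg [simp]: "sqnorm f \<ge> 0"
  by (simp add: sqnorm_def)

lemma Lnorm_2_eq: "Lnorm 2 f = sqrt (sqnorm f)"
  by (simp add: Lnorm_def norm_powr_2 sqnorm_def powr_half_sqrt)

lemma Lnorm_2_squared: "(Lnorm 2 f)\<^sup>2 = sqnorm f"
  by (simp add: Lnorm_2_eq)

lemma sq_integrableD [measurable_dest]: "sq_integrable f \<Longrightarrow> f \<in> borel_measurable borel"
  by (simp add: sq_integrable_def)

lemma sq_integrable_dominated:
  assumes "sq_integrable g" "f \<in> borel_measurable borel" "AE x in lborel. norm (f x) \<le> norm (g x)"
  shows "sq_integrable f"
proof -
  have "integrable lborel (\<lambda>x. (norm (f x))\<^sup>2)"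
    apply (rule Bochner_Integration.integrable_bound[of _ "\<lambda>x. (norm (g x))\<^sup>2"])
    using assms by (auto simp: sq_integrable_def elim!: eventually_mono)
  then show ?thesis using assms by (simp add: sq_integrable_def)
qed

lemma sqnorm_mono:
  assumes "sq_integrable g" "f \<in> borel_measurable borel" "AE x in lborel. norm (f x) \<le> norm (g x)"
  shows "sqnorm f \<le> sqnorm g"
  unfolding sqnorm_def
  apply (rule integral_mono_AE)
  using sq_integrable_dominated[OF assms] assms
  by (auto simp: sq_integrable_def elim!: eventually_mono)

lemma sq_integrable_prod:
  assumes [measurable]: "sq_integrable f" "sq_integrable g"
  shows "integrable lborel (\<lambda>x. norm (f x) * norm (g x))"
proof (rule Bochner_Integration.integrable_bound[of _ "\<lambda>x. (norm (f x))\<^sup>2 + (norm (g x))\<^sup>2"])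
  show "integrable lborel (\<lambda>x. (norm (f x))\<^sup>2 + (norm (g x))\<^sup>2)"
    using assms by (auto simp: sq_integrable_def)
  have "a * b \<le> a\<^sup>2 + b\<^sup>2" if "a \<ge> 0" "b \<ge> 0" for a b :: real
    using sum_squares_bound[of a b] that mult_nonneg_nonneg[of a b] by linarith
  then show "AE x in lborel. norm (norm (f x) * norm (g x)) \<le> norm ((norm (f x))\<^sup>2 + (norm (g x))\<^sup>2)"
    by (auto simp: )
qed simp

lemma sq_integrable_mult:
  fixes f g :: "'a::euclidean_space \<Rightarrow> real"
  assumes [measurable]: "sq_integrable f" "sq_integrable g"
  shows "integrable lborel (\<lambda>x. f x * g x)"
  by (rule Bochner_Integration.integrable_bound[OF sq_integrable_prod[OF assms]]) (auto simp: abs_mult)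

lemma sq_integrable_add:
  assumes [measurable]: "sq_integrable f" "sq_integrable g"
  shows "sq_integrable (\<lambda>x. f x + g x)"
proof -
  have "integrable lborel (\<lambda>x. (norm (f x + g x))\<^sup>2)"
  proof (rule Bochner_Integration.integrable_bound[of _ "\<lambda>x. (norm (f x))\<^sup>2 + (norm (g x))\<^sup>2 + 2 * (norm (f x) * norm (g x))"])
    show "integrable lborel (\<lambda>x. (norm (f x))\<^sup>2 + (norm (g x))\<^sup>2 + 2 * (norm (f x) * norm (g x)))"
      using assms sq_integrable_prod[OF assms] by (auto simp: sq_integrable_def)
    have "(norm (f x + g x))\<^sup>2 \<le> (norm (f x))\<^sup>2 + (norm (g x))\<^sup>2 + 2 * (norm (f x) * norm (g x))" for x
      using power_mono[OF norm_triangle_ineq[of "f x" "g x"], of 2] by (simp add: power2_sum mult.assoc)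
    then show "AE x in lborel. norm ((norm (f x + g x))\<^sup>2) \<le> norm ((norm (f x))\<^sup>2 + (norm (g x))\<^sup>2 + 2 * (norm (f x) * norm (g x)))"
      by (auto simp: abs_of_nonneg)
  qed measurable
  then show ?thesis by (auto simp: sq_integrable_def)
qed

lemma sq_integrable_scaleR:
  assumes "sq_integrable f"
  shows "sq_integrable (\<lambda>x. c *\<^sub>R f x)"
  using assms by (auto simp: sq_integrable_def power_mult_distrib)

lemma sq_integrable_cmult:
  fixes f :: "'a::euclidean_space \<Rightarrow> real"
  shows "sq_integrable f \<Longrightarrow> sq_integrable (\<lambda>x. c * f x)"
  using sq_integrable_scaleR[of f c] by simp

lemma sq_integrable_uminus: "sq_integrable f \<Longrightarrow> sq_integrable (\<lambda>x. - f x)"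
  using sq_integrable_scaleR[of f "-1"] by simp

lemma sq_integrable_diff:
  assumes "sq_integrable f" "sq_integrable g"
  shows "sq_integrable (\<lambda>x. f x - g x)"
  using sq_integrable_add[OF assms(1) sq_integrable_uminus[OF assms(2)]] by simp

lemma sq_integrable_zero [simp]: "sq_integrable (\<lambda>x. 0)"
  by (simp add: sq_integrable_def)

lemma sq_integrable_sum:
  assumes "\<And>i. i \<in> I \<Longrightarrow> sq_integrable (f i)"
  shows "sq_integrable (\<lambda>x. \<Sum>i\<in>I. f i x)"
  using assms by (induction I rule: infinite_finite_induct) (auto intro!: sq_integrable_add)

lemma sqnorm_scaleR: "sqnorm (\<lambda>x. c *\<^sub>R f x) = c\<^sup>2 * sqnorm f"
  by (simp add: sqnorm_def power_mult_distrib)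

lemma sqnorm_cmult: "sqnorm (\<lambda>x. c * f x :: real) = c\<^sup>2 * sqnorm f"
  using sqnorm_scaleR[of c f] by simp

lemma sqnorm_cong_AE:
  assumes "f \<in> borel_measurable borel" "g \<in> borel_measurable borel" "AE x in lborel. f x = g x"
  shows "sqnorm f = sqnorm g"
  unfolding sqnorm_def by (rule integral_cong_AE) (use assms in \<open>auto elim!: eventually_mono\<close>)

lemma sq_integrable_cong_AE:
  assumes "sq_integrable f" "g \<in> borel_measurable borel" "AE x in lborel. f x = g x"
  shows "sq_integrable g"
  by (rule sq_integrable_dominated[OF assms(1,2)]) (use assms(3) in \<open>auto elim!: eventually_mono\<close>)

lemma sqnorm_minus_commute: "sqnorm (\<lambda>x. f x - g x) = sqnorm (\<lambda>x. g x - f x)"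
  by (simp add: sqnorm_def norm_minus_commute)

lemma sqnorm_eq_0_AE:
  assumes "sq_integrable f" "sqnorm f = 0"
  shows "AE x in lborel. f x = 0"
  using assms integral_nonneg_eq_0_iff_AE[of lborel "\<lambda>x. (norm (f x))\<^sup>2"]
  by (auto simp: sq_integrable_def sqnorm_def)

lemma quadratic_nonneg_discriminant:
  fixes A B C :: real
  assumes "\<And>s. A - 2 * s * B + s\<^sup>2 * C \<ge> 0" "C \<ge> 0"
  shows "B\<^sup>2 \<le> A * C"
proof (cases "C = 0")
  case True
  have "B = 0"
  proof (rule ccontr)
    assume "B \<noteq> 0"
    \<comment> \<open>With C = 0 this choice of \<open>s\<close> turns the expression into A - (A +
      1) = -1.\<close>
    with assms(1)[of "(A + 1) / (2 * B)"] True show False by simp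
  qed
  then show ?thesis using True by simp
next
  case False
  then have "C > 0" using assms(2) by simp
  have "A - 2 * (B / C) * B + (B / C)\<^sup>2 * C = A - B\<^sup>2 / C"
    using \<open>C > 0\<close> by (simp add: power2_eq_square field_simps)
  with assms(1)[of "B / C"] have "B\<^sup>2 / C \<le> A" by simp
  then show ?thesis using \<open>C > 0\<close> by (simp add: field_simps)
qed

text \<open>Nonnegativity of the quadratic polynomial in \<open>s\<close> given by integrating the
  square of norm f - s norm g. Using norms instead of inner products lets the same bound serve
  functions on the frequency side, which are complex.\<close>

lemma Cauchy_Schwarz_norm:
  assumes [measurable]: "sq_integrable f" "sq_integrable g"
  shows "(LINT x|lborel. norm (f x) * norm (g x)) \<le> sqrt (sqnorm f) * sqrt (sqnorm g)"
proof -
  have "(LINT x|lborel. norm (f x) * norm (g x))\<^sup>2 \<le> sqnorm f * sqnorm g"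
  proof (rule quadratic_nonneg_discriminant)
    fix s :: real
    have "0 \<le> (LINT x|lborel. (norm (f x) - s * norm (g x))\<^sup>2)" by simp
    also have "\<dots> = (LINT x|lborel. (norm (f x))\<^sup>2 - 2 * s * (norm (f x) * norm (g x)) + s\<^sup>2 * (norm (g x))\<^sup>2)"
      by (simp add: power2_diff power_mult_distrib algebra_simps)
    also have "\<dots> = sqnorm f - 2 * s * (LINT x|lborel. norm (f x) * norm (g x)) + s\<^sup>2 * sqnorm g"
      using assms sq_integrable_prod[OF assms] unfolding sq_integrable_def sqnorm_def
      by (subst Bochner_Integration.integral_add Bochner_Integration.integral_diff; (auto simp: )?)+
    finally show "0 \<le> sqnorm f - 2 * s * (LINT x|lborel. norm (f x) * norm (g x)) + s\<^sup>2 * sqnorm g" .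
  qed simp
  then have "\<bar>LINT x|lborel. norm (f x) * norm (g x)\<bar> \<le> sqrt (sqnorm f * sqnorm g)"
    using real_sqrt_le_mono by fastforce
  then show ?thesis by (simp add: real_sqrt_mult)
qed

lemma Cauchy_Schwarz_real:
  fixes f g :: "'a::euclidean_space \<Rightarrow> real"
  assumes "sq_integrable f" "sq_integrable g"
  shows "\<bar>LINT x|lborel. f x * g x\<bar> \<le> sqrt (sqnorm f) * sqrt (sqnorm g)"
proof -
  have "\<bar>LINT x|lborel. f x * g x\<bar> \<le> (LINT x|lborel. \<bar>f x * g x\<bar>)"
    by (rule integral_abs_bound)
  also have "\<dots> \<le> sqrt (sqnorm f) * sqrt (sqnorm g)"
    using Cauchy_Schwarz_norm[OF assms] by (simp add: abs_mult)
  finally show ?thesis .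
qed

lemma sqnorm_triangle:
  assumes [measurable]: "sq_integrable f" "sq_integrable g"
  shows "sqrt (sqnorm (\<lambda>x. f x + g x)) \<le> sqrt (sqnorm f) + sqrt (sqnorm g)"
proof (rule real_le_lsqrt)
  have "sqnorm (\<lambda>x. f x + g x) \<le> (LINT x|lborel. (norm (f x))\<^sup>2 + (norm (g x))\<^sup>2 + 2 * (norm (f x) * norm (g x)))"
    unfolding sqnorm_def
  proof (rule integral_mono)
    show "integrable lborel (\<lambda>x. (norm (f x + g x))\<^sup>2)"
      using sq_integrable_add[OF assms] by (simp add: sq_integrable_def)
    show "integrable lborel (\<lambda>x. (norm (f x))\<^sup>2 + (norm (g x))\<^sup>2 + 2 * (norm (f x) * norm (g x)))"
      using assms sq_integrable_prod[OF assms] by (auto simp: sq_integrable_def)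
    show "(norm (f x + g x))\<^sup>2 \<le> (norm (f x))\<^sup>2 + (norm (g x))\<^sup>2 + 2 * (norm (f x) * norm (g x))" for x
      using power_mono[OF norm_triangle_ineq[of "f x" "g x"], of 2] by (simp add: power2_sum mult.assoc)
  qed
  also have "\<dots> = sqnorm f + sqnorm g + 2 * (LINT x|lborel. norm (f x) * norm (g x))"
    using assms sq_integrable_prod[OF assms] unfolding sq_integrable_def sqnorm_def
    by (subst Bochner_Integration.integral_add; (auto simp: )?)+
  also have "\<dots> \<le> sqnorm f + sqnorm g + 2 * (sqrt (sqnorm f) * sqrt (sqnorm g))"
    using Cauchy_Schwarz_norm[OF assms] by simp
  also have "\<dots> = (sqrt (sqnorm f) + sqrt (sqnorm g))\<^sup>2"
    by (simp add: power2_sum)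
  finally show "sqnorm (\<lambda>x. f x + g x) \<le> (sqrt (sqnorm f) + sqrt (sqnorm g))\<^sup>2" .
qed (auto)

lemma sqnorm_triangle_diff:
  assumes "sq_integrable f" "sq_integrable g"
  shows "\<bar>sqrt (sqnorm f) - sqrt (sqnorm g)\<bar> \<le> sqrt (sqnorm (\<lambda>x. f x - g x))"
  using sqnorm_triangle[OF sq_integrable_diff[OF assms] assms(2)]
        sqnorm_triangle[OF sq_integrable_diff[OF assms(2,1)] assms(1)]
  by (simp add: sqnorm_minus_commute[of g f])

lemma sqnorm_add_le:
  assumes "sq_integrable f" "sq_integrable g"
  shows "sqnorm (\<lambda>x. f x + g x) \<le> 2 * sqnorm f + 2 * sqnorm g"
proof -
  have "(sqrt (sqnorm (\<lambda>x. f x + g x)))\<^sup>2 \<le> (sqrt (sqnorm f) + sqrt (sqnorm g))\<^sup>2"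
    by (rule power_mono[OF sqnorm_triangle[OF assms]]) simp
  also have "\<dots> \<le> 2 * (sqrt (sqnorm f))\<^sup>2 + 2 * (sqrt (sqnorm g))\<^sup>2"
    using sum_squares_bound[of "sqrt (sqnorm f)" "sqrt (sqnorm g)"] by (simp add: power2_sum)
  finally show ?thesis by simp
qed

lemma tendsto_sqnorm:
  assumes "\<And>n. sq_integrable (f n)" "sq_integrable g" "(\<lambda>n. sqnorm (\<lambda>x. f n x - g x)) \<longlonglongrightarrow> 0"
  shows "(\<lambda>n. sqnorm (f n)) \<longlonglongrightarrow> sqnorm g"
proof -
  have 1: "(\<lambda>n. sqrt (sqnorm (\<lambda>x. f n x - g x))) \<longlonglongrightarrow> 0"
    using tendsto_real_sqrt[OF assms(3)] by simp
  have "(\<lambda>n. sqrt (sqnorm (f n))) \<longlonglongrightarrow> sqrt (sqnorm g)"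
    by (rule LIM_zero_cancel, rule Lim_null_comparison[OF _ 1])
       (use sqnorm_triangle_diff[OF assms(1,2)] in auto)
  from tendsto_power[OF this, of 2] show ?thesis by simp
qed

lemma sqnorm_dominated_convergence:
  assumes [measurable]: "\<And>n. f n \<in> borel_measurable borel" "g \<in> borel_measurable borel"
    and d: "sq_integrable d" "\<And>n. AE x in lborel. norm (f n x) \<le> norm (d x)"
    and lim: "AE x in lborel. (\<lambda>n. f n x) \<longlonglongrightarrow> g x"
  shows "sq_integrable g" "\<And>n. sq_integrable (f n)" "(\<lambda>n. sqnorm (\<lambda>x. f n x - g x)) \<longlonglongrightarrow> 0"
proof -
  have ae: "AE x in lborel. \<forall>n. norm (f n x) \<le> norm (d x)" using d(2) by (simp add: AE_all_countable)
  have g: "AE x in lborel. norm (g x) \<le> norm (d x)"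
    using ae lim
  proof eventually_elim
    case (elim x)
    show ?case by (rule LIMSEQ_le_const2[OF tendsto_norm[OF elim(2)]]) (use elim in auto)
  qed
  show sg: "sq_integrable g" by (rule sq_integrable_dominated[OF d(1) _ g]) simp
  show sf: "sq_integrable (f n)" for n by (rule sq_integrable_dominated[OF d(1) _ d(2)]) simp
  have "(\<lambda>n. LINT x|lborel. (norm (f n x - g x))\<^sup>2) \<longlonglongrightarrow> (LINT x|(lborel::'a measure). 0)"
  proof (rule integral_dominated_convergence)
    show "integrable lborel (\<lambda>x. (2 * norm (d x))\<^sup>2)"
      using d(1) by (simp add: sq_integrable_def power_mult_distrib)
    show "AE x in lborel. (\<lambda>n. (norm (f n x - g x))\<^sup>2) \<longlonglongrightarrow> 0"
      using lim
    proof eventually_elim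
      case (elim x)
      from tendsto_power[OF tendsto_norm[OF LIM_zero[OF elim]], of 2] show ?case by simp
    qed
    show "AE x in lborel. norm ((norm (f n x - g x))\<^sup>2) \<le> (2 * norm (d x))\<^sup>2" for n
      using ae g
    proof eventually_elim
      case (elim x)
      have "norm (f n x - g x) \<le> 2 * norm (d x)"
        using norm_triangle_ineq4[of "f n x" "g x"] elim(1)[rule_format, of n] elim(2) by linarith
      from power_mono[OF this, of 2] show ?case by simp
    qed
  qed (measurable)
  then show "(\<lambda>n. sqnorm (\<lambda>x. f n x - g x)) \<longlonglongrightarrow> 0" by (simp add: sqnorm_def)
qed

text \<open>Needed to compare two L2 limits of Fourier transforms at almost every frequency, where
  multiplication by the unbounded symbol of a derivative passes to the limit pointwise.\<close>

lemma sqnorm_tendsto_AE_subseq: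
  assumes "\<And>n. sq_integrable (f n)" "(\<lambda>n. sqnorm (f n)) \<longlonglongrightarrow> 0"
  shows "\<exists>r::nat \<Rightarrow> nat. strict_mono r \<and> (AE x in lborel. (\<lambda>n. f (r n) x) \<longlonglongrightarrow> 0)"
proof -
  have "\<exists>r::nat\<Rightarrow>nat. strict_mono r \<and> (AE x in lborel. (\<lambda>n. (norm (f (r n) x))\<^sup>2) \<longlonglongrightarrow> 0)"
    by (rule tendsto_L1_AE_subseq) (use assms in \<open>auto simp: sq_integrable_def sqnorm_def\<close>)
  then obtain r :: "nat \<Rightarrow> nat" where r: "strict_mono r" "AE x in lborel. (\<lambda>n. (norm (f (r n) x))\<^sup>2) \<longlonglongrightarrow> 0" by blast
  have "AE x in lborel. (\<lambda>n. f (r n) x) \<longlonglongrightarrow> 0"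
    using r(2)
  proof eventually_elim
    case (elim x)
    from tendsto_real_sqrt[OF elim] show ?case by (simp add: tendsto_norm_zero_iff)
  qed
  with r show ?thesis by blast
qed

text \<open>Riesz--Fischer. Weighting the squared increments of a fast subsequence by \<open>2 ^ k\<close> keeps
  their sum integrable, which yields summable increments almost everywhere.\<close>

lemma sq_integrable_complete:
  fixes f :: "nat \<Rightarrow> 'a::euclidean_space \<Rightarrow> 'b::euclidean_space"
  assumes f: "\<And>n. sq_integrable (f n)"
    and Cauchy: "\<And>e. e > 0 \<Longrightarrow> \<exists>M. \<forall>m\<ge>M. \<forall>n\<ge>M. sqnorm (\<lambda>x. f m x - f n x) < e"
  shows "\<exists>g. sq_integrable g \<and> (\<lambda>n. sqnorm (\<lambda>x. f n x - g x)) \<longlonglongrightarrow> 0"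
proof -
  have [measurable]: "f n \<in> borel_measurable borel" for n using f by (simp add: sq_integrable_def)
  have "\<exists>r. strict_mono (r::nat\<Rightarrow>nat) \<and> (\<forall>k. \<forall>m\<ge>r k. \<forall>n\<ge>r k. sqnorm (\<lambda>x. f m x - f n x) < (1/4)^k)"
  proof -
    have "\<forall>k. \<exists>M. \<forall>m\<ge>M. \<forall>n\<ge>M. sqnorm (\<lambda>x. f m x - f n x) < (1/4)^k"
      using Cauchy by simp
    then obtain M where M: "\<And>k m n. m \<ge> M k \<Longrightarrow> n \<ge> M k \<Longrightarrow> sqnorm (\<lambda>x. f m x - f n x) < (1/4)^k"
      by metis
    \<comment> \<open>Adding \<open>k\<close> to a growing sum makes \<open>r\<close> strictly
      increasing while keeping \<open>M k \<le> r k\<close>.\<close>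
    define r where "r k = k + (\<Sum>j\<le>k. M j)" for k
    have "strict_mono r" by (rule strict_mono_Suc_iff[THEN iffD2]) (auto simp: r_def)
    moreover have "M k \<le> r k" for k
      unfolding r_def using member_le_sum[of k "{..k}" M] by simp
    ultimately show ?thesis using M by (meson le_trans)
  qed
  then obtain r where r: "strict_mono (r::nat\<Rightarrow>nat)"
    and rM: "\<And>k m n. m \<ge> r k \<Longrightarrow> n \<ge> r k \<Longrightarrow> sqnorm (\<lambda>x. f m x - f n x) < (1/4)^k" by blast
  define d where "d k x = f (r (Suc k)) x - f (r k) x" for k x
  have [measurable]: "d k \<in> borel_measurable borel" for k unfolding d_def by measurable
  have di: "integrable lborel (\<lambda>x. (norm (d k x))\<^sup>2)" for k
    using sq_integrable_diff[OF f f] by (auto simp: d_def sq_integrable_def)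
  have dk: "(LINT x|lborel. (norm (d k x))\<^sup>2) \<le> (1/4)^k" for k
    using rM[of k "r (Suc k)" "r k"] r by (auto simp: d_def sqnorm_def strict_mono_less_eq less_imp_le)
  have "(\<integral>\<^sup>+x. (\<Sum>k. ennreal (2^k * (norm (d k x))\<^sup>2)) \<partial>lborel) = (\<Sum>k. \<integral>\<^sup>+x. ennreal (2^k * (norm (d k x))\<^sup>2) \<partial>lborel)"
    by (rule nn_integral_suminf) measurable
  also have "\<dots> \<le> (\<Sum>k. ennreal ((1/2)^k))"
  proof (rule suminf_le)
    fix k
    have "(\<integral>\<^sup>+x. ennreal (2^k * (norm (d k x))\<^sup>2) \<partial>lborel) = ennreal (LINT x|lborel. 2^k * (norm (d k x))\<^sup>2)"
      by (rule nn_integral_eq_integral) (use di in auto)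
    also have "\<dots> \<le> ennreal (2^k * (1/4)^k)"
      using dk[of k] by (intro ennreal_leI) simp
    also have "\<dots> = ennreal ((1/2)^k)" by (simp flip: power_mult_distrib)
    finally show "(\<integral>\<^sup>+x. ennreal (2^k * (norm (d k x))\<^sup>2) \<partial>lborel) \<le> ennreal ((1/2)^k)" .
  qed auto
  also have "\<dots> = ennreal (\<Sum>k. (1/2)^k)"
    by (rule suminf_ennreal2) (auto intro: summable_geometric)
  finally have "(\<integral>\<^sup>+x. (\<Sum>k. ennreal (2^k * (norm (d k x))\<^sup>2)) \<partial>lborel) < \<infinity>"
    by (rule le_less_trans) simp
  then have "AE x in lborel. (\<Sum>k. ennreal (2^k * (norm (d k x))\<^sup>2)) \<noteq> \<infinity>"
    by (intro nn_integral_noteq_infinite) (auto simp: top.not_eq_extremum)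
  then have conv: "AE x in lborel. convergent (\<lambda>k. f (r k) x)"
  proof eventually_elim
    case (elim x)
    have "summable (\<lambda>k. 2^k * (norm (d k x))\<^sup>2)"
      by (rule summable_suminf_not_top) (use elim in auto)
    then have "(\<lambda>k. 2^k * (norm (d k x))\<^sup>2) \<longlonglongrightarrow> 0" by (rule summable_LIMSEQ_zero)
    then have "eventually (\<lambda>k. 2^k * (norm (d k x))\<^sup>2 < 1) sequentially"
      by (rule order_tendstoD) simp
    then obtain K where K: "\<And>k. k \<ge> K \<Longrightarrow> 2^k * (norm (d k x))\<^sup>2 < 1"
      by (auto simp: eventually_sequentially)
    have "summable (\<lambda>k. d k x)"
    proof (rule summable_comparison_test)
      show "\<exists>M. \<forall>k\<ge>M. norm (d k x) \<le> (sqrt (1/2))^k"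
      proof (intro exI allI impI)
        fix k assume "k \<ge> K"
        from K[OF this] have "(norm (d k x))\<^sup>2 \<le> (1/2)^k" by (simp add: field_simps)
        also have "\<dots> = ((sqrt (1/2))^k)\<^sup>2" by (simp flip: power_mult power_even_eq add: mult.commute[of k] power_mult)
        finally show "norm (d k x) \<le> (sqrt (1/2))^k" by (rule power2_le_imp_le) simp
      qed
      show "summable (\<lambda>k. (sqrt (1/2))^k)" by (rule summable_geometric) (simp add: real_sqrt_less_iff)
    qed
    then have "convergent (\<lambda>n. \<Sum>k<n. d k x)" by (simp add: summable_iff_convergent)
    moreover have "(\<Sum>k<n. d k x) = f (r n) x - f (r 0) x" for n
      unfolding d_def by (rule sum_lessThan_telescope)
    ultimately have "convergent (\<lambda>n. f (r n) x - f (r 0) x)" by simp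
    then show "convergent (\<lambda>n. f (r n) x)" by (simp add: convergent_diff_const_right_iff)
  qed
  define g where "g x = lim (\<lambda>k. f (r k) x)" for x
  have [measurable]: "g \<in> borel_measurable borel" unfolding g_def by measurable
  have lim: "AE x in lborel. (\<lambda>k. f (r k) x) \<longlonglongrightarrow> g x"
    using conv unfolding g_def by eventually_elim (simp add: convergent_LIMSEQ_iff)
  \<comment> \<open>Fatou along the subsequence bounds the distance of every late \<open>f n\<close>
    to \<open>g\<close>, so the full sequence converges with the same rate; finiteness of this
    distance also gives square integrability of \<open>g\<close>.\<close>
  have key: "(\<integral>\<^sup>+x. ennreal ((norm (f n x - g x))\<^sup>2) \<partial>lborel) \<le> ennreal ((1/4)^k)" if "n \<ge> r k" for n k
  proof -
    have "(\<integral>\<^sup>+x. ennreal ((norm (f n x - g x))\<^sup>2) \<partial>lborel)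
        = (\<integral>\<^sup>+x. liminf (\<lambda>j. ennreal ((norm (f n x - f (r j) x))\<^sup>2)) \<partial>lborel)"
    proof (rule nn_integral_cong_AE)
      show "AE x in lborel. ennreal ((norm (f n x - g x))\<^sup>2) = liminf (\<lambda>j. ennreal ((norm (f n x - f (r j) x))\<^sup>2))"
        using lim
      proof eventually_elim
        case (elim x)
        have "(\<lambda>j. ennreal ((norm (f n x - f (r j) x))\<^sup>2)) \<longlonglongrightarrow> ennreal ((norm (f n x - g x))\<^sup>2)"
          by (intro tendsto_ennrealI tendsto_intros elim)
        from lim_imp_Liminf[OF _ this] show ?case by simp
      qed
    qed
    also have "\<dots> \<le> liminf (\<lambda>j. \<integral>\<^sup>+x. ennreal ((norm (f n x - f (r j) x))\<^sup>2) \<partial>lborel)"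
      by (rule nn_integral_liminf) measurable
    also have "\<dots> \<le> ennreal ((1/4)^k)"
    proof (rule Liminf_le)
      show "\<forall>\<^sub>F j in sequentially. (\<integral>\<^sup>+x. ennreal ((norm (f n x - f (r j) x))\<^sup>2) \<partial>lborel) \<le> ennreal ((1/4)^k)"
        using eventually_ge_at_top[of k]
      proof eventually_elim
        case (elim j)
        have "(\<integral>\<^sup>+x. ennreal ((norm (f n x - f (r j) x))\<^sup>2) \<partial>lborel) = ennreal (sqnorm (\<lambda>x. f n x - f (r j) x))"
          unfolding sqnorm_def
          by (rule nn_integral_eq_integral) (use sq_integrable_diff[OF f f] in \<open>auto simp: sq_integrable_def\<close>)
        also have "\<dots> \<le> ennreal ((1/4)^k)"
          using rM[of k n "r j"] that elim r by (intro ennreal_leI) (auto simp: strict_mono_less_eq less_imp_le)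
        finally show ?case .
      qed
    qed simp
    finally show ?thesis .
  qed
  have sd: "sq_integrable (\<lambda>x. f n x - g x)" if "n \<ge> r 0" for n
    unfolding sq_integrable_def
  proof
    show "integrable lborel (\<lambda>x. (norm (f n x - g x))\<^sup>2)"
      by (rule integrableI_bounded) (use key[OF that] in \<open>auto simp: le_less_trans\<close>)
  qed measurable
  have "sq_integrable g"
    using sq_integrable_diff[OF f sd[OF order_refl], of "r 0"] by simp
  moreover have "(\<lambda>n. sqnorm (\<lambda>x. f n x - g x)) \<longlonglongrightarrow> 0"
  proof (rule LIMSEQ_I)
    fix e :: real assume "e > 0"
    then obtain k where k: "(1/4::real)^k < e" using real_arch_pow_inv[of e "1/4"] by auto
    have "sqnorm (\<lambda>x. f n x - g x) < e" if "n \<ge> r k" for n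
    proof -
      have n0: "n \<ge> r 0" using that r by (meson le0 le_trans strict_mono_less_eq)
      have "ennreal (sqnorm (\<lambda>x. f n x - g x)) = (\<integral>\<^sup>+x. ennreal ((norm (f n x - g x))\<^sup>2) \<partial>lborel)"
        unfolding sqnorm_def
        by (rule nn_integral_eq_integral[symmetric]) (use sd[OF n0] in \<open>auto simp: sq_integrable_def\<close>)
      also have "\<dots> \<le> ennreal ((1/4)^k)" by (rule key[OF that])
      finally have "sqnorm (\<lambda>x. f n x - g x) \<le> (1/4)^k" by (simp add: ennreal_le_iff)
      with k show ?thesis by simp
    qed
    then show "\<exists>no. \<forall>n\<ge>no. norm (sqnorm (\<lambda>x. f n x - g x) - 0) < e" by auto
  qed
  ultimately show ?thesis by blast
qed

text \<open>These are the truncations that occur in the definition of \<open>fourier\<close>. On a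
  ball square integrability implies integrability, so their transforms are honest integrals.\<close>

lemma sqnorm_truncation:
  fixes f :: "'a::euclidean_space \<Rightarrow> real"
  assumes "sq_integrable f"
  shows "sq_integrable (\<lambda>x. indicator (cball 0 (real n)) x * f x)"
    "(\<lambda>n. sqnorm (\<lambda>x. indicator (cball 0 (real n)) x * f x - f x)) \<longlonglongrightarrow> 0"
proof -
  have [measurable]: "f \<in> borel_measurable borel" using assms by (simp add: sq_integrable_def)
  have lim: "(\<lambda>n. indicator (cball 0 (real n)) x * f x) \<longlonglongrightarrow> f x" for x
  proof (rule tendsto_eventually)
    obtain n0 where "norm x \<le> real n0" using real_arch_simple by blast
    then show "\<forall>\<^sub>F n in sequentially. indicator (cball 0 (real n)) x * f x = f x"
      by (auto simp: eventually_sequentially indicator_def intro!: exI[of _ n0])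
  qed
  note * = sqnorm_dominated_convergence[of "\<lambda>n x. indicator (cball 0 (real n)) x * f x" f f]
  show "(\<lambda>n. sqnorm (\<lambda>x. indicator (cball 0 (real n)) x * f x - f x)) \<longlonglongrightarrow> 0"
    by (rule *(3)) (use assms lim in \<open>auto simp: indicator_def\<close>)
  show "sq_integrable (\<lambda>x. indicator (cball 0 (real n)) x * f x)"
    by (rule *(2)) (use assms lim in \<open>auto simp: indicator_def\<close>)
qed

lemma sq_integrable_indicator_cball: "sq_integrable (indicator (cball 0 r) :: 'a::euclidean_space \<Rightarrow> real)"
proof -
  have "(norm (indicator (cball 0 r) x :: real))\<^sup>2 = indicator (cball 0 r) x" for x :: 'a
    by (auto simp: indicator_def)
  then show ?thesis unfolding sq_integrable_def
    by (auto intro!: integrable_real_indicator emeasure_lborel_cball_finite borel_measurable_indicator)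
qed

lemma sq_integrable_cball_integrable:
  fixes f :: "'a::euclidean_space \<Rightarrow> real"
  assumes "sq_integrable f"
  shows "integrable lborel (\<lambda>x. indicator (cball 0 r) x * f x)"
  by (rule sq_integrable_mult[OF sq_integrable_indicator_cball assms])

text \<open>For the gauge integral, measurability of a function means being a limit of continuous
  functions off a negligible set; on the whole space this coincides with Lebesgue
  measurability.\<close>

lemma borel_measurable_AE_limit_continuous:
  fixes f :: "'a::euclidean_space \<Rightarrow> real"
  assumes "f \<in> borel_measurable borel"
  obtains g where "\<And>n::nat. continuous_on UNIV (g n)" "AE x in lborel. (\<lambda>n. g n x) \<longlonglongrightarrow> f x"
proof -
  have "f \<in> borel_measurable lebesgue" using assms
    by (intro measurable_completion) simp
  then have "f measurable_on UNIV"
    using measurable_on_iff_borel_measurable[of UNIV f] by simp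
  then obtain N g where N: "negligible N" "\<And>n. continuous_on UNIV (g n)"
    "\<And>x. x \<notin> N \<Longrightarrow> (\<lambda>n. g n x) \<longlonglongrightarrow> f x"
    unfolding measurable_on_def by auto
  have "AE x in lebesgue. x \<notin> N"
    using N(1) by (simp add: negligible_iff_null_sets AE_not_in)
  then have "AE x in lborel. x \<notin> N" by (simp add: AE_completion_iff)
  then have "AE x in lborel. (\<lambda>n. g n x) \<longlonglongrightarrow> f x"
    by eventually_elim (rule N(3))
  with that N(2) show ?thesis by blast
qed

text \<open>Values are clamped and space is cut off first, by continuous operations. Passing
  continuous a.e. approximants through the same operations keeps them below a fixed multiple of the
  indicator of a ball, so their a.e. convergence becomes L2 convergence.\<close>

lemma sq_integrable_approx_continuous:
  fixes f :: "'a::euclidean_space \<Rightarrow> real"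
  assumes f: "sq_integrable f" and "e > 0"
  obtains g r M where "continuous_on UNIV g" "\<And>x. norm x > r \<Longrightarrow> g x = 0" "\<And>x. \<bar>g x\<bar> \<le> M"
    "sq_integrable g" "sqnorm (\<lambda>x. f x - g x) < e"
proof -
  have [measurable]: "f \<in> borel_measurable borel" using f by (simp add: sq_integrable_def)
  define c where "c n x = max 0 (min 1 (real n + 1 - norm x))" for n and x :: 'a
  define clamp where "clamp n t = max (- real n) (min (real n) t)" for n and t :: real
  define F where "F n x = c n x * clamp n (f x)" for n x
  have c: "0 \<le> c n x" "c n x \<le> 1" for n x by (auto simp: c_def)
  have cl: "\<bar>clamp n t\<bar> \<le> \<bar>t\<bar>" "\<bar>clamp n t\<bar> \<le> real n" for n t by (auto simp: clamp_def)
  have lim: "(\<lambda>n. F n x) \<longlonglongrightarrow> f x" for x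
  proof (rule tendsto_eventually)
    obtain n0 where n0: "norm x + \<bar>f x\<bar> \<le> real n0" using real_arch_simple by blast
    have "F n x = f x" if "n \<ge> n0" for n
    proof -
      have "norm x \<le> real n" "\<bar>f x\<bar> \<le> real n" using n0 that norm_ge_zero[of x] abs_ge_zero[of "f x"] of_nat_mono[OF that, where 'a=real]
        by linarith+
      then show ?thesis by (auto simp: F_def c_def clamp_def)
    qed
    then show "\<forall>\<^sub>F n in sequentially. F n x = f x" by (auto simp: eventually_sequentially)
  qed
  have Fle: "\<bar>F n x\<bar> \<le> \<bar>f x\<bar>" for n x
    using mult_mono[OF c(2)[of n x] cl(1)[of n "f x"]] c(1)[of n x] by (auto simp: F_def abs_mult)
  have [measurable]: "c n \<in> borel_measurable borel" "clamp n \<in> borel_measurable borel" for n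
    unfolding c_def clamp_def by measurable
  have [measurable]: "F n \<in> borel_measurable borel" for n unfolding F_def by measurable
  note * = sqnorm_dominated_convergence[of F f f]
  have sF: "sq_integrable (F n)" for n by (rule *(2)) (use f Fle lim in auto)
  have "(\<lambda>n. sqnorm (\<lambda>x. F n x - f x)) \<longlonglongrightarrow> 0" by (rule *(3)) (use f Fle lim in auto)
  then have "eventually (\<lambda>n. sqnorm (\<lambda>x. F n x - f x) < e / 4) sequentially"
    by (rule order_tendstoD) (use \<open>e > 0\<close> in auto)
  then obtain n where n: "sqnorm (\<lambda>x. F n x - f x) < e / 4" by (auto simp: eventually_sequentially)
  obtain g where g: "\<And>m::nat. continuous_on UNIV (g m)" "AE x in lborel. (\<lambda>m. g m x) \<longlonglongrightarrow> f x"
    using borel_measurable_AE_limit_continuous[of f] by auto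
  have [measurable]: "g m \<in> borel_measurable borel" for m
    using g(1) by (simp add: borel_measurable_continuous_onI)
  define G where "G m x = c n x * clamp n (g m x)" for m x
  have Gc: "continuous_on UNIV (G m)" for m
    unfolding G_def c_def clamp_def by (intro continuous_intros g(1))
  have Gb: "\<bar>G m x\<bar> \<le> real n" for m x
    using mult_mono[OF c(2)[of n x] cl(2)[of n "g m x"]] c(1)[of n x] by (auto simp: G_def abs_mult)
  have Gs: "G m x = 0" if "norm x > real n + 1" for m x using that by (auto simp: G_def c_def)
  have [measurable]: "G m \<in> borel_measurable borel" for m unfolding G_def by measurable
  have d: "sq_integrable (\<lambda>x. real n * indicator (cball 0 (real n + 1)) (x::'a))"
    by (intro sq_integrable_cmult sq_integrable_indicator_cball)
  have Gd: "norm (G m x) \<le> norm (real n * indicator (cball 0 (real n + 1)) x)" for m x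
    using Gb[of m x] Gs[of x m] by (auto simp: indicator_def)
  have Glim: "AE x in lborel. (\<lambda>m. G m x) \<longlonglongrightarrow> F n x"
    using g(2) unfolding G_def F_def clamp_def by eventually_elim (intro tendsto_intros)
  note * = sqnorm_dominated_convergence[of G "F n" "\<lambda>x. real n * indicator (cball 0 (real n + 1)) x"]
  have sG: "sq_integrable (G m)" for m by (rule *(2)) (use d Gd Glim in auto)
  have "(\<lambda>m. sqnorm (\<lambda>x. G m x - F n x)) \<longlonglongrightarrow> 0" by (rule *(3)) (use d Gd Glim in auto)
  then have "eventually (\<lambda>m. sqnorm (\<lambda>x. G m x - F n x) < e / 4) sequentially"
    by (rule order_tendstoD) (use \<open>e > 0\<close> in auto)
  then obtain m where m: "sqnorm (\<lambda>x. G m x - F n x) < e / 4" by (auto simp: eventually_sequentially)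
  have "sqnorm (\<lambda>x. f x - G m x) = sqnorm (\<lambda>x. (f x - F n x) + (F n x - G m x))" by simp
  also have "\<dots> \<le> 2 * sqnorm (\<lambda>x. f x - F n x) + 2 * sqnorm (\<lambda>x. F n x - G m x)"
    by (intro sqnorm_add_le sq_integrable_diff sF sG f)
  also have "\<dots> < e" using m n sqnorm_minus_commute[of f "F n"] sqnorm_minus_commute[of "F n" "G m"] by simp
  finally show ?thesis using that[of "G m" "real n + 1" "real n"] Gc Gb Gs sG by auto
qed

section \<open>Smooth test functions\<close>

lemma partial_derivI: "(f has_derivative D) (at x) \<Longrightarrow> partial_deriv i f x = D i"
  unfolding partial_deriv_def by (metis frechet_derivative_at)

text \<open>The classical smooth function that is flat at 0. The power of \<open>t\<close> in the
  denominator is carried along because differentiation only shifts \<open>m\<close>, which makes the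
  family closed under derivatives.\<close>

definition flat_exp :: "nat \<Rightarrow> real \<Rightarrow> real" where
  "flat_exp m t = (if t \<le> 0 then 0 else exp (- 1 / t) / t ^ m)"

lemma flat_exp_nonneg: "flat_exp m t \<ge> 0"
  by (simp add: flat_exp_def)

lemma flat_exp_tendsto_0: "(flat_exp m \<longlongrightarrow> 0) (at 0)"
proof (rule filterlim_split_at)
  show "(flat_exp m \<longlongrightarrow> 0) (at_left 0)"
    by (rule tendsto_eventually) (auto simp: flat_exp_def eventually_at_filter)
  have "((\<lambda>t::real. (inverse t) ^ m / exp (inverse t)) \<longlongrightarrow> 0) (at_right 0)"
    by (rule filterlim_compose[OF tendsto_power_div_exp_0 filterlim_inverse_at_top_right])
  moreover have "\<forall>\<^sub>F t in at_right (0::real). (inverse t) ^ m / exp (inverse t) = flat_exp m t"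
    using eventually_at_right_less[of 0]
    by eventually_elim (auto simp: flat_exp_def exp_minus field_simps power_inverse)
  ultimately show "(flat_exp m \<longlongrightarrow> 0) (at_right 0)"
    using Lim_transform_eventually by blast
qed

lemma flat_exp_has_derivative:
  "(flat_exp m has_real_derivative flat_exp (m + 2) t - real m * flat_exp (m + 1) t) (at t)"
proof (cases t "0::real" rule: linorder_cases)
  case less
  have "((\<lambda>t. 0) has_real_derivative 0) (at t)" by simp
  then have "(flat_exp m has_real_derivative 0) (at t)"
    by (rule has_field_derivative_transform_within_open[of _ _ _ "{..<0}"])
       (use less in \<open>auto simp: flat_exp_def\<close>)
  then show ?thesis using less by (simp add: flat_exp_def)
next
  case equal
  \<comment> \<open>The difference quotient of \<open>flat_exp m\<close> at 0 is
    \<open>flat_exp (Suc m)\<close>, so the limit just proved is the derivative.\<close>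
  have "(flat_exp m has_real_derivative 0) (at 0)"
    unfolding has_field_derivative_iff
  proof (rule Lim_transform_eventually[OF flat_exp_tendsto_0[of "Suc m"]])
    show "\<forall>\<^sub>F y in at 0. flat_exp (Suc m) y = (flat_exp m y - flat_exp m 0) / (y - 0)"
      by (auto simp: flat_exp_def eventually_at_filter)
  qed
  then show ?thesis using equal by (simp add: flat_exp_def)
next
  case greater
  have "((\<lambda>t. exp (- 1 / t) / t ^ m) has_real_derivative flat_exp (m + 2) t - real m * flat_exp (m + 1) t) (at t)"
    using greater
    apply (auto intro!: derivative_eq_intros simp: flat_exp_def)
    apply (cases m)
    apply (auto simp: field_simps power2_eq_square)
    done
  then show ?thesis
    by (rule has_field_derivative_transform_within_open[of _ _ _ "{0<..}"])
       (use greater in \<open>auto simp: flat_exp_def\<close>)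
qed

text \<open>A family of functions closed under partial derivatives, hence consisting of smooth functions.\<close>

inductive elementary_smooth :: "('a::euclidean_space \<Rightarrow> real) \<Rightarrow> bool" where
  "elementary_smooth (\<lambda>x. c)"
| "elementary_smooth (\<lambda>x. x \<bullet> b)"
| "elementary_smooth (\<lambda>x. x \<bullet> x)"
| "elementary_smooth f \<Longrightarrow> elementary_smooth (\<lambda>x. flat_exp m (f x))"
| "elementary_smooth f \<Longrightarrow> elementary_smooth (\<lambda>x. cos (f x))"
| "elementary_smooth f \<Longrightarrow> elementary_smooth (\<lambda>x. sin (f x))"
| "elementary_smooth f \<Longrightarrow> elementary_smooth g \<Longrightarrow> elementary_smooth (\<lambda>x. f x + g x)"
| "elementary_smooth f \<Longrightarrow> elementary_smooth g \<Longrightarrow> elementary_smooth (\<lambda>x. f x * g x)"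

lemma elementary_smooth_minus:
  "elementary_smooth f \<Longrightarrow> elementary_smooth g \<Longrightarrow> elementary_smooth (\<lambda>x. f x - g x)"
  using elementary_smooth.intros(7)[OF _ elementary_smooth.intros(8)[OF elementary_smooth.intros(1)[of "-1"], of g], of f]
  by simp

lemma has_derivative_compose_real:
  fixes f :: "'a::euclidean_space \<Rightarrow> real"
  assumes "(f has_derivative D) (at x)" "(g has_real_derivative g') (at (f x))"
  shows "((\<lambda>x. g (f x)) has_derivative (\<lambda>h. g' * D h)) (at x)"
  using has_derivative_compose[OF assms(1), of g "(*) g'"] assms(2)
  by (simp add: has_field_derivative_def)

lemma elementary_smooth_derivative:
  assumes "elementary_smooth f"
  shows "\<exists>D. (\<forall>x. (f has_derivative D x) (at x)) \<and> (\<forall>i. elementary_smooth (\<lambda>x. D x i))"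
  using assms
proof induction
  case (1 c)
  show ?case by (rule exI[of _ "\<lambda>x h. 0"]) (auto intro: elementary_smooth.intros)
next
  case (2 b)
  show ?case by (rule exI[of _ "\<lambda>x h. h \<bullet> b"])
    (auto intro: elementary_smooth.intros bounded_linear_imp_has_derivative bounded_linear_inner_left)
next
  case 3
  have "((\<lambda>x::'a. x \<bullet> x) has_derivative (\<lambda>h. 2 * (x \<bullet> h))) (at x)" for x
    by (auto intro!: derivative_eq_intros simp: inner_commute)
  then show ?case
    by (intro exI[of _ "\<lambda>x h. 2 * (x \<bullet> h)"]) (auto intro: elementary_smooth.intros)
next
  case (4 f m)
  then obtain D where D: "\<And>x. (f has_derivative D x) (at x)" "\<And>i. elementary_smooth (\<lambda>x. D x i)" by blast
  show ?case
    by (intro exI[of _ "\<lambda>x h. (flat_exp (m + 2) (f x) - real m * flat_exp (m + 1) (f x)) * D x h"] conjI allI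
        has_derivative_compose_real D flat_exp_has_derivative elementary_smooth.intros(1,4,8) elementary_smooth_minus 4)
next
  case (5 f)
  then obtain D where D: "\<And>x. (f has_derivative D x) (at x)" "\<And>i. elementary_smooth (\<lambda>x. D x i)" by blast
  \<comment> \<open>The factor \<open>-1\<close> stands for the sign of the derivative because the
    inductive class is built from constants, sums and products.\<close>
  have "((\<lambda>x. cos (f x)) has_derivative (\<lambda>h. (-1 * sin (f x)) * D x h)) (at x)" for x
    by (rule has_derivative_compose_real[OF D(1)]) (auto intro!: derivative_eq_intros)
  then show ?case
    by (intro exI[of _ "\<lambda>x h. (-1 * sin (f x)) * D x h"] conjI allI D elementary_smooth.intros(1,6,8) 5)
next
  case (6 f)
  then obtain D where D: "\<And>x. (f has_derivative D x) (at x)" "\<And>i. elementary_smooth (\<lambda>x. D x i)" by blast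
  have "((\<lambda>x. sin (f x)) has_derivative (\<lambda>h. cos (f x) * D x h)) (at x)" for x
    by (rule has_derivative_compose_real[OF D(1)]) (auto intro!: derivative_eq_intros)
  then show ?case
    by (intro exI[of _ "\<lambda>x h. cos (f x) * D x h"] conjI allI D elementary_smooth.intros(5,8) 6)
next
  case (7 f g)
  then obtain D E where D: "\<And>x. (f has_derivative D x) (at x)" "\<And>i. elementary_smooth (\<lambda>x. D x i)"
    "\<And>x. (g has_derivative E x) (at x)" "\<And>i. elementary_smooth (\<lambda>x. E x i)" by blast
  show ?case
    by (intro exI[of _ "\<lambda>x h. D x h + E x h"] conjI allI has_derivative_add D elementary_smooth.intros(7))
next
  case (8 f g)
  then obtain D E where D: "\<And>x. (f has_derivative D x) (at x)" "\<And>i. elementary_smooth (\<lambda>x. D x i)"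
    "\<And>x. (g has_derivative E x) (at x)" "\<And>i. elementary_smooth (\<lambda>x. E x i)" by blast
  show ?case
    by (intro exI[of _ "\<lambda>x h. f x * E x h + D x h * g x"] conjI allI has_derivative_mult D
        elementary_smooth.intros(7,8) 8)
qed

lemma elementary_smooth_Ck: "elementary_smooth f \<Longrightarrow> Ck k f"
proof (induction k arbitrary: f)
  case 0
  then obtain D where "\<And>x. (f has_derivative D x) (at x)" using elementary_smooth_derivative by blast
  then show ?case by (auto intro!: continuous_at_imp_continuous_on has_derivative_continuous)
next
  case (Suc k)
  then obtain D where D: "\<And>x. (f has_derivative D x) (at x)" "\<And>i. elementary_smooth (\<lambda>x. D x i)"
    using elementary_smooth_derivative by blast
  have "partial_deriv i f = (\<lambda>x. D x i)" for i using partial_derivI[OF D(1)] by blast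
  then show ?case using D Suc.IH by (auto simp: differentiable_def)
qed

lemma elementary_smooth_test_fun:
  fixes f :: "'a::euclidean_space \<Rightarrow> real"
  assumes "elementary_smooth f" "\<And>x. norm x > r \<Longrightarrow> f x = 0"
  shows "test_fun f"
  unfolding test_fun_def
proof (intro conjI allI elementary_smooth_Ck assms(1))
  have "{x. f x \<noteq> 0} \<subseteq> cball 0 r" using assms(2) by (force simp: not_less)
  then have "closure {x. f x \<noteq> 0} \<subseteq> cball 0 r" by (rule closure_minimal) simp
  then show "compact (closure {x. f x \<noteq> 0})"
    by (meson closed_closure compact_cball compact_Int_closed inf.absorb2 inf.orderE bounded_subset bounded_cball compact_eq_bounded_closed)
qed

text \<open>The standard mollifier profile exp (-1 / (1 - |x|^2 / R^2)), supported in the ball of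
  radius \<open>R\<close>. The factor \<open>exp 1\<close> normalises its value at the origin to 1,
  so that the bumps tend to 1 pointwise as \<open>R\<close> grows.\<close>

definition bump :: "real \<Rightarrow> 'a::euclidean_space \<Rightarrow> real" where
  "bump R x = exp 1 * flat_exp 0 (1 - (1 / R\<^sup>2) * (x \<bullet> x))"

lemma elementary_smooth_bump: "elementary_smooth (bump R)"
  unfolding bump_def [abs_def] by (intro elementary_smooth.intros elementary_smooth_minus)

lemma bump_eq_0: "R > 0 \<Longrightarrow> norm x \<ge> R \<Longrightarrow> bump R x = 0"
  using power_mono[of R "norm x" 2] by (auto simp: bump_def flat_exp_def power2_norm_eq_inner field_simps)

lemma bump_pos: "R > 0 \<Longrightarrow> norm x < R \<Longrightarrow> bump R x > 0"
  using power_strict_mono[of "norm x" R 2] by (auto simp: bump_def flat_exp_def power2_norm_eq_inner field_simps)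

lemma bump_nonneg: "bump R x \<ge> 0"
  by (simp add: bump_def flat_exp_nonneg)

lemma bump_le_1: "bump R x \<le> 1"
proof -
  have "exp 1 * exp (- 1 / t) \<le> (1::real)" if "0 < t" "t \<le> 1" for t :: real
  proof -
    have "exp 1 * exp (- 1 / t) = exp (1 - 1 / t)" by (simp flip: exp_add)
    also have "\<dots> \<le> 1" using that by (simp add: field_simps)
    finally show ?thesis .
  qed
  then show ?thesis by (auto simp: bump_def flat_exp_def)
qed

lemma bump_tendsto_1: "(\<lambda>n. bump (real (Suc n)) x) \<longlonglongrightarrow> 1"
proof -
  have "(\<lambda>n. (1 / (real (Suc n))\<^sup>2) * (x \<bullet> x)) \<longlonglongrightarrow> 0 * (x \<bullet> x)"
  proof (intro tendsto_intros)
    have "(\<lambda>n. (1 / real (Suc n))\<^sup>2) \<longlonglongrightarrow> 0\<^sup>2" by (intro tendsto_intros LIMSEQ_Suc[OF lim_1_over_n])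
    then show "(\<lambda>n. 1 / (real (Suc n))\<^sup>2) \<longlonglongrightarrow> 0" by (simp add: power_divide)
  qed
  then have "(\<lambda>n. 1 - (1 / (real (Suc n))\<^sup>2) * (x \<bullet> x)) \<longlonglongrightarrow> 1" by (auto intro: tendsto_eq_intros)
  moreover have "isCont (flat_exp 0) 1" using flat_exp_has_derivative DERIV_isCont by blast
  ultimately have "(\<lambda>n. flat_exp 0 (1 - (1 / (real (Suc n))\<^sup>2) * (x \<bullet> x))) \<longlonglongrightarrow> flat_exp 0 1"
    using isCont_tendsto_compose by blast
  then have "(\<lambda>n. exp 1 * flat_exp 0 (1 - (1 / (real (Suc n))\<^sup>2) * (x \<bullet> x))) \<longlonglongrightarrow> exp 1 * flat_exp 0 1"
    by (intro tendsto_intros)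
  moreover have "exp 1 * flat_exp 0 1 = 1" by (simp add: flat_exp_def flip: exp_add)
  ultimately show ?thesis by (simp add: bump_def)
qed

text \<open>With s = 1 / t the left side is s^2 exp (-s). Squaring s / 2 \<le> exp (s / 2 - 1)
  bounds it by 4 / e^2, which is at most 1 because e \<ge> 2.\<close>

lemma flat_exp_2_le: "flat_exp 2 t \<le> 1"
proof (cases "t \<le> 0")
  case False
  define s where "s = 1 / t"
  have "s > 0" using False by (simp add: s_def)
  have "s / 2 \<le> exp (s/2 - 1)" using exp_ge_add_one_self[of "s/2 - 1"] by simp
  then have "(s / 2)\<^sup>2 \<le> (exp (s/2 - 1))\<^sup>2" using \<open>s > 0\<close> by (intro power_mono) auto
  also have "\<dots> = exp (s - 2)" by (simp flip: exp_double)
  also have "\<dots> = exp s / (exp 1)\<^sup>2" by (simp add: exp_diff flip: exp_double)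
  finally have "s\<^sup>2 \<le> exp s * (4 / (exp 1)\<^sup>2)" by (simp add: power2_eq_square field_simps)
  also have "\<dots> \<le> exp s * 1"
  proof (rule mult_left_mono)
    have "2\<^sup>2 \<le> (exp 1 :: real)\<^sup>2" using exp_ge_add_one_self[of 1] by (intro power_mono) auto
    then show "4 / (exp 1)\<^sup>2 \<le> (1::real)" by simp
  qed simp
  finally have "s\<^sup>2 * exp (- s) \<le> 1" by (simp add: exp_minus field_simps)
  then show ?thesis using False by (simp add: flat_exp_def s_def power_divide)
qed (simp add: flat_exp_def)

lemma bump_has_derivative:
  "(bump R has_derivative (\<lambda>h. exp 1 * (flat_exp 2 (1 - (1 / R\<^sup>2) * (x \<bullet> x)) * (- (2 / R\<^sup>2) * (x \<bullet> h))))) (at x)"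
proof -
  have "((\<lambda>x. x \<bullet> x) has_derivative (\<lambda>h. 2 * (x \<bullet> h))) (at x)"
    by (auto intro!: derivative_eq_intros simp: inner_commute)
  from has_derivative_diff[OF has_derivative_const[of 1] has_derivative_mult_right[OF this, of "1 / R\<^sup>2"]]
  have "((\<lambda>x. 1 - (1 / R\<^sup>2) * (x \<bullet> x)) has_derivative (\<lambda>h. - (2 / R\<^sup>2) * (x \<bullet> h))) (at x)"
    by simp
  from has_derivative_compose_real[OF this flat_exp_has_derivative[of 0]]
  have "((\<lambda>x. flat_exp 0 (1 - (1 / R\<^sup>2) * (x \<bullet> x))) has_derivative
    (\<lambda>h. flat_exp 2 (1 - (1 / R\<^sup>2) * (x \<bullet> x)) * (- (2 / R\<^sup>2) * (x \<bullet> h)))) (at x)" by (simp add: numeral_2_eq_2)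
  from has_derivative_mult_right[OF this] show ?thesis unfolding bump_def[abs_def] .
qed

definition bump_partial :: "real \<Rightarrow> 'a::euclidean_space \<Rightarrow> 'a \<Rightarrow> real" where
  "bump_partial R i x = exp 1 * (flat_exp 2 (1 - (1 / R\<^sup>2) * (x \<bullet> x)) * (- (2 / R\<^sup>2) * (x \<bullet> i)))"

text \<open>Inside the ball a coordinate of \<open>x\<close> is at most \<open>R\<close> against the
  factor 2 / R^2; outside, the profile vanishes. This decay in \<open>R\<close> is what makes the
  error of cutting off a function disappear when the cutoff is differentiated.\<close>

lemma bump_partial_bound:
  assumes "R > 0" "i \<in> Basis"
  shows "\<bar>bump_partial R i x\<bar> \<le> 2 * exp 1 / R"
proof (cases "norm x \<ge> R")
  case True
  then have "flat_exp 2 (1 - (1 / R\<^sup>2) * (x \<bullet> x)) = 0"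
    using power_mono[of R "norm x" 2] \<open>R > 0\<close> by (auto simp: flat_exp_def power2_norm_eq_inner field_simps)
  then show ?thesis using assms by (simp add: bump_partial_def)
next
  case False
  have "\<bar>x \<bullet> i\<bar> \<le> R" using Basis_le_norm[OF assms(2), of x] False by simp
  then have "\<bar>flat_exp 2 (1 - (1 / R\<^sup>2) * (x \<bullet> x)) * (- (2 / R\<^sup>2) * (x \<bullet> i))\<bar> \<le> 1 * ((2 / R\<^sup>2) * R)"
    unfolding abs_mult using flat_exp_2_le flat_exp_nonneg
    by (intro mult_mono) (auto simp: abs_of_nonneg)
  also have "\<dots> = 2 / R" using \<open>R > 0\<close> by (simp add: power2_eq_square)
  finally have "exp 1 * \<bar>flat_exp 2 (1 - (1 / R\<^sup>2) * (x \<bullet> x)) * (- (2 / R\<^sup>2) * (x \<bullet> i))\<bar> \<le> exp 1 * (2 / R)"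
    by (intro mult_left_mono) auto
  then show ?thesis by (simp add: bump_partial_def abs_mult mult.commute)
qed

lemma bump_trig_test_fun:
  assumes "R > 0"
  shows "test_fun (\<lambda>x. bump R x * cos (x \<bullet> \<xi>))" "test_fun (\<lambda>x. bump R x * sin (x \<bullet> \<xi>))"
  using bump_eq_0[OF assms less_imp_le]
  by (auto simp del: mult_eq_0_iff intro!: elementary_smooth_test_fun[of _ R] elementary_smooth.intros elementary_smooth_bump)

lemma bump_trig_partial:
  "partial_deriv i (\<lambda>x. bump R x * cos (x \<bullet> \<xi>)) x = bump_partial R i x * cos (x \<bullet> \<xi>) - (i \<bullet> \<xi>) * (bump R x * sin (x \<bullet> \<xi>))"
  "partial_deriv i (\<lambda>x. bump R x * sin (x \<bullet> \<xi>)) x = bump_partial R i x * sin (x \<bullet> \<xi>) + (i \<bullet> \<xi>) * (bump R x * cos (x \<bullet> \<xi>))"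
proof -
  have l: "((\<lambda>x. x \<bullet> \<xi>) has_derivative (\<lambda>h. h \<bullet> \<xi>)) (at x)"
    by (auto intro: bounded_linear_imp_has_derivative bounded_linear_inner_left)
  have c: "((\<lambda>x. cos (x \<bullet> \<xi>)) has_derivative (\<lambda>h. - sin (x \<bullet> \<xi>) * (h \<bullet> \<xi>))) (at x)"
    by (rule has_derivative_compose_real[OF l]) (auto intro!: derivative_eq_intros)
  have s: "((\<lambda>x. sin (x \<bullet> \<xi>)) has_derivative (\<lambda>h. cos (x \<bullet> \<xi>) * (h \<bullet> \<xi>))) (at x)"
    by (rule has_derivative_compose_real[OF l]) (auto intro!: derivative_eq_intros)
  show "partial_deriv i (\<lambda>x. bump R x * cos (x \<bullet> \<xi>)) x = bump_partial R i x * cos (x \<bullet> \<xi>) - (i \<bullet> \<xi>) * (bump R x * sin (x \<bullet> \<xi>))"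
    by (subst partial_derivI[OF has_derivative_mult[OF bump_has_derivative c]]) (simp add: bump_partial_def algebra_simps)
  show "partial_deriv i (\<lambda>x. bump R x * sin (x \<bullet> \<xi>)) x = bump_partial R i x * sin (x \<bullet> \<xi>) + (i \<bullet> \<xi>) * (bump R x * cos (x \<bullet> \<xi>))"
    by (subst partial_derivI[OF has_derivative_mult[OF bump_has_derivative s]]) (simp add: bump_partial_def algebra_simps)
qed

lemma bump_partial_measurable [measurable]: "bump_partial R i \<in> borel_measurable borel"
  unfolding bump_partial_def flat_exp_def by measurable

lemma bump_measurable [measurable]: "bump R \<in> borel_measurable borel"
  unfolding bump_def flat_exp_def by measurable

section \<open>Gaussians and the heat semigroup\<close>

lemma cis_measurable [measurable (raw)]:
  "f \<in> borel_measurable M \<Longrightarrow> (\<lambda>x. cis (f x)) \<in> borel_measurable M"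
  by (rule borel_measurable_continuous_on[of cis]) (auto intro!: continuous_intros)

section \<open>Affine changes of variables for Lebesgue measure\<close>

lemma lborel_nn_integral_affine:
  fixes f :: "'a::euclidean_space \<Rightarrow> ennreal"
  assumes [measurable]: "f \<in> borel_measurable borel" and "c \<noteq> 0"
  shows "(\<integral>\<^sup>+x. f x \<partial>lborel) = ennreal (\<bar>c\<bar> ^ DIM('a)) * (\<integral>\<^sup>+x. f (t + c *\<^sub>R x) \<partial>lborel)"
  by (subst lborel_affine[OF assms(2), of t])
     (simp add: nn_integral_density nn_integral_distr nn_integral_cmult)

lemma lborel_integrable_affine:
  fixes f :: "'a::euclidean_space \<Rightarrow> 'b::{banach, second_countable_topology}"
  assumes [measurable]: "f \<in> borel_measurable borel" and "c \<noteq> 0"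
  shows "integrable lborel (\<lambda>x. f (t + c *\<^sub>R x)) \<longleftrightarrow> integrable lborel f"
proof -
  have "integrable lborel f \<longleftrightarrow> integrable lborel (\<lambda>x. \<bar>c\<bar> ^ DIM('a) *\<^sub>R f (t + c *\<^sub>R x))"
    by (subst lborel_affine[OF assms(2), of t])
       (simp add: integrable_density integrable_distr_eq)
  moreover have "integrable lborel (\<lambda>x. f (t + c *\<^sub>R x))"
    if "integrable lborel (\<lambda>x. \<bar>c\<bar> ^ DIM('a) *\<^sub>R f (t + c *\<^sub>R x))"
    using integrable_scaleR_right[OF that, of "1 / \<bar>c\<bar> ^ DIM('a)"] assms(2) by simp
  ultimately show ?thesis by (auto intro: integrable_scaleR_right)
qed

lemma lborel_integral_affine:
  fixes f :: "'a::euclidean_space \<Rightarrow> 'b::{banach, second_countable_topology}"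
  assumes [measurable]: "f \<in> borel_measurable borel" and "c \<noteq> 0"
  shows "(LINT x|lborel. f x) = \<bar>c\<bar> ^ DIM('a) *\<^sub>R (LINT x|lborel. f (t + c *\<^sub>R x))"
proof -
  have "(LINT x|lborel. f x) = (LINT x|lborel. \<bar>c\<bar> ^ DIM('a) *\<^sub>R f (t + c *\<^sub>R x))"
    by (subst lborel_affine[OF assms(2), of t])
       (simp add: integral_density integral_distr)
  then show ?thesis by simp
qed

lemma lborel_integral_reflect:
  fixes f :: "'a::euclidean_space \<Rightarrow> 'b::{banach, second_countable_topology}"
  assumes "f \<in> borel_measurable borel"
  shows "(LINT y|lborel. f (x - y)) = (LINT y|lborel. f y)"
    "integrable lborel (\<lambda>y. f (x - y)) \<longleftrightarrow> integrable lborel f"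
  using lborel_integral_affine[OF assms, of "-1" x] lborel_integrable_affine[OF assms, of "-1" x] by simp_all

lemma lborel_integral_translate:
  fixes f :: "'a::euclidean_space \<Rightarrow> 'b::{banach, second_countable_topology}"
  assumes "f \<in> borel_measurable borel"
  shows "(LINT y|lborel. f (y + x)) = (LINT y|lborel. f y)"
    "integrable lborel (\<lambda>y. f (y + x)) \<longleftrightarrow> integrable lborel f"
  using lborel_integral_affine[OF assms, of 1 x] lborel_integrable_affine[OF assms, of 1 x]
  by (simp_all add: add.commute)

text \<open>Read off from the characteristic function exp (-z^2 / 2) of the standard normal
  distribution by scaling the variable with c = sqrt (2 t).\<close>

lemma gaussian_fourier_1d:
  fixes t z :: real
  assumes "t > 0"
  shows "integrable lborel (\<lambda>x::real. exp (- t * x\<^sup>2))"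
    "(LINT x|lborel. complex_of_real (exp (- t * x\<^sup>2)) * cis (z * x)) = complex_of_real (sqrt (pi / t) * exp (- z\<^sup>2 / (4 * t)))"
proof -
  define c where "c = sqrt (2 * t)"
  have c: "c > 0" "c\<^sup>2 = 2 * t" using assms by (auto simp: c_def)
  have e: "std_normal_density (c * x) = exp (- t * x\<^sup>2) / sqrt (2 * pi)" for x
    by (simp add: normal_density_def power_mult_distrib c)
  have "integrable lborel std_normal_density" by simp
  then have "integrable lborel (\<lambda>x. std_normal_density (0 + c * x))"
    by (rule lborel_integrable_real_affine) (use c in simp)
  then have "integrable lborel (\<lambda>x. sqrt (2 * pi) * std_normal_density (0 + c * x))"
    by (rule integrable_mult_right)
  then show "integrable lborel (\<lambda>x::real. exp (- t * x\<^sup>2))"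
    by (simp add: e)
  have "complex_of_real (exp (- (z / c)\<^sup>2 / 2)) = (CLINT x|std_normal_distribution. iexp (z / c * x))"
    using char_std_normal_distribution[THEN fun_cong, of "z / c"] unfolding char_def by (rule sym)
  also have "\<dots> = (LINT x|lborel. std_normal_density x *\<^sub>R iexp (z / c * x))"
    by (subst integral_density) auto
  also have "\<dots> = c *\<^sub>R (LINT x|lborel. std_normal_density (c * x) *\<^sub>R iexp (z / c * (c * x)))"
    by (subst lborel_integral_real_affine[of c _ 0]) (use c in auto)
  also have "\<dots> = c *\<^sub>R (LINT x|lborel. (1 / sqrt (2 * pi)) *\<^sub>R (complex_of_real (exp (- t * x\<^sup>2)) * cis (z * x)))"
    unfolding e using c by (simp add: cis_conv_exp scaleR_conv_of_real field_simps)
  also have "\<dots> = (c / sqrt (2 * pi)) *\<^sub>R (LINT x|lborel. complex_of_real (exp (- t * x\<^sup>2)) * cis (z * x))"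
    by (subst integral_scaleR_right) simp
  finally have *: "complex_of_real (exp (- (z / c)\<^sup>2 / 2)) = (c / sqrt (2 * pi)) *\<^sub>R (LINT x|lborel. complex_of_real (exp (- t * x\<^sup>2)) * cis (z * x))" .
  have "c / sqrt (2 * pi) = 1 / sqrt (pi / t)"
    using assms by (simp add: c_def real_sqrt_divide real_sqrt_mult)
  then have "(LINT x|lborel. complex_of_real (exp (- t * x\<^sup>2)) * cis (z * x)) = sqrt (pi / t) *\<^sub>R complex_of_real (exp (- (z / c)\<^sup>2 / 2))"
    unfolding * using assms by simp
  also have "\<dots> = complex_of_real (sqrt (pi / t) * exp (- z\<^sup>2 / (4 * t)))"
    by (simp add: power_divide c scaleR_conv_of_real)
  finally show "(LINT x|lborel. complex_of_real (exp (- t * x\<^sup>2)) * cis (z * x)) = complex_of_real (sqrt (pi / t) * exp (- z\<^sup>2 / (4 * t)))" .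
qed

lemma cis_sum: "finite A \<Longrightarrow> cis (\<Sum>b\<in>A. f b) = (\<Prod>b\<in>A. cis (f b))"
  by (induction A rule: finite_induct) (auto simp: cis_mult[symmetric])

text \<open>Gaussian and character both factor over the coordinates, and \<open>lborel\<close> is
  the image of a product of one-dimensional Lebesgue measures, so the integral is a product of
  one-dimensional ones.\<close>

lemma gaussian_fourier:
  fixes z :: "'a::euclidean_space"
  assumes "t > 0"
  shows "integrable lborel (\<lambda>x::'a. exp (- t * (x \<bullet> x)))"
    "(LINT x|lborel. complex_of_real (exp (- t * (x \<bullet> x))) * cis (x \<bullet> z))
       = complex_of_real ((pi / t) powr (real DIM('a) / 2) * exp (- (z \<bullet> z) / (4 * t)))"
proof -
  interpret product_sigma_finite "\<lambda>b::'a. lborel :: real measure"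
    by (simp add: product_sigma_finite_def sigma_finite_lborel)
  let ?g = "\<lambda>b s. complex_of_real (exp (- t * s\<^sup>2)) * cis ((z \<bullet> b) * s)"
  have [measurable]: "?g b \<in> borel_measurable borel" for b by measurable
  let ?T = "\<lambda>f. \<Sum>b\<in>Basis. f b *\<^sub>R (b::'a)"
  have g: "integrable lborel (?g b)" for b
    by (rule Bochner_Integration.integrable_bound[OF gaussian_fourier_1d(1)[OF assms]])
       (auto simp: norm_mult)
  have coord: "?T f \<bullet> b = f b" if "b \<in> Basis" for f b
    using that by (simp add: inner_sum_left inner_Basis if_distrib cong: if_cong)
  have eq: "complex_of_real (exp (- t * (?T f \<bullet> ?T f))) * cis (?T f \<bullet> z) = (\<Prod>b\<in>Basis. ?g b (f b))" for f
  proof -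
    have "?T f \<bullet> ?T f = (\<Sum>b\<in>Basis. (f b)\<^sup>2)"
      by (subst euclidean_inner) (simp add: coord power2_eq_square)
    moreover have "?T f \<bullet> z = (\<Sum>b\<in>Basis. (z \<bullet> b) * f b)"
      by (subst euclidean_inner) (simp add: coord mult.commute)
    ultimately show ?thesis
      by (simp add: sum_distrib_left exp_sum cis_sum prod.distrib)
  qed
  have meas: "?T \<in> Pi\<^sub>M Basis (\<lambda>b. lborel) \<rightarrow>\<^sub>M borel" by measurable
  have meas': "(\<lambda>x::'a. complex_of_real (exp (- t * (x \<bullet> x))) * cis (x \<bullet> z)) \<in> borel_measurable borel"
    by measurable
  have "integrable (Pi\<^sub>M Basis (\<lambda>b. lborel)) (\<lambda>f. complex_of_real (exp (- t * (?T f \<bullet> ?T f))) * cis (?T f \<bullet> z))"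
    unfolding eq by (rule product_integrable_prod) (use g in auto)
  then have intb: "integrable lborel (\<lambda>x::'a. complex_of_real (exp (- t * (x \<bullet> x))) * cis (x \<bullet> z))"
    unfolding lborel_eq[where 'a='a] by (subst integrable_distr_eq[OF meas meas'])
  have "integrable lborel (\<lambda>x::'a. norm (complex_of_real (exp (- t * (x \<bullet> x))) * cis (x \<bullet> z)))"
    by (rule integrable_norm[OF intb])
  then show "integrable lborel (\<lambda>x::'a. exp (- t * (x \<bullet> x)))" by (simp add: norm_mult)
  have "(LINT x|lborel. complex_of_real (exp (- t * (x \<bullet> x))) * cis (x \<bullet> z)) = (\<Prod>b\<in>Basis. integral\<^sup>L lborel (?g b))"
    unfolding lborel_eq[where 'a='a] integral_distr[OF meas meas'] eq
    by (rule product_integral_prod) (use g in auto)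
  also have "\<dots> = (\<Prod>b\<in>Basis. complex_of_real (sqrt (pi / t) * exp (- (z \<bullet> b)\<^sup>2 / (4 * t))))"
    by (simp only: gaussian_fourier_1d(2)[OF assms])
  also have "\<dots> = complex_of_real (sqrt (pi / t) ^ DIM('a) * exp (\<Sum>b\<in>Basis. - (z \<bullet> b)\<^sup>2 / (4 * t)))"
    by (simp add: prod.distrib exp_sum)
  also have "(\<Sum>b\<in>Basis. - (z \<bullet> b)\<^sup>2 / (4 * t)) = - (z \<bullet> z) / (4 * t)"
    by (subst euclidean_inner[of z z]) (simp add: sum_divide_distrib power2_eq_square sum_negf)
  also have "sqrt (pi / t) ^ DIM('a) = (pi / t) powr (real DIM('a) / 2)"
    using assms by (simp add: powr_half_sqrt[symmetric] powr_realpow[symmetric] powr_powr del: powr_half_sqrt)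
  finally show "(LINT x|lborel. complex_of_real (exp (- t * (x \<bullet> x))) * cis (x \<bullet> z))
       = complex_of_real ((pi / t) powr (real DIM('a) / 2) * exp (- (z \<bullet> z) / (4 * t)))" .
qed

lemma gaussian_integral:
  assumes "t > 0"
  shows "(LINT x|lborel. exp (- t * ((x::'a::euclidean_space) \<bullet> x))) = (pi / t) powr (real DIM('a) / 2)"
proof -
  have "complex_of_real (LINT x|lborel. exp (- t * ((x::'a) \<bullet> x))) = complex_of_real ((pi / t) powr (real DIM('a) / 2))"
    using gaussian_fourier(2)[OF assms, of "0::'a"] by simp
  then show ?thesis by (simp only: of_real_eq_iff)
qed

definition heat :: "real \<Rightarrow> 'a::euclidean_space \<Rightarrow> real" where
  "heat t x = (4 * pi * t) powr (- real DIM('a) / 2) * exp (- (1 / (4 * t)) * (x \<bullet> x))"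

lemma heat_pos: "t > 0 \<Longrightarrow> heat t x > 0"
  by (simp add: heat_def)

lemma heat_measurable [measurable]: "heat t \<in> borel_measurable borel"
  unfolding heat_def by measurable

lemma heat_minus [simp]: "heat t (- x) = heat t x"
  by (simp add: heat_def)

lemma heat_commute: "heat t (x - y) = heat t (y - x)"
  using heat_minus[of t "x - y"] by simp

lemma heat_integrable: "t > 0 \<Longrightarrow> integrable lborel (heat t)"
  unfolding heat_def [abs_def] using gaussian_fourier(1)[of "1 / (4 * t)"] by simp

lemma heat_fourier:
  fixes z :: "'a::euclidean_space"
  assumes "t > 0"
  shows "(LINT x|lborel. complex_of_real (heat t x) * cis (x \<bullet> z)) = complex_of_real (exp (- t * (z \<bullet> z)))"
proof -
  define A where "A = (4 * pi * t) powr (- real DIM('a) / 2)"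
  have pi4: "pi / (1 / (4 * t)) = 4 * pi * t" using assms by simp
  have A: "A * (pi / (1 / (4 * t))) powr (real DIM('a) / 2) = 1"
    unfolding A_def pi4 using assms by (simp flip: powr_add)
  have "(LINT x|lborel. complex_of_real (heat t x) * cis (x \<bullet> z))
      = complex_of_real A * (LINT x|lborel. complex_of_real (exp (- (1 / (4 * t)) * (x \<bullet> x))) * cis (x \<bullet> z))"
    unfolding heat_def A_def[symmetric] by (simp only: of_real_mult mult.assoc integral_mult_right_zero)
  also have "\<dots> = complex_of_real (A * (pi / (1 / (4 * t))) powr (real DIM('a) / 2) * exp (- (z \<bullet> z) / (4 * (1 / (4 * t)))))"
    using gaussian_fourier(2)[of "1 / (4 * t)" z] assms by (simp add: mult.assoc)
  also have "\<dots> = complex_of_real (exp (- t * (z \<bullet> z)))"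
    unfolding A using assms by (simp add: mult.commute)
  finally show ?thesis .
qed

lemma heat_integral:
  assumes "t > 0"
  shows "(LINT x|lborel. heat t (x::'a::euclidean_space)) = 1"
proof -
  have "complex_of_real (LINT x|lborel. heat t (x::'a)) = 1"
    using heat_fourier[OF assms, of "0::'a"] by simp
  then show ?thesis by (simp only: of_real_eq_1_iff)
qed

text \<open>Fourier inversion for one explicit function, obtained by comparing constants. Every
  inversion statement below is reduced to this one by Fubini.\<close>

lemma heat_inversion:
  fixes z :: "'a::euclidean_space"
  assumes "t > 0"
  shows "complex_of_real (heat t z)
    = complex_of_real ((2 * pi) powr (- real DIM('a))) * (LINT x|lborel. complex_of_real (exp (- t * (x \<bullet> x))) * cis (x \<bullet> z))"
proof -
  have "(pi / t) = (2 * pi)\<^sup>2 / (4 * pi * t)" using assms by (simp add: power2_eq_square)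
  then have "(pi / t) powr (real DIM('a) / 2) = ((2 * pi)\<^sup>2 / (4 * pi * t)) powr (real DIM('a) / 2)"
    by (rule arg_cong)
  also have "\<dots> = ((2 * pi) powr 2) powr (real DIM('a) / 2) / (4 * pi * t) powr (real DIM('a) / 2)"
    using assms by (subst powr_divide) auto
  also have "\<dots> = (2 * pi) powr real DIM('a) * (4 * pi * t) powr (- real DIM('a) / 2)"
    unfolding powr_powr by (simp add: powr_minus field_simps)
  finally have "(4 * pi * t) powr (- real DIM('a) / 2) = (2 * pi) powr (- real DIM('a)) * (pi / t) powr (real DIM('a) / 2)"
    by (simp add: powr_minus field_simps)
  then show ?thesis
    unfolding gaussian_fourier(2)[OF assms] heat_def by (simp add: mult.assoc flip: of_real_mult)
qed

text \<open>The product of two integrable functions with a bounded kernel is integrable on the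
  product space. Stated in this shape to shift a character or a heat kernel from one factor to the
  other.\<close>

lemma Fubini_bounded_kernel:
  fixes f :: "'a::euclidean_space \<Rightarrow> 'b::{euclidean_space, real_normed_field}"
    and g :: "'c::euclidean_space \<Rightarrow> 'b"
  assumes f: "integrable lborel f" and g: "integrable lborel g"
    and k [measurable]: "(\<lambda>(x, y). k x y) \<in> borel_measurable (lborel \<Otimes>\<^sub>M lborel)"
    and B: "\<And>x y. norm (k x y) \<le> B"
  shows "(LINT x|lborel. f x * (LINT y|lborel. g y * k x y)) = (LINT y|lborel. g y * (LINT x|lborel. f x * k x y))"
proof -
  have [measurable]: "f \<in> borel_measurable lborel" "g \<in> borel_measurable lborel" using f g by auto
  have "B \<ge> 0" using B[of undefined undefined] norm_ge_zero order_trans by blast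
  have gk: "integrable lborel (\<lambda>y. g y * k x y)" for x
    by (rule Bochner_Integration.integrable_bound[OF integrable_mult_right[OF integrable_norm[OF g], of B]])
       (use B mult_right_mono[OF B] \<open>B \<ge> 0\<close> in \<open>auto simp: norm_mult mult.commute[of "norm (g _)"]\<close>)
  have int: "integrable (lborel \<Otimes>\<^sub>M lborel) (\<lambda>(x, y). f x * (g y * k x y))"
  proof (rule lborel_pair.Fubini_integrable)
    show "AE x in lborel. integrable lborel (\<lambda>y. case (x, y) of (x, y) \<Rightarrow> f x * (g y * k x y))"
      using gk by (intro AE_I2) simp
    show "integrable lborel (\<lambda>x. LINT y|lborel. norm (case (x, y) of (x, y) \<Rightarrow> f x * (g y * k x y)))"
    proof (rule Bochner_Integration.integrable_bound)
      show "integrable lborel (\<lambda>x. norm (f x) * (LINT y|lborel. norm (g y) * B))"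
        using f by (intro integrable_mult_left integrable_norm)
      have "(LINT y|lborel. norm (f x * (g y * k x y))) \<le> norm (f x) * (LINT y|lborel. norm (g y) * B)" for x
      proof -
        have "(LINT y|lborel. norm (f x * (g y * k x y))) = norm (f x) * (LINT y|lborel. norm (g y * k x y))"
          by (simp add: norm_mult mult.assoc)
        also have "\<dots> \<le> norm (f x) * (LINT y|lborel. norm (g y) * B)"
        proof (intro mult_left_mono integral_mono)
          show "integrable lborel (\<lambda>y. norm (g y * k x y))" using gk by (rule integrable_norm)
          show "integrable lborel (\<lambda>y. norm (g y) * B)" using g by (intro integrable_mult_left integrable_norm)
          show "norm (g y * k x y) \<le> norm (g y) * B" for y
            using B by (simp add: norm_mult mult_left_mono)
        qed simp
        finally show ?thesis .
      qed
      then show "AE x in lborel. norm (LINT y|lborel. norm (case (x, y) of (x, y) \<Rightarrow> f x * (g y * k x y)))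
          \<le> norm (norm (f x) * (LINT y|lborel. norm (g y) * B))"
        by (auto intro!: AE_I2 order_trans[OF _ abs_ge_self])
    qed measurable
  qed measurable
  have "(LINT x|lborel. f x * (LINT y|lborel. g y * k x y)) = (LINT x|lborel. LINT y|lborel. f x * (g y * k x y))"
    using gk by simp
  also have "\<dots> = (LINT y|lborel. LINT x|lborel. f x * (g y * k x y))"
    by (rule lborel_pair.Fubini_integral[symmetric, OF int])
  also have "\<dots> = (LINT y|lborel. LINT x|lborel. g y * (f x * k x y))" by (simp add: mult.left_commute)
  also have "\<dots> = (LINT y|lborel. g y * (LINT x|lborel. f x * k x y))" by simp
  finally show ?thesis .
qed

section \<open>The Fourier integral of integrable functions\<close>

lemma fourier_L1_measurable [measurable]:
  assumes [measurable]: "f \<in> borel_measurable borel"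
  shows "fourier_L1 f \<in> borel_measurable borel"
  unfolding fourier_L1_def by measurable

lemma fourier_L1_integrand:
  assumes "integrable lborel f"
  shows "integrable lborel (\<lambda>x. complex_of_real (f x) * cis (- (x \<bullet> \<xi>)))"
proof -
  have [measurable]: "f \<in> borel_measurable borel" using assms by auto
  show ?thesis
    by (rule Bochner_Integration.integrable_bound[OF integrable_norm[OF assms]]) (auto simp: norm_mult)
qed

lemma fourier_L1_bound:
  assumes "integrable lborel f"
  shows "norm (fourier_L1 f \<xi>) \<le> (LINT x|lborel. \<bar>f x\<bar>)"
proof -
  have "norm (fourier_L1 f \<xi>) \<le> (LINT x|lborel. norm (complex_of_real (f x) * cis (- (x \<bullet> \<xi>))))"
    unfolding fourier_L1_def by (rule integral_norm_bound)
  then show ?thesis by (simp add: norm_mult)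
qed

lemma fourier_L1_add:
  assumes "integrable lborel f" "integrable lborel g"
  shows "fourier_L1 (\<lambda>x. f x + g x) \<xi> = fourier_L1 f \<xi> + fourier_L1 g \<xi>"
  using fourier_L1_integrand[OF assms(1)] fourier_L1_integrand[OF assms(2)]
  by (simp add: fourier_L1_def distrib_right)

lemma fourier_L1_cmult: "fourier_L1 (\<lambda>x. c * f x) \<xi> = complex_of_real c * fourier_L1 f \<xi>"
  by (simp add: fourier_L1_def mult.assoc)

section \<open>Convolution with integrable bounded kernels\<close>

definition conv :: "('a::euclidean_space \<Rightarrow> real) \<Rightarrow> ('a \<Rightarrow> real) \<Rightarrow> 'a \<Rightarrow> real" where
  "conv f k x = (LINT y|lborel. f y * k (x - y))"

text \<open>Integrable and bounded, hence square integrable. Convolving an L2 function with such a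
  kernel is therefore meaningful at every point and gives a function that is bounded and again in
  L2.\<close>

definition kernel :: "('a::euclidean_space \<Rightarrow> real) \<Rightarrow> bool" where
  "kernel k \<longleftrightarrow> integrable lborel k \<and> (\<exists>B. \<forall>x. \<bar>k x\<bar> \<le> B)"

lemma kernel_measurable [measurable_dest]: "kernel k \<Longrightarrow> k \<in> borel_measurable borel"
  by (auto simp: kernel_def)

lemma kernel_abs: "kernel k \<Longrightarrow> kernel (\<lambda>x. \<bar>k x\<bar>)"
  by (auto simp: kernel_def)

lemma kernel_sq_integrable:
  assumes "kernel k"
  shows "sq_integrable k"
proof -
  obtain B where B: "\<And>x. \<bar>k x\<bar> \<le> B" using assms by (auto simp: kernel_def)
  have [measurable]: "k \<in> borel_measurable borel" using assms by measurable
  have "integrable lborel (\<lambda>x. (norm (k x))\<^sup>2)"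
  proof (rule Bochner_Integration.integrable_bound)
    show "integrable lborel (\<lambda>x. B * k x)" using assms by (simp add: kernel_def)
    have "\<bar>k x\<bar> * \<bar>k x\<bar> \<le> \<bar>B * k x\<bar>" for x
      unfolding abs_mult by (rule mult_right_mono) (use B[of x] in auto)
    then show "AE x in lborel. norm ((norm (k x))\<^sup>2) \<le> norm (B * k x)"
      by (auto simp: power2_eq_square abs_mult)
  qed measurable
  then show ?thesis by (simp add: sq_integrable_def)
qed

lemma kernel_heat: "t > 0 \<Longrightarrow> kernel (heat t)"
  unfolding kernel_def
  by (auto intro!: heat_integrable exI[of _ "(4 * pi * t) powr (- real DIM('a) / 2)"] simp: heat_def abs_mult)

lemma sq_integrable_reflect:
  assumes "sq_integrable (f :: 'a::euclidean_space \<Rightarrow> 'b::euclidean_space)"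
  shows "sq_integrable (\<lambda>y. f (x - y))" "sqnorm (\<lambda>y. f (x - y)) = sqnorm f"
proof -
  have [measurable]: "f \<in> borel_measurable borel" using assms by measurable
  show "sq_integrable (\<lambda>y. f (x - y))"
    using assms lborel_integral_reflect(2)[of "\<lambda>y. (norm (f y))\<^sup>2" x] by (simp add: sq_integrable_def)
  show "sqnorm (\<lambda>y. f (x - y)) = sqnorm f"
    using lborel_integral_reflect(1)[of "\<lambda>y. (norm (f y))\<^sup>2" x] by (simp add: sqnorm_def)
qed

lemma conv_measurable [measurable]:
  assumes [measurable]: "f \<in> borel_measurable borel" "k \<in> borel_measurable borel"
  shows "conv f k \<in> borel_measurable borel"
  unfolding conv_def [abs_def] by measurable

lemma conv_integrand:
  assumes "sq_integrable f" "kernel k"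
  shows "integrable lborel (\<lambda>y. f y * k (x - y))"
  by (rule sq_integrable_mult[OF assms(1) sq_integrable_reflect(1)[OF kernel_sq_integrable[OF assms(2)]]])

lemma conv_bound:
  assumes "sq_integrable f" "kernel k"
  shows "\<bar>conv f k x\<bar> \<le> sqrt (sqnorm f) * sqrt (sqnorm k)"
  using Cauchy_Schwarz_real[OF assms(1) sq_integrable_reflect(1)[OF kernel_sq_integrable[OF assms(2)], of x]]
  by (simp add: conv_def sq_integrable_reflect(2)[OF kernel_sq_integrable[OF assms(2)]])

lemma conv_diff:
  assumes "sq_integrable f" "sq_integrable g" "kernel k"
  shows "conv (\<lambda>x. f x - g x) k x = conv f k x - conv g k x"
  using conv_integrand[OF assms(1,3)] conv_integrand[OF assms(2,3)]
  by (simp add: conv_def left_diff_distrib)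

lemma conv_abs_le: "\<bar>conv f k x\<bar> \<le> conv (\<lambda>x. \<bar>f x\<bar>) (\<lambda>x. \<bar>k x\<bar>) x"
  unfolding conv_def using integral_abs_bound[of lborel "\<lambda>y. f y * k (x - y)"] by (simp add: abs_mult)

lemma conv_commute:
  assumes [measurable]: "f \<in> borel_measurable borel" "k \<in> borel_measurable borel"
  shows "conv f k x = conv k f x"
  unfolding conv_def
  by (subst lborel_integral_reflect(1)[of _ x, symmetric]) (simp_all add: mult.commute)

text \<open>Writing |k| as a product of two square roots and applying Cauchy--Schwarz bounds the
  square of the convolution pointwise by the integral of |k| times the convolution of f^2 with |k|;
  Tonelli then integrates this bound.\<close>

lemma Young_L2:
  assumes f: "sq_integrable f" and k: "kernel k"
  shows "sq_integrable (conv f k)" "sqnorm (conv f k) \<le> (LINT x|lborel. \<bar>k x\<bar>)\<^sup>2 * sqnorm f"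
proof -
  have [measurable]: "f \<in> borel_measurable borel" "k \<in> borel_measurable borel" using f k by measurable
  obtain B where B: "\<And>x. \<bar>k x\<bar> \<le> B" using k by (auto simp: kernel_def)
  define K where "K = (LINT x|lborel. \<bar>k x\<bar>)"
  have K: "K \<ge> 0" unfolding K_def by simp
  have ki: "integrable lborel (\<lambda>y. \<bar>k (x - y)\<bar>)" "(LINT y|lborel. \<bar>k (x - y)\<bar>) = K" for x
    using k lborel_integral_reflect[of "\<lambda>y. \<bar>k y\<bar>" x] by (auto simp: kernel_def K_def)
  have fk: "integrable lborel (\<lambda>y. (f y)\<^sup>2 * \<bar>k (x - y)\<bar>)" for x
  proof (rule Bochner_Integration.integrable_bound)
    show "integrable lborel (\<lambda>y. B * (f y)\<^sup>2)" using f by (simp add: sq_integrable_def)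
    show "AE y in lborel. norm ((f y)\<^sup>2 * \<bar>k (x - y)\<bar>) \<le> norm (B * (f y)\<^sup>2)"
      using B order_trans[OF abs_ge_zero B] by (auto simp: abs_mult mult.commute[of B] intro!: mult_left_mono order_trans[OF B])
  qed measurable
  have pt: "(conv f k x)\<^sup>2 \<le> K * (LINT y|lborel. (f y)\<^sup>2 * \<bar>k (x - y)\<bar>)" for x
  proof -
    let ?p = "\<lambda>y. \<bar>f y\<bar> * sqrt \<bar>k (x - y)\<bar>" and ?q = "\<lambda>y. sqrt \<bar>k (x - y)\<bar>"
    have p: "sq_integrable ?p" unfolding sq_integrable_def using fk[of x] by (simp add: power_mult_distrib)
    have q: "sq_integrable ?q" unfolding sq_integrable_def using ki(1)[of x] by simp
    have "\<bar>conv f k x\<bar> \<le> (LINT y|lborel. \<bar>f y\<bar> * \<bar>k (x - y)\<bar>)" using conv_abs_le[of f k x] by (simp add: conv_def)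
    also have "\<dots> = (LINT y|lborel. ?p y * ?q y)" by (simp add: mult.assoc)
    also have "\<dots> \<le> \<bar>LINT y|lborel. ?p y * ?q y\<bar>" by (rule abs_ge_self)
    also have "\<dots> \<le> sqrt (sqnorm ?p) * sqrt (sqnorm ?q)" by (rule Cauchy_Schwarz_real[OF p q])
    finally have "\<bar>conv f k x\<bar>\<^sup>2 \<le> (sqrt (sqnorm ?p) * sqrt (sqnorm ?q))\<^sup>2"
      by (rule power_mono) simp
    also have "\<dots> = K * (LINT y|lborel. (f y)\<^sup>2 * \<bar>k (x - y)\<bar>)"
      using ki(2)[of x] K by (simp add: power_mult_distrib sqnorm_def)
    finally show ?thesis by simp
  qed
  have le: "(\<integral>\<^sup>+x. ennreal ((conv f k x)\<^sup>2) \<partial>lborel) \<le> ennreal (K\<^sup>2 * sqnorm f)"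
  proof -
    have "(\<integral>\<^sup>+x. ennreal ((conv f k x)\<^sup>2) \<partial>lborel) \<le> (\<integral>\<^sup>+x. ennreal K * (\<integral>\<^sup>+y. ennreal ((f y)\<^sup>2 * \<bar>k (x - y)\<bar>) \<partial>lborel) \<partial>lborel)"
    proof (rule nn_integral_mono)
      fix x
      have "ennreal ((conv f k x)\<^sup>2) \<le> ennreal K * ennreal (LINT y|lborel. (f y)\<^sup>2 * \<bar>k (x - y)\<bar>)"
        using pt[of x] K by (simp flip: ennreal_mult add: ennreal_leI)
      also have "ennreal (LINT y|lborel. (f y)\<^sup>2 * \<bar>k (x - y)\<bar>) = (\<integral>\<^sup>+y. ennreal ((f y)\<^sup>2 * \<bar>k (x - y)\<bar>) \<partial>lborel)"
        by (rule nn_integral_eq_integral[symmetric]) (use fk in auto)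
      finally show "ennreal ((conv f k x)\<^sup>2) \<le> ennreal K * (\<integral>\<^sup>+y. ennreal ((f y)\<^sup>2 * \<bar>k (x - y)\<bar>) \<partial>lborel)" .
    qed
    also have "\<dots> = ennreal K * (\<integral>\<^sup>+x. (\<integral>\<^sup>+y. ennreal ((f y)\<^sup>2 * \<bar>k (x - y)\<bar>) \<partial>lborel) \<partial>lborel)"
      by (rule nn_integral_cmult) measurable
    also have "(\<integral>\<^sup>+x. (\<integral>\<^sup>+y. ennreal ((f y)\<^sup>2 * \<bar>k (x - y)\<bar>) \<partial>lborel) \<partial>lborel)
        = (\<integral>\<^sup>+y. (\<integral>\<^sup>+x. ennreal ((f y)\<^sup>2 * \<bar>k (x - y)\<bar>) \<partial>lborel) \<partial>lborel)"
      by (rule lborel_pair.Fubini'[symmetric]) measurable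
    also have "\<dots> = (\<integral>\<^sup>+y. ennreal ((f y)\<^sup>2) * ennreal K \<partial>lborel)"
    proof (rule nn_integral_cong)
      fix y
      have "(\<integral>\<^sup>+x. ennreal ((f y)\<^sup>2 * \<bar>k (x - y)\<bar>) \<partial>lborel) = ennreal ((f y)\<^sup>2) * (\<integral>\<^sup>+x. ennreal \<bar>k (x - y)\<bar> \<partial>lborel)"
        by (simp add: ennreal_mult nn_integral_cmult)
      also have "(\<integral>\<^sup>+x. ennreal \<bar>k (x - y)\<bar> \<partial>lborel) = ennreal (LINT x|lborel. \<bar>k (x - y)\<bar>)"
        by (rule nn_integral_eq_integral)
           (use lborel_integral_translate(2)[of "\<lambda>x. \<bar>k x\<bar>" "-y"] k in \<open>auto simp: kernel_def\<close>)
      also have "(LINT x|lborel. \<bar>k (x - y)\<bar>) = K"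
        using lborel_integral_translate(1)[of "\<lambda>x. \<bar>k x\<bar>" "-y"] by (simp add: K_def)
      finally show "(\<integral>\<^sup>+x. ennreal ((f y)\<^sup>2 * \<bar>k (x - y)\<bar>) \<partial>lborel) = ennreal ((f y)\<^sup>2) * ennreal K" .
    qed
    also have "\<dots> = (\<integral>\<^sup>+y. ennreal ((f y)\<^sup>2) \<partial>lborel) * ennreal K"
      by (rule nn_integral_multc) measurable
    also have "(\<integral>\<^sup>+y. ennreal ((f y)\<^sup>2) \<partial>lborel) = ennreal (sqnorm f)"
      using nn_integral_eq_integral[of lborel "\<lambda>y. (f y)\<^sup>2"] f by (simp add: sq_integrable_def sqnorm_def)
    finally show ?thesis using K by (simp flip: ennreal_mult add: power2_eq_square ac_simps)
  qed
  have int: "integrable lborel (\<lambda>x. (conv f k x)\<^sup>2)"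
    by (rule integrableI_bounded) (use le in \<open>auto simp: le_less_trans\<close>)
  then show "sq_integrable (conv f k)" by (simp add: sq_integrable_def)
  have "ennreal (sqnorm (conv f k)) \<le> ennreal (K\<^sup>2 * sqnorm f)"
    using nn_integral_eq_integral[OF int] le by (simp add: sqnorm_def)
  then show "sqnorm (conv f k) \<le> (LINT x|lborel. \<bar>k x\<bar>)\<^sup>2 * sqnorm f"
    by (simp add: ennreal_le_iff K_def)
qed

text \<open>The last hypothesis is absolute integrability of the double integral. It is kept
  abstract because the lemma serves square integrable \<open>g\<close> as well as the nonlinearity
  |u|^(p-2) u, for which it is verified through an L^p bound.\<close>

lemma conv_Fubini:
  assumes f: "sq_integrable f" and k: "kernel k" and [measurable]: "g \<in> borel_measurable borel"
    and int: "integrable lborel (\<lambda>x. \<bar>g x\<bar> * conv (\<lambda>x. \<bar>f x\<bar>) (\<lambda>x. \<bar>k x\<bar>) x)"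
  shows "(LINT x|lborel. g x * conv f k x) = (LINT y|lborel. f y * (LINT x|lborel. g x * k (x - y)))"
proof -
  have [measurable]: "f \<in> borel_measurable borel" "k \<in> borel_measurable borel" using f k by measurable
  have "integrable (lborel \<Otimes>\<^sub>M lborel) (\<lambda>(x, y). g x * (f y * k (x - y)))"
  proof (rule lborel_pair.Fubini_integrable)
    show "AE x in lborel. integrable lborel (\<lambda>y. case (x, y) of (x, y) \<Rightarrow> g x * (f y * k (x - y)))"
      using conv_integrand[OF f k] by simp
    show "integrable lborel (\<lambda>x. LINT y|lborel. norm (case (x, y) of (x, y) \<Rightarrow> g x * (f y * k (x - y))))"
      using int by (simp add: abs_mult conv_def)
  qed measurable
  note F = lborel_pair.Fubini_integral[OF this]
  have "(LINT x|lborel. g x * conv f k x) = (LINT x|lborel. LINT y|lborel. g x * (f y * k (x - y)))"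
    by (simp add: conv_def)
  also have "\<dots> = (LINT y|lborel. LINT x|lborel. g x * (f y * k (x - y)))" by (rule F[symmetric])
  also have "\<dots> = (LINT y|lborel. LINT x|lborel. f y * (g x * k (x - y)))"
    by (intro Bochner_Integration.integral_cong refl) (simp add: mult.left_commute)
  finally show ?thesis by simp
qed

lemma conv_Fubini_L2:
  assumes f: "sq_integrable f" and k: "kernel k" and g: "sq_integrable g"
  shows "(LINT x|lborel. g x * conv f k x) = (LINT y|lborel. f y * (LINT x|lborel. g x * k (x - y)))"
proof (rule conv_Fubini[OF f k])
  have f': "sq_integrable (\<lambda>x. \<bar>f x\<bar>)" "sq_integrable (\<lambda>x. \<bar>g x\<bar>)" using f g by (auto simp: sq_integrable_def)
  show "integrable lborel (\<lambda>x. \<bar>g x\<bar> * conv (\<lambda>x. \<bar>f x\<bar>) (\<lambda>x. \<bar>k x\<bar>) x)"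
    by (rule sq_integrable_mult[OF f'(2) Young_L2(1)[OF f'(1) kernel_abs[OF k]]])
qed (use g in measurable)

text \<open>Insert the inversion formula of the heat kernel and exchange integrals. The Gaussian
  factor supplies the integrability in frequency that \<open>fourier_L1 f\<close> alone may
  lack.\<close>

lemma conv_heat_inversion:
  fixes f :: "'a::euclidean_space \<Rightarrow> real"
  assumes f: "integrable lborel f" and "t > 0"
  shows "complex_of_real (conv f (heat t) x) = complex_of_real ((2 * pi) powr (- real DIM('a)))
     * (LINT \<xi>|lborel. complex_of_real (exp (- t * (\<xi> \<bullet> \<xi>))) * (cis (x \<bullet> \<xi>) * fourier_L1 f \<xi>))"
proof -
  let ?c = "complex_of_real ((2 * pi) powr (- real DIM('a)))"
  have [measurable]: "f \<in> borel_measurable borel" using f by auto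
  have "complex_of_real (conv f (heat t) x) = (LINT y|lborel. complex_of_real (f y) * complex_of_real (heat t (x - y)))"
    unfolding conv_def by (simp flip: integral_complex_of_real)
  also have "\<dots> = (LINT y|lborel. ?c * (complex_of_real (f y) * (LINT \<xi>|lborel. complex_of_real (exp (- t * (\<xi> \<bullet> \<xi>))) * cis (\<xi> \<bullet> (x - y)))))"
    by (simp only: heat_inversion[OF assms(2)] mult.left_commute)
  also have "\<dots> = ?c * (LINT y|lborel. complex_of_real (f y) * (LINT \<xi>|lborel. complex_of_real (exp (- t * (\<xi> \<bullet> \<xi>))) * cis (\<xi> \<bullet> (x - y))))"
    by (rule integral_mult_right_zero)
  also have "(LINT y|lborel. complex_of_real (f y) * (LINT \<xi>|lborel. complex_of_real (exp (- t * (\<xi> \<bullet> \<xi>))) * cis (\<xi> \<bullet> (x - y))))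
     = (LINT \<xi>|lborel. complex_of_real (exp (- t * (\<xi> \<bullet> \<xi>))) * (LINT y|lborel. complex_of_real (f y) * cis (\<xi> \<bullet> (x - y))))"
    by (rule Fubini_bounded_kernel[where B = 1])
       (use f gaussian_fourier(1)[OF assms(2)] in \<open>auto intro!: integrable_of_real\<close>)
  also have "\<dots> = (LINT \<xi>|lborel. complex_of_real (exp (- t * (\<xi> \<bullet> \<xi>))) * (cis (x \<bullet> \<xi>) * fourier_L1 f \<xi>))"
  proof (rule Bochner_Integration.integral_cong)
    fix \<xi> :: 'a
    have "(LINT y|lborel. complex_of_real (f y) * cis (\<xi> \<bullet> (x - y)))
        = (LINT y|lborel. cis (x \<bullet> \<xi>) * (complex_of_real (f y) * cis (- (y \<bullet> \<xi>))))"
      by (intro Bochner_Integration.integral_cong refl)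
         (simp add: inner_diff_right inner_commute mult.left_commute[of "cis _"] cis_mult)
    also have "\<dots> = cis (x \<bullet> \<xi>) * (LINT y|lborel. complex_of_real (f y) * cis (- (y \<bullet> \<xi>)))"
      by (rule integral_mult_right_zero)
    finally show "complex_of_real (exp (- t * (\<xi> \<bullet> \<xi>))) * (LINT y|lborel. complex_of_real (f y) * cis (\<xi> \<bullet> (x - y)))
       = complex_of_real (exp (- t * (\<xi> \<bullet> \<xi>))) * (cis (x \<bullet> \<xi>) * fourier_L1 f \<xi>)"
      by (simp add: fourier_L1_def)
  qed simp
  finally show ?thesis .
qed

lemma fourier_L1_gaussian_integrable:
  assumes f: "integrable lborel f" and "t > 0"
  shows "integrable lborel (\<lambda>\<xi>::'a::euclidean_space. complex_of_real (exp (- t * (\<xi> \<bullet> \<xi>))) * fourier_L1 f \<xi>)"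
proof (rule Bochner_Integration.integrable_bound)
  have [measurable]: "f \<in> borel_measurable borel" using f by auto
  show "integrable lborel (\<lambda>\<xi>::'a. (LINT x|lborel. \<bar>f x\<bar>) * exp (- t * (\<xi> \<bullet> \<xi>)))"
    by (rule integrable_mult_right[OF gaussian_fourier(1)[OF assms(2)]])
  show "AE \<xi> in lborel. norm (complex_of_real (exp (- t * (\<xi> \<bullet> \<xi>))) * fourier_L1 f \<xi>) \<le> norm ((LINT x|lborel. \<bar>f x\<bar>) * exp (- t * (\<xi> \<bullet> \<xi>)))"
    using fourier_L1_bound[OF f] by (auto simp: norm_mult mult.commute abs_mult intro!: mult_mono)
  show "(\<lambda>\<xi>. complex_of_real (exp (- t * (\<xi> \<bullet> \<xi>))) * fourier_L1 f \<xi>) \<in> borel_measurable lborel" by measurable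
qed

text \<open>Plancherel with a Gaussian regularisation, available for every integrable
  \<open>f\<close>. Letting \<open>t\<close> tend to 0 removes the regularisation on both
  sides.\<close>

lemma heat_pairing_fourier:
  fixes f :: "'a::euclidean_space \<Rightarrow> real"
  assumes f: "integrable lborel f" and "t > 0"
  shows "integrable lborel (\<lambda>\<xi>. exp (- t * (\<xi> \<bullet> \<xi>)) * (norm (fourier_L1 f \<xi>))\<^sup>2)"
    "(LINT x|lborel. f x * conv f (heat t) x)
     = (2 * pi) powr (- real DIM('a)) * (LINT \<xi>|lborel. exp (- t * (\<xi> \<bullet> \<xi>)) * (norm (fourier_L1 f \<xi>))\<^sup>2)"
proof -
  let ?c = "(2 * pi) powr (- real DIM('a))"
  have [measurable]: "f \<in> borel_measurable borel" using f by auto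
  have inner: "(LINT x|lborel. complex_of_real (f x) * cis (x \<bullet> \<xi>)) = cnj (fourier_L1 f \<xi>)" for \<xi>
    unfolding fourier_L1_def by (subst Bochner_Integration.integral_cnj[symmetric]) (simp add: cis_cnj)
  have e: "complex_of_real (exp (- t * (\<xi> \<bullet> \<xi>))) * fourier_L1 f \<xi> * cnj (fourier_L1 f \<xi>)
      = complex_of_real (exp (- t * (\<xi> \<bullet> \<xi>)) * (norm (fourier_L1 f \<xi>))\<^sup>2)" for \<xi>
    using complex_norm_square[of "fourier_L1 f \<xi>"] by (simp add: mult.assoc)
  have "complex_of_real (LINT x|lborel. f x * conv f (heat t) x)
      = (LINT x|lborel. complex_of_real (f x) * complex_of_real (conv f (heat t) x))"
    by (simp flip: integral_complex_of_real)
  also have "\<dots> = (LINT x|lborel. complex_of_real ?c * (complex_of_real (f x) * (LINT \<xi>|lborel. (complex_of_real (exp (- t * (\<xi> \<bullet> \<xi>))) * fourier_L1 f \<xi>) * cis (x \<bullet> \<xi>))))"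
    unfolding conv_heat_inversion[OF assms] by (simp only: mult.left_commute mult.assoc mult.commute[of "fourier_L1 f _"])
  also have "\<dots> = complex_of_real ?c * (LINT x|lborel. complex_of_real (f x) * (LINT \<xi>|lborel. (complex_of_real (exp (- t * (\<xi> \<bullet> \<xi>))) * fourier_L1 f \<xi>) * cis (x \<bullet> \<xi>)))"
    by (rule integral_mult_right_zero)
  also have "(LINT x|lborel. complex_of_real (f x) * (LINT \<xi>|lborel. (complex_of_real (exp (- t * (\<xi> \<bullet> \<xi>))) * fourier_L1 f \<xi>) * cis (x \<bullet> \<xi>)))
     = (LINT \<xi>|lborel. (complex_of_real (exp (- t * (\<xi> \<bullet> \<xi>))) * fourier_L1 f \<xi>) * (LINT x|lborel. complex_of_real (f x) * cis (x \<bullet> \<xi>)))"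
    by (rule Fubini_bounded_kernel[where B = 1])
       (use f fourier_L1_gaussian_integrable[OF assms] in \<open>auto intro!: integrable_of_real\<close>)
  also have "\<dots> = complex_of_real (LINT \<xi>|lborel. exp (- t * (\<xi> \<bullet> \<xi>)) * (norm (fourier_L1 f \<xi>))\<^sup>2)"
    unfolding inner e by (rule integral_complex_of_real)
  finally have "complex_of_real (LINT x|lborel. f x * conv f (heat t) x) =
     complex_of_real (?c * (LINT \<xi>|lborel. exp (- t * (\<xi> \<bullet> \<xi>)) * (norm (fourier_L1 f \<xi>))\<^sup>2))" by simp
  then show "(LINT x|lborel. f x * conv f (heat t) x)
     = ?c * (LINT \<xi>|lborel. exp (- t * (\<xi> \<bullet> \<xi>)) * (norm (fourier_L1 f \<xi>))\<^sup>2)"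
    by (simp only: of_real_eq_iff)
  show "integrable lborel (\<lambda>\<xi>. exp (- t * (\<xi> \<bullet> \<xi>)) * (norm (fourier_L1 f \<xi>))\<^sup>2)"
  proof (rule Bochner_Integration.integrable_bound)
    show "integrable lborel (\<lambda>\<xi>::'a. (LINT x|lborel. \<bar>f x\<bar>)\<^sup>2 * exp (- t * (\<xi> \<bullet> \<xi>)))"
      by (rule integrable_mult_right[OF gaussian_fourier(1)[OF assms(2)]])
    show "AE \<xi> in lborel. norm (exp (- t * (\<xi> \<bullet> \<xi>)) * (norm (fourier_L1 f \<xi>))\<^sup>2) \<le> norm ((LINT x|lborel. \<bar>f x\<bar>)\<^sup>2 * exp (- t * (\<xi> \<bullet> \<xi>)))"
      using fourier_L1_bound[OF f] by (auto simp: abs_mult mult.commute intro!: mult_left_mono power_mono)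
  qed measurable
qed

text \<open>The substitution y = x - s z with s = sqrt t turns the shrinking kernel into the fixed
  probability density \<open>heat 1\<close>; continuity and dominated convergence do the
  rest.\<close>

lemma conv_heat_tendsto:
  fixes g :: "'a::euclidean_space \<Rightarrow> real"
  assumes g: "continuous_on UNIV g" "\<And>x. \<bar>g x\<bar> \<le> M"
  shows "(\<lambda>n. conv g (heat (1 / real (Suc n))) x) \<longlonglongrightarrow> g x"
    "\<bar>conv g (heat (1 / real (Suc n))) x\<bar> \<le> M"
proof -
  have [measurable]: "g \<in> borel_measurable borel" using g(1) by (rule borel_measurable_continuous_onI)
  define s where "s n = sqrt (1 / real (Suc n))" for n
  have s: "s n > 0" "(s n)\<^sup>2 = 1 / real (Suc n)" for n by (auto simp: s_def)
  have h1: "heat (1::real) z = \<bar>- s n\<bar> ^ DIM('a) * heat (1 / real (Suc n)) (s n *\<^sub>R z)" for n and z :: 'a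
  proof -
    have "(4 * pi * (s n)\<^sup>2) powr (- real DIM('a) / 2) = (4 * pi) powr (- real DIM('a) / 2) * (s n powr 2) powr (- real DIM('a) / 2)"
      using s(1)[of n] by (subst powr_mult) auto
    also have "(s n powr 2) powr (- real DIM('a) / 2) = 1 / s n ^ DIM('a)"
      unfolding powr_powr using s(1)[of n] by (simp add: powr_minus powr_realpow field_simps)
    finally have 1: "s n ^ DIM('a) * (4 * pi * (1 / real (Suc n))) powr (- real DIM('a) / 2) = (4 * pi) powr (- real DIM('a) / 2)"
      using s(1)[of n] unfolding s(2) by simp
    have 2: "1 / (4 * (1 / real (Suc n))) * (s n *\<^sub>R z \<bullet> s n *\<^sub>R z) = 1 / 4 * (z \<bullet> z)"
    proof -
      have "s n *\<^sub>R z \<bullet> s n *\<^sub>R z = (s n)\<^sup>2 * (z \<bullet> z)" by (simp add: power2_eq_square)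
      moreover have "1 / (4 * (1 / N)) * (1 / N * w) = 1 / 4 * w" if "N > 0" for N w :: real
        using that by simp
      ultimately show ?thesis unfolding s(2) by (metis of_nat_0_less_iff zero_less_Suc)
    qed
    show ?thesis unfolding heat_def using s(1)[of n]
      by (simp only: minus_mult_left[symmetric] 2 mult.assoc[symmetric] abs_minus_cancel abs_of_pos 1) simp
  qed
  have e: "conv g (heat (1 / real (Suc n))) x = (LINT z|lborel. g (x - s n *\<^sub>R z) * heat 1 z)" for n
  proof -
    have "conv g (heat (1 / real (Suc n))) x = \<bar>- s n\<bar> ^ DIM('a) *\<^sub>R (LINT z|lborel. g (x + (- s n) *\<^sub>R z) * heat (1 / real (Suc n)) (x - (x + (- s n) *\<^sub>R z)))"
      unfolding conv_def by (rule lborel_integral_affine) (use s(1)[of n] in auto)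
    also have "\<dots> = (LINT z|lborel. g (x - s n *\<^sub>R z) * heat 1 z)"
      unfolding h1[of _ n] by (simp add: mult.left_commute)
    finally show ?thesis .
  qed
  have M: "M \<ge> 0" using g(2)[of undefined] by simp
  have bnd: "\<bar>g (x - s n *\<^sub>R z) * heat 1 z\<bar> \<le> M * heat 1 z" for n z
    unfolding abs_mult using g(2) heat_pos[of 1 z] M by (intro mult_mono) auto
  have hi: "integrable lborel (\<lambda>z::'a. M * heat 1 z)" by (rule integrable_mult_right[OF heat_integrable]) simp
  have "(\<lambda>n. LINT z|lborel. g (x - s n *\<^sub>R z) * heat 1 z) \<longlonglongrightarrow> (LINT z|(lborel :: 'a measure). g x * heat 1 z)"
  proof (rule integral_dominated_convergence)
    show "integrable lborel (\<lambda>z::'a. M * heat 1 z)" by (rule hi)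
    have "s \<longlonglongrightarrow> 0"
    proof -
      have "(\<lambda>n. sqrt (1 / real (Suc n))) \<longlonglongrightarrow> sqrt 0" by (intro tendsto_intros LIMSEQ_Suc[OF lim_1_over_n])
      then show ?thesis by (simp add: s_def[abs_def])
    qed
    then have "(\<lambda>n. x - s n *\<^sub>R z) \<longlonglongrightarrow> x" for z by (auto intro!: tendsto_eq_intros)
    then have "(\<lambda>n. g (x - s n *\<^sub>R z)) \<longlonglongrightarrow> g x" for z
      using g(1) continuous_on_tendsto_compose[of UNIV g] by fastforce
    then show "AE z in lborel. (\<lambda>n. g (x - s n *\<^sub>R z) * heat 1 z) \<longlonglongrightarrow> g x * heat 1 z"
      by (auto intro!: tendsto_mult)
    show "AE z in lborel. norm (g (x - s n *\<^sub>R z) * heat 1 z) \<le> M * heat 1 z" for n using bnd by simp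
  qed measurable
  then show "(\<lambda>n. conv g (heat (1 / real (Suc n))) x) \<longlonglongrightarrow> g x"
    unfolding e using heat_integral[of 1, where 'a='a] by simp
  have "\<bar>LINT z|lborel. g (x - s n *\<^sub>R z) * heat 1 z\<bar> \<le> (LINT z|lborel. \<bar>g (x - s n *\<^sub>R z) * heat 1 z\<bar>)"
    by (rule integral_abs_bound)
  also have "\<dots> \<le> (LINT z|lborel. M * heat 1 (z::'a))"
  proof (rule integral_mono[OF _ hi bnd])
    show "integrable lborel (\<lambda>z. \<bar>g (x - s n *\<^sub>R z) * heat 1 z\<bar>)"
      by (rule Bochner_Integration.integrable_bound[OF hi]) (use bnd M in \<open>auto intro!: AE_I2 order_trans[OF bnd]\<close>)
  qed
  also have "\<dots> = M" using heat_integral[of 1, where 'a='a] by simp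
  finally show "\<bar>conv g (heat (1 / real (Suc n))) x\<bar> \<le> M" unfolding e .
qed

text \<open>For continuous \<open>g\<close> of compact support the limit follows from pointwise
  convergence. Since the heat flow contracts L2, replacing \<open>f\<close> by \<open>g\<close>
  costs an error that is uniform in \<open>n\<close>.\<close>

lemma heat_pairing_tendsto:
  fixes f :: "'a::euclidean_space \<Rightarrow> real"
  assumes f: "sq_integrable f"
  shows "(\<lambda>n. LINT x|lborel. f x * conv f (heat (1 / real (Suc n))) x) \<longlonglongrightarrow> sqnorm f"
proof (rule LIMSEQ_I)
  fix e :: real assume "e > 0"
  let ?h = "\<lambda>n. heat (1 / real (Suc n)) :: 'a \<Rightarrow> real"
  have k: "kernel (?h n)" for n by (rule kernel_heat) simp
  have contr: "sq_integrable (conv g (?h n))" "sqrt (sqnorm (conv g (?h n))) \<le> sqrt (sqnorm g)"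
    if "sq_integrable g" for g n
  proof -
    show "sq_integrable (conv g (?h n))" by (rule Young_L2(1)[OF that k])
    have "(LINT x|lborel. \<bar>?h n x\<bar>) = 1"
      using heat_integral[of "1 / real (Suc n)", where 'a='a] heat_pos[of "1 / real (Suc n)", where 'a='a]
      by (simp add: abs_of_pos)
    then show "sqrt (sqnorm (conv g (?h n))) \<le> sqrt (sqnorm g)"
      using Young_L2(2)[OF that k, of n] by simp
  qed
  \<comment> \<open>In the estimate \<open>close\<close> the distance of \<open>f\<close> and
    \<open>g\<close> is multiplied by 2 norm f + 1 = A / 2; a distance of at most e / (2 A)
    therefore costs e / 4.\<close>
  define A where "A = 2 * (2 * sqrt (sqnorm f) + 1)"
  have "A > 0" by (simp add: A_def add_nonneg_pos)
  define d where "d = min 1 ((e / (2 * A))\<^sup>2)"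
  have "d > 0" using \<open>e > 0\<close> \<open>A > 0\<close> by (simp add: d_def)
  obtain g r M where g: "continuous_on UNIV g" "\<And>x. norm x > r \<Longrightarrow> g x = 0" "\<And>x. \<bar>g x\<bar> \<le> M"
    "sq_integrable g" "sqnorm (\<lambda>x. f x - g x) < d"
    using sq_integrable_approx_continuous[OF f \<open>d > 0\<close>] by blast
  have [measurable]: "f \<in> borel_measurable borel" "g \<in> borel_measurable borel" using f g(4) by measurable
  have dist: "sqrt (sqnorm (\<lambda>x. f x - g x)) \<le> 1" "sqrt (sqnorm (\<lambda>x. f x - g x)) \<le> e / (2 * A)"
    using g(5) \<open>e > 0\<close> \<open>A > 0\<close> by (auto simp: d_def intro: real_le_lsqrt)
  have gn: "sqrt (sqnorm g) \<le> sqrt (sqnorm f) + 1"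
    using sqnorm_triangle_diff[OF f g(4)] dist(1) by linarith
  have close: "\<bar>(LINT x|lborel. f x * P x) - (LINT x|lborel. g x * Q x)\<bar> \<le> e / 4"
    if P: "sq_integrable P" "sq_integrable Q" "sqrt (sqnorm P) \<le> sqrt (sqnorm f)"
      "sqrt (sqnorm (\<lambda>x. P x - Q x)) \<le> sqrt (sqnorm (\<lambda>x. f x - g x))" for P Q
  proof -
    have "(LINT x|lborel. f x * P x) - (LINT x|lborel. g x * Q x) = (LINT x|lborel. (f x - g x) * P x + g x * (P x - Q x))"
      using sq_integrable_mult[OF f P(1)] sq_integrable_mult[OF g(4) P(1)] sq_integrable_mult[OF g(4) P(2)]
      by (simp add: left_diff_distrib right_diff_distrib)
    also have "\<dots> = (LINT x|lborel. (f x - g x) * P x) + (LINT x|lborel. g x * (P x - Q x))"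
      by (intro Bochner_Integration.integral_add sq_integrable_mult sq_integrable_diff f g(4) P)
    also have "\<bar>\<dots>\<bar> \<le> \<bar>LINT x|lborel. (f x - g x) * P x\<bar> + \<bar>LINT x|lborel. g x * (P x - Q x)\<bar>" by simp
    also have "\<dots> \<le> sqrt (sqnorm (\<lambda>x. f x - g x)) * sqrt (sqnorm P) + sqrt (sqnorm g) * sqrt (sqnorm (\<lambda>x. P x - Q x))"
      by (intro add_mono Cauchy_Schwarz_real sq_integrable_diff f g(4) P)
    also have "\<dots> \<le> sqrt (sqnorm (\<lambda>x. f x - g x)) * sqrt (sqnorm f) + (sqrt (sqnorm f) + 1) * sqrt (sqnorm (\<lambda>x. f x - g x))"
      by (intro add_mono mult_mono P gn) auto
    also have "\<dots> = sqrt (sqnorm (\<lambda>x. f x - g x)) * (A / 2)" by (simp add: A_def algebra_simps)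
    also have "\<dots> \<le> e / (2 * A) * (A / 2)" using dist(2) \<open>A > 0\<close> by (intro mult_right_mono) auto
    also have "\<dots> = e / 4" using \<open>A > 0\<close> by simp
    finally show ?thesis .
  qed
  have c1: "\<bar>(LINT x|lborel. f x * conv f (?h n) x) - (LINT x|lborel. g x * conv g (?h n) x)\<bar> \<le> e / 4" for n
  proof (intro close contr f g(4))
    have "(\<lambda>x. conv f (?h n) x - conv g (?h n) x) = conv (\<lambda>x. f x - g x) (?h n)"
      by (rule ext, rule conv_diff[OF f g(4) k, symmetric])
    then show "sqrt (sqnorm (\<lambda>x. conv f (?h n) x - conv g (?h n) x)) \<le> sqrt (sqnorm (\<lambda>x. f x - g x))"
      using contr(2)[OF sq_integrable_diff[OF f g(4)], of n] by (simp only:)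
  qed
  have c2: "\<bar>sqnorm f - sqnorm g\<bar> \<le> e / 4"
    using close[OF f g(4)] by (simp add: sqnorm_def power2_eq_square)
  have gi: "integrable lborel g"
  proof -
    have "(\<lambda>x. indicator (cball 0 r) x * g x) = g" using g(2) by (force simp: indicator_def)
    then show ?thesis using sq_integrable_cball_integrable[OF g(4), of r] by simp
  qed
  have "(\<lambda>n. LINT x|lborel. g x * conv g (?h n) x) \<longlonglongrightarrow> (LINT x|lborel. g x * g x)"
  proof (rule integral_dominated_convergence)
    show "integrable lborel (\<lambda>x. M * \<bar>g x\<bar>)" using gi by simp
    show "AE x in lborel. (\<lambda>n. g x * conv g (?h n) x) \<longlonglongrightarrow> g x * g x"
      using conv_heat_tendsto(1)[OF g(1,3)] by (intro AE_I2 tendsto_intros)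
    show "AE x in lborel. norm (g x * conv g (?h n) x) \<le> M * \<bar>g x\<bar>" for n
      using conv_heat_tendsto(2)[OF g(1,3)] by (auto simp: abs_mult mult.commute[of M] intro!: mult_left_mono)
  qed measurable
  then have "(\<lambda>n. LINT x|lborel. g x * conv g (?h n) x) \<longlonglongrightarrow> sqnorm g" by (simp add: sqnorm_def power2_eq_square)
  from LIMSEQ_D[OF this, of "e / 4"] obtain n0 where
    n0: "\<And>n. n \<ge> n0 \<Longrightarrow> \<bar>(LINT x|lborel. g x * conv g (?h n) x) - sqnorm g\<bar> < e / 4" using \<open>e > 0\<close> by auto
  have "norm ((LINT x|lborel. f x * conv f (?h n) x) - sqnorm f) < e" if "n \<ge> n0" for n
    using c1[of n] c2 n0[OF that] \<open>e > 0\<close> unfolding real_norm_def by linarith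
  then show "\<exists>n0. \<forall>n\<ge>n0. norm ((LINT x|lborel. f x * conv f (?h n) x) - sqnorm f) < e" by blast
qed

text \<open>As the time decreases to 0 the Gaussian factors increase to 1, so monotone convergence
  yields square integrability of the transform together with its norm.\<close>

lemma Plancherel_L1:
  fixes f :: "'a::euclidean_space \<Rightarrow> real"
  assumes f: "integrable lborel f" "sq_integrable f"
  shows "sq_integrable (fourier_L1 f)" "sqnorm (fourier_L1 f) = (2 * pi) powr real DIM('a) * sqnorm f"
proof -
  have [measurable]: "f \<in> borel_measurable borel" using f by measurable
  let ?t = "\<lambda>n. 1 / real (Suc n)"
  let ?F = "\<lambda>n \<xi>. exp (- ?t n * (\<xi> \<bullet> \<xi>)) * (norm (fourier_L1 f \<xi>))\<^sup>2"
  have lim: "(\<lambda>n. integral\<^sup>L lborel (?F n)) \<longlonglongrightarrow> (2 * pi) powr real DIM('a) * sqnorm f"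
  proof -
    have "integral\<^sup>L lborel (?F n) = (2 * pi) powr real DIM('a) * (LINT x|lborel. f x * conv f (heat (?t n)) x)" for n
      by (subst heat_pairing_fourier(2)[OF f(1)]) (simp_all add: powr_minus)
    then show ?thesis using tendsto_mult_left[OF heat_pairing_tendsto[OF f(2)]] by simp
  qed
  have conv: "AE \<xi> in lborel. (\<lambda>n. ?F n \<xi>) \<longlonglongrightarrow> (norm (fourier_L1 f \<xi>))\<^sup>2"
  proof (rule AE_I2)
    fix \<xi> :: 'a
    have "(\<lambda>n. ?F n \<xi>) \<longlonglongrightarrow> exp (- 0 * (\<xi> \<bullet> \<xi>)) * (norm (fourier_L1 f \<xi>))\<^sup>2"
      by (intro tendsto_intros LIMSEQ_Suc[OF lim_1_over_n])
    then show "(\<lambda>n. ?F n \<xi>) \<longlonglongrightarrow> (norm (fourier_L1 f \<xi>))\<^sup>2" by simp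
  qed
  have mono: "AE \<xi> in lborel. mono (\<lambda>n. ?F n \<xi>)"
    by (intro AE_I2 monoI mult_right_mono) (auto intro!: mult_right_mono divide_left_mono)
  have int: "integrable lborel (?F n)" for n by (rule heat_pairing_fourier(1)[OF f(1)]) simp
  have 1: "integrable lborel (\<lambda>\<xi>. (norm (fourier_L1 f \<xi>))\<^sup>2)"
    by (rule integrable_monotone_convergence[OF int mono conv lim]) measurable
  have 2: "(LINT \<xi>|lborel. (norm (fourier_L1 f \<xi>))\<^sup>2) = (2 * pi) powr real DIM('a) * sqnorm f"
    by (rule integral_monotone_convergence[OF int mono conv lim]) measurable
  show "sq_integrable (fourier_L1 f)" using 1 by (simp add: sq_integrable_def)
  show "sqnorm (fourier_L1 f) = (2 * pi) powr real DIM('a) * sqnorm f" using 2 by (simp add: sqnorm_def)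
qed

text \<open>By inversion all heat evolutions of \<open>f\<close> vanish, and the symmetry of the
  heat kernel turns this into orthogonality of \<open>f\<close> to every bounded continuous
  integrable function. Such functions approximate the sign of \<open>f\<close>, whence the integral
  of |f| is 0.\<close>

lemma fourier_L1_eq_0_imp:
  fixes f :: "'a::euclidean_space \<Rightarrow> real"
  assumes f: "integrable lborel f" and zero: "\<And>\<xi>. fourier_L1 f \<xi> = 0"
  shows "AE x in lborel. f x = 0"
proof -
  have [measurable]: "f \<in> borel_measurable borel" using f by measurable
  let ?h = "\<lambda>n. heat (1 / real (Suc n)) :: 'a \<Rightarrow> real"
  have c0: "conv f (?h n) x = 0" for n x
    using conv_heat_inversion[OF f, of "1 / real (Suc n)" x] by (simp add: zero)
  have pair: "(LINT x|lborel. f x * g x) = 0"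
    if g: "continuous_on UNIV g" "\<And>x. \<bar>g x\<bar> \<le> 1" "integrable lborel g" for g
  proof -
    have [measurable]: "g \<in> borel_measurable borel" using g by measurable
    have "(LINT x|lborel. f x * conv g (?h n) x) = 0" for n
    proof -
      obtain B where B: "\<And>x. \<bar>?h n x\<bar> \<le> B" using kernel_heat[of "1 / real (Suc n)", where 'a='a] by (auto simp: kernel_def)
      have "(LINT x|lborel. f x * conv g (?h n) x) = (LINT y|lborel. g y * (LINT x|lborel. f x * ?h n (x - y)))"
        unfolding conv_def by (rule Fubini_bounded_kernel[OF f g(3), where B = B]) (use B in auto)
      also have "\<dots> = (LINT y|lborel. g y * conv f (?h n) y)"
        unfolding conv_def by (subst heat_commute) simp
      finally show ?thesis by (simp only: c0) simp
    qed
    moreover have "(\<lambda>n. LINT x|lborel. f x * conv g (?h n) x) \<longlonglongrightarrow> (LINT x|lborel. f x * g x)"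
    proof (rule integral_dominated_convergence)
      show "integrable lborel (\<lambda>x. \<bar>f x\<bar>)" using f by simp
      show "AE x in lborel. (\<lambda>n. f x * conv g (?h n) x) \<longlonglongrightarrow> f x * g x"
        using conv_heat_tendsto(1)[OF g(1,2)] by (intro AE_I2 tendsto_intros)
      show "AE x in lborel. norm (f x * conv g (?h n) x) \<le> \<bar>f x\<bar>" for n
        using conv_heat_tendsto(2)[OF g(1,2)] by (auto simp: abs_mult mult_left_le)
    qed measurable
    ultimately show ?thesis by (simp add: LIMSEQ_const_iff)
  qed
  obtain G where G: "\<And>m::nat. continuous_on UNIV (G m)" "AE x in lborel. (\<lambda>m. G m x) \<longlonglongrightarrow> sgn (f x)"
    using borel_measurable_AE_limit_continuous[of "\<lambda>x. sgn (f x)"] by auto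
  \<comment> \<open>The clamp to [-1, 1] leaves the values of \<open>sgn\<close> unchanged and makes
    the approximants bounded by 1; the spatial cutoff makes them integrable.\<close>
  define H where "H m x = max 0 (min 1 (real m + 1 - norm x)) * max (-1) (min 1 (G m x))" for m x
  have Hc: "continuous_on UNIV (H m)" for m unfolding H_def by (intro continuous_intros G(1))
  have [measurable]: "H m \<in> borel_measurable borel" for m using Hc by (rule borel_measurable_continuous_onI)
  have Hb: "\<bar>H m x\<bar> \<le> 1" for m x
    unfolding H_def abs_mult by (rule mult_le_one) auto
  have Hi: "integrable lborel (H m)" for m
  proof (rule Bochner_Integration.integrable_bound)
    show "integrable lborel (indicator (cball 0 (real m + 1)) :: 'a \<Rightarrow> real)"
      by (auto intro!: integrable_real_indicator emeasure_lborel_cball_finite)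
    have "H m x = 0" if "norm x > real m + 1" for x using that by (simp add: H_def)
    then show "AE x in lborel. norm (H m x) \<le> norm (indicator (cball 0 (real m + 1)) x :: real)"
      using Hb by (auto simp: indicator_def)
  qed measurable
  have Hlim: "AE x in lborel. (\<lambda>m. H m x) \<longlonglongrightarrow> sgn (f x)"
    using G(2)
  proof eventually_elim
    case (elim x)
    have "(\<lambda>m. max (-1) (min 1 (G m x))) \<longlonglongrightarrow> max (-1) (min 1 (sgn (f x)))" by (intro tendsto_intros elim)
    moreover have "max (-1) (min 1 (sgn (f x))) = sgn (f x)" by (auto simp: sgn_if)
    moreover have "(\<lambda>m. max 0 (min 1 (real m + 1 - norm x))) \<longlonglongrightarrow> 1"
    proof (rule tendsto_eventually)
      obtain n0 where n0: "norm x \<le> real n0" using real_arch_simple by blast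
      show "\<forall>\<^sub>F m in sequentially. max 0 (min 1 (real m + 1 - norm x)) = 1"
        using eventually_ge_at_top[of n0] by eventually_elim (use n0 in auto)
    qed
    ultimately show ?case unfolding H_def using tendsto_mult by fastforce
  qed
  have "(\<lambda>m. LINT x|lborel. f x * H m x) \<longlonglongrightarrow> (LINT x|lborel. f x * sgn (f x))"
  proof (rule integral_dominated_convergence)
    show "integrable lborel (\<lambda>x. \<bar>f x\<bar>)" using f by simp
    show "AE x in lborel. (\<lambda>m. f x * H m x) \<longlonglongrightarrow> f x * sgn (f x)"
      using Hlim by eventually_elim (intro tendsto_intros)
    show "AE x in lborel. norm (f x * H m x) \<le> \<bar>f x\<bar>" for m
      using Hb by (auto simp: abs_mult mult_left_le)
  qed measurable
  moreover have "(LINT x|lborel. f x * H m x) = 0" for m by (rule pair[OF Hc Hb Hi])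
  ultimately have "(LINT x|lborel. f x * sgn (f x)) = 0" by (simp add: LIMSEQ_const_iff)
  moreover have "f x * sgn (f x) = \<bar>f x\<bar>" for x by (simp add: abs_sgn)
  ultimately have "(LINT x|lborel. \<bar>f x\<bar>) = 0" by simp
  then show ?thesis
    using integral_nonneg_eq_0_iff_AE[of lborel "\<lambda>x. \<bar>f x\<bar>"] f by auto
qed

section \<open>The Fourier transform of square-integrable functions\<close>

lemma cnj_measurable [measurable (raw)]:
  "f \<in> borel_measurable M \<Longrightarrow> (\<lambda>x. cnj (f x)) \<in> borel_measurable M"
  by (rule borel_measurable_continuous_on[of cnj]) (auto intro!: continuous_intros)

lemma abs_heat: "t > 0 \<Longrightarrow> \<bar>heat t x\<bar> = heat t x"
  using heat_pos[of t x] by simp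

text \<open>The L2 Fourier transform as a relation: \<open>V\<close> may be reached along any
  approximants in L1 and L2, not only along truncations to balls. This makes linear operations,
  rotations and heat convolution immediate, and it matches the fact that \<open>V\<close> is
  determined only up to null sets.\<close>

definition is_fourier :: "('a::euclidean_space \<Rightarrow> real) \<Rightarrow> ('a \<Rightarrow> complex) \<Rightarrow> bool" where
  "is_fourier v V \<longleftrightarrow> sq_integrable v \<and> sq_integrable V \<and>
     (\<exists>w::nat \<Rightarrow> 'a \<Rightarrow> real. (\<forall>n. integrable lborel (w n) \<and> sq_integrable (w n)) \<and>
        (\<lambda>n. sqnorm (\<lambda>x. w n x - v x)) \<longlonglongrightarrow> 0 \<and>
        (\<lambda>n. sqnorm (\<lambda>\<xi>. fourier_L1 (w n) \<xi> - V \<xi>)) \<longlonglongrightarrow> 0)"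

lemma is_fourierD:
  assumes "is_fourier v V"
  shows "sq_integrable v" "sq_integrable V"
  using assms by (auto simp: is_fourier_def)

lemma is_fourierE:
  assumes "is_fourier v V"
  obtains w where "\<And>n::nat. integrable lborel (w n)" "\<And>n. sq_integrable (w n)"
    "(\<lambda>n. sqnorm (\<lambda>x. w n x - v x)) \<longlonglongrightarrow> 0" "(\<lambda>n. sqnorm (\<lambda>\<xi>. fourier_L1 (w n) \<xi> - V \<xi>)) \<longlonglongrightarrow> 0"
  using assms by (auto simp: is_fourier_def)

lemma is_fourierI:
  assumes "sq_integrable v" "sq_integrable V" "\<And>n::nat. integrable lborel (w n)" "\<And>n. sq_integrable (w n)"
    "(\<lambda>n. sqnorm (\<lambda>x. w n x - v x)) \<longlonglongrightarrow> 0" "(\<lambda>n. sqnorm (\<lambda>\<xi>. fourier_L1 (w n) \<xi> - V \<xi>)) \<longlonglongrightarrow> 0"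
  shows "is_fourier v V"
  using assms unfolding is_fourier_def by blast

lemma is_fourier_L1:
  assumes "integrable lborel f" "sq_integrable f"
  shows "is_fourier f (fourier_L1 f)"
  by (rule is_fourierI[where w = "\<lambda>n. f"]) (use assms Plancherel_L1(1)[OF assms] in \<open>auto simp: sqnorm_def\<close>)

lemma is_fourier_sqnorm:
  fixes v :: "'a::euclidean_space \<Rightarrow> real"
  assumes "is_fourier v V"
  shows "sqnorm V = (2 * pi) powr real DIM('a) * sqnorm v"
proof -
  from assms obtain w where w: "\<And>n::nat. integrable lborel (w n)" "\<And>n. sq_integrable (w n)"
    "(\<lambda>n. sqnorm (\<lambda>x. w n x - v x)) \<longlonglongrightarrow> 0" "(\<lambda>n. sqnorm (\<lambda>\<xi>. fourier_L1 (w n) \<xi> - V \<xi>)) \<longlonglongrightarrow> 0"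
    by (rule is_fourierE) blast
  have "(\<lambda>n. sqnorm (fourier_L1 (w n))) \<longlonglongrightarrow> sqnorm V"
    by (rule tendsto_sqnorm[OF Plancherel_L1(1)[OF w(1,2)] is_fourierD(2)[OF assms] w(4)])
  moreover have "(\<lambda>n. (2 * pi) powr real DIM('a) * sqnorm (w n)) \<longlonglongrightarrow> (2 * pi) powr real DIM('a) * sqnorm v"
    by (intro tendsto_intros tendsto_sqnorm[OF w(2) is_fourierD(1)[OF assms] w(3)])
  ultimately show ?thesis
    unfolding Plancherel_L1(2)[OF w(1,2)] by (rule LIMSEQ_unique)
qed

lemma tendsto_sqnorm_add:
  assumes "\<And>n. sq_integrable (f n)" "\<And>n. sq_integrable (g n)"
    "(\<lambda>n. sqnorm (f n)) \<longlonglongrightarrow> 0" "(\<lambda>n. sqnorm (g n)) \<longlonglongrightarrow> 0"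
  shows "(\<lambda>n. sqnorm (\<lambda>x. f n x + g n x)) \<longlonglongrightarrow> 0"
proof (rule tendsto_sandwich[OF _ _ tendsto_const])
  show "\<forall>\<^sub>F n in sequentially. 0 \<le> sqnorm (\<lambda>x. f n x + g n x)" by simp
  show "\<forall>\<^sub>F n in sequentially. sqnorm (\<lambda>x. f n x + g n x) \<le> 2 * sqnorm (f n) + 2 * sqnorm (g n)"
    using sqnorm_add_le[OF assms(1,2)] by simp
  show "(\<lambda>n. 2 * sqnorm (f n) + 2 * sqnorm (g n)) \<longlonglongrightarrow> 0"
    using tendsto_add[OF tendsto_mult_left[OF assms(3), of 2] tendsto_mult_left[OF assms(4), of 2]] by simp
qed

lemma sqnorm_cmult_complex: "sqnorm (\<lambda>x. complex_of_real c * F x) = c\<^sup>2 * sqnorm F"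
  using sqnorm_scaleR[of c F] by (simp add: scaleR_conv_of_real)

lemma is_fourier_cmult:
  assumes "is_fourier v V"
  shows "is_fourier (\<lambda>x. c * v x) (\<lambda>\<xi>. complex_of_real c * V \<xi>)"
proof -
  from assms obtain w where w: "\<And>n::nat. integrable lborel (w n)" "\<And>n. sq_integrable (w n)"
    "(\<lambda>n. sqnorm (\<lambda>x. w n x - v x)) \<longlonglongrightarrow> 0" "(\<lambda>n. sqnorm (\<lambda>\<xi>. fourier_L1 (w n) \<xi> - V \<xi>)) \<longlonglongrightarrow> 0"
    by (rule is_fourierE) blast
  show ?thesis
  proof (rule is_fourierI[where w = "\<lambda>n x. c * w n x"])
    show "sq_integrable (\<lambda>\<xi>. complex_of_real c * V \<xi>)"
      using sq_integrable_scaleR[OF is_fourierD(2)[OF assms], of c] by (simp add: scaleR_conv_of_real)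
    show "(\<lambda>n. sqnorm (\<lambda>x. c * w n x - c * v x)) \<longlonglongrightarrow> 0"
      using tendsto_mult_left[OF w(3), of "c\<^sup>2"] by (simp add: sqnorm_cmult flip: right_diff_distrib)
    show "(\<lambda>n. sqnorm (\<lambda>\<xi>. fourier_L1 (\<lambda>x. c * w n x) \<xi> - complex_of_real c * V \<xi>)) \<longlonglongrightarrow> 0"
      using tendsto_mult_left[OF w(4), of "c\<^sup>2"]
      by (simp add: fourier_L1_cmult sqnorm_cmult_complex flip: right_diff_distrib)
  qed (use w sq_integrable_cmult is_fourierD(1)[OF assms] in auto)
qed

lemma is_fourier_add:
  assumes "is_fourier u U" "is_fourier v V"
  shows "is_fourier (\<lambda>x. u x + v x) (\<lambda>\<xi>. U \<xi> + V \<xi>)"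
proof -
  from assms(1) obtain f where f: "\<And>n::nat. integrable lborel (f n)" "\<And>n. sq_integrable (f n)"
    "(\<lambda>n. sqnorm (\<lambda>x. f n x - u x)) \<longlonglongrightarrow> 0" "(\<lambda>n. sqnorm (\<lambda>\<xi>. fourier_L1 (f n) \<xi> - U \<xi>)) \<longlonglongrightarrow> 0"
    by (rule is_fourierE) blast
  from assms(2) obtain g where g: "\<And>n::nat. integrable lborel (g n)" "\<And>n. sq_integrable (g n)"
    "(\<lambda>n. sqnorm (\<lambda>x. g n x - v x)) \<longlonglongrightarrow> 0" "(\<lambda>n. sqnorm (\<lambda>\<xi>. fourier_L1 (g n) \<xi> - V \<xi>)) \<longlonglongrightarrow> 0"
    by (rule is_fourierE) blast
  note D = is_fourierD[OF assms(1)] is_fourierD[OF assms(2)]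
  show ?thesis
  proof (rule is_fourierI[where w = "\<lambda>n x. f n x + g n x"])
    show "(\<lambda>n. sqnorm (\<lambda>x. f n x + g n x - (u x + v x))) \<longlonglongrightarrow> 0"
      using tendsto_sqnorm_add[OF sq_integrable_diff[OF f(2) D(1)] sq_integrable_diff[OF g(2) D(3)] f(3) g(3)]
      by (simp add: algebra_simps)
    show "(\<lambda>n. sqnorm (\<lambda>\<xi>. fourier_L1 (\<lambda>x. f n x + g n x) \<xi> - (U \<xi> + V \<xi>))) \<longlonglongrightarrow> 0"
      using tendsto_sqnorm_add[OF sq_integrable_diff[OF Plancherel_L1(1)[OF f(1,2)] D(2)]
          sq_integrable_diff[OF Plancherel_L1(1)[OF g(1,2)] D(4)] f(4) g(4)]
      by (simp add: fourier_L1_add[OF f(1) g(1)] algebra_simps)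
  qed (use f g D in \<open>auto intro!: sq_integrable_add\<close>)
qed

lemma is_fourier_diff:
  assumes "is_fourier u U" "is_fourier v V"
  shows "is_fourier (\<lambda>x. u x - v x) (\<lambda>\<xi>. U \<xi> - V \<xi>)"
  using is_fourier_add[OF assms(1) is_fourier_cmult[OF assms(2), of "-1"]] by simp

lemma is_fourier_sum:
  assumes "\<And>i. i \<in> I \<Longrightarrow> is_fourier (u i) (U i)"
  shows "is_fourier (\<lambda>x. \<Sum>i\<in>I. u i x) (\<lambda>\<xi>. \<Sum>i\<in>I. U i \<xi>)"
proof -
  have z: "is_fourier (\<lambda>x. 0) (\<lambda>\<xi>. 0)"
    using is_fourier_L1[of "\<lambda>x. 0"] by (simp add: fourier_L1_def[abs_def])
  show ?thesis
    using assms by (induction I rule: infinite_finite_induct) (auto intro!: is_fourier_add z)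
qed

lemma is_fourier_dist:
  fixes u :: "'a::euclidean_space \<Rightarrow> real"
  assumes "is_fourier u U" "is_fourier v V"
  shows "sqnorm (\<lambda>\<xi>. U \<xi> - V \<xi>) = (2 * pi) powr real DIM('a) * sqnorm (\<lambda>x. u x - v x)"
  by (rule is_fourier_sqnorm[OF is_fourier_diff[OF assms]])

lemma is_fourier_unique:
  assumes "is_fourier u U" "is_fourier u V"
  shows "AE \<xi> in lborel. U \<xi> = V \<xi>"
proof -
  have "sqnorm (\<lambda>\<xi>. U \<xi> - V \<xi>) = 0" unfolding is_fourier_dist[OF assms] by (simp add: sqnorm_def)
  from sqnorm_eq_0_AE[OF sq_integrable_diff[OF is_fourierD(2)[OF assms(1)] is_fourierD(2)[OF assms(2)]] this]
  show ?thesis by simp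
qed

text \<open>Plancherel read as injectivity; it carries identities verified for transforms back to
  the functions.\<close>

lemma is_fourier_inj_AE:
  fixes u :: "'a::euclidean_space \<Rightarrow> real"
  assumes "is_fourier u U" "is_fourier v V" "AE \<xi> in lborel. U \<xi> = V \<xi>"
  shows "AE x in lborel. u x = v x"
proof -
  note D = is_fourierD[OF assms(1)] is_fourierD[OF assms(2)]
  have "sqnorm (\<lambda>\<xi>. U \<xi> - V \<xi>) = sqnorm (\<lambda>\<xi>::'a. 0 :: complex)"
  proof (rule sqnorm_cong_AE)
    show "(\<lambda>\<xi>. U \<xi> - V \<xi>) \<in> borel_measurable borel"
      using sq_integrable_diff[OF D(2,4)] by (rule sq_integrableD)
    show "AE \<xi> in lborel. U \<xi> - V \<xi> = 0" using assms(3) by eventually_elim simp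
  qed simp
  then have "sqnorm (\<lambda>x. u x - v x) = 0" unfolding is_fourier_dist[OF assms(1,2)] by (simp add: sqnorm_def)
  from sqnorm_eq_0_AE[OF sq_integrable_diff[OF D(1,3)] this] show ?thesis by simp
qed

lemma is_fourier_cong_AE:
  assumes F: "is_fourier u U" and [measurable]: "v \<in> borel_measurable borel" "V \<in> borel_measurable borel"
    and "AE x in lborel. u x = v x" "AE \<xi> in lborel. U \<xi> = V \<xi>"
  shows "is_fourier v V"
proof -
  note D = is_fourierD[OF F]
  have [measurable]: "u \<in> borel_measurable borel" "U \<in> borel_measurable borel" using D by measurable
  from F obtain w where w: "\<And>n::nat. integrable lborel (w n)" "\<And>n. sq_integrable (w n)"
    "(\<lambda>n. sqnorm (\<lambda>x. w n x - u x)) \<longlonglongrightarrow> 0" "(\<lambda>n. sqnorm (\<lambda>\<xi>. fourier_L1 (w n) \<xi> - U \<xi>)) \<longlonglongrightarrow> 0"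
    by (rule is_fourierE) blast
  have [measurable]: "w n \<in> borel_measurable borel" for n using w(2) by measurable
  show ?thesis
  proof (rule is_fourierI[where w = w])
    have "sqnorm (\<lambda>x. w n x - u x) = sqnorm (\<lambda>x. w n x - v x)" for n
      by (rule sqnorm_cong_AE) (use assms(4) in \<open>auto elim!: eventually_mono\<close>)
    then show "(\<lambda>n. sqnorm (\<lambda>x. w n x - v x)) \<longlonglongrightarrow> 0" using w(3) by simp
    have "sqnorm (\<lambda>\<xi>. fourier_L1 (w n) \<xi> - U \<xi>) = sqnorm (\<lambda>\<xi>. fourier_L1 (w n) \<xi> - V \<xi>)" for n
      by (rule sqnorm_cong_AE) (use assms(5) in \<open>auto elim!: eventually_mono\<close>)
    then show "(\<lambda>n. sqnorm (\<lambda>\<xi>. fourier_L1 (w n) \<xi> - V \<xi>)) \<longlonglongrightarrow> 0" using w(4) by simp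
  qed (use D w assms in \<open>auto intro: sq_integrable_cong_AE\<close>)
qed

text \<open>The truncations form a Cauchy sequence in L2, Plancherel transfers this to their
  transforms, and completeness provides the limit that the choice in \<open>fourier\<close> refers
  to.\<close>

lemma is_fourier_fourier:
  fixes v :: "'a::euclidean_space \<Rightarrow> real"
  assumes v: "sq_integrable v"
  shows "is_fourier v (fourier v)"
proof -
  define w where "w n x = indicator (cball 0 (real n)) x * v x" for n :: nat and x
  have w: "integrable lborel (w n)" "sq_integrable (w n)" "(\<lambda>n. sqnorm (\<lambda>x. w n x - v x)) \<longlonglongrightarrow> 0" for n
    unfolding w_def using sqnorm_truncation[OF v] sq_integrable_cball_integrable[OF v] by auto
  note P = Plancherel_L1(1)[OF w(1,2)]
  define c where "c = (2 * pi) powr real DIM('a)"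
  have "c > 0" by (simp add: c_def)
  have "\<exists>g. sq_integrable g \<and> (\<lambda>n. sqnorm (\<lambda>\<xi>. fourier_L1 (w n) \<xi> - g \<xi>)) \<longlonglongrightarrow> 0"
  proof (rule sq_integrable_complete[OF P])
    fix e :: real assume "e > 0"
    then obtain M where M: "\<And>n. n \<ge> M \<Longrightarrow> sqnorm (\<lambda>x. w n x - v x) < e / (4 * c)"
      using LIMSEQ_D[OF w(3), of "e / (4 * c)"] \<open>c > 0\<close> by auto
    have "sqnorm (\<lambda>\<xi>. fourier_L1 (w m) \<xi> - fourier_L1 (w n) \<xi>) < e" if "m \<ge> M" "n \<ge> M" for m n
    proof -
      have "sqnorm (\<lambda>x. w m x - w n x) = sqnorm (\<lambda>x. (w m x - v x) + (v x - w n x))" by simp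
      also have "\<dots> \<le> 2 * sqnorm (\<lambda>x. w m x - v x) + 2 * sqnorm (\<lambda>x. v x - w n x)"
        by (intro sqnorm_add_le sq_integrable_diff w v)
      also have "\<dots> < e / c" using M[OF that(1)] M[OF that(2)] sqnorm_minus_commute[of v "w n"] by simp
      finally show ?thesis
        using is_fourier_dist[OF is_fourier_L1[OF w(1,2), of m] is_fourier_L1[OF w(1,2), of n]] \<open>c > 0\<close>
        unfolding c_def[symmetric] by (simp add: field_simps)
    qed
    then show "\<exists>M. \<forall>m\<ge>M. \<forall>n\<ge>M. sqnorm (\<lambda>\<xi>. fourier_L1 (w m) \<xi> - fourier_L1 (w n) \<xi>) < e" by blast
  qed
  then obtain g where g: "sq_integrable g" "(\<lambda>n. sqnorm (\<lambda>\<xi>. fourier_L1 (w n) \<xi> - g \<xi>)) \<longlonglongrightarrow> 0" by blast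
  have "\<exists>g. g \<in> Lspace 2 \<and>
     (\<lambda>n. Lnorm 2 (\<lambda>\<xi>. g \<xi> - fourier_L1 (\<lambda>x. indicator (cball 0 (real n)) x * v x) \<xi>)) \<longlonglongrightarrow> 0"
    using g tendsto_real_sqrt[OF g(2)]
    by (intro exI[of _ g]) (simp add: Lspace_2_iff Lnorm_2_eq sqnorm_minus_commute[of g] w_def[abs_def])
  from someI_ex[OF this, folded fourier_def]
  have F: "sq_integrable (fourier v)" "(\<lambda>n. sqrt (sqnorm (\<lambda>\<xi>. fourier_L1 (w n) \<xi> - fourier v \<xi>))) \<longlonglongrightarrow> 0"
    by (simp_all add: Lspace_2_iff Lnorm_2_eq sqnorm_minus_commute[of "fourier v"] w_def[abs_def])
  have "(\<lambda>n. sqnorm (\<lambda>\<xi>. fourier_L1 (w n) \<xi> - fourier v \<xi>)) \<longlonglongrightarrow> 0"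
    using tendsto_power[OF F(2), of 2] by simp
  with is_fourierI[OF v F(1) w] show ?thesis by blast
qed

lemma Re_mult_cnj_integrable:
  fixes U V :: "'a::euclidean_space \<Rightarrow> complex"
  assumes [measurable]: "sq_integrable U" "sq_integrable V"
  shows "integrable lborel (\<lambda>\<xi>. Re (U \<xi> * cnj (V \<xi>)))"
proof (rule Bochner_Integration.integrable_bound[OF sq_integrable_prod[OF assms]])
  have "\<bar>Re (U \<xi> * cnj (V \<xi>))\<bar> \<le> norm (U \<xi>) * norm (V \<xi>)" for \<xi>
    using abs_Re_le_cmod[of "U \<xi> * cnj (V \<xi>)"] by (simp add: norm_mult)
  then show "AE \<xi> in lborel. norm (Re (U \<xi> * cnj (V \<xi>))) \<le> norm (norm (U \<xi>) * norm (V \<xi>))" by simp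
qed measurable

text \<open>Polarisation: Plancherel for u + v compared with Plancherel for \<open>u\<close> and for
  \<open>v\<close>.\<close>

lemma Parseval:
  fixes u v :: "'a::euclidean_space \<Rightarrow> real"
  assumes "is_fourier u U" "is_fourier v V"
  shows "(LINT \<xi>|lborel. Re (U \<xi> * cnj (V \<xi>))) = (2 * pi) powr real DIM('a) * (LINT x|lborel. u x * v x)"
proof -
  note D = is_fourierD[OF assms(1)] is_fourierD[OF assms(2)]
  have 1: "sqnorm (\<lambda>x. u x + v x) = sqnorm u + sqnorm v + 2 * (LINT x|lborel. u x * v x)"
  proof -
    have "sqnorm (\<lambda>x. u x + v x) = (LINT x|lborel. (norm (u x))\<^sup>2 + (norm (v x))\<^sup>2 + 2 * (u x * v x))"
      unfolding sqnorm_def by (simp add: power2_sum mult.assoc)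
    then show ?thesis
      using D sq_integrable_mult[OF D(1,3)] by (simp add: sq_integrable_def sqnorm_def)
  qed
  have 2: "sqnorm (\<lambda>\<xi>. U \<xi> + V \<xi>) = sqnorm U + sqnorm V + 2 * (LINT \<xi>|lborel. Re (U \<xi> * cnj (V \<xi>)))"
  proof -
    have "sqnorm (\<lambda>\<xi>. U \<xi> + V \<xi>) = (LINT \<xi>|lborel. (norm (U \<xi>))\<^sup>2 + (norm (V \<xi>))\<^sup>2 + 2 * Re (U \<xi> * cnj (V \<xi>)))"
      unfolding sqnorm_def by (simp add: cmod_add_squared[symmetric] cmod_power2 power2_sum algebra_simps)
    then show ?thesis
      using D Re_mult_cnj_integrable[OF D(2,4)]
      by (simp add: sq_integrable_def sqnorm_def del: times_complex.sel complex_cnj)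
  qed
  show ?thesis
    using is_fourier_sqnorm[OF is_fourier_add[OF assms]] is_fourier_sqnorm[OF assms(1)] is_fourier_sqnorm[OF assms(2)]
    unfolding 1 2 by (simp add: algebra_simps)
qed

lemma fourier_L1_conv_heat:
  fixes f :: "'a::euclidean_space \<Rightarrow> real"
  assumes f: "integrable lborel f" and "t > 0"
  shows "integrable lborel (conv f (heat t))"
    "fourier_L1 (conv f (heat t)) \<xi> = complex_of_real (exp (- t * (\<xi> \<bullet> \<xi>))) * fourier_L1 f \<xi>"
proof -
  have [measurable]: "f \<in> borel_measurable borel" using f by measurable
  have ht: "integrable lborel (\<lambda>x. heat t (x - y))" "(LINT x|lborel. heat t (x - y)) = 1" for y :: 'a
    using lborel_integral_translate[of "heat t :: 'a \<Rightarrow> real" "- y"] heat_integrable[OF assms(2)] heat_integral[OF assms(2)]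
    by auto
  have P: "integrable (lborel \<Otimes>\<^sub>M lborel) (\<lambda>(y, x). f y * heat t (x - y))"
  proof (rule lborel_pair.Fubini_integrable)
    have "(\<lambda>y. LINT x|lborel. norm (case (y, x) of (y, x) \<Rightarrow> f y * heat t (x - y))) = (\<lambda>y. \<bar>f y\<bar>)"
      using ht assms(2) by (simp add: abs_mult abs_heat)
    then show "integrable lborel (\<lambda>y. LINT x|lborel. norm (case (y, x) of (y, x) \<Rightarrow> f y * heat t (x - y)))"
      using f by simp
    show "AE y in lborel. integrable lborel (\<lambda>x. case (y, x) of (y, x) \<Rightarrow> f y * heat t (x - y))"
      using ht by simp
  qed measurable
  from lborel_pair.integrable_snd[OF P] show "integrable lborel (conv f (heat t))"
    unfolding conv_def[abs_def] by simp
  have Q: "integrable (lborel \<Otimes>\<^sub>M lborel) (\<lambda>(y, x). complex_of_real (f y * heat t (x - y)) * cis (- (x \<bullet> \<xi>)))"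
    by (rule Bochner_Integration.integrable_bound[OF P]) (auto simp: norm_mult abs_mult)
  have "fourier_L1 (conv f (heat t)) \<xi> = (LINT x|lborel. LINT y|lborel. complex_of_real (f y * heat t (x - y)) * cis (- (x \<bullet> \<xi>)))"
    unfolding fourier_L1_def conv_def by (simp flip: integral_complex_of_real)
  also have "\<dots> = (LINT y|lborel. LINT x|lborel. complex_of_real (f y * heat t (x - y)) * cis (- (x \<bullet> \<xi>)))"
    by (rule lborel_pair.Fubini_integral[OF Q])
  also have "\<dots> = (LINT y|lborel. complex_of_real (exp (- t * (\<xi> \<bullet> \<xi>))) * (complex_of_real (f y) * cis (- (y \<bullet> \<xi>))))"
  proof (intro Bochner_Integration.integral_cong refl)
    fix y :: 'a
    have "(LINT x|lborel. complex_of_real (f y * heat t (x - y)) * cis (- (x \<bullet> \<xi>)))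
       = (LINT x|lborel. complex_of_real (f y * heat t (x + y - y)) * cis (- ((x + y) \<bullet> \<xi>)))"
      by (rule lborel_integral_translate(1)[symmetric]) measurable
    also have "\<dots> = (LINT x|lborel. (complex_of_real (f y) * cis (- (y \<bullet> \<xi>))) * (complex_of_real (heat t x) * cis (x \<bullet> (- \<xi>))))"
    proof (intro Bochner_Integration.integral_cong refl)
      fix x :: 'a
      have "cis (- ((x + y) \<bullet> \<xi>)) = cis (- (y \<bullet> \<xi>)) * cis (x \<bullet> (- \<xi>))"
        by (simp add: cis_mult inner_add_left algebra_simps)
      then show "complex_of_real (f y * heat t (x + y - y)) * cis (- ((x + y) \<bullet> \<xi>))
        = (complex_of_real (f y) * cis (- (y \<bullet> \<xi>))) * (complex_of_real (heat t x) * cis (x \<bullet> (- \<xi>)))"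
        by (simp only: add_diff_cancel_right' of_real_mult ac_simps)
    qed
    also have "\<dots> = (complex_of_real (f y) * cis (- (y \<bullet> \<xi>))) * (LINT x|lborel. (complex_of_real (heat t x) * cis (x \<bullet> (- \<xi>))))"
      by (rule integral_mult_right_zero)
    also have "\<dots> = complex_of_real (exp (- t * (\<xi> \<bullet> \<xi>))) * (complex_of_real (f y) * cis (- (y \<bullet> \<xi>)))"
      unfolding heat_fourier[OF assms(2)] by simp
    finally show "(LINT x|lborel. complex_of_real (f y * heat t (x - y)) * cis (- (x \<bullet> \<xi>)))
      = complex_of_real (exp (- t * (\<xi> \<bullet> \<xi>))) * (complex_of_real (f y) * cis (- (y \<bullet> \<xi>)))" .
  qed
  also have "\<dots> = complex_of_real (exp (- t * (\<xi> \<bullet> \<xi>))) * fourier_L1 f \<xi>"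
    unfolding fourier_L1_def by (rule integral_mult_right_zero)
  finally show "fourier_L1 (conv f (heat t)) \<xi> = complex_of_real (exp (- t * (\<xi> \<bullet> \<xi>))) * fourier_L1 f \<xi>" .
qed

lemma conv_heat_contraction:
  fixes f :: "'a::euclidean_space \<Rightarrow> real"
  assumes "sq_integrable f" "t > 0"
  shows "sqnorm (conv f (heat t)) \<le> sqnorm f"
proof -
  have "(LINT x|lborel. \<bar>heat t (x::'a)\<bar>) = 1"
    using heat_integral[OF assms(2), where 'a='a] assms(2) by (simp add: abs_heat)
  with Young_L2(2)[OF assms(1) kernel_heat[OF assms(2)]] show ?thesis by simp
qed

lemma gaussian_mult_le:
  fixes V :: "'a::euclidean_space \<Rightarrow> complex"
  assumes "t > 0"
  shows "norm (complex_of_real (exp (- t * (\<xi> \<bullet> \<xi>))) * V \<xi>) \<le> norm (V \<xi>)"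
proof -
  have "exp (- t * (\<xi> \<bullet> \<xi>)) \<le> 1" using assms by simp
  then show ?thesis by (simp add: norm_mult mult_left_le_one_le)
qed

text \<open>Heat convolution in space and multiplication by the Gaussian in frequency are both L2
  contractions, so the identity for integrable functions survives the limit.\<close>

lemma is_fourier_conv_heat:
  fixes v :: "'a::euclidean_space \<Rightarrow> real"
  assumes F: "is_fourier v V" and t: "t > 0"
  shows "is_fourier (conv v (heat t)) (\<lambda>\<xi>. complex_of_real (exp (- t * (\<xi> \<bullet> \<xi>))) * V \<xi>)"
proof -
  note D = is_fourierD[OF F]
  have [measurable]: "V \<in> borel_measurable borel" using D by measurable
  from F obtain w where w: "\<And>n::nat. integrable lborel (w n)" "\<And>n. sq_integrable (w n)"
    "(\<lambda>n. sqnorm (\<lambda>x. w n x - v x)) \<longlonglongrightarrow> 0" "(\<lambda>n. sqnorm (\<lambda>\<xi>. fourier_L1 (w n) \<xi> - V \<xi>)) \<longlonglongrightarrow> 0"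
    by (rule is_fourierE) blast
  have [measurable]: "w n \<in> borel_measurable borel" for n using w(2) by measurable
  note k = kernel_heat[OF t]
  show ?thesis
  proof (rule is_fourierI[where w = "\<lambda>n. conv (w n) (heat t)"])
    show "sq_integrable (conv v (heat t))" "sq_integrable (conv (w n) (heat t))" for n
      using Young_L2(1)[OF _ k] D w by auto
    show "integrable lborel (conv (w n) (heat t))" for n by (rule fourier_L1_conv_heat(1)[OF w(1) t])
    show "sq_integrable (\<lambda>\<xi>. complex_of_real (exp (- t * (\<xi> \<bullet> \<xi>))) * V \<xi>)"
      by (rule sq_integrable_dominated[OF D(2)]) (use gaussian_mult_le[OF t] in auto)
    show "(\<lambda>n. sqnorm (\<lambda>x. conv (w n) (heat t) x - conv v (heat t) x)) \<longlonglongrightarrow> 0"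
    proof (rule tendsto_sandwich[OF _ _ tendsto_const w(3)])
      have "(\<lambda>x. conv (w n) (heat t) x - conv v (heat t) x) = conv (\<lambda>x. w n x - v x) (heat t)" for n
        by (rule ext, rule conv_diff[OF w(2) D(1) k, symmetric])
      then show "\<forall>\<^sub>F n in sequentially. sqnorm (\<lambda>x. conv (w n) (heat t) x - conv v (heat t) x) \<le> sqnorm (\<lambda>x. w n x - v x)"
        using conv_heat_contraction[OF sq_integrable_diff[OF w(2) D(1)] t] by simp
    qed simp
    show "(\<lambda>n. sqnorm (\<lambda>\<xi>. fourier_L1 (conv (w n) (heat t)) \<xi> - complex_of_real (exp (- t * (\<xi> \<bullet> \<xi>))) * V \<xi>)) \<longlonglongrightarrow> 0"
    proof (rule tendsto_sandwich[OF _ _ tendsto_const w(4)])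
      have "sqnorm (\<lambda>\<xi>. complex_of_real (exp (- t * (\<xi> \<bullet> \<xi>))) * (fourier_L1 (w n) \<xi> - V \<xi>)) \<le> sqnorm (\<lambda>\<xi>. fourier_L1 (w n) \<xi> - V \<xi>)" for n
        by (rule sqnorm_mono[OF sq_integrable_diff[OF Plancherel_L1(1)[OF w(1,2)] D(2)]]) (use gaussian_mult_le[OF t, of _ "\<lambda>\<xi>. fourier_L1 (w n) \<xi> - V \<xi>"] in auto)
      then show "\<forall>\<^sub>F n in sequentially. sqnorm (\<lambda>\<xi>. fourier_L1 (conv (w n) (heat t)) \<xi> - complex_of_real (exp (- t * (\<xi> \<bullet> \<xi>))) * V \<xi>)
          \<le> sqnorm (\<lambda>\<xi>. fourier_L1 (w n) \<xi> - V \<xi>)"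
        by (simp add: fourier_L1_conv_heat(2)[OF w(1) t] flip: right_diff_distrib)
    qed simp
  qed
qed

lemma sq_integrable_gaussian:
  assumes "t > 0"
  shows "sq_integrable (\<lambda>\<xi>::'a::euclidean_space. exp (- t * (\<xi> \<bullet> \<xi>)))"
proof -
  have "(exp (- t * (\<xi> \<bullet> \<xi>)))\<^sup>2 = exp (- (2 * t) * (\<xi> \<bullet> \<xi>))" for \<xi> :: 'a
    by (simp flip: exp_double)
  then show ?thesis using gaussian_fourier(1)[of "2 * t", where 'a='a] assms by (simp add: sq_integrable_def)
qed

text \<open>The bridge from frequency to sup bounds, used for the Sobolev estimate and for
  vanishing. Inversion gives it for integrable approximants. In the limit, the left side converges
  at the fixed point \<open>x\<close> by Cauchy--Schwarz and the right side because the Gaussian is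
  in L2.\<close>

lemma conv_heat_sup_bound:
  fixes v :: "'a::euclidean_space \<Rightarrow> real"
  assumes F: "is_fourier v V" and t: "t > 0"
  shows "\<bar>conv v (heat t) x\<bar> \<le> (2 * pi) powr (- real DIM('a)) * (LINT \<xi>|lborel. exp (- t * (\<xi> \<bullet> \<xi>)) * norm (V \<xi>))"
proof -
  let ?c = "(2 * pi) powr (- real DIM('a))"
  let ?g = "\<lambda>\<xi>::'a. exp (- t * (\<xi> \<bullet> \<xi>))"
  note D = is_fourierD[OF F]
  note g = sq_integrable_gaussian[OF t, where 'a='a]
  from F obtain w where w: "\<And>n::nat. integrable lborel (w n)" "\<And>n. sq_integrable (w n)"
    "(\<lambda>n. sqnorm (\<lambda>x. w n x - v x)) \<longlonglongrightarrow> 0" "(\<lambda>n. sqnorm (\<lambda>\<xi>. fourier_L1 (w n) \<xi> - V \<xi>)) \<longlonglongrightarrow> 0"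
    by (rule is_fourierE) blast
  note P = Plancherel_L1(1)[OF w(1,2)]
  have b: "\<bar>conv (w n) (heat t) x\<bar> \<le> ?c * (LINT \<xi>|lborel. ?g \<xi> * norm (fourier_L1 (w n) \<xi>))" for n
  proof -
    have "\<bar>conv (w n) (heat t) x\<bar> = norm (complex_of_real (conv (w n) (heat t) x))" by simp
    also have "\<dots> = ?c * norm (LINT \<xi>|lborel. complex_of_real (?g \<xi>) * (cis (x \<bullet> \<xi>) * fourier_L1 (w n) \<xi>))"
      unfolding conv_heat_inversion[OF w(1) t] by (simp add: norm_mult)
    also have "\<dots> \<le> ?c * (LINT \<xi>|lborel. norm (complex_of_real (?g \<xi>) * (cis (x \<bullet> \<xi>) * fourier_L1 (w n) \<xi>)))"
      by (intro mult_left_mono integral_norm_bound) simp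
    finally show ?thesis by (simp add: norm_mult)
  qed
  have "(\<lambda>n. conv (w n) (heat t) x) \<longlonglongrightarrow> conv v (heat t) x"
  proof (rule LIM_zero_cancel, rule Lim_null_comparison)
    show "(\<lambda>n. sqrt (sqnorm (\<lambda>x. w n x - v x)) * sqrt (sqnorm (heat t :: 'a \<Rightarrow> real))) \<longlonglongrightarrow> 0"
      using tendsto_mult_right[OF tendsto_real_sqrt[OF w(3)]] by simp
    show "\<forall>\<^sub>F n in sequentially. norm (conv (w n) (heat t) x - conv v (heat t) x) \<le> sqrt (sqnorm (\<lambda>x. w n x - v x)) * sqrt (sqnorm (heat t :: 'a \<Rightarrow> real))"
      using conv_bound[OF sq_integrable_diff[OF w(2) D(1)] kernel_heat[OF t]] by (simp add: conv_diff[OF w(2) D(1) kernel_heat[OF t]])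
  qed
  then have L: "(\<lambda>n. \<bar>conv (w n) (heat t) x\<bar>) \<longlonglongrightarrow> \<bar>conv v (heat t) x\<bar>" by (rule tendsto_rabs)
  have R: "(\<lambda>n. LINT \<xi>|lborel. ?g \<xi> * norm (fourier_L1 (w n) \<xi>)) \<longlonglongrightarrow> (LINT \<xi>|lborel. ?g \<xi> * norm (V \<xi>))"
  proof (rule LIM_zero_cancel, rule Lim_null_comparison)
    show "(\<lambda>n. sqrt (sqnorm ?g) * sqrt (sqnorm (\<lambda>\<xi>. fourier_L1 (w n) \<xi> - V \<xi>))) \<longlonglongrightarrow> 0"
      using tendsto_mult_left[OF tendsto_real_sqrt[OF w(4)]] by simp
    have "\<bar>(LINT \<xi>|lborel. ?g \<xi> * norm (fourier_L1 (w n) \<xi>)) - (LINT \<xi>|lborel. ?g \<xi> * norm (V \<xi>))\<bar>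
      \<le> sqrt (sqnorm ?g) * sqrt (sqnorm (\<lambda>\<xi>. fourier_L1 (w n) \<xi> - V \<xi>))" for n
    proof -
      have i: "integrable lborel (\<lambda>\<xi>. ?g \<xi> * norm (fourier_L1 (w n) \<xi>))" "integrable lborel (\<lambda>\<xi>. ?g \<xi> * norm (V \<xi>))"
        using sq_integrable_prod[OF g P] sq_integrable_prod[OF g D(2)] by simp_all
      have j: "integrable lborel (\<lambda>\<xi>. ?g \<xi> * norm (fourier_L1 (w n) \<xi> - V \<xi>))"
        using sq_integrable_prod[OF g sq_integrable_diff[OF P D(2)]] by simp
      have "\<bar>(LINT \<xi>|lborel. ?g \<xi> * norm (fourier_L1 (w n) \<xi>)) - (LINT \<xi>|lborel. ?g \<xi> * norm (V \<xi>))\<bar>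
        = \<bar>LINT \<xi>|lborel. ?g \<xi> * norm (fourier_L1 (w n) \<xi>) - ?g \<xi> * norm (V \<xi>)\<bar>" using i by simp
      also have "\<dots> \<le> (LINT \<xi>|lborel. \<bar>?g \<xi> * norm (fourier_L1 (w n) \<xi>) - ?g \<xi> * norm (V \<xi>)\<bar>)"
        by (rule integral_abs_bound)
      also have "\<dots> \<le> (LINT \<xi>|lborel. ?g \<xi> * norm (fourier_L1 (w n) \<xi> - V \<xi>))"
      proof (intro integral_mono integrable_abs Bochner_Integration.integrable_diff i j)
        show "\<bar>?g \<xi> * norm (fourier_L1 (w n) \<xi>) - ?g \<xi> * norm (V \<xi>)\<bar> \<le> ?g \<xi> * norm (fourier_L1 (w n) \<xi> - V \<xi>)" for \<xi>
          unfolding right_diff_distrib[symmetric] abs_mult by (intro mult_mono norm_triangle_ineq3) auto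
      qed
      also have "\<dots> \<le> sqrt (sqnorm ?g) * sqrt (sqnorm (\<lambda>\<xi>. fourier_L1 (w n) \<xi> - V \<xi>))"
        using Cauchy_Schwarz_norm[OF g sq_integrable_diff[OF P D(2)]] by simp
      finally show ?thesis .
    qed
    then show "\<forall>\<^sub>F n in sequentially. norm ((LINT \<xi>|lborel. ?g \<xi> * norm (fourier_L1 (w n) \<xi>)) - (LINT \<xi>|lborel. ?g \<xi> * norm (V \<xi>)))
      \<le> sqrt (sqnorm ?g) * sqrt (sqnorm (\<lambda>\<xi>. fourier_L1 (w n) \<xi> - V \<xi>))" by simp
  qed
  show ?thesis
    by (rule LIMSEQ_le[OF L tendsto_mult_left[OF R]]) (use b in auto)
qed

section \<open>Weak derivatives and the space H2\<close>

text \<open>Measurability is not stated in the definition; it is recovered from the integrable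
  restrictions to growing balls.\<close>

lemma locally_integrable_measurable [measurable_dest]:
  assumes "locally_integrable f"
  shows "f \<in> borel_measurable borel"
proof (rule borel_measurable_LIMSEQ_metric)
  show "(\<lambda>x. indicator (cball 0 (real n)) x *\<^sub>R f x) \<in> borel_measurable borel" for n
    using assms borel_measurable_integrable[of lborel "\<lambda>x. indicator (cball 0 (real n)) x *\<^sub>R f x"]
    unfolding locally_integrable_def set_integrable_def by simp
  fix x :: 'a
  show "(\<lambda>n. indicator (cball 0 (real n)) x *\<^sub>R f x) \<longlonglongrightarrow> f x"
  proof (rule tendsto_eventually)
    obtain n0 where "norm x \<le> real n0" using real_arch_simple by blast
    then show "\<forall>\<^sub>F n in sequentially. indicator (cball 0 (real n)) x *\<^sub>R f x = f x"
      by (auto simp: eventually_sequentially indicator_def intro!: exI[of _ n0])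
  qed
qed

lemma locally_integrable_times_bounded:
  assumes f: "locally_integrable f" and [measurable]: "\<phi> \<in> borel_measurable borel"
    and b: "\<And>x. \<bar>\<phi> x\<bar> \<le> B" and s: "\<And>x. norm x > r \<Longrightarrow> \<phi> x = 0"
  shows "integrable lborel (\<lambda>x. f x * \<phi> x)"
proof (rule Bochner_Integration.integrable_bound)
  have [measurable]: "f \<in> borel_measurable borel" using f by measurable
  show "integrable lborel (\<lambda>x. B * (indicator (cball 0 r) x *\<^sub>R f x))"
    using f unfolding locally_integrable_def set_integrable_def by (intro integrable_mult_right) auto
  have "\<bar>f x\<bar> * \<bar>\<phi> x\<bar> \<le> \<bar>B\<bar> * \<bar>f x\<bar>" for x
    using mult_left_mono[OF order_trans[OF b[of x] abs_ge_self] abs_ge_zero[of "f x"]] by (simp only: mult.commute)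
  then show "AE x in lborel. norm (f x * \<phi> x) \<le> norm (B * (indicator (cball 0 r) x *\<^sub>R f x))"
    using s by (auto simp: abs_mult indicator_def)
qed (use f in measurable)

lemma sq_integrable_locally_integrable:
  fixes f :: "'a::euclidean_space \<Rightarrow> real"
  assumes "sq_integrable f"
  shows "locally_integrable f"
  unfolding locally_integrable_def set_integrable_def
proof (intro allI impI)
  fix K :: "'a set" assume K: "compact K"
  then obtain r where r: "K \<subseteq> cball 0 r" using bounded_subset_ballD[OF compact_imp_bounded, of K 0] ball_subset_cball by blast
  have [measurable]: "K \<in> sets borel" "f \<in> borel_measurable borel" using K assms by (auto simp: borel_compact)
  show "integrable lborel (\<lambda>x. indicator K x *\<^sub>R f x)"
    by (rule Bochner_Integration.integrable_bound[OF sq_integrable_cball_integrable[OF assms, of r]])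
       (use r in \<open>auto simp: indicator_def intro!: AE_I2\<close>)
qed

lemma locally_integrable_continuous:
  fixes f :: "'a::euclidean_space \<Rightarrow> real"
  assumes "continuous_on UNIV f"
  shows "locally_integrable f"
  unfolding locally_integrable_def
  using borel_integrable_compact[OF _ continuous_on_subset[OF assms]] by (simp add: set_integrable_def)

lemma bump_trig_integrable:
  assumes f: "locally_integrable f" and "R > 0"
  shows "integrable lborel (\<lambda>x. f x * (bump R x * cos (x \<bullet> \<xi>)))" "integrable lborel (\<lambda>x. f x * (bump R x * sin (x \<bullet> \<xi>)))"
    "integrable lborel (\<lambda>x. f x * bump R x)"
proof -
  have b: "\<bar>bump R x\<bar> \<le> 1" for x :: 'a using bump_nonneg[of R x] bump_le_1[of R x] by simp
  have z: "bump R x = 0" if "norm x > R" for x :: 'a using bump_eq_0[OF assms(2), of x] that by simp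
  show "integrable lborel (\<lambda>x. f x * bump R x)"
    by (rule locally_integrable_times_bounded[OF f _ b z]) measurable
  have c: "\<bar>bump R x * cos (x \<bullet> \<xi>)\<bar> \<le> 1" "\<bar>bump R x * sin (x \<bullet> \<xi>)\<bar> \<le> 1" for x
    unfolding abs_mult by (intro mult_le_one b abs_ge_zero abs_cos_le_one abs_sin_le_one)+
  have d: "bump R x * cos (x \<bullet> \<xi>) = 0" "bump R x * sin (x \<bullet> \<xi>) = 0" if "norm x > R" for x
    using z[OF that] by simp_all
  show "integrable lborel (\<lambda>x. f x * (bump R x * cos (x \<bullet> \<xi>)))"
    by (rule locally_integrable_times_bounded[OF f _ c(1) d(1)]) measurable
  show "integrable lborel (\<lambda>x. f x * (bump R x * sin (x \<bullet> \<xi>)))"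
    by (rule locally_integrable_times_bounded[OF f _ c(2) d(2)]) measurable
qed

lemma fourier_L1_Re_Im:
  assumes "integrable lborel f"
  shows "fourier_L1 f \<xi> = Complex (LINT x|lborel. f x * cos (x \<bullet> \<xi>)) (- (LINT x|lborel. f x * sin (x \<bullet> \<xi>)))"
proof (rule complex_eqI)
  note i = fourier_L1_integrand[OF assms, of \<xi>]
  show "Re (fourier_L1 f \<xi>) = Re (Complex (LINT x|lborel. f x * cos (x \<bullet> \<xi>)) (- (LINT x|lborel. f x * sin (x \<bullet> \<xi>))))"
    unfolding fourier_L1_def integral_Re[OF i, symmetric] by simp
  show "Im (fourier_L1 f \<xi>) = Im (Complex (LINT x|lborel. f x * cos (x \<bullet> \<xi>)) (- (LINT x|lborel. f x * sin (x \<bullet> \<xi>))))"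
    unfolding fourier_L1_def integral_Im[OF i, symmetric] by simp
qed

text \<open>Testing against \<open>bump R x * cos (x \<bullet> \<xi>)\<close> and \<open>bump R x * sin (x \<bullet> \<xi>)\<close> shows that
  the Fourier transform of \<open>f * bump R\<close> vanishes.\<close>

lemma has_weak_partial_unique:
  fixes g h :: "'a::euclidean_space \<Rightarrow> real"
  assumes "has_weak_partial u i g" "has_weak_partial u i h"
  shows "AE x in lborel. g x = h x"
proof -
  have g: "locally_integrable g" and h: "locally_integrable h" using assms by (auto simp: has_weak_partial_def)
  have eq: "(LINT x|lborel. g x * \<phi> x) = (LINT x|lborel. h x * \<phi> x)" if "test_fun \<phi>" for \<phi>
    using assms that unfolding has_weak_partial_def by (metis add.inverse_inverse)
  have ae: "AE x in lborel. (g x - h x) * bump (real (Suc n)) x = 0" for n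
  proof (rule fourier_L1_eq_0_imp)
    let ?R = "real (Suc n)"
    have R: "?R > 0" by simp
    show i: "integrable lborel (\<lambda>x. (g x - h x) * bump ?R x)"
      using bump_trig_integrable(3)[OF g R] bump_trig_integrable(3)[OF h R] by (simp only: left_diff_distrib Bochner_Integration.integrable_diff)
    fix \<xi> :: 'a
    have "(LINT x|lborel. ((g x - h x) * bump ?R x) * cos (x \<bullet> \<xi>)) = 0"
      using eq[OF bump_trig_test_fun(1)[OF R]] bump_trig_integrable(1)[OF g R] bump_trig_integrable(1)[OF h R]
      by (simp only: left_diff_distrib mult.assoc Bochner_Integration.integral_diff diff_self)
    moreover have "(LINT x|lborel. ((g x - h x) * bump ?R x) * sin (x \<bullet> \<xi>)) = 0"
      using eq[OF bump_trig_test_fun(2)[OF R]] bump_trig_integrable(2)[OF g R] bump_trig_integrable(2)[OF h R]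
      by (simp only: left_diff_distrib mult.assoc Bochner_Integration.integral_diff diff_self)
    ultimately show "fourier_L1 (\<lambda>x. (g x - h x) * bump ?R x) \<xi> = 0"
      by (simp only: fourier_L1_Re_Im[OF i]) (simp add: complex_eq_iff)
  qed
  then have "AE x in lborel. \<forall>n. (g x - h x) * bump (real (Suc n)) x = 0"
    by (simp only: AE_all_countable) simp
  then show ?thesis
  proof eventually_elim
    case (elim x)
    obtain n where "norm x < real n" using reals_Archimedean2 by blast
    then have "bump (real (Suc n)) x > 0" by (intro bump_pos) auto
    with elim[rule_format, of n] show ?case by simp
  qed
qed

section \<open>Supports and integrability of test functions\<close>

lemma test_fun_partial_measurable:
  assumes "test_fun \<phi>"
  shows "continuous_on UNIV \<phi>" "i \<in> Basis \<Longrightarrow> continuous_on UNIV (partial_deriv i \<phi>)"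
proof -
  have "Ck 0 \<phi>" "Ck 1 \<phi>" using assms unfolding test_fun_def by blast+
  then show "continuous_on UNIV \<phi>" "i \<in> Basis \<Longrightarrow> continuous_on UNIV (partial_deriv i \<phi>)" by simp_all
qed

lemma test_fun_support:
  assumes "test_fun \<phi>"
  obtains r where "r > 0" "\<And>x. norm x > r \<Longrightarrow> \<phi> x = 0" "\<And>x i. norm x > r \<Longrightarrow> partial_deriv i \<phi> x = 0"
proof -
  have "compact (closure {x. \<phi> x \<noteq> 0})" using assms by (simp add: test_fun_def)
  then obtain r where r: "r > 0" "closure {x. \<phi> x \<noteq> 0} \<subseteq> ball 0 r"
    using bounded_subset_ballD compact_imp_bounded by blast
  have z: "\<phi> x = 0" if "norm x > r" for x
    using r(2) that closure_subset[of "{x. \<phi> x \<noteq> 0}"] by (force simp: subset_iff)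
  have "partial_deriv i \<phi> x = 0" if "norm x > r" for x i
  proof -
    have "(\<phi> has_derivative (\<lambda>h. 0)) (at x)"
    proof (rule has_derivative_transform_within_open[of "\<lambda>x. 0"])
      show "open (- cball (0::'a) r)" by (simp add: open_Compl)
    qed (use that z in auto)
    then show ?thesis by (simp add: partial_derivI)
  qed
  with z r(1) that show ?thesis by blast
qed

lemma compact_support_bounded:
  fixes f :: "'a::euclidean_space \<Rightarrow> real"
  assumes "continuous_on UNIV f" "\<And>x. norm x > r \<Longrightarrow> f x = 0"
  shows "\<exists>B. \<forall>x. \<bar>f x\<bar> \<le> B"
proof -
  have "compact (f ` cball 0 r)"
    by (rule compact_continuous_image[OF continuous_on_subset[OF assms(1)]]) auto
  then obtain B where B: "\<And>y. y \<in> f ` cball 0 r \<Longrightarrow> norm y \<le> B" using compact_imp_bounded bounded_iff by metis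
  have "\<bar>f x\<bar> \<le> max 0 B" for x using B[of "f x"] assms(2)[of x] by (cases "norm x \<le> r") (auto simp: max_def)
  then show ?thesis by blast
qed

lemma kernel_compact_support:
  fixes f :: "'a::euclidean_space \<Rightarrow> real"
  assumes "continuous_on UNIV f" "\<And>x. norm x > r \<Longrightarrow> f x = 0"
  shows "kernel f"
proof -
  obtain B where B: "\<And>x. \<bar>f x\<bar> \<le> B" using compact_support_bounded[OF assms] by blast
  have [measurable]: "f \<in> borel_measurable borel" using assms(1) by (rule borel_measurable_continuous_onI)
  have "integrable lborel f"
  proof (rule Bochner_Integration.integrable_bound)
    show "integrable lborel (\<lambda>x. B * indicator (cball 0 r) x :: real)"
      by (intro integrable_mult_right integrable_real_indicator emeasure_lborel_cball_finite) simp
    show "AE x in lborel. norm (f x) \<le> norm (B * indicator (cball 0 r) x)"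
      using B assms(2) by (auto simp: indicator_def intro!: order_trans[OF B])
  qed measurable
  with B show ?thesis by (auto simp: kernel_def)
qed

lemma test_fun_kernel:
  assumes "test_fun \<phi>"
  shows "kernel \<phi>" "i \<in> Basis \<Longrightarrow> kernel (partial_deriv i \<phi>)"
proof -
  obtain r where r: "\<And>x. norm x > r \<Longrightarrow> \<phi> x = 0" "\<And>x i. norm x > r \<Longrightarrow> partial_deriv i \<phi> x = 0"
    using test_fun_support[OF assms] by metis
  show "kernel \<phi>" "i \<in> Basis \<Longrightarrow> kernel (partial_deriv i \<phi>)"
    using kernel_compact_support test_fun_partial_measurable[OF assms] r by blast+
qed

lemma test_fun_times_integrable:
  fixes f :: "'a::euclidean_space \<Rightarrow> real"
  assumes f: "locally_integrable f" and t: "test_fun \<phi>"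
  shows "integrable lborel (\<lambda>x. f x * \<phi> x)" "i \<in> Basis \<Longrightarrow> integrable lborel (\<lambda>x. f x * partial_deriv i \<phi> x)"
proof -
  obtain r where r: "\<And>x. norm x > r \<Longrightarrow> \<phi> x = 0" "\<And>x i. norm x > r \<Longrightarrow> partial_deriv i \<phi> x = 0"
    using test_fun_support[OF t] by metis
  note k = test_fun_kernel[OF t]
  show "integrable lborel (\<lambda>x. f x * \<phi> x)"
    using k(1) locally_integrable_times_bounded[OF f kernel_measurable[OF k(1)]] r(1) unfolding kernel_def by blast
  assume i: "i \<in> Basis"
  show "integrable lborel (\<lambda>x. f x * partial_deriv i \<phi> x)"
    using k(2)[OF i] locally_integrable_times_bounded[OF f kernel_measurable[OF k(2)[OF i]]] r(2) unfolding kernel_def by blast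
qed

lemma has_weak_partial_cong_AE:
  assumes w: "has_weak_partial u i g" and i: "i \<in> Basis" and u: "locally_integrable u'" and g: "locally_integrable g'"
    and ae: "AE x in lborel. u x = u' x" "AE x in lborel. g x = g' x"
  shows "has_weak_partial u' i g'"
  unfolding has_weak_partial_def
proof (intro conjI allI impI u g)
  fix \<phi> :: "'a \<Rightarrow> real" assume t: "test_fun \<phi>"
  have [measurable]: "u \<in> borel_measurable borel" "g \<in> borel_measurable borel" "u' \<in> borel_measurable borel" "g' \<in> borel_measurable borel"
    using w u g by (auto simp: has_weak_partial_def intro: locally_integrable_measurable)
  have [measurable]: "\<phi> \<in> borel_measurable borel" "partial_deriv i \<phi> \<in> borel_measurable borel"
    using test_fun_kernel[OF t] i by (auto intro: kernel_measurable)
  have 1: "(LINT x|lborel. u x * partial_deriv i \<phi> x) = (LINT x|lborel. u' x * partial_deriv i \<phi> x)"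
    by (rule integral_cong_AE) (use ae(1) in \<open>auto elim: eventually_mono\<close>)
  have 2: "(LINT x|lborel. g x * \<phi> x) = (LINT x|lborel. g' x * \<phi> x)"
    by (rule integral_cong_AE) (use ae(2) in \<open>auto elim: eventually_mono\<close>)
  show "(LINT x|lborel. u' x * partial_deriv i \<phi> x) = - (LINT x|lborel. g' x * \<phi> x)"
    using w t 1 2 by (simp add: has_weak_partial_def)
qed

lemma sq_integrable_bounded_mult:
  fixes f :: "'a::euclidean_space \<Rightarrow> real"
  assumes f: "sq_integrable f" and [measurable]: "c \<in> borel_measurable borel" and b: "\<And>x. \<bar>c x\<bar> \<le> B"
  shows "sq_integrable (\<lambda>x. c x * f x)" "sqnorm (\<lambda>x. c x * f x) \<le> B\<^sup>2 * sqnorm f"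
proof -
  have [measurable]: "f \<in> borel_measurable borel" using f by measurable
  have le: "AE x in lborel. norm (c x * f x) \<le> norm (B * f x)"
    using b by (auto simp: abs_mult intro!: mult_right_mono order_trans[OF b])
  show "sq_integrable (\<lambda>x. c x * f x)"
    by (rule sq_integrable_dominated[OF sq_integrable_cmult[OF f, of B] _ le]) measurable
  have "sqnorm (\<lambda>x. c x * f x) \<le> sqnorm (\<lambda>x. B * f x)"
    by (rule sqnorm_mono[OF sq_integrable_cmult[OF f, of B] _ le]) measurable
  then show "sqnorm (\<lambda>x. c x * f x) \<le> B\<^sup>2 * sqnorm f" by (simp add: sqnorm_cmult)
qed

text \<open>Characters have no compact support, so \<open>u\<close> is cut off by bumps. By the
  product rule \<open>gn\<close> is the weak derivative of \<open>un\<close>, and the two transforms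
  are related exactly. The term with the differentiated bump is O(1 / R) in L2, so both cutoffs
  converge, and an a.e. convergent subsequence identifies the limit.\<close>

lemma is_fourier_weak_partial:
  fixes u g :: "'a::euclidean_space \<Rightarrow> real"
  assumes w: "has_weak_partial u i g" and i: "i \<in> Basis" and g: "sq_integrable g" and F: "is_fourier u U"
  shows "is_fourier g (\<lambda>\<xi>. \<i> * complex_of_real (\<xi> \<bullet> i) * U \<xi>)"
proof -
  define G where "G = fourier g"
  have FG: "is_fourier g G" unfolding G_def by (rule is_fourier_fourier[OF g])
  note u = is_fourierD[OF F]
  have [measurable]: "u \<in> borel_measurable borel" "g \<in> borel_measurable borel" "U \<in> borel_measurable borel" "G \<in> borel_measurable borel"
    using u g is_fourierD[OF FG] by measurable
  have lu: "locally_integrable u" "locally_integrable g" using w by (auto simp: has_weak_partial_def)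
  let ?R = "\<lambda>n. real (Suc n)"
  define un where "un n x = bump (?R n) x * u x" for n x
  define gn where "gn n x = bump (?R n) x * g x + bump_partial (?R n) i x * u x" for n x
  have R: "?R n > 0" for n by simp
  have bb: "\<bar>bump (?R n) x\<bar> \<le> 1" for n and x :: 'a using bump_nonneg[of "?R n" x] bump_le_1[of "?R n" x] by simp
  have bp: "\<bar>bump_partial (?R n) i x\<bar> \<le> 2 * exp 1 / ?R n" for n x by (rule bump_partial_bound[OF R i])
  have bz: "bump_partial (?R n) i x = 0" if "norm x > ?R n" for n x
  proof -
    have "(?R n)\<^sup>2 \<le> (norm x)\<^sup>2" using that R by (intro power_mono) auto
    then show ?thesis using R[of n] by (simp add: bump_partial_def flat_exp_def power2_norm_eq_inner field_simps)
  qed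
  have Bi: "integrable lborel (\<lambda>x. u x * bump_partial (?R n) i x)" for n
    by (rule locally_integrable_times_bounded[OF lu(1) _ bp bz]) measurable
  have s0: "sq_integrable (\<lambda>x. bump (?R n) x * u x)" for n
    by (rule sq_integrable_bounded_mult(1)[OF u(1) _ bb]) measurable
  have un: "integrable lborel (un n)" "sq_integrable (un n)" for n
    using bump_trig_integrable(3)[OF lu(1) R, of n] s0[of n]
    unfolding un_def[abs_def] by (simp_all only: mult.commute[of "u _"] bump_measurable)
  have s2: "sq_integrable (\<lambda>x. bump_partial (?R n) i x * u x)" for n
    by (rule sq_integrable_bounded_mult(1)[OF u(1) _ bp]) measurable
  have s1: "sq_integrable (\<lambda>x. bump (?R n) x * g x)" for n
    by (rule sq_integrable_bounded_mult(1)[OF g _ bb]) measurable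
  have gn: "integrable lborel (gn n)" "sq_integrable (gn n)" for n
    using bump_trig_integrable(3)[OF lu(2) R, of n] Bi[of n] sq_integrable_add[OF s1 s2, of n n]
    unfolding gn_def[abs_def] by (simp_all only: mult.commute[of "u _"] mult.commute[of "g _"] Bochner_Integration.integrable_add)
  have unlim: "(\<lambda>n. sqnorm (\<lambda>x. un n x - u x)) \<longlonglongrightarrow> 0"
  proof (rule sqnorm_dominated_convergence(3)[OF _ _ u(1)])
    show "AE x in lborel. norm (un n x) \<le> norm (u x)" for n
      using bb by (auto simp: un_def abs_mult mult_left_le_one_le)
    show "AE x in lborel. (\<lambda>n. un n x) \<longlonglongrightarrow> u x"
      unfolding un_def using tendsto_mult_right[OF bump_tendsto_1] by (intro AE_I2) force
  qed (auto simp: un_def)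
  have gnlim: "(\<lambda>n. sqnorm (\<lambda>x. gn n x - g x)) \<longlonglongrightarrow> 0"
  proof -
    have 1: "(\<lambda>n. sqnorm (\<lambda>x. bump (?R n) x * g x - g x)) \<longlonglongrightarrow> 0"
    proof (rule sqnorm_dominated_convergence(3)[OF _ _ g])
      show "AE x in lborel. norm (bump (?R n) x * g x) \<le> norm (g x)" for n
        using bb by (auto simp: abs_mult mult_left_le_one_le)
      show "AE x in lborel. (\<lambda>n. bump (?R n) x * g x) \<longlonglongrightarrow> g x"
        using tendsto_mult_right[OF bump_tendsto_1] by (intro AE_I2) force
    qed auto
    have 2: "(\<lambda>n. sqnorm (\<lambda>x. bump_partial (?R n) i x * u x)) \<longlonglongrightarrow> 0"
    proof (rule tendsto_sandwich[OF _ _ tendsto_const])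
      show "\<forall>\<^sub>F n in sequentially. sqnorm (\<lambda>x. bump_partial (?R n) i x * u x) \<le> (2 * exp 1 / ?R n)\<^sup>2 * sqnorm u"
        by (intro always_eventually allI sq_integrable_bounded_mult(2)[OF u(1) _ bp]) measurable
      have "(\<lambda>n. (2 * exp 1 / ?R n)\<^sup>2 * sqnorm u) \<longlonglongrightarrow> (2 * exp 1 * 0)\<^sup>2 * sqnorm u"
        unfolding divide_inverse by (intro tendsto_intros LIMSEQ_Suc[OF lim_inverse_n])
      then show "(\<lambda>n. (2 * exp 1 / ?R n)\<^sup>2 * sqnorm u) \<longlonglongrightarrow> 0" by simp
    qed simp
    have "(\<lambda>n. sqnorm (\<lambda>x. (bump (?R n) x * g x - g x) + bump_partial (?R n) i x * u x)) \<longlonglongrightarrow> 0"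
      by (rule tendsto_sqnorm_add[OF sq_integrable_diff[OF s1 g] s2 1 2])
    then show ?thesis by (simp add: gn_def algebra_simps)
  qed
  \<comment> \<open>Testing the weak derivative against bump times cosine and bump times sine gives
    the real and the imaginary part of this identity.\<close>
  have key: "fourier_L1 (gn n) \<xi> = \<i> * complex_of_real (\<xi> \<bullet> i) * fourier_L1 (un n) \<xi>" for n \<xi>
  proof -
    note IU = bump_trig_integrable(1,2)[OF lu(1) R, of n \<xi>]
    note IG = bump_trig_integrable(1,2)[OF lu(2) R, of n \<xi>]
    have Bt: "integrable lborel (\<lambda>x. u x * (bump_partial (?R n) i x * cos (x \<bullet> \<xi>)))"
      "integrable lborel (\<lambda>x. u x * (bump_partial (?R n) i x * sin (x \<bullet> \<xi>)))"
      by (rule Bochner_Integration.integrable_bound[OF Bi[of n]]; auto simp: abs_mult mult_left_le mult.assoc[symmetric])+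
    have 1: "(LINT x|lborel. u x * (bump_partial (?R n) i x * cos (x \<bullet> \<xi>))) - (\<xi> \<bullet> i) * (LINT x|lborel. u x * (bump (?R n) x * sin (x \<bullet> \<xi>)))
       = - (LINT x|lborel. g x * (bump (?R n) x * cos (x \<bullet> \<xi>)))"
    proof -
      have "(LINT x|lborel. u x * partial_deriv i (\<lambda>x. bump (?R n) x * cos (x \<bullet> \<xi>)) x) = - (LINT x|lborel. g x * (bump (?R n) x * cos (x \<bullet> \<xi>)))"
        using w bump_trig_test_fun(1)[OF R] unfolding has_weak_partial_def by blast
      moreover have "(LINT x|lborel. u x * partial_deriv i (\<lambda>x. bump (?R n) x * cos (x \<bullet> \<xi>)) x)
        = (LINT x|lborel. u x * (bump_partial (?R n) i x * cos (x \<bullet> \<xi>)) - (\<xi> \<bullet> i) * (u x * (bump (?R n) x * sin (x \<bullet> \<xi>))))"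
        by (simp only: bump_trig_partial right_diff_distrib mult.left_commute[of "u _"] inner_commute[of i])
      moreover have "\<dots> = (LINT x|lborel. u x * (bump_partial (?R n) i x * cos (x \<bullet> \<xi>))) - (LINT x|lborel. (\<xi> \<bullet> i) * (u x * (bump (?R n) x * sin (x \<bullet> \<xi>))))"
        by (rule Bochner_Integration.integral_diff[OF Bt(1) integrable_mult_right[OF IU(2)]])
      moreover have "(LINT x|lborel. (\<xi> \<bullet> i) * (u x * (bump (?R n) x * sin (x \<bullet> \<xi>)))) = (\<xi> \<bullet> i) * (LINT x|lborel. u x * (bump (?R n) x * sin (x \<bullet> \<xi>)))"
        by (rule integral_mult_right_zero)
      ultimately show ?thesis by linarith
    qed
    have 2: "(LINT x|lborel. u x * (bump_partial (?R n) i x * sin (x \<bullet> \<xi>))) + (\<xi> \<bullet> i) * (LINT x|lborel. u x * (bump (?R n) x * cos (x \<bullet> \<xi>)))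
       = - (LINT x|lborel. g x * (bump (?R n) x * sin (x \<bullet> \<xi>)))"
    proof -
      have "(LINT x|lborel. u x * partial_deriv i (\<lambda>x. bump (?R n) x * sin (x \<bullet> \<xi>)) x) = - (LINT x|lborel. g x * (bump (?R n) x * sin (x \<bullet> \<xi>)))"
        using w bump_trig_test_fun(2)[OF R] unfolding has_weak_partial_def by blast
      moreover have "(LINT x|lborel. u x * partial_deriv i (\<lambda>x. bump (?R n) x * sin (x \<bullet> \<xi>)) x)
        = (LINT x|lborel. u x * (bump_partial (?R n) i x * sin (x \<bullet> \<xi>)) + (\<xi> \<bullet> i) * (u x * (bump (?R n) x * cos (x \<bullet> \<xi>))))"
        by (simp only: bump_trig_partial distrib_left mult.left_commute[of "u _"] inner_commute[of i])
      moreover have "\<dots> = (LINT x|lborel. u x * (bump_partial (?R n) i x * sin (x \<bullet> \<xi>))) + (LINT x|lborel. (\<xi> \<bullet> i) * (u x * (bump (?R n) x * cos (x \<bullet> \<xi>))))"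
        by (rule Bochner_Integration.integral_add[OF Bt(2) integrable_mult_right[OF IU(1)]])
      moreover have "(LINT x|lborel. (\<xi> \<bullet> i) * (u x * (bump (?R n) x * cos (x \<bullet> \<xi>)))) = (\<xi> \<bullet> i) * (LINT x|lborel. u x * (bump (?R n) x * cos (x \<bullet> \<xi>)))"
        by (rule integral_mult_right_zero)
      ultimately show ?thesis by linarith
    qed
    have c: "(LINT x|lborel. gn n x * cos (x \<bullet> \<xi>)) = (LINT x|lborel. g x * (bump (?R n) x * cos (x \<bullet> \<xi>))) + (LINT x|lborel. u x * (bump_partial (?R n) i x * cos (x \<bullet> \<xi>)))"
      unfolding Bochner_Integration.integral_add[OF IG(1) Bt(1), symmetric]
      by (intro Bochner_Integration.integral_cong refl) (simp add: gn_def algebra_simps)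
    have s: "(LINT x|lborel. gn n x * sin (x \<bullet> \<xi>)) = (LINT x|lborel. g x * (bump (?R n) x * sin (x \<bullet> \<xi>))) + (LINT x|lborel. u x * (bump_partial (?R n) i x * sin (x \<bullet> \<xi>)))"
      unfolding Bochner_Integration.integral_add[OF IG(2) Bt(2), symmetric]
      by (intro Bochner_Integration.integral_cong refl) (simp add: gn_def algebra_simps)
    have uc: "un n x * cos (x \<bullet> \<xi>) = u x * (bump (?R n) x * cos (x \<bullet> \<xi>))" "un n x * sin (x \<bullet> \<xi>) = u x * (bump (?R n) x * sin (x \<bullet> \<xi>))" for x
      by (simp_all only: un_def ac_simps)
    show ?thesis
      unfolding fourier_L1_Re_Im[OF gn(1)] fourier_L1_Re_Im[OF un(1)] c s uc complex_eq_iff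
      using 1 2 by simp
  qed
  have "(\<lambda>n. sqnorm (\<lambda>\<xi>. fourier_L1 (un n) \<xi> - U \<xi>)) \<longlonglongrightarrow> 0"
    unfolding is_fourier_dist[OF is_fourier_L1[OF un] F] using tendsto_mult_left[OF unlim] by simp
  from sqnorm_tendsto_AE_subseq[OF sq_integrable_diff[OF Plancherel_L1(1)[OF un] u(2)] this]
  obtain r where r: "strict_mono (r::nat\<Rightarrow>nat)" "AE \<xi> in lborel. (\<lambda>n. fourier_L1 (un (r n)) \<xi> - U \<xi>) \<longlonglongrightarrow> 0" by blast
  have "(\<lambda>n. sqnorm (\<lambda>\<xi>. fourier_L1 (gn n) \<xi> - G \<xi>)) \<longlonglongrightarrow> 0"
    unfolding is_fourier_dist[OF is_fourier_L1[OF gn] FG] using tendsto_mult_left[OF gnlim] by simp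
  \<comment> \<open>The second subsequence is extracted from the first, so that both transforms
    converge a.e. along the same indices.\<close>
  from LIMSEQ_subseq_LIMSEQ[OF this r(1)]
  have "(\<lambda>n. sqnorm (\<lambda>\<xi>. fourier_L1 (gn (r n)) \<xi> - G \<xi>)) \<longlonglongrightarrow> 0" by (simp add: o_def)
  from sqnorm_tendsto_AE_subseq[OF sq_integrable_diff[OF Plancherel_L1(1)[OF gn] is_fourierD(2)[OF FG]] this]
  obtain s where s: "strict_mono (s::nat\<Rightarrow>nat)" "AE \<xi> in lborel. (\<lambda>n. fourier_L1 (gn (r (s n))) \<xi> - G \<xi>) \<longlonglongrightarrow> 0" by blast
  have "AE \<xi> in lborel. G \<xi> = \<i> * complex_of_real (\<xi> \<bullet> i) * U \<xi>"
    using r(2) s(2)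
  proof eventually_elim
    case (elim \<xi>)
    have "(\<lambda>n. fourier_L1 (un (r (s n))) \<xi>) \<longlonglongrightarrow> U \<xi>"
      using LIMSEQ_subseq_LIMSEQ[OF LIM_zero_cancel[OF elim(1)] s(1)] by (simp add: o_def)
    then have "(\<lambda>n. fourier_L1 (gn (r (s n))) \<xi>) \<longlonglongrightarrow> \<i> * complex_of_real (\<xi> \<bullet> i) * U \<xi>"
      unfolding key by (rule tendsto_mult_left)
    with LIM_zero_cancel[OF elim(2)] show ?case by (rule LIMSEQ_unique)
  qed
  then show ?thesis
    by (intro is_fourier_cong_AE[OF FG]) auto
qed

section \<open>Linear calculus in \<open>H2\<close>, symbols of derivatives and integration by
  parts\<close>

lemma has_weak_partial_add:
  fixes u v :: "'a::euclidean_space \<Rightarrow> real"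
  assumes i: "i \<in> Basis" and u: "has_weak_partial u i g" and v: "has_weak_partial v i h"
  shows "has_weak_partial (\<lambda>x. u x + v x) i (\<lambda>x. g x + h x)"
proof -
  have l: "locally_integrable u" "locally_integrable g" "locally_integrable v" "locally_integrable h"
    using u v by (auto simp: has_weak_partial_def)
  have add: "locally_integrable (\<lambda>x. a x + b x)" if "locally_integrable a" "locally_integrable b" for a b :: "'a \<Rightarrow> real"
    using that unfolding locally_integrable_def by (auto intro: set_integral_add)
  show ?thesis
    unfolding has_weak_partial_def
  proof (intro conjI allI impI add l)
    fix \<phi> :: "'a \<Rightarrow> real" assume t: "test_fun \<phi>"
    have "(LINT x|lborel. u x * partial_deriv i \<phi> x) = - (LINT x|lborel. g x * \<phi> x)"
      "(LINT x|lborel. v x * partial_deriv i \<phi> x) = - (LINT x|lborel. h x * \<phi> x)"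
      using u v t by (auto simp: has_weak_partial_def)
    then show "(LINT x|lborel. (u x + v x) * partial_deriv i \<phi> x) = - (LINT x|lborel. (g x + h x) * \<phi> x)"
      using test_fun_times_integrable[OF _ t] l i by (simp add: distrib_right)
  qed
qed

lemma has_weak_partial_cmult:
  fixes u :: "'a::euclidean_space \<Rightarrow> real"
  assumes u: "has_weak_partial u i g"
  shows "has_weak_partial (\<lambda>x. c * u x) i (\<lambda>x. c * g x)"
proof -
  have cm: "locally_integrable (\<lambda>x. c * a x)" if "locally_integrable a" for a :: "'a \<Rightarrow> real"
    using that unfolding locally_integrable_def by auto
  show ?thesis
    using u cm unfolding has_weak_partial_def by (auto simp: mult.assoc)
qed

lemma H2I:
  assumes "sq_integrable u" "\<And>i. i \<in> Basis \<Longrightarrow> sq_integrable (g i)" "\<And>i. i \<in> Basis \<Longrightarrow> has_weak_partial u i (g i)"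
    "\<And>i j. i \<in> Basis \<Longrightarrow> j \<in> Basis \<Longrightarrow> sq_integrable (h i j)"
    "\<And>i j. i \<in> Basis \<Longrightarrow> j \<in> Basis \<Longrightarrow> has_weak_partial (g i) j (h i j)"
  shows "u \<in> H2"
  using assms unfolding H2_def Lspace_2_iff by blast

lemma H2E:
  assumes "u \<in> H2"
  obtains g h where "sq_integrable u" "\<And>i. i \<in> Basis \<Longrightarrow> sq_integrable (g i)" "\<And>i. i \<in> Basis \<Longrightarrow> has_weak_partial u i (g i)"
    "\<And>i j. i \<in> Basis \<Longrightarrow> j \<in> Basis \<Longrightarrow> sq_integrable (h i j)"
    "\<And>i j. i \<in> Basis \<Longrightarrow> j \<in> Basis \<Longrightarrow> has_weak_partial (g i) j (h i j)"
  using assms unfolding H2_def Lspace_2_iff by blast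

lemma H2_sq_integrable: "u \<in> H2 \<Longrightarrow> sq_integrable u"
  by (simp add: H2_def Lspace_2_iff)

lemma weak_partialI:
  fixes u :: "'a::euclidean_space \<Rightarrow> real"
  assumes "has_weak_partial u i g"
  shows "has_weak_partial u i (weak_partial i u)" "AE x in lborel. weak_partial i u x = g x"
proof -
  show 1: "has_weak_partial u i (weak_partial i u)" unfolding weak_partial_def by (rule someI[of _ g]) (rule assms)
  show "AE x in lborel. weak_partial i u x = g x" by (rule has_weak_partial_unique[OF 1 assms])
qed

lemma weak_partial_sq_integrable:
  fixes u :: "'a::euclidean_space \<Rightarrow> real"
  assumes "has_weak_partial u i g" "sq_integrable g"
  shows "sq_integrable (weak_partial i u)"
proof (rule sq_integrable_cong_AE[OF assms(2)])
  show "weak_partial i u \<in> borel_measurable borel"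
    using weak_partialI(1)[OF assms(1)] by (auto simp: has_weak_partial_def intro: locally_integrable_measurable)
  show "AE x in lborel. g x = weak_partial i u x" using weak_partialI(2)[OF assms(1)] by eventually_elim simp
qed

text \<open>\<open>weak_laplacian\<close> iterates an arbitrary choice of representatives.
  Uniqueness of weak derivatives, applied twice, shows that any derivatives at hand compute it up to
  a null set.\<close>

lemma weak_laplacian_eq_AE:
  fixes u :: "'a::euclidean_space \<Rightarrow> real"
  assumes g: "\<And>i. i \<in> Basis \<Longrightarrow> has_weak_partial u i (g i)" and h: "\<And>i. i \<in> Basis \<Longrightarrow> has_weak_partial (g i) i (h i)"
  shows "i \<in> Basis \<Longrightarrow> has_weak_partial (weak_partial i u) i (h i)"
    "AE x in lborel. weak_laplacian u x = (\<Sum>i\<in>Basis. h i x)"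
proof -
  show 1: "has_weak_partial (weak_partial i u) i (h i)" if i: "i \<in> Basis" for i
  proof (rule has_weak_partial_cong_AE[OF h[OF i] i])
    show "locally_integrable (weak_partial i u)" using weak_partialI(1)[OF g[OF i]] by (simp add: has_weak_partial_def)
    show "locally_integrable (h i)" using h[OF i] by (simp add: has_weak_partial_def)
    show "AE x in lborel. g i x = weak_partial i u x" using weak_partialI(2)[OF g[OF i]] by eventually_elim simp
  qed simp
  have "AE x in lborel. \<forall>i\<in>Basis. weak_partial i (weak_partial i u) x = h i x"
    by (rule AE_finite_allI) (auto intro: weak_partialI(2)[OF 1])
  then show "AE x in lborel. weak_laplacian u x = (\<Sum>i\<in>Basis. h i x)"
    by eventually_elim (simp add: weak_laplacian_def)
qed

lemma H2_weak_partial: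
  fixes u :: "'a::euclidean_space \<Rightarrow> real"
  assumes u: "u \<in> H2" and i: "i \<in> Basis"
  shows "has_weak_partial u i (weak_partial i u)" "sq_integrable (weak_partial i u)"
    "has_weak_partial (weak_partial i u) i (weak_partial i (weak_partial i u))"
    "sq_integrable (weak_partial i (weak_partial i u))"
proof -
  from H2E[OF u] obtain g h where g: "\<And>i. i \<in> Basis \<Longrightarrow> sq_integrable (g i)" "\<And>i. i \<in> Basis \<Longrightarrow> has_weak_partial u i (g i)"
    "\<And>i j. i \<in> Basis \<Longrightarrow> j \<in> Basis \<Longrightarrow> sq_integrable (h i j)"
    "\<And>i j. i \<in> Basis \<Longrightarrow> j \<in> Basis \<Longrightarrow> has_weak_partial (g i) j (h i j)" by metis
  have w: "has_weak_partial (weak_partial i u) i (h i i)"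
    using weak_laplacian_eq_AE(1)[of u g "\<lambda>i. h i i", OF g(2,4) i] by simp
  show "has_weak_partial u i (weak_partial i u)" by (rule weak_partialI(1)[OF g(2)[OF i]])
  show "sq_integrable (weak_partial i u)" by (rule weak_partial_sq_integrable[OF g(2)[OF i] g(1)[OF i]])
  show "has_weak_partial (weak_partial i u) i (weak_partial i (weak_partial i u))" by (rule weak_partialI(1)[OF w])
  show "sq_integrable (weak_partial i (weak_partial i u))" by (rule weak_partial_sq_integrable[OF w g(3)[OF i i]])
qed

lemma H2_laplacian_sq_integrable:
  fixes u :: "'a::euclidean_space \<Rightarrow> real"
  assumes "u \<in> H2"
  shows "sq_integrable (weak_laplacian u)"
  unfolding weak_laplacian_def[abs_def] by (intro sq_integrable_sum H2_weak_partial(4)[OF assms])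

lemma is_fourier_weak_partial_H2:
  fixes u :: "'a::euclidean_space \<Rightarrow> real"
  assumes u: "u \<in> H2" and F: "is_fourier u U" and i: "i \<in> Basis"
  shows "is_fourier (weak_partial i u) (\<lambda>\<xi>. \<i> * complex_of_real (\<xi> \<bullet> i) * U \<xi>)"
  by (rule is_fourier_weak_partial[OF H2_weak_partial(1)[OF u i] i H2_weak_partial(2)[OF u i] F])

lemma is_fourier_laplacian:
  fixes u :: "'a::euclidean_space \<Rightarrow> real"
  assumes u: "u \<in> H2" and F: "is_fourier u U"
  shows "is_fourier (weak_laplacian u) (\<lambda>\<xi>. - complex_of_real (\<xi> \<bullet> \<xi>) * U \<xi>)"
proof -
  have "is_fourier (weak_partial i (weak_partial i u)) (\<lambda>\<xi>. \<i> * complex_of_real (\<xi> \<bullet> i) * (\<i> * complex_of_real (\<xi> \<bullet> i) * U \<xi>))" if i: "i \<in> Basis" for i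
    by (rule is_fourier_weak_partial[OF H2_weak_partial(3)[OF u i] i H2_weak_partial(4)[OF u i] is_fourier_weak_partial_H2[OF u F i]])
  then have "is_fourier (\<lambda>x. \<Sum>i\<in>Basis. weak_partial i (weak_partial i u) x)
     (\<lambda>\<xi>. \<Sum>i\<in>Basis. \<i> * complex_of_real (\<xi> \<bullet> i) * (\<i> * complex_of_real (\<xi> \<bullet> i) * U \<xi>))"
    by (rule is_fourier_sum)
  moreover have "(\<Sum>i\<in>Basis. \<i> * complex_of_real (\<xi> \<bullet> i) * (\<i> * complex_of_real (\<xi> \<bullet> i) * U \<xi>)) = - complex_of_real (\<xi> \<bullet> \<xi>) * U \<xi>" for \<xi>
  proof -
    have "(\<Sum>i\<in>Basis. \<i> * complex_of_real (\<xi> \<bullet> i) * (\<i> * complex_of_real (\<xi> \<bullet> i) * U \<xi>))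
       = (\<Sum>i\<in>Basis. complex_of_real ((\<xi> \<bullet> i) * (\<xi> \<bullet> i)) * (- U \<xi>))"
      by (intro sum.cong refl) (simp add: algebra_simps)
    also have "\<dots> = complex_of_real (\<xi> \<bullet> \<xi>) * (- U \<xi>)"
      by (subst euclidean_inner[of \<xi> \<xi>]) (simp add: sum_distrib_right sum_negf)
    finally show ?thesis by simp
  qed
  ultimately show ?thesis by (simp add: weak_laplacian_def[abs_def])
qed

lemma weak_grad_inner: "weak_grad u x \<bullet> weak_grad v x = (\<Sum>i\<in>Basis. weak_partial i u x * weak_partial i v x)"
  by (subst euclidean_inner) (simp add: weak_grad_def inner_sum_left inner_Basis if_distrib cong: if_cong)

text \<open>By Parseval this is skew symmetry of the multiplier i \<xi>_i, which needs no cutoff or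
  boundary argument.\<close>

lemma integral_by_parts:
  fixes u v :: "'a::euclidean_space \<Rightarrow> real"
  assumes i: "i \<in> Basis" and u: "sq_integrable u" "sq_integrable g" "has_weak_partial u i g"
    and v: "sq_integrable v" "sq_integrable h" "has_weak_partial v i h"
  shows "(LINT x|lborel. g x * v x) = - (LINT x|lborel. u x * h x)"
proof -
  note U = is_fourier_fourier[OF u(1)] and V = is_fourier_fourier[OF v(1)]
  note G = is_fourier_weak_partial[OF u(3) i u(2) U] and H = is_fourier_weak_partial[OF v(3) i v(2) V]
  have "(LINT \<xi>|lborel. Re (\<i> * complex_of_real (\<xi> \<bullet> i) * fourier u \<xi> * cnj (fourier v \<xi>)))
    = - (LINT \<xi>|lborel. Re (fourier u \<xi> * cnj (\<i> * complex_of_real (\<xi> \<bullet> i) * fourier v \<xi>)))"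
    by (subst Bochner_Integration.integral_minus[symmetric], intro Bochner_Integration.integral_cong refl)
       (simp add: algebra_simps)
  then have "(2 * pi) powr real DIM('a) * (LINT x|lborel. g x * v x) = (2 * pi) powr real DIM('a) * (- (LINT x|lborel. u x * h x))"
    using Parseval[OF G V] Parseval[OF U H] by simp
  then show ?thesis by (subst (asm) mult_cancel_left) simp
qed

lemma H2_integral_by_parts:
  fixes u v :: "'a::euclidean_space \<Rightarrow> real"
  assumes u: "u \<in> H2" and v: "v \<in> H2"
  shows "(LINT x|lborel. weak_grad u x \<bullet> weak_grad v x) = - (LINT x|lborel. u x * weak_laplacian v x)"
    "(LINT x|lborel. weak_laplacian u x * v x) = (LINT x|lborel. u x * weak_laplacian v x)"
proof -
  note U = H2_sq_integrable[OF u] H2_weak_partial[OF u] and V = H2_sq_integrable[OF v] H2_weak_partial[OF v]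
  have g: "(LINT x|lborel. weak_grad u x \<bullet> weak_grad v x) = (\<Sum>i\<in>Basis. LINT x|lborel. weak_partial i u x * weak_partial i v x)"
    unfolding weak_grad_inner by (rule Bochner_Integration.integral_sum) (intro sq_integrable_mult U V)
  have l: "(LINT x|lborel. u x * weak_laplacian v x) = (\<Sum>i\<in>Basis. LINT x|lborel. u x * weak_partial i (weak_partial i v) x)"
    unfolding weak_laplacian_def sum_distrib_left by (rule Bochner_Integration.integral_sum) (intro sq_integrable_mult U V)
  have r: "(LINT x|lborel. weak_laplacian u x * v x) = (\<Sum>i\<in>Basis. LINT x|lborel. weak_partial i (weak_partial i u) x * v x)"
    unfolding weak_laplacian_def sum_distrib_right by (rule Bochner_Integration.integral_sum) (intro sq_integrable_mult U V)
  have 1: "(LINT x|lborel. weak_partial i u x * weak_partial i v x) = - (LINT x|lborel. u x * weak_partial i (weak_partial i v) x)" if "i \<in> Basis" for i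
    by (rule integral_by_parts[OF that]) (use U V that in auto)
  have 2: "(LINT x|lborel. weak_partial i (weak_partial i u) x * v x) = - (LINT x|lborel. weak_partial i u x * weak_partial i v x)" if "i \<in> Basis" for i
    by (rule integral_by_parts[OF that]) (use U V that in auto)
  show "(LINT x|lborel. weak_grad u x \<bullet> weak_grad v x) = - (LINT x|lborel. u x * weak_laplacian v x)"
    unfolding g l sum_negf[symmetric] by (rule sum.cong) (use 1 in auto)
  show "(LINT x|lborel. weak_laplacian u x * v x) = (LINT x|lborel. u x * weak_laplacian v x)"
    unfolding r l by (rule sum.cong) (use 1 2 in auto)
qed

lemma sqnorm_weak_grad:
  fixes u :: "'a::euclidean_space \<Rightarrow> real"
  assumes "u \<in> H2"
  shows "sqnorm (weak_grad u) = - (LINT x|lborel. u x * weak_laplacian u x)"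
  using H2_integral_by_parts(1)[OF assms assms] by (simp add: sqnorm_def power2_norm_eq_inner)

text \<open>Chosen representatives of weak derivatives need not add up pointwise, so additivity of
  the Laplacian is an a.e. statement.\<close>

lemma H2_add:
  fixes u v :: "'a::euclidean_space \<Rightarrow> real"
  assumes u: "u \<in> H2" and v: "v \<in> H2"
  shows "(\<lambda>x. u x + v x) \<in> H2" "AE x in lborel. weak_laplacian (\<lambda>x. u x + v x) x = weak_laplacian u x + weak_laplacian v x"
proof -
  from H2E[OF u] obtain g h where g: "sq_integrable u" "\<And>i. i \<in> Basis \<Longrightarrow> sq_integrable (g i)" "\<And>i. i \<in> Basis \<Longrightarrow> has_weak_partial u i (g i)"
    "\<And>i j. i \<in> Basis \<Longrightarrow> j \<in> Basis \<Longrightarrow> sq_integrable (h i j)"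
    "\<And>i j. i \<in> Basis \<Longrightarrow> j \<in> Basis \<Longrightarrow> has_weak_partial (g i) j (h i j)" by metis
  from H2E[OF v] obtain g' h' where g': "sq_integrable v" "\<And>i. i \<in> Basis \<Longrightarrow> sq_integrable (g' i)" "\<And>i. i \<in> Basis \<Longrightarrow> has_weak_partial v i (g' i)"
    "\<And>i j. i \<in> Basis \<Longrightarrow> j \<in> Basis \<Longrightarrow> sq_integrable (h' i j)"
    "\<And>i j. i \<in> Basis \<Longrightarrow> j \<in> Basis \<Longrightarrow> has_weak_partial (g' i) j (h' i j)" by metis
  show "(\<lambda>x. u x + v x) \<in> H2"
    by (rule H2I[where g = "\<lambda>i x. g i x + g' i x" and h = "\<lambda>i j x. h i j x + h' i j x"])
       (intro sq_integrable_add has_weak_partial_add g g'; assumption)+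
  have 1: "AE x in lborel. weak_laplacian (\<lambda>x. u x + v x) x = (\<Sum>i\<in>Basis. h i i x + h' i i x)"
    by (rule weak_laplacian_eq_AE(2)[where g = "\<lambda>i x. g i x + g' i x"]) (intro has_weak_partial_add g g'; assumption)+
  have 2: "AE x in lborel. weak_laplacian u x = (\<Sum>i\<in>Basis. h i i x)" by (rule weak_laplacian_eq_AE(2)[OF g(3,5)])
  have 3: "AE x in lborel. weak_laplacian v x = (\<Sum>i\<in>Basis. h' i i x)" by (rule weak_laplacian_eq_AE(2)[OF g'(3,5)])
  show "AE x in lborel. weak_laplacian (\<lambda>x. u x + v x) x = weak_laplacian u x + weak_laplacian v x"
    using 1 2 3 by eventually_elim (simp add: sum.distrib)
qed

lemma H2_cmult:
  fixes u :: "'a::euclidean_space \<Rightarrow> real"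
  assumes u: "u \<in> H2"
  shows "(\<lambda>x. c * u x) \<in> H2" "AE x in lborel. weak_laplacian (\<lambda>x. c * u x) x = c * weak_laplacian u x"
proof -
  from H2E[OF u] obtain g h where g: "sq_integrable u" "\<And>i. i \<in> Basis \<Longrightarrow> sq_integrable (g i)" "\<And>i. i \<in> Basis \<Longrightarrow> has_weak_partial u i (g i)"
    "\<And>i j. i \<in> Basis \<Longrightarrow> j \<in> Basis \<Longrightarrow> sq_integrable (h i j)"
    "\<And>i j. i \<in> Basis \<Longrightarrow> j \<in> Basis \<Longrightarrow> has_weak_partial (g i) j (h i j)" by metis
  show "(\<lambda>x. c * u x) \<in> H2"
    by (rule H2I[where g = "\<lambda>i x. c * g i x" and h = "\<lambda>i j x. c * h i j x"])
       (intro sq_integrable_cmult has_weak_partial_cmult g; assumption)+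
  have 1: "AE x in lborel. weak_laplacian (\<lambda>x. c * u x) x = (\<Sum>i\<in>Basis. c * h i i x)"
    by (rule weak_laplacian_eq_AE(2)[where g = "\<lambda>i x. c * g i x"]) (intro has_weak_partial_cmult g; assumption)+
  have 2: "AE x in lborel. weak_laplacian u x = (\<Sum>i\<in>Basis. h i i x)" by (rule weak_laplacian_eq_AE(2)[OF g(3,5)])
  show "AE x in lborel. weak_laplacian (\<lambda>x. c * u x) x = c * weak_laplacian u x"
    using 1 2 by eventually_elim (simp add: sum_distrib_left)
qed

lemma H2_diff:
  fixes u v :: "'a::euclidean_space \<Rightarrow> real"
  assumes u: "u \<in> H2" and v: "v \<in> H2"
  shows "(\<lambda>x. u x - v x) \<in> H2" "AE x in lborel. weak_laplacian (\<lambda>x. u x - v x) x = weak_laplacian u x - weak_laplacian v x"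
proof -
  have m: "(\<lambda>x. - 1 * v x) \<in> H2" "AE x in lborel. weak_laplacian (\<lambda>x. - 1 * v x) x = - 1 * weak_laplacian v x"
    using H2_cmult[OF v, of "- 1"] by blast+
  note a = H2_add[OF u m(1)]
  show "(\<lambda>x. u x - v x) \<in> H2" using a(1) by simp
  show "AE x in lborel. weak_laplacian (\<lambda>x. u x - v x) x = weak_laplacian u x - weak_laplacian v x"
    using a(2) m(2) by eventually_elim simp
qed

text \<open>Completing the square: the quadratic part of the energy is controlled by \<open>\<Delta> + \<mu>/2\<close>.\<close>

lemma sqnorm_shifted_laplacian:
  fixes u :: "'a::euclidean_space \<Rightarrow> real"
  assumes u: "u \<in> H2"
  shows "sqnorm (\<lambda>x. weak_laplacian u x + m * u x) = sqnorm (weak_laplacian u) - 2 * m * sqnorm (weak_grad u) + m\<^sup>2 * sqnorm u"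
proof -
  note s = H2_sq_integrable[OF u] H2_laplacian_sq_integrable[OF u]
  have "sqnorm (\<lambda>x. weak_laplacian u x + m * u x)
     = (LINT x|lborel. (weak_laplacian u x)\<^sup>2 + 2 * m * (u x * weak_laplacian u x) + m\<^sup>2 * (u x)\<^sup>2)"
    unfolding sqnorm_def by (simp add: power2_sum power_mult_distrib algebra_simps)
  also have "\<dots> = sqnorm (weak_laplacian u) + 2 * m * (LINT x|lborel. u x * weak_laplacian u x) + m\<^sup>2 * sqnorm u"
    using s sq_integrable_mult[OF s] by (simp add: sq_integrable_def sqnorm_def)
  finally show ?thesis by (simp add: sqnorm_weak_grad[OF u])
qed

lemma energy_eq:
  fixes u :: "'a::euclidean_space \<Rightarrow> real"
  assumes u: "u \<in> H2"
  shows "energy p \<mu> u = 1/2 * sqnorm (\<lambda>x. weak_laplacian u x + \<mu>/2 * u x) - \<mu>\<^sup>2 / 8 * sqnorm u - 1/p * Lnorm p u powr p"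
  unfolding energy_def Lnorm_2_squared sqnorm_shifted_laplacian[OF u] by (simp add: algebra_simps power2_eq_square)

text \<open>Difference quotients have integral 0 by translation invariance, and they converge to the
  partial derivative under a common bound supplied by the mean value theorem.\<close>

lemma integral_partial_deriv_eq_0:
  fixes F :: "'a::euclidean_space \<Rightarrow> real"
  assumes i: "i \<in> Basis" and d: "\<And>x. (F has_derivative F' x) (at x)" and c: "continuous_on UNIV (\<lambda>x. F' x i)"
    and s: "\<And>x. norm x > r \<Longrightarrow> F x = 0" "\<And>x. norm x > r \<Longrightarrow> F' x i = 0"
  shows "(LINT x|lborel. F' x i) = 0"
proof -
  have Fc: "continuous_on UNIV F" using d by (auto intro!: continuous_at_imp_continuous_on has_derivative_continuous)
  have F: "kernel F" by (rule kernel_compact_support[OF Fc s(1)])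
  have [measurable]: "F \<in> borel_measurable borel" "(\<lambda>x. F' x i) \<in> borel_measurable borel"
    using Fc c by (auto intro: borel_measurable_continuous_onI)
  obtain B where B: "\<And>x. \<bar>F' x i\<bar> \<le> B" using compact_support_bounded[OF c s(2)] by blast
  define h where "h n = 1 / real (Suc n)" for n
  have h: "h n > 0" "h n \<le> 1" for n by (auto simp: h_def)
  have dl: "((\<lambda>s. F (x + s *\<^sub>R i)) has_real_derivative F' (x + s *\<^sub>R i) i) (at s)" for x s
  proof -
    have "((\<lambda>s. x + s *\<^sub>R i) has_derivative (\<lambda>k. k *\<^sub>R i)) (at s)" by (auto intro!: derivative_eq_intros)
    from has_derivative_compose[OF this d] have "((\<lambda>s. F (x + s *\<^sub>R i)) has_derivative (\<lambda>k. F' (x + s *\<^sub>R i) (k *\<^sub>R i))) (at s)" .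
    moreover have "F' (x + s *\<^sub>R i) (k *\<^sub>R i) = F' (x + s *\<^sub>R i) i * k" for k
      using linear_scale[OF has_derivative_linear[OF d]] by simp
    ultimately show ?thesis by (simp add: has_field_derivative_def mult.commute[of _ "F' _ i"])
  qed
  define Q where "Q n x = (F (x + h n *\<^sub>R i) - F x) / h n" for n x
  have [measurable]: "Q n \<in> borel_measurable borel" for n unfolding Q_def by measurable
  have Q0: "(LINT x|lborel. Q n x) = 0" for n
    unfolding Q_def using lborel_integral_translate[of F "h n *\<^sub>R i"] F by (simp add: kernel_def)
  \<comment> \<open>The shift \<open>h n\<close> is at most 1, so outside the ball of radius
    \<open>r + 1\<close> both values in the quotient vanish.\<close>
  have Qb: "\<bar>Q n x\<bar> \<le> B * indicator (cball 0 (r + 1)) x" for n x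
  proof (cases "norm x \<le> r + 1")
    case True
    obtain z where "F (x + h n *\<^sub>R i) - F (x + 0 *\<^sub>R i) = (h n - 0) * F' (x + z *\<^sub>R i) i"
      using MVT2[OF h(1)[of n], of "\<lambda>s. F (x + s *\<^sub>R i)" "\<lambda>s. F' (x + s *\<^sub>R i) i"] dl by blast
    then have "Q n x = F' (x + z *\<^sub>R i) i" using h(1)[of n] by (simp add: Q_def)
    with B True show ?thesis by simp
  next
    case False
    have "norm x \<le> norm (x + h n *\<^sub>R i) + norm (h n *\<^sub>R i)" using norm_triangle_ineq4[of "x + h n *\<^sub>R i" "h n *\<^sub>R i"] by simp
    then have "norm (x + h n *\<^sub>R i) > r" using False h[of n] i by simp
    then show ?thesis using s False by (simp add: Q_def)
  qed
  have "(\<lambda>n. LINT x|lborel. Q n x) \<longlonglongrightarrow> (LINT x|lborel. F' x i)"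
  proof (rule integral_dominated_convergence)
    show "integrable lborel (\<lambda>x::'a. B * indicator (cball 0 (r + 1)) x)"
      by (intro integrable_mult_right integrable_real_indicator emeasure_lborel_cball_finite) simp
    show "AE x in lborel. norm (Q n x) \<le> B * indicator (cball 0 (r + 1)) x" for n using Qb by simp
    have "(\<lambda>n. Q n x) \<longlonglongrightarrow> F' x i" for x
    proof -
      have "((\<lambda>s. (F (x + (0 + s) *\<^sub>R i) - F (x + 0 *\<^sub>R i)) / s) \<longlongrightarrow> F' (x + 0 *\<^sub>R i) i) (at 0)"
        using dl[of x 0] unfolding DERIV_def by simp
      moreover have "filterlim h (at 0) sequentially"
        unfolding filterlim_at using h LIMSEQ_Suc[OF lim_1_over_n] by (auto simp: h_def[abs_def] intro!: always_eventually)
      ultimately have "(\<lambda>n. (F (x + (0 + h n) *\<^sub>R i) - F (x + 0 *\<^sub>R i)) / h n) \<longlonglongrightarrow> F' (x + 0 *\<^sub>R i) i"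
        by (rule filterlim_compose)
      then show ?thesis by (simp add: Q_def)
    qed
    then show "AE x in lborel. (\<lambda>n. Q n x) \<longlonglongrightarrow> F' x i" by simp
  qed measurable
  then show ?thesis unfolding Q0 by (simp add: LIMSEQ_const_iff)
qed

lemma has_weak_partial_classical:
  fixes u :: "'a::euclidean_space \<Rightarrow> real"
  assumes i: "i \<in> Basis" and d: "\<And>x. (u has_derivative D x) (at x)" and c: "continuous_on UNIV (\<lambda>x. D x i)"
  shows "has_weak_partial u i (\<lambda>x. D x i)"
proof -
  have uc: "continuous_on UNIV u" using d by (auto intro!: continuous_at_imp_continuous_on has_derivative_continuous)
  show ?thesis
    unfolding has_weak_partial_def
  proof (intro conjI allI impI locally_integrable_continuous uc c)
    fix \<phi> :: "'a \<Rightarrow> real" assume t: "test_fun \<phi>"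
    obtain r where r: "\<And>x. norm x > r \<Longrightarrow> \<phi> x = 0" "\<And>x i. norm x > r \<Longrightarrow> partial_deriv i \<phi> x = 0"
      using test_fun_support[OF t] by metis
    have "Ck 1 \<phi>" using t unfolding test_fun_def by blast
    then have "\<phi> differentiable (at x)" for x by simp
    then have d\<phi>: "(\<phi> has_derivative (\<lambda>h. partial_deriv h \<phi> x)) (at x)" for x
      unfolding partial_deriv_def by (simp add: frechet_derivative_works)
    have "(LINT x|lborel. u x * partial_deriv i \<phi> x + D x i * \<phi> x) = 0"
    proof (rule integral_partial_deriv_eq_0[OF i, where F = "\<lambda>x. u x * \<phi> x" and F' = "\<lambda>x h. u x * partial_deriv h \<phi> x + D x h * \<phi> x" and r = r])
      show "((\<lambda>x. u x * \<phi> x) has_derivative (\<lambda>h. u x * partial_deriv h \<phi> x + D x h * \<phi> x)) (at x)" for x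
        by (rule has_derivative_mult[OF d d\<phi>])
      show "continuous_on UNIV (\<lambda>x. u x * partial_deriv i \<phi> x + D x i * \<phi> x)"
        by (intro continuous_intros uc c test_fun_partial_measurable[OF t] i)
    qed (use r in auto)
    then show "(LINT x|lborel. u x * partial_deriv i \<phi> x) = - (LINT x|lborel. D x i * \<phi> x)"
      using test_fun_times_integrable(2)[OF locally_integrable_continuous[OF uc] t i]
        test_fun_times_integrable(1)[OF locally_integrable_continuous[OF c] t] by simp
  qed
qed

section \<open>Weak derivatives under translation and convolution\<close>

lemma test_fun_translate:
  fixes \<phi> :: "'a::euclidean_space \<Rightarrow> real"
  assumes "test_fun \<phi>"
  shows "test_fun (\<lambda>x. \<phi> (x + y))" "partial_deriv i (\<lambda>x. \<phi> (x + y)) x = partial_deriv i \<phi> (x + y)"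
proof -
  have d: "((\<lambda>x. f (x + y)) has_derivative D) (at x) \<longleftrightarrow> (f has_derivative D) (at (x + y))" for f :: "'a \<Rightarrow> real" and x D
  proof
    have t: "((\<lambda>x. x + z) has_derivative (\<lambda>h. h)) (at w)" for w z :: 'a
      by (auto intro!: derivative_eq_intros)
    show "((\<lambda>x. f (x + y)) has_derivative D) (at x)" if "(f has_derivative D) (at (x + y))"
      using has_derivative_compose[OF t that] by simp
    assume "((\<lambda>x. f (x + y)) has_derivative D) (at x)"
    then have "((\<lambda>x. f (x + y)) has_derivative D) (at (x + y + - y))" by simp
    from has_derivative_compose[OF t this] show "(f has_derivative D) (at (x + y))" by simp
  qed
  have p: "partial_deriv i (\<lambda>x. f (x + y)) = (\<lambda>x. partial_deriv i f (x + y))" for f :: "'a \<Rightarrow> real" and i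
    by (rule ext) (simp add: partial_deriv_def frechet_derivative_def d)
  have "Ck k f \<Longrightarrow> Ck k (\<lambda>x. f (x + y))" for k and f :: "'a \<Rightarrow> real"
  proof (induction k arbitrary: f)
    case 0
    then have "continuous_on UNIV f" by simp
    moreover have "continuous_on UNIV (\<lambda>x. x + y)" by (intro continuous_intros)
    ultimately show ?case using continuous_on_compose2[of UNIV f UNIV "\<lambda>x. x + y"] by simp
  next
    case (Suc k)
    then show ?case unfolding Ck.simps p differentiable_def d by blast
  qed
  then have 1: "\<forall>k. Ck k (\<lambda>x. \<phi> (x + y))" using assms by (simp add: test_fun_def)
  obtain r where r: "\<And>x. norm x > r \<Longrightarrow> \<phi> x = 0" using test_fun_support[OF assms] by metis
  have "{x. \<phi> (x + y) \<noteq> 0} \<subseteq> cball (- y) r"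
  proof
    fix x assume "x \<in> {x. \<phi> (x + y) \<noteq> 0}"
    then have "norm (x + y) \<le> r" using r[of "x + y"] by force
    then show "x \<in> cball (- y) r" by (simp add: dist_norm norm_minus_commute add.commute)
  qed
  then have "bounded {x. \<phi> (x + y) \<noteq> 0}" using bounded_cball bounded_subset by blast
  then have "compact (closure {x. \<phi> (x + y) \<noteq> 0})" by (simp add: compact_closure)
  with 1 show "test_fun (\<lambda>x. \<phi> (x + y))" by (simp add: test_fun_def)
  show "partial_deriv i (\<lambda>x. \<phi> (x + y)) x = partial_deriv i \<phi> (x + y)" by (simp add: p)
qed

text \<open>A convolution superposes translates of \<open>f\<close>. Fubini moves the translation
  onto the test function, whose translates are test functions again, so the derivative falls on
  \<open>f\<close>.\<close>

lemma has_weak_partial_conv: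
  fixes f :: "'a::euclidean_space \<Rightarrow> real"
  assumes f: "sq_integrable f" "sq_integrable g" "has_weak_partial f i g" and i: "i \<in> Basis" and k: "kernel k"
  shows "has_weak_partial (conv f k) i (conv g k)"
  unfolding has_weak_partial_def
proof (intro conjI allI impI)
  show "locally_integrable (conv f k)" "locally_integrable (conv g k)"
    using Young_L2(1)[OF _ k] f sq_integrable_locally_integrable by blast+
  fix \<phi> :: "'a \<Rightarrow> real" assume t: "test_fun \<phi>"
  note k\<phi> = kernel_sq_integrable[OF test_fun_kernel(1)[OF t]] kernel_sq_integrable[OF test_fun_kernel(2)[OF t i]]
  have [measurable]: "f \<in> borel_measurable borel" "g \<in> borel_measurable borel" "k \<in> borel_measurable borel"
    "\<phi> \<in> borel_measurable borel" "partial_deriv i \<phi> \<in> borel_measurable borel"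
    using f k k\<phi> by measurable
  have key: "(LINT x|lborel. conv w k x * \<psi> x) = (LINT y|lborel. k y * (LINT x|lborel. w x * \<psi> (x + y)))"
    if w: "sq_integrable w" and \<psi>: "sq_integrable \<psi>" for w \<psi> :: "'a \<Rightarrow> real"
  proof -
    have [measurable]: "w \<in> borel_measurable borel" "\<psi> \<in> borel_measurable borel" using w \<psi> by measurable
    have w': "sq_integrable (\<lambda>x. \<bar>w x\<bar>)" "sq_integrable (\<lambda>x. \<bar>\<psi> x\<bar>)" using w \<psi> by (auto simp: sq_integrable_def)
    have i1: "integrable lborel (\<lambda>x. \<bar>\<psi> x\<bar> * conv (\<lambda>x. \<bar>w x\<bar>) (\<lambda>x. \<bar>k x\<bar>) x)"
      by (rule sq_integrable_mult[OF w'(2) Young_L2(1)[OF w'(1) kernel_abs[OF k]]])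
    have c: "(LINT y|lborel. \<bar>k y\<bar> * \<bar>w (x - y)\<bar>) = conv (\<lambda>x. \<bar>w x\<bar>) (\<lambda>x. \<bar>k x\<bar>) x" for x
      by (subst conv_commute) (auto simp: conv_def)
    have P: "integrable (lborel \<Otimes>\<^sub>M lborel) (\<lambda>(x, y). \<psi> x * (k y * w (x - y)))"
    proof (rule lborel_pair.Fubini_integrable)
      show "integrable lborel (\<lambda>x. LINT y|lborel. norm (case (x, y) of (x, y) \<Rightarrow> \<psi> x * (k y * w (x - y))))"
        using i1 by (simp add: abs_mult c)
      have "integrable lborel (\<lambda>y. k y * w (x - y))" for x
        by (rule sq_integrable_mult[OF kernel_sq_integrable[OF k] sq_integrable_reflect(1)[OF w]])
      then show "AE x in lborel. integrable lborel (\<lambda>y. case (x, y) of (x, y) \<Rightarrow> \<psi> x * (k y * w (x - y)))" by simp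
    qed measurable
    have "(LINT x|lborel. conv w k x * \<psi> x) = (LINT x|lborel. \<psi> x * conv k w x)"
      by (subst conv_commute) (auto simp: mult.commute)
    also have "\<dots> = (LINT x|lborel. LINT y|lborel. \<psi> x * (k y * w (x - y)))"
      by (simp add: conv_def)
    also have "\<dots> = (LINT y|lborel. LINT x|lborel. \<psi> x * (k y * w (x - y)))"
      by (rule lborel_pair.Fubini_integral[OF P, symmetric])
    also have "\<dots> = (LINT y|lborel. k y * (LINT x|lborel. w x * \<psi> (x + y)))"
    proof (intro Bochner_Integration.integral_cong refl)
      fix y :: 'a
      have "(LINT x|lborel. \<psi> x * (k y * w (x - y))) = (LINT x|lborel. \<psi> (x + y) * (k y * w (x + y - y)))"
        by (rule lborel_integral_translate(1)[symmetric]) measurable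
      also have "\<dots> = (LINT x|lborel. k y * (w x * \<psi> (x + y)))"
        by (intro Bochner_Integration.integral_cong refl) simp
      also have "\<dots> = k y * (LINT x|lborel. w x * \<psi> (x + y))" by (rule integral_mult_right_zero)
      finally show "(LINT x|lborel. \<psi> x * (k y * w (x - y))) = k y * (LINT x|lborel. w x * \<psi> (x + y))" .
    qed
    finally show ?thesis .
  qed
  have tr: "(LINT x|lborel. f x * partial_deriv i \<phi> (x + y)) = - (LINT x|lborel. g x * \<phi> (x + y))" for y
    using f(3) test_fun_translate(1)[OF t, of y] unfolding has_weak_partial_def test_fun_translate(2)[OF t, symmetric] by blast
  show "(LINT x|lborel. conv f k x * partial_deriv i \<phi> x) = - (LINT x|lborel. conv g k x * \<phi> x)"
    unfolding key[OF f(1) k\<phi>(2)] key[OF f(2) k\<phi>(1)] tr by simp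
qed

lemma H2_conv:
  fixes f :: "'a::euclidean_space \<Rightarrow> real"
  assumes f: "f \<in> H2" and k: "kernel k"
  shows "conv f k \<in> H2" "AE x in lborel. weak_laplacian (conv f k) x = conv (weak_laplacian f) k x"
proof -
  from H2E[OF f] obtain g h where g: "sq_integrable f" "\<And>i. i \<in> Basis \<Longrightarrow> sq_integrable (g i)" "\<And>i. i \<in> Basis \<Longrightarrow> has_weak_partial f i (g i)"
    "\<And>i j. i \<in> Basis \<Longrightarrow> j \<in> Basis \<Longrightarrow> sq_integrable (h i j)"
    "\<And>i j. i \<in> Basis \<Longrightarrow> j \<in> Basis \<Longrightarrow> has_weak_partial (g i) j (h i j)" by metis
  show "conv f k \<in> H2"
    by (rule H2I[where g = "\<lambda>i. conv (g i) k" and h = "\<lambda>i j. conv (h i j) k"])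
       (intro Young_L2(1) has_weak_partial_conv g k; assumption)+
  have 1: "AE x in lborel. weak_laplacian (conv f k) x = (\<Sum>i\<in>Basis. conv (weak_partial i (weak_partial i f)) k x)"
    by (rule weak_laplacian_eq_AE(2)[where g = "\<lambda>i. conv (weak_partial i f) k"])
       (intro has_weak_partial_conv H2_weak_partial[OF f] g k; assumption)+
  have "conv (weak_laplacian f) k x = (\<Sum>i\<in>Basis. conv (weak_partial i (weak_partial i f)) k x)" for x
    unfolding conv_def weak_laplacian_def sum_distrib_right
    by (intro Bochner_Integration.integral_sum conv_integrand H2_weak_partial[OF f] k)
  with 1 show "AE x in lborel. weak_laplacian (conv f k) x = conv (weak_laplacian f) k x" by simp
qed

section \<open>Weak Sobolev inequality and vanishing in Lq\<close>

lemma mult_sqnorm_expand: "sqnorm (\<lambda>\<xi>. complex_of_real (a \<xi>) * V \<xi>) = (LINT \<xi>|lborel. (a \<xi>)\<^sup>2 * (norm (V \<xi>))\<^sup>2)"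
  by (simp add: sqnorm_def norm_mult power_mult_distrib)

text \<open>On the frequency side 1 - exp (-t |\<xi>|^2) \<le> t |\<xi>|^2, and the right side is
  the symbol of -t times the Laplacian.\<close>

lemma heat_approx_sqnorm:
  fixes v :: "'a::euclidean_space \<Rightarrow> real"
  assumes v: "v \<in> H2" and t: "t > 0"
  shows "sqnorm (\<lambda>x. v x - conv v (heat t) x) \<le> t\<^sup>2 * sqnorm (weak_laplacian v)"
proof -
  define V where "V = fourier v"
  have F: "is_fourier v V" unfolding V_def by (rule is_fourier_fourier[OF H2_sq_integrable[OF v]])
  have [measurable]: "V \<in> borel_measurable borel" using is_fourierD[OF F] by measurable
  note L = is_fourier_laplacian[OF v F]
  have "(2 * pi) powr real DIM('a) * sqnorm (\<lambda>x. v x - conv v (heat t) x)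
      = sqnorm (\<lambda>\<xi>. V \<xi> - complex_of_real (exp (- t * (\<xi> \<bullet> \<xi>))) * V \<xi>)"
    by (rule is_fourier_dist[OF F is_fourier_conv_heat[OF F t], symmetric])
  also have "\<dots> \<le> sqnorm (\<lambda>\<xi>. complex_of_real t * (- complex_of_real (\<xi> \<bullet> \<xi>) * V \<xi>))"
  proof (rule sqnorm_mono)
    show "sq_integrable (\<lambda>\<xi>. complex_of_real t * (- complex_of_real (\<xi> \<bullet> \<xi>) * V \<xi>))"
      using sq_integrable_scaleR[OF is_fourierD(2)[OF L], of t] by (simp add: scaleR_conv_of_real)
    have "norm (V \<xi> - complex_of_real (exp (- t * (\<xi> \<bullet> \<xi>))) * V \<xi>) \<le> norm (complex_of_real t * (- complex_of_real (\<xi> \<bullet> \<xi>) * V \<xi>))" for \<xi>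
    proof -
      have "norm (V \<xi> - complex_of_real (exp (- t * (\<xi> \<bullet> \<xi>))) * V \<xi>) = norm (complex_of_real (1 - exp (- t * (\<xi> \<bullet> \<xi>))) * V \<xi>)"
        by (simp add: left_diff_distrib)
      also have "\<dots> = (1 - exp (- t * (\<xi> \<bullet> \<xi>))) * norm (V \<xi>)"
        unfolding norm_mult norm_of_real using t by simp
      also have "\<dots> \<le> (t * (\<xi> \<bullet> \<xi>)) * norm (V \<xi>)"
        using exp_ge_add_one_self[of "- t * (\<xi> \<bullet> \<xi>)"] by (intro mult_right_mono) auto
      finally show ?thesis using t by (simp add: norm_mult)
    qed
    then show "AE \<xi> in lborel. norm (V \<xi> - complex_of_real (exp (- t * (\<xi> \<bullet> \<xi>))) * V \<xi>) \<le> norm (complex_of_real t * (- complex_of_real (\<xi> \<bullet> \<xi>) * V \<xi>))" by simp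
  qed measurable
  also have "\<dots> = t\<^sup>2 * ((2 * pi) powr real DIM('a) * sqnorm (weak_laplacian v))"
    unfolding sqnorm_cmult_complex is_fourier_sqnorm[OF L] by simp
  finally show ?thesis
    by (subst (asm) mult.left_commute) simp
qed

text \<open>Dominated convergence in frequency. In contrast to the preceding rate it asks only for
  L2, so it also applies to the Laplacian of a test function.\<close>

lemma heat_approx_tendsto:
  fixes f :: "'a::euclidean_space \<Rightarrow> real"
  assumes f: "sq_integrable f"
  shows "(\<lambda>n. sqnorm (\<lambda>x. conv f (heat (1 / real (Suc n))) x - f x)) \<longlonglongrightarrow> 0"
proof -
  define V where "V = fourier f"
  have F: "is_fourier f V" unfolding V_def by (rule is_fourier_fourier[OF f])
  note D = is_fourierD[OF F]
  have [measurable]: "V \<in> borel_measurable borel" using D by measurable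
  let ?e = "\<lambda>n \<xi>. complex_of_real (exp (- (1 / real (Suc n)) * (\<xi> \<bullet> \<xi>))) * V \<xi>"
  have lim: "(\<lambda>n. sqnorm (\<lambda>\<xi>. ?e n \<xi> - V \<xi>)) \<longlonglongrightarrow> 0"
  proof (rule sqnorm_dominated_convergence(3)[OF _ _ D(2)])
    show "AE \<xi> in lborel. norm (?e n \<xi>) \<le> norm (V \<xi>)" for n
      by (intro AE_I2 gaussian_mult_le) simp
    have "(\<lambda>n. ?e n \<xi>) \<longlonglongrightarrow> complex_of_real (exp (- 0 * (\<xi> \<bullet> \<xi>))) * V \<xi>" for \<xi>
      by (intro tendsto_intros LIMSEQ_Suc[OF lim_1_over_n])
    then show "AE \<xi> in lborel. (\<lambda>n. ?e n \<xi>) \<longlonglongrightarrow> V \<xi>" by simp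
  qed auto
  have "sqnorm (\<lambda>\<xi>. ?e n \<xi> - V \<xi>) = (2 * pi) powr real DIM('a) * sqnorm (\<lambda>x. conv f (heat (1 / real (Suc n))) x - f x)" for n
    by (rule is_fourier_dist[OF is_fourier_conv_heat[OF F] F]) simp
  then have "(\<lambda>n. inverse ((2 * pi) powr real DIM('a)) * ((2 * pi) powr real DIM('a) * sqnorm (\<lambda>x. conv f (heat (1 / real (Suc n))) x - f x))) \<longlonglongrightarrow> inverse ((2 * pi) powr real DIM('a)) * 0"
    using lim by (intro tendsto_intros) simp
  then show ?thesis by (simp add: mult.assoc[symmetric])
qed

text \<open>The lower end is strict to match superlevel sets, and \<open>j\<close> starts at 0, so
  the brackets cover exactly the numbers above 1.\<close>

lemma dyadic_bracket:
  fixes s :: real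
  assumes "s > 1"
  obtains j :: nat where "2 ^ j < s" "s \<le> 2 ^ Suc j"
proof -
  obtain n0 :: nat where "s < 2 ^ n0" using real_arch_pow[of 2 s] by auto
  then have ex: "\<exists>n. s \<le> 2 ^ n" by (intro exI[of _ n0]) simp
  define n where "n = (LEAST n. s \<le> 2 ^ n)"
  have n: "s \<le> 2 ^ n" unfolding n_def using ex by (rule LeastI_ex)
  have "n \<noteq> 0" using n assms by (intro notI) simp
  then obtain j where j: "n = Suc j" using not0_implies_Suc by blast
  have "\<not> s \<le> 2 ^ j" using not_less_Least[of j "\<lambda>n. s \<le> 2 ^ n"] j unfolding n_def by simp
  then show ?thesis using n by (intro that[of j]) (simp_all add: j)
qed

lemma ennreal_le_suminf: "f j \<le> (\<Sum>i. f i :: ennreal)"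
  using sum_le_suminf[of f "{j}"] by simp

text \<open>Only the singularity at 0 matters. A point near 0 lies in a dyadic ball of radius 2^(-j)
  on which it is charged (2^(j+1))^4; the volume is O(2^(-5 j)) since the dimension is at least 5,
  leaving the geometric series of 2^(-j). At 0 itself the quotient is 0 by the convention for
  division.\<close>

lemma inverse_fourth_power_gaussian_integrable:
  assumes "DIM('a::euclidean_space) \<ge> 5"
  shows "integrable lborel (\<lambda>\<eta>::'a. exp (- 2 * (\<eta> \<bullet> \<eta>)) / (\<eta> \<bullet> \<eta>)\<^sup>2)"
proof (rule integrableI_bounded)
  let ?u = "unit_ball_vol (real DIM('a))"
  have u: "?u \<ge> 0" by (simp add: unit_ball_vol_def)
  define S where "S j \<eta> = ennreal ((2 ^ Suc j) ^ 4) * indicator (cball 0 ((1/2) ^ j)) \<eta>" for j :: nat and \<eta> :: 'a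
  have [measurable]: "S j \<in> borel_measurable borel" for j
    unfolding S_def by (intro borel_measurable_times_ennreal borel_measurable_const borel_measurable_indicator) simp
  have pt: "ennreal (norm (exp (- 2 * (\<eta> \<bullet> \<eta>)) / (\<eta> \<bullet> \<eta>)\<^sup>2)) \<le> ennreal (exp (- 2 * (\<eta> \<bullet> \<eta>))) + (\<Sum>j. S j \<eta>)" for \<eta> :: 'a
  proof (cases "\<eta> = 0 \<or> norm \<eta> \<ge> 1")
    case True
    have "exp (- 2 * (\<eta> \<bullet> \<eta>)) / (\<eta> \<bullet> \<eta>)\<^sup>2 \<le> exp (- 2 * (\<eta> \<bullet> \<eta>))"
    proof (cases "\<eta> = 0")
      case False
      then have "1 \<le> (norm \<eta>)\<^sup>2" using True by simp
      then have "1 \<le> (\<eta> \<bullet> \<eta>)\<^sup>2" by (simp add: power2_norm_eq_inner)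
      then show ?thesis by (intro divide_le_eq[THEN iffD2]) (auto simp: mult_le_cancel_left1)
    qed simp
    then have "ennreal (norm (exp (- 2 * (\<eta> \<bullet> \<eta>)) / (\<eta> \<bullet> \<eta>)\<^sup>2)) \<le> ennreal (exp (- 2 * (\<eta> \<bullet> \<eta>)))"
      by (intro ennreal_leI) simp
    then show ?thesis by (rule order_trans) simp
  next
    case False
    then have n: "0 < norm \<eta>" "1 / norm \<eta> > 1" by auto
    from dyadic_bracket[OF n(2)] obtain j :: nat where j: "2 ^ j < 1 / norm \<eta>" "1 / norm \<eta> \<le> 2 ^ Suc j" by blast
    have mem: "\<eta> \<in> cball 0 ((1/2) ^ j)" using j(1) n(1) by (simp add: field_simps power_divide)
    have "exp (- 2 * (\<eta> \<bullet> \<eta>)) / (\<eta> \<bullet> \<eta>)\<^sup>2 \<le> 1 / (\<eta> \<bullet> \<eta>)\<^sup>2" by (intro divide_right_mono) auto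
    also have "\<dots> = (1 / norm \<eta>) ^ 4" by (simp add: power2_norm_eq_inner[symmetric] power_divide flip: power_mult)
    also have "\<dots> \<le> (2 ^ Suc j) ^ 4" using n by (intro power_mono j) auto
    finally have "ennreal (norm (exp (- 2 * (\<eta> \<bullet> \<eta>)) / (\<eta> \<bullet> \<eta>)\<^sup>2)) \<le> S j \<eta>"
      using mem by (simp add: ennreal_leI S_def)
    also have "\<dots> \<le> (\<Sum>j. S j \<eta>)" by (rule ennreal_le_suminf)
    finally show ?thesis by (rule order_trans) simp
  qed
  have "(\<integral>\<^sup>+\<eta>. ennreal (norm (exp (- 2 * ((\<eta>::'a) \<bullet> \<eta>)) / (\<eta> \<bullet> \<eta>)\<^sup>2)) \<partial>lborel)
     \<le> (\<integral>\<^sup>+\<eta>. (ennreal (exp (- 2 * ((\<eta>::'a) \<bullet> \<eta>))) + (\<Sum>j. S j \<eta>)) \<partial>lborel)"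
    by (rule nn_integral_mono) (rule pt)
  also have "\<dots> = (\<integral>\<^sup>+\<eta>. ennreal (exp (- 2 * ((\<eta>::'a) \<bullet> \<eta>))) \<partial>lborel) + (\<Sum>j. \<integral>\<^sup>+\<eta>. S j \<eta> \<partial>lborel)"
    by (simp add: nn_integral_add nn_integral_suminf)
  also have "\<dots> < \<infinity>"
  proof -
    have 1: "(\<integral>\<^sup>+\<eta>. ennreal (exp (- 2 * ((\<eta>::'a) \<bullet> \<eta>))) \<partial>lborel) < \<infinity>"
      using nn_integral_eq_integral[OF gaussian_fourier(1)[of 2, where 'a='a]] by simp
    have "(\<Sum>j. \<integral>\<^sup>+\<eta>. S j \<eta> \<partial>lborel) \<le> (\<Sum>j. ennreal (16 * ?u * (1/2) ^ j))"
    proof (rule suminf_le)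
      fix j :: nat
      have "(\<integral>\<^sup>+\<eta>. S j \<eta> \<partial>lborel) = ennreal ((2 ^ Suc j) ^ 4) * ennreal (?u * ((1/2) ^ j) ^ DIM('a))"
        by (simp add: S_def nn_integral_cmult_indicator emeasure_cball)
      also have "\<dots> = ennreal ((2 ^ Suc j) ^ 4 * (?u * ((1/2) ^ j) ^ DIM('a)))"
        using u by (intro ennreal_mult[symmetric]) auto
      also have "\<dots> \<le> ennreal (16 * ?u * (1/2) ^ j)"
      proof (rule ennreal_leI)
        have "((1/2::real) ^ j) ^ DIM('a) \<le> ((1/2) ^ j) ^ 5"
          by (rule power_decreasing[OF assms]) (auto intro: power_le_one)
        then have "(2 ^ Suc j) ^ 4 * (?u * ((1/2) ^ j) ^ DIM('a)) \<le> (2 ^ Suc j) ^ 4 * (?u * ((1/2) ^ j) ^ 5)"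
          using u by (intro mult_left_mono) auto
        also have "\<dots> = 16 * ?u * (1/2) ^ j"
          by (simp add: power_mult_distrib power_divide eval_nat_numeral)
        finally show "(2 ^ Suc j) ^ 4 * (?u * ((1/2) ^ j) ^ DIM('a)) \<le> 16 * ?u * (1/2) ^ j" .
      qed
      finally show "(\<integral>\<^sup>+\<eta>. S j \<eta> \<partial>lborel) \<le> ennreal (16 * ?u * (1/2) ^ j)" .
    qed auto
    also have "\<dots> = ennreal (\<Sum>j. 16 * ?u * (1/2) ^ j)"
      by (rule suminf_ennreal2) (use u in \<open>auto intro!: summable_mult summable_geometric\<close>)
    finally have "(\<Sum>j. \<integral>\<^sup>+\<eta>. S j \<eta> \<partial>lborel) < \<infinity>" by (rule le_less_trans) simp
    with 1 show ?thesis by simp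
  qed
  finally show "(\<integral>\<^sup>+\<eta>. ennreal (norm (exp (- 2 * ((\<eta>::'a) \<bullet> \<eta>)) / (\<eta> \<bullet> \<eta>)\<^sup>2)) \<partial>lborel) < \<infinity>" .
qed measurable

lemma inverse_fourth_power_gaussian_scaling:
  assumes N: "DIM('a::euclidean_space) \<ge> 5" and t: "t > 0"
  shows "integrable lborel (\<lambda>\<xi>::'a. exp (- 2 * t * (\<xi> \<bullet> \<xi>)) / (\<xi> \<bullet> \<xi>)\<^sup>2)"
    "(LINT \<xi>|lborel. exp (- 2 * t * ((\<xi>::'a) \<bullet> \<xi>)) / (\<xi> \<bullet> \<xi>)\<^sup>2)
      = t powr (2 - real DIM('a) / 2) * (LINT \<eta>|lborel. exp (- 2 * ((\<eta>::'a) \<bullet> \<eta>)) / (\<eta> \<bullet> \<eta>)\<^sup>2)"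
proof -
  let ?f = "\<lambda>\<xi>::'a. exp (- 2 * t * (\<xi> \<bullet> \<xi>)) / (\<xi> \<bullet> \<xi>)\<^sup>2"
  let ?g = "\<lambda>\<eta>::'a. exp (- 2 * (\<eta> \<bullet> \<eta>)) / (\<eta> \<bullet> \<eta>)\<^sup>2"
  define c where "c = t powr (- 1 / 2)"
  have "c\<^sup>2 = t powr (real 2 * (- 1 / 2))" unfolding c_def by (rule powr_power) (use t in simp)
  then have c: "c > 0" "c\<^sup>2 = 1 / t" using t by (auto simp: c_def powr_minus_divide)
  have e: "?f (0 + c *\<^sub>R \<eta>) = t\<^sup>2 * ?g \<eta>" for \<eta>
  proof -
    have "c *\<^sub>R \<eta> \<bullet> c *\<^sub>R \<eta> = (\<eta> \<bullet> \<eta>) / t" using c(2) by (simp add: power2_eq_square[symmetric] mult.assoc[symmetric])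
    then show ?thesis using t by (simp add: power_divide)
  qed
  have "integrable lborel (\<lambda>\<eta>. ?f (0 + c *\<^sub>R \<eta>))"
    unfolding e by (rule integrable_mult_right[OF inverse_fourth_power_gaussian_integrable[OF N]])
  then show "integrable lborel ?f"
    by (subst (asm) lborel_integrable_affine) (use c(1) in auto)
  have "(LINT \<xi>|lborel. ?f \<xi>) = \<bar>c\<bar> ^ DIM('a) *\<^sub>R (LINT \<eta>|lborel. ?f (0 + c *\<^sub>R \<eta>))"
    by (rule lborel_integral_affine) (use c(1) in auto)
  also have "\<dots> = (c ^ DIM('a) * t\<^sup>2) * (LINT \<eta>|lborel. ?g \<eta>)"
    unfolding e integral_mult_right_zero using c(1) by simp
  also have "c ^ DIM('a) * t\<^sup>2 = t powr (2 - real DIM('a) / 2)"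
  proof -
    have "c ^ DIM('a) = t powr (- real DIM('a) / 2)" unfolding c_def using t by (simp add: powr_power)
    moreover have "t\<^sup>2 = t powr 2" using t by simp
    ultimately show ?thesis by (simp only: powr_add[symmetric]) (simp add: algebra_simps)
  qed
  finally show "(LINT \<xi>|lborel. ?f \<xi>) = t powr (2 - real DIM('a) / 2) * (LINT \<eta>|lborel. ?g \<eta>)" .
qed

text \<open>Cauchy--Schwarz pairs the transform |\<xi>|^2 V of the Laplacian with the Gaussian
  divided by |\<xi>|^2. The power of \<open>t\<close> is the square root of the scaling factor of
  that weight, which has exponent 2 - N / 2.\<close>

lemma heat_sup_bound_laplacian:
  assumes N: "DIM('a::euclidean_space) \<ge> 5"
  shows "\<exists>A\<ge>0. \<forall>(v::'a \<Rightarrow> real)\<in>H2. \<forall>t>0. \<forall>x.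
    \<bar>conv v (heat t) x\<bar> \<le> A * sqrt (sqnorm (weak_laplacian v)) * t powr (1 - real DIM('a) / 4)"
proof -
  define J where "J = (LINT \<eta>|lborel. exp (- 2 * ((\<eta>::'a) \<bullet> \<eta>)) / (\<eta> \<bullet> \<eta>)\<^sup>2)"
  define c where "c = (2 * pi) powr real DIM('a)"
  have "\<bar>conv v (heat t) x\<bar> \<le> (1 / c) * (sqrt c * sqrt J) * sqrt (sqnorm (weak_laplacian v)) * t powr (1 - real DIM('a) / 4)"
    if v: "v \<in> H2" and t: "t > 0" for v :: "'a \<Rightarrow> real" and t x
  proof -
    define V where "V = fourier v"
    have F: "is_fourier v V" unfolding V_def by (rule is_fourier_fourier[OF H2_sq_integrable[OF v]])
    note L = is_fourier_laplacian[OF v F]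
    have [measurable]: "V \<in> borel_measurable borel" using is_fourierD[OF F] by measurable
    let ?g = "\<lambda>\<xi>::'a. exp (- t * (\<xi> \<bullet> \<xi>)) / (\<xi> \<bullet> \<xi>)"
    have g2: "(norm (?g \<xi>))\<^sup>2 = exp (- 2 * t * (\<xi> \<bullet> \<xi>)) / (\<xi> \<bullet> \<xi>)\<^sup>2" for \<xi>
      by (simp add: power_divide flip: exp_double)
    have g: "sq_integrable ?g" unfolding sq_integrable_def g2
      using inverse_fourth_power_gaussian_scaling(1)[OF N t] by simp
    have ae: "AE \<xi> in lborel. \<xi> \<noteq> (0::'a)" by (rule AE_lborel_singleton)
    have "(LINT \<xi>|lborel. exp (- t * (\<xi> \<bullet> \<xi>)) * norm (V \<xi>)) = (LINT \<xi>|lborel. norm (?g \<xi>) * norm (- complex_of_real (\<xi> \<bullet> \<xi>) * V \<xi>))"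
    proof (rule integral_cong_AE)
      show "AE \<xi> in lborel. exp (- t * (\<xi> \<bullet> \<xi>)) * norm (V \<xi>) = norm (?g \<xi>) * norm (- complex_of_real (\<xi> \<bullet> \<xi>) * V \<xi>)"
        using ae by eventually_elim (simp add: norm_mult)
    qed measurable
    also have "\<dots> \<le> sqrt (sqnorm ?g) * sqrt (sqnorm (\<lambda>\<xi>. - complex_of_real (\<xi> \<bullet> \<xi>) * V \<xi>))"
      by (rule Cauchy_Schwarz_norm[OF g is_fourierD(2)[OF L]])
    also have "\<dots> = sqrt (t powr (2 - real DIM('a) / 2) * J) * sqrt (c * sqnorm (weak_laplacian v))"
      unfolding is_fourier_sqnorm[OF L] c_def[symmetric] sqnorm_def[of ?g] g2 inverse_fourth_power_gaussian_scaling(2)[OF N t] J_def ..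
    also have "\<dots> = (sqrt c * sqrt J) * sqrt (sqnorm (weak_laplacian v)) * t powr (1 - real DIM('a) / 4)"
      using t by (simp add: real_sqrt_mult powr_half_sqrt[symmetric] powr_powr diff_divide_distrib)
    finally have le: "(LINT \<xi>|lborel. exp (- t * (\<xi> \<bullet> \<xi>)) * norm (V \<xi>)) \<le> (sqrt c * sqrt J) * sqrt (sqnorm (weak_laplacian v)) * t powr (1 - real DIM('a) / 4)" .
    have "\<bar>conv v (heat t) x\<bar> \<le> (1 / c) * (LINT \<xi>|lborel. exp (- t * (\<xi> \<bullet> \<xi>)) * norm (V \<xi>))"
      using conv_heat_sup_bound[OF F t, of x] by (simp add: c_def powr_minus divide_inverse)
    also have "\<dots> \<le> (1 / c) * ((sqrt c * sqrt J) * sqrt (sqnorm (weak_laplacian v)) * t powr (1 - real DIM('a) / 4))"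
      by (rule mult_left_mono[OF le]) (simp add: c_def)
    finally show ?thesis by (simp only: mult.assoc)
  qed
  moreover have "(1 / c) * (sqrt c * sqrt J) \<ge> 0"
    unfolding c_def J_def by (intro mult_nonneg_nonneg divide_nonneg_nonneg real_sqrt_ge_zero Bochner_Integration.integral_nonneg) auto
  ultimately show ?thesis by (intro exI[of _ "(1 / c) * (sqrt c * sqrt J)"]) blast
qed

text \<open>Where |v| exceeds \<open>l\<close> the smoothed function accounts for at most half of
  it, so the difference of the two is at least l / 2; Markov's inequality for its square and the
  smoothing rate bound the measure.\<close>

lemma level_set_bound:
  fixes v :: "'a::euclidean_space \<Rightarrow> real"
  assumes v: "v \<in> H2" and t: "t > 0" and l: "l > 0" and b: "\<And>x. \<bar>conv v (heat t) x\<bar> \<le> l / 2"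
  shows "emeasure lborel {x. \<bar>v x\<bar> > l} \<le> ennreal (4 * t\<^sup>2 * sqnorm (weak_laplacian v) / l\<^sup>2)"
proof -
  let ?d = "\<lambda>x. v x - conv v (heat t) x"
  have d: "sq_integrable ?d"
    by (intro sq_integrable_diff Young_L2(1) H2_sq_integrable[OF v] kernel_heat[OF t])
  have [measurable]: "?d \<in> borel_measurable borel" using d by measurable
  have "emeasure lborel {x. \<bar>v x\<bar> > l} \<le> emeasure lborel {x \<in> space lborel. (?d x)\<^sup>2 \<ge> (l / 2)\<^sup>2}"
  proof (rule emeasure_mono)
    show "{x. \<bar>v x\<bar> > l} \<subseteq> {x \<in> space lborel. (?d x)\<^sup>2 \<ge> (l / 2)\<^sup>2}"
    proof
      fix x assume "x \<in> {x. \<bar>v x\<bar> > l}"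
      then have "l / 2 \<le> \<bar>?d x\<bar>" using b[of x] abs_triangle_ineq2[of "v x" "conv v (heat t) x"] by simp
      then have "(l / 2)\<^sup>2 \<le> \<bar>?d x\<bar>\<^sup>2" using l by (intro power_mono) auto
      then show "x \<in> {x \<in> space lborel. (?d x)\<^sup>2 \<ge> (l / 2)\<^sup>2}" by simp
    qed
    show "{x \<in> space lborel. (?d x)\<^sup>2 \<ge> (l / 2)\<^sup>2} \<in> sets lborel" by measurable
  qed
  also have "\<dots> \<le> ennreal ((LINT x|lborel. (?d x)\<^sup>2) / (l / 2)\<^sup>2)"
    using integral_Markov_inequality[of lborel "\<lambda>x. (?d x)\<^sup>2" "(l / 2)\<^sup>2"] d l by (simp add: sq_integrable_def)
  also have "\<dots> \<le> ennreal (4 * t\<^sup>2 * sqnorm (weak_laplacian v) / l\<^sup>2)"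
    using heat_approx_sqnorm[OF v t] l by (intro ennreal_leI) (simp add: sqnorm_def field_simps)
  finally show ?thesis .
qed

text \<open>Weak-type Sobolev inequality at the critical exponent: choose the heat time so that the smoothed
  function stays below \<open>l / 2\<close>.\<close>

lemma weak_Sobolev:
  assumes N: "DIM('a::euclidean_space) \<ge> 5" and D: "D > 0"
  shows "\<exists>K\<ge>0. \<forall>(v::'a \<Rightarrow> real)\<in>H2. sqnorm (weak_laplacian v) \<le> D \<longrightarrow>
    (\<forall>l>0. emeasure lborel {x. \<bar>v x\<bar> > l} \<le> ennreal (K * l powr (- crit_exp DIM('a))))"
proof -
  obtain A where A: "A \<ge> 0" "\<And>(v::'a \<Rightarrow> real) t x. v \<in> H2 \<Longrightarrow> t > 0 \<Longrightarrow>
    \<bar>conv v (heat t) x\<bar> \<le> A * sqrt (sqnorm (weak_laplacian v)) * t powr (1 - real DIM('a) / 4)"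
    using heat_sup_bound_laplacian[OF N] by metis
  define B where "B = 2 * A * sqrt D + 1"
  have B: "B > 0" using A(1) D by (simp add: B_def add_nonneg_pos)
  let ?N = "real DIM('a)"
  have N4: "?N - 4 > 0" using N by simp
  let ?s = "8 / (?N - 4)"
  show ?thesis
  proof (intro exI[of _ "4 * D * B powr ?s"] conjI ballI impI allI)
    show "4 * D * B powr ?s \<ge> 0" using D by simp
    fix v :: "'a \<Rightarrow> real" and l :: real
    assume v: "v \<in> H2" "sqnorm (weak_laplacian v) \<le> D" and l: "l > 0"
    \<comment> \<open>The exponent inverts t^(1 - N/4), so that this power equals l / B and the sup
      bound becomes at most l / 2. Then t^2 scales like l^(-8/(N-4)), and t^2 / l^2 like l to minus
      the critical exponent.\<close>
    define t where "t = (l / B) powr (- 4 / (?N - 4))"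
    have t: "t > 0" using l B by (simp add: t_def)
    have tp: "t powr (1 - ?N / 4) = l / B"
    proof -
      have "(- 4 / (?N - 4)) * (1 - ?N / 4) = 1" using N4 by (simp add: field_simps)
      then show ?thesis unfolding t_def powr_powr using l B by simp
    qed
    have t2: "t\<^sup>2 = B powr ?s * l powr (- ?s)"
    proof -
      have "t\<^sup>2 = (l / B) powr (- ?s)"
        unfolding t_def using l B by (simp add: powr_power)
      also have "\<dots> = B powr ?s * l powr (- ?s)" using l B by (simp add: powr_divide powr_minus field_simps)
      finally show ?thesis .
    qed
    have b: "\<bar>conv v (heat t) x\<bar> \<le> l / 2" for x
    proof -
      have "\<bar>conv v (heat t) x\<bar> \<le> A * sqrt (sqnorm (weak_laplacian v)) * (l / B)"
        using A(2)[OF v(1) t, of x] unfolding tp .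
      also have "\<dots> \<le> A * sqrt D * (l / B)"
        using v(2) A(1) l B by (intro mult_right_mono mult_left_mono) auto
      also have "\<dots> \<le> (B / 2) * (l / B)" using l B by (intro mult_right_mono) (auto simp: B_def)
      finally show ?thesis using B by simp
    qed
    have "emeasure lborel {x. \<bar>v x\<bar> > l} \<le> ennreal (4 * t\<^sup>2 * sqnorm (weak_laplacian v) / l\<^sup>2)"
      by (rule level_set_bound[OF v(1) t l b])
    also have "\<dots> \<le> ennreal (4 * D * B powr ?s * l powr (- crit_exp DIM('a)))"
    proof (rule ennreal_leI)
      have "- crit_exp DIM('a) = - ?s - 2" using N4 by (simp add: crit_exp_def field_simps)
      then have "l powr (- crit_exp DIM('a)) = l powr (- ?s) / l powr 2"
        by (simp only: powr_diff)
      then have "l powr (- crit_exp DIM('a)) = l powr (- ?s) / l\<^sup>2" using l by simp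
      then have "4 * D * B powr ?s * l powr (- crit_exp DIM('a)) = 4 * t\<^sup>2 * D / l\<^sup>2" unfolding t2 by simp
      moreover have "4 * t\<^sup>2 * sqnorm (weak_laplacian v) / l\<^sup>2 \<le> 4 * t\<^sup>2 * D / l\<^sup>2"
        using v(2) by (intro divide_right_mono mult_left_mono) auto
      ultimately show "4 * t\<^sup>2 * sqnorm (weak_laplacian v) / l\<^sup>2 \<le> 4 * D * B powr ?s * l powr (- crit_exp DIM('a))" by simp
    qed
    finally show "emeasure lborel {x. \<bar>v x\<bar> > l} \<le> ennreal (4 * D * B powr ?s * l powr (- crit_exp DIM('a)))" .
  qed
qed

text \<open>Three ranges of |v|: below \<open>d\<close> the surplus power q - 2 is paid by
  \<open>d\<close>; up to 2^J the integrand is at most 2^(J q) on the level set of \<open>d\<close>;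
  above 2^J the weak-type bound gives a geometric series of ratio 2^(q - r) < 1. Both
  \<open>d\<close> and \<open>J\<close> stay free, so each of the three terms can be made small in
  turn.\<close>

lemma Lq_layer_bound:
  fixes v :: "'a::euclidean_space \<Rightarrow> real" and J :: nat
  assumes v: "sq_integrable v" and q: "2 < q" "q < r" and d: "d > 0" and K: "K \<ge> 0"
    and lev: "\<And>l. l > 0 \<Longrightarrow> emeasure lborel {x. \<bar>v x\<bar> > l} \<le> ennreal (K * l powr (- r))"
  shows "v \<in> Lspace q"
    "(LINT x|lborel. \<bar>v x\<bar> powr q) \<le> d powr (q - 2) * sqnorm v + (2 ^ J) powr q * measure lborel {x. \<bar>v x\<bar> > d}
       + K * 2 powr q * (2 powr (q - r)) ^ J / (1 - 2 powr (q - r))"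
proof -
  have [measurable]: "v \<in> borel_measurable borel" using v by measurable
  define z where "z = 2 powr (q - r)"
  have z: "0 < z" "z < 1" using q by (auto simp: z_def powr_less_one)
  have fin: "emeasure lborel {x. \<bar>v x\<bar> > d} < \<infinity>" using lev[OF d] by (rule le_less_trans) simp
  \<comment> \<open>On the layer between 2^(J+j) and 2^(J+j+1) the integrand is charged its value at
    the upper end, the measure its value at the lower end.\<close>
  let ?S = "\<lambda>j x. ennreal ((2 ^ (J + Suc j)) powr q) * indicator {x. \<bar>v x\<bar> > 2 ^ (J + j)} x"
  have pt: "ennreal (\<bar>v x\<bar> powr q) \<le> ennreal (d powr (q - 2) * (v x)\<^sup>2) + ennreal ((2 ^ J) powr q) * indicator {x. \<bar>v x\<bar> > d} x + (\<Sum>j. ?S j x)" for x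
  proof -
    consider "\<bar>v x\<bar> \<le> d" | "\<bar>v x\<bar> > d" "\<bar>v x\<bar> \<le> 2 ^ J" | "\<bar>v x\<bar> > 2 ^ J" by linarith
    then show ?thesis
    proof cases
      case 1
      have "\<bar>v x\<bar> powr q \<le> d powr (q - 2) * (v x)\<^sup>2"
      proof (cases "v x = 0")
        case False
        have "\<bar>v x\<bar> powr q = \<bar>v x\<bar> powr (q - 2) * \<bar>v x\<bar> powr 2" by (simp only: powr_add[symmetric]) simp
        also have "\<bar>v x\<bar> powr 2 = (v x)\<^sup>2" by simp
        finally show ?thesis using 1 q by (auto intro!: mult_right_mono powr_mono2)
      qed simp
      then have "ennreal (\<bar>v x\<bar> powr q) \<le> ennreal (d powr (q - 2) * (v x)\<^sup>2)" by (rule ennreal_leI)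
      then show ?thesis by (simp add: add.assoc add_increasing2)
    next
      case 2
      have "ennreal (\<bar>v x\<bar> powr q) \<le> ennreal ((2 ^ J) powr q) * indicator {x. \<bar>v x\<bar> > d} x"
        using 2 q by (auto intro!: ennreal_leI powr_mono2)
      then show ?thesis by (simp add: add_increasing add_increasing2)
    next
      case 3
      then have "\<bar>v x\<bar> / 2 ^ J > 1" by simp
      from dyadic_bracket[OF this] obtain j :: nat where j: "2 ^ j < \<bar>v x\<bar> / 2 ^ J" "\<bar>v x\<bar> / 2 ^ J \<le> 2 ^ Suc j" by blast
      then have j': "2 ^ (J + j) < \<bar>v x\<bar>" "\<bar>v x\<bar> \<le> 2 ^ (J + Suc j)" by (simp_all add: field_simps power_add)
      have "ennreal (\<bar>v x\<bar> powr q) \<le> ?S j x" using j' q by (auto intro!: ennreal_leI powr_mono2)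
      also have "\<dots> \<le> (\<Sum>j. ?S j x)" by (rule ennreal_le_suminf)
      finally show ?thesis by (simp add: add_increasing)
    qed
  qed
  have tail: "(\<Sum>j. \<integral>\<^sup>+x. ?S j x \<partial>lborel) \<le> ennreal (K * 2 powr q * z ^ J / (1 - z))"
  proof -
    have "(\<Sum>j. \<integral>\<^sup>+x. ?S j x \<partial>lborel) \<le> (\<Sum>j. ennreal (K * 2 powr q * z ^ J * z ^ j))"
    proof (rule suminf_le)
      fix j :: nat
      have "(\<integral>\<^sup>+x. ?S j x \<partial>lborel) = ennreal ((2 ^ (J + Suc j)) powr q) * emeasure lborel {x. \<bar>v x\<bar> > 2 ^ (J + j)}"
        by (rule nn_integral_cmult_indicator) measurable
      also have "\<dots> \<le> ennreal ((2 ^ (J + Suc j)) powr q) * ennreal (K * (2 ^ (J + j)) powr (- r))"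
        by (intro mult_left_mono lev) auto
      also have "\<dots> = ennreal ((2 ^ (J + Suc j)) powr q * (K * (2 ^ (J + j)) powr (- r)))"
        using K by (intro ennreal_mult[symmetric]) auto
      also have "(2 ^ (J + Suc j)) powr q * (K * (2 ^ (J + j)) powr (- r)) = K * 2 powr q * z ^ J * z ^ j"
      proof -
        have "(2 ^ (J + Suc j)) powr q = 2 powr q * (2 ^ (J + j)) powr q" by (simp add: powr_mult)
        then have "(2 ^ (J + Suc j)) powr q * (K * (2 ^ (J + j)) powr (- r)) = K * 2 powr q * ((2 ^ (J + j)) powr q * (2 ^ (J + j)) powr (- r))" by simp
        also have "(2 ^ (J + j)) powr q * (2 ^ (J + j)) powr (- r) = (2::real) powr (real (J + j) * (q - r))"
        proof -
          have "(2 ^ (J + j)) = (2::real) powr real (J + j)" by (simp only: powr_realpow zero_less_numeral)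
          then show ?thesis by (simp only: powr_powr powr_add[symmetric]) (simp add: algebra_simps)
        qed
        also have "\<dots> = z ^ (J + j)" unfolding z_def by (simp add: powr_power)
        finally show ?thesis by (simp add: power_add)
      qed
      finally show "(\<integral>\<^sup>+x. ?S j x \<partial>lborel) \<le> ennreal (K * 2 powr q * z ^ J * z ^ j)" .
    qed auto
    also have "\<dots> = ennreal (\<Sum>j. K * 2 powr q * z ^ J * z ^ j)"
      by (rule suminf_ennreal2) (use K z in \<open>auto intro!: summable_mult summable_geometric\<close>)
    also have "(\<Sum>j. K * 2 powr q * z ^ J * z ^ j) = K * 2 powr q * z ^ J / (1 - z)"
      using z by (subst suminf_mult) (auto intro!: summable_geometric simp: suminf_geometric)
    finally show ?thesis .
  qed
  have le: "(\<integral>\<^sup>+x. ennreal (\<bar>v x\<bar> powr q) \<partial>lborel) \<le> ennreal (d powr (q - 2) * sqnorm v + (2 ^ J) powr q * measure lborel {x. \<bar>v x\<bar> > d} + K * 2 powr q * z ^ J / (1 - z))"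
  proof -
    have "(\<integral>\<^sup>+x. ennreal (\<bar>v x\<bar> powr q) \<partial>lborel) \<le> (\<integral>\<^sup>+x. (ennreal (d powr (q - 2) * (v x)\<^sup>2) + ennreal ((2 ^ J) powr q) * indicator {x. \<bar>v x\<bar> > d} x + (\<Sum>j. ?S j x)) \<partial>lborel)"
      by (rule nn_integral_mono) (rule pt)
    also have "\<dots> = (\<integral>\<^sup>+x. ennreal (d powr (q - 2) * (v x)\<^sup>2) \<partial>lborel) + ennreal ((2 ^ J) powr q) * emeasure lborel {x. \<bar>v x\<bar> > d} + (\<Sum>j. \<integral>\<^sup>+x. ?S j x \<partial>lborel)"
      by (simp add: nn_integral_add nn_integral_suminf nn_integral_cmult_indicator)
    also have "(\<integral>\<^sup>+x. ennreal (d powr (q - 2) * (v x)\<^sup>2) \<partial>lborel) = ennreal (d powr (q - 2) * sqnorm v)"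
      using v nn_integral_eq_integral[of lborel "\<lambda>x. d powr (q - 2) * (v x)\<^sup>2"] by (simp add: sq_integrable_def sqnorm_def)
    also have "emeasure lborel {x. \<bar>v x\<bar> > d} = ennreal (measure lborel {x. \<bar>v x\<bar> > d})"
      by (rule emeasure_eq_ennreal_measure) (use fin in auto)
    also have "ennreal (d powr (q - 2) * sqnorm v) + ennreal ((2 ^ J) powr q) * ennreal (measure lborel {x. \<bar>v x\<bar> > d}) + (\<Sum>j. \<integral>\<^sup>+x. ?S j x \<partial>lborel)
       \<le> ennreal (d powr (q - 2) * sqnorm v) + ennreal ((2 ^ J) powr q) * ennreal (measure lborel {x. \<bar>v x\<bar> > d}) + ennreal (K * 2 powr q * z ^ J / (1 - z))"
      by (rule add_left_mono[OF tail])
    also have "\<dots> = ennreal (d powr (q - 2) * sqnorm v + (2 ^ J) powr q * measure lborel {x. \<bar>v x\<bar> > d} + K * 2 powr q * z ^ J / (1 - z))"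
      using K z by (simp add: ennreal_mult[symmetric] ennreal_plus[symmetric] del: ennreal_plus)
    finally show ?thesis .
  qed
  have int: "integrable lborel (\<lambda>x. \<bar>v x\<bar> powr q)"
    by (rule integrableI_bounded) (use le in \<open>auto simp: le_less_trans\<close>)
  then show "v \<in> Lspace q" by (simp add: Lspace_def)
  have "ennreal (LINT x|lborel. \<bar>v x\<bar> powr q) = (\<integral>\<^sup>+x. ennreal (\<bar>v x\<bar> powr q) \<partial>lborel)"
    by (rule nn_integral_eq_integral[symmetric, OF int]) simp
  with le have "ennreal (LINT x|lborel. \<bar>v x\<bar> powr q) \<le> ennreal (d powr (q - 2) * sqnorm v + (2 ^ J) powr q * measure lborel {x. \<bar>v x\<bar> > d} + K * 2 powr q * z ^ J / (1 - z))" by simp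
  moreover have "0 \<le> d powr (q - 2) * sqnorm v + (2 ^ J) powr q * measure lborel {x. \<bar>v x\<bar> > d} + K * 2 powr q * z ^ J / (1 - z)"
    using K z by simp
  ultimately show "(LINT x|lborel. \<bar>v x\<bar> powr q) \<le> d powr (q - 2) * sqnorm v + (2 ^ J) powr q * measure lborel {x. \<bar>v x\<bar> > d}
       + K * 2 powr q * (2 powr (q - r)) ^ J / (1 - 2 powr (q - r))"
    unfolding z_def by (simp only: ennreal_le_iff)
qed

text \<open>Fourier mass concentrating on the null set \<open>\<xi> \<bullet> \<xi> = m\<close> disappears in the weighted \<open>L\<^sup>1\<close> norm:
  use Cauchy--Schwarz with the weight \<open>(\<xi> \<bullet> \<xi> - m)\<^sup>2 + \<eta>\<close> and then let \<open>\<eta>\<close> tend to 0.\<close>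

lemma sphere_concentration_L1:
  fixes V :: "nat \<Rightarrow> 'a::euclidean_space \<Rightarrow> complex"
  assumes V: "\<And>k. sq_integrable (V k)" "\<And>k. sqnorm (V k) \<le> C"
    and W: "\<And>k. sq_integrable (\<lambda>\<xi>. complex_of_real (\<xi> \<bullet> \<xi> - m) * V k \<xi>)"
    and lim: "(\<lambda>k. sqnorm (\<lambda>\<xi>. complex_of_real (\<xi> \<bullet> \<xi> - m) * V k \<xi>)) \<longlonglongrightarrow> 0"
    and t: "t > 0" and m: "m > 0"
  shows "(\<lambda>k. LINT \<xi>|lborel. exp (- t * (\<xi> \<bullet> \<xi>)) * norm (V k \<xi>)) \<longlonglongrightarrow> 0"
proof -
  have [measurable]: "V k \<in> borel_measurable borel" for k using V(1) by measurable
  define s where "s k = sqnorm (\<lambda>\<xi>. complex_of_real (\<xi> \<bullet> \<xi> - m) * V k \<xi>)" for k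
  define I where "I k = (LINT \<xi>|lborel. exp (- t * (\<xi> \<bullet> \<xi>)) * norm (V k \<xi>))" for k
  define h where "h n = 1 / real (Suc n)" for n
  have h: "h n > 0" for n by (simp add: h_def)
  define w where "w n \<xi> = sqrt ((\<xi> \<bullet> \<xi> - m)\<^sup>2 + h n)" for n and \<xi> :: 'a
  have w2: "(w n \<xi>)\<^sup>2 = (\<xi> \<bullet> \<xi> - m)\<^sup>2 + h n" for n \<xi> unfolding w_def using h[of n] by (simp add: less_imp_le)
  have wpos: "w n \<xi> > 0" for n \<xi> unfolding w_def using h[of n] by (simp add: add_nonneg_pos)
  have [measurable]: "w n \<in> borel_measurable borel" for n unfolding w_def by measurable
  have C: "C \<ge> 0" using V(2)[of 0] sqnorm_nonneg[of "V 0"] by linarith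
  define g where "g n \<xi> = exp (- t * (\<xi> \<bullet> \<xi>)) / w n \<xi>" for n \<xi>
  have [measurable]: "g n \<in> borel_measurable borel" for n unfolding g_def by measurable
  have g2: "(g n \<xi>)\<^sup>2 = exp (- (2 * t) * (\<xi> \<bullet> \<xi>)) / ((\<xi> \<bullet> \<xi> - m)\<^sup>2 + h n)" for n \<xi>
    unfolding g_def power_divide w2 by (simp flip: exp_double)
  have gb: "h n * (g n \<xi>)\<^sup>2 \<le> exp (- (2 * t) * (\<xi> \<bullet> \<xi>))" for n \<xi>
  proof -
    have "h n / ((\<xi> \<bullet> \<xi> - m)\<^sup>2 + h n) \<le> 1" using h[of n] by (simp add: divide_le_eq add_nonneg_pos)
    from mult_right_mono[OF this, of "exp (- (2 * t) * (\<xi> \<bullet> \<xi>))"] show ?thesis unfolding g2 by simp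
  qed
  have E: "integrable lborel (\<lambda>\<xi>::'a. exp (- (2 * t) * (\<xi> \<bullet> \<xi>)))" by (rule gaussian_fourier(1)) (use t in simp)
  have hg: "integrable lborel (\<lambda>\<xi>. h n * (g n \<xi>)\<^sup>2)" for n
    by (rule Bochner_Integration.integrable_bound[OF E]) (use gb h[of n] in \<open>auto simp: abs_mult less_imp_le\<close>)
  have gi: "sq_integrable (g n)" for n
    using integrable_mult_right[OF hg[of n], of "1 / h n"] h[of n] by (simp add: sq_integrable_def)
  define Q where "Q n = sqnorm (g n)" for n
  \<comment> \<open>The quotient h / ((|\<xi>|^2 - m)^2 + h) never exceeds 1 and tends to 0 off the
    sphere |\<xi>|^2 = m. Spheres are null sets, so the Gaussian dominates an a.e. vanishing
    sequence.\<close>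
  have Qlim: "(\<lambda>n. h n * Q n) \<longlonglongrightarrow> 0"
  proof -
    have "(\<lambda>n. LINT \<xi>|lborel. h n * (g n \<xi>)\<^sup>2) \<longlonglongrightarrow> (LINT \<xi>|(lborel :: 'a measure). 0)"
    proof (rule integral_dominated_convergence)
      show "integrable lborel (\<lambda>\<xi>::'a. exp (- (2 * t) * (\<xi> \<bullet> \<xi>)))" by (rule E)
      show "AE \<xi> in lborel. norm (h n * (g n \<xi>)\<^sup>2) \<le> exp (- (2 * t) * (\<xi> \<bullet> \<xi>))" for n
        using gb h[of n] by (auto simp: abs_mult less_imp_le)
      have "negligible (sphere (0::'a) (sqrt m))" by (rule negligible_sphere)
      then have "AE \<xi> in lebesgue. \<xi> \<notin> sphere (0::'a) (sqrt m)"
        by (intro AE_not_in) (simp only: negligible_iff_null_sets)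
      then have "AE \<xi> in lborel. \<xi> \<notin> sphere (0::'a) (sqrt m)" by (simp add: AE_completion_iff)
      then show "AE \<xi> in lborel. (\<lambda>n. h n * (g n \<xi>)\<^sup>2) \<longlonglongrightarrow> 0"
      proof eventually_elim
        case (elim \<xi>)
        have ne: "(\<xi> \<bullet> \<xi> - m)\<^sup>2 \<noteq> 0" using elim by (auto simp: norm_eq_sqrt_inner)
        have "h \<longlonglongrightarrow> 0" unfolding h_def[abs_def] by (rule LIMSEQ_Suc[OF lim_1_over_n])
        then have "(\<lambda>n. h n * (exp (- (2 * t) * (\<xi> \<bullet> \<xi>)) / ((\<xi> \<bullet> \<xi> - m)\<^sup>2 + h n))) \<longlonglongrightarrow> 0 * (exp (- (2 * t) * (\<xi> \<bullet> \<xi>)) / ((\<xi> \<bullet> \<xi> - m)\<^sup>2 + 0))"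
          using ne by (intro tendsto_intros) auto
        then show ?case unfolding g2 by simp
      qed
    qed measurable
    then show ?thesis by (simp add: Q_def sqnorm_def)
  qed
  have I0: "I k \<ge> 0" for k unfolding I_def by simp
  have key: "(I k)\<^sup>2 \<le> Q n * s k + C * (h n * Q n)" for k n
  proof -
    have wV: "sqnorm (\<lambda>\<xi>. complex_of_real (w n \<xi>) * V k \<xi>) = s k + h n * sqnorm (V k)"
      "sq_integrable (\<lambda>\<xi>. complex_of_real (w n \<xi>) * V k \<xi>)"
    proof -
      have i1: "integrable lborel (\<lambda>\<xi>. (\<xi> \<bullet> \<xi> - m)\<^sup>2 * (norm (V k \<xi>))\<^sup>2)"
        using W[of k] unfolding sq_integrable_def by (simp only: norm_mult norm_of_real power_mult_distrib power2_abs)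
      have i2: "integrable lborel (\<lambda>\<xi>. h n * (norm (V k \<xi>))\<^sup>2)" using V(1)[of k] by (simp add: sq_integrable_def)
      have e: "(norm (complex_of_real (w n \<xi>) * V k \<xi>))\<^sup>2 = (\<xi> \<bullet> \<xi> - m)\<^sup>2 * (norm (V k \<xi>))\<^sup>2 + h n * (norm (V k \<xi>))\<^sup>2" for \<xi>
        by (simp add: norm_mult power_mult_distrib w2 distrib_right)
      show "sq_integrable (\<lambda>\<xi>. complex_of_real (w n \<xi>) * V k \<xi>)"
        unfolding sq_integrable_def e using i1 i2 by simp
      show "sqnorm (\<lambda>\<xi>. complex_of_real (w n \<xi>) * V k \<xi>) = s k + h n * sqnorm (V k)"
        unfolding s_def mult_sqnorm_expand[of "\<lambda>\<xi>. \<xi> \<bullet> \<xi> - m"] unfolding sqnorm_def e using i1 i2 by simp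
    qed
    have "I k = (LINT \<xi>|lborel. norm (g n \<xi>) * norm (complex_of_real (w n \<xi>) * V k \<xi>))"
      unfolding I_def g_def using wpos[of n] by (intro Bochner_Integration.integral_cong refl) (simp add: norm_mult abs_of_pos less_imp_neq[symmetric])
    also have "\<dots> \<le> sqrt (Q n) * sqrt (s k + h n * sqnorm (V k))"
      using Cauchy_Schwarz_norm[OF gi wV(2), of n] unfolding wV(1) Q_def .
    finally have "(I k)\<^sup>2 \<le> (sqrt (Q n) * sqrt (s k + h n * sqnorm (V k)))\<^sup>2" using I0 by (intro power_mono) auto
    also have "\<dots> = Q n * (s k + h n * sqnorm (V k))"
      using h[of n] by (simp add: power_mult_distrib Q_def s_def)
    also have "\<dots> \<le> Q n * (s k + h n * C)"
      using V(2)[of k] h[of n] by (intro mult_left_mono add_left_mono) (auto simp: Q_def)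
    finally show ?thesis by (simp add: algebra_simps)
  qed
  \<comment> \<open>The order of choices matters: \<open>n\<close> first makes the second term of
    \<open>key\<close> small uniformly in \<open>k\<close>; then \<open>Q n\<close> is a constant,
    however large, and \<open>s k\<close> tends to 0.\<close>
  have "(\<lambda>k. (I k)\<^sup>2) \<longlonglongrightarrow> 0"
  proof (rule LIMSEQ_I)
    fix e :: real assume e: "e > 0"
    have "(\<lambda>n. C * (h n * Q n)) \<longlonglongrightarrow> C * 0" by (intro tendsto_intros Qlim)
    then have "\<forall>\<^sub>F n in sequentially. C * (h n * Q n) < e / 2" using e by (intro order_tendstoD) auto
    then obtain n where n: "C * (h n * Q n) < e / 2" by (auto simp: eventually_sequentially)
    have "(\<lambda>k. Q n * s k) \<longlonglongrightarrow> Q n * 0" unfolding s_def by (intro tendsto_intros lim)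
    then have "\<forall>\<^sub>F k in sequentially. Q n * s k < e / 2" using e by (intro order_tendstoD) auto
    then obtain k0 where k0: "\<And>k. k \<ge> k0 \<Longrightarrow> Q n * s k < e / 2" by (auto simp: eventually_sequentially)
    have "norm ((I k)\<^sup>2 - 0) < e" if "k \<ge> k0" for k using key[of k n] n k0[OF that] by simp
    then show "\<exists>k0. \<forall>k\<ge>k0. norm ((I k)\<^sup>2 - 0) < e" by blast
  qed
  from tendsto_real_sqrt[OF this] show ?thesis using I0 unfolding I_def[abs_def] by (simp add: I_def)
qed

section \<open>From concentration in frequency to vanishing in Lq\<close>

lemma is_fourier_shifted_laplacian:
  fixes v :: "'a::euclidean_space \<Rightarrow> real"
  assumes v: "v \<in> H2" and F: "is_fourier v V"
  shows "sq_integrable (\<lambda>\<xi>. complex_of_real (\<xi> \<bullet> \<xi> - m) * V \<xi>)"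
    "sqnorm (\<lambda>\<xi>. complex_of_real (\<xi> \<bullet> \<xi> - m) * V \<xi>) = (2 * pi) powr real DIM('a) * sqnorm (\<lambda>x. weak_laplacian v x + m * v x)"
proof -
  note G = is_fourier_cmult[OF is_fourier_add[OF is_fourier_laplacian[OF v F] is_fourier_cmult[OF F, of m]], of "- 1"]
  have e: "complex_of_real (- 1) * (- complex_of_real (\<xi> \<bullet> \<xi>) * V \<xi> + complex_of_real m * V \<xi>) = complex_of_real (\<xi> \<bullet> \<xi> - m) * V \<xi>" for \<xi>
    by (simp add: algebra_simps)
  show "sq_integrable (\<lambda>\<xi>. complex_of_real (\<xi> \<bullet> \<xi> - m) * V \<xi>)"
    using is_fourierD(2)[OF G] unfolding e .
  show "sqnorm (\<lambda>\<xi>. complex_of_real (\<xi> \<bullet> \<xi> - m) * V \<xi>) = (2 * pi) powr real DIM('a) * sqnorm (\<lambda>x. weak_laplacian v x + m * v x)"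
    using is_fourier_sqnorm[OF G] unfolding e sqnorm_cmult by simp
qed

text \<open>Plancherel for the Laplacian shifted by \<open>m\<close>. Integrability is recorded next
  to the value, since a divergent integral would be 0 by convention and smallness would then say
  nothing.\<close>

lemma fourier_shifted_laplacian:
  fixes v :: "'a::euclidean_space \<Rightarrow> real"
  assumes v: "v \<in> H2"
  shows "integrable lborel (\<lambda>\<xi>. ((norm \<xi>)\<^sup>2 - m)\<^sup>2 * (cmod (fourier v \<xi>))\<^sup>2)"
    "(LINT \<xi>|lborel. ((norm \<xi>)\<^sup>2 - m)\<^sup>2 * (cmod (fourier v \<xi>))\<^sup>2) = (2 * pi) powr real DIM('a) * sqnorm (\<lambda>x. weak_laplacian v x + m * v x)"
proof -
  note S = is_fourier_shifted_laplacian[OF v is_fourier_fourier[OF H2_sq_integrable[OF v]], of m]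
  show "integrable lborel (\<lambda>\<xi>. ((norm \<xi>)\<^sup>2 - m)\<^sup>2 * (cmod (fourier v \<xi>))\<^sup>2)"
    using S(1) unfolding sq_integrable_def power2_norm_eq_inner[of "_ :: 'a"]
    by (simp only: norm_mult norm_of_real power_mult_distrib power2_abs)
  show "(LINT \<xi>|lborel. ((norm \<xi>)\<^sup>2 - m)\<^sup>2 * (cmod (fourier v \<xi>))\<^sup>2) = (2 * pi) powr real DIM('a) * sqnorm (\<lambda>x. weak_laplacian v x + m * v x)"
    using S(2) unfolding mult_sqnorm_expand[of "\<lambda>\<xi>. \<xi> \<bullet> \<xi> - m"] power2_norm_eq_inner[of "_ :: 'a"] .
qed

lemma shifted_laplacian_sq_integrable:
  fixes v :: "'a::euclidean_space \<Rightarrow> real"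
  assumes "v \<in> H2"
  shows "sq_integrable (\<lambda>x. weak_laplacian v x + m * v x)"
  by (intro sq_integrable_add sq_integrable_cmult H2_laplacian_sq_integrable[OF assms] H2_sq_integrable[OF assms])

lemma Lq_vanishing:
  fixes v :: "nat \<Rightarrow> 'a::euclidean_space \<Rightarrow> real"
  assumes N: "DIM('a) \<ge> 5" and v: "\<And>k. v k \<in> H2" and S: "\<And>k. sqnorm (v k) \<le> S" and D: "\<And>k. sqnorm (weak_laplacian (v k)) \<le> D"
    and m: "m > 0" and lim: "(\<lambda>k. sqnorm (\<lambda>x. weak_laplacian (v k) x + m * v k x)) \<longlonglongrightarrow> 0"
    and q: "2 < q" "q < crit_exp DIM('a)"
  shows "v k \<in> Lspace q" "(\<lambda>k. Lnorm q (v k)) \<longlonglongrightarrow> 0"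
proof -
  \<comment> \<open>\<open>weak_Sobolev\<close> asks for a positive bound, whereas \<open>D\<close>
    itself may be 0.\<close>
  have D1: "D + 1 > 0" using D[of 0] sqnorm_nonneg[of "weak_laplacian (v 0)"] by linarith
  have Dle: "sqnorm (weak_laplacian (v k)) \<le> D + 1" for k using D[of k] by simp
  have S0: "S \<ge> 0" using S[of 0] sqnorm_nonneg[of "v 0"] by linarith
  note sv = H2_sq_integrable[OF v]
  obtain K where K: "K \<ge> 0" and lev: "\<And>k l. l > 0 \<Longrightarrow> emeasure lborel {x. \<bar>v k x\<bar> > l} \<le> ennreal (K * l powr (- crit_exp DIM('a)))"
    using weak_Sobolev[OF N D1] v Dle by metis
  note B = Lq_layer_bound[OF sv q _ K lev]
  show "v k \<in> Lspace q" by (rule B(1)[of 1]) auto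
  define V where "V k = fourier (v k)" for k
  have F: "is_fourier (v k) (V k)" for k unfolding V_def by (rule is_fourier_fourier[OF sv])
  let ?c = "(2 * pi) powr real DIM('a)"
  have small: "(\<lambda>k. measure lborel {x. \<bar>v k x\<bar> > d}) \<longlonglongrightarrow> 0" if d: "d > 0" for d
  proof (rule LIMSEQ_I)
    fix e :: real assume e: "e > 0"
    \<comment> \<open>Chosen so that the level set bound 4 t^2 (D + 1) / d^2 equals e / 2. The time
      is then fixed, and the sup bound of the heat evolution at this time tends to 0 with
      \<open>k\<close>.\<close>
    define t where "t = sqrt (e * d\<^sup>2 / (8 * (D + 1)))"
    have t: "t > 0" "t\<^sup>2 = e * d\<^sup>2 / (8 * (D + 1))" using e d D1 by (auto simp: t_def)
    have "(\<lambda>k. LINT \<xi>|lborel. exp (- t * (\<xi> \<bullet> \<xi>)) * norm (V k \<xi>)) \<longlonglongrightarrow> 0"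
    proof (rule sphere_concentration_L1[OF is_fourierD(2)[OF F] _ is_fourier_shifted_laplacian(1)[OF v F] _ t(1) m])
      show "sqnorm (V k) \<le> ?c * S" for k unfolding is_fourier_sqnorm[OF F] using S by (intro mult_left_mono) auto
      show "(\<lambda>k. sqnorm (\<lambda>\<xi>. complex_of_real (\<xi> \<bullet> \<xi> - m) * V k \<xi>)) \<longlonglongrightarrow> 0"
        unfolding is_fourier_shifted_laplacian(2)[OF v F] using tendsto_mult_left[OF lim] by simp
    qed
    from tendsto_mult_left[OF this, of "(2 * pi) powr (- real DIM('a))"]
    have "\<forall>\<^sub>F k in sequentially. (2 * pi) powr (- real DIM('a)) * (LINT \<xi>|lborel. exp (- t * (\<xi> \<bullet> \<xi>)) * norm (V k \<xi>)) < d / 2"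
      by (rule order_tendstoD(2)) (use d in simp)
    then obtain k0 where k0: "\<And>k. k \<ge> k0 \<Longrightarrow> (2 * pi) powr (- real DIM('a)) * (LINT \<xi>|lborel. exp (- t * (\<xi> \<bullet> \<xi>)) * norm (V k \<xi>)) < d / 2"
      by (auto simp: eventually_sequentially)
    have "norm (measure lborel {x. \<bar>v k x\<bar> > d} - 0) < e" if k: "k \<ge> k0" for k
    proof -
      have "emeasure lborel {x. \<bar>v k x\<bar> > d} \<le> ennreal (4 * t\<^sup>2 * sqnorm (weak_laplacian (v k)) / d\<^sup>2)"
        by (rule level_set_bound[OF v t(1) d order_trans[OF conv_heat_sup_bound[OF F t(1)] less_imp_le[OF k0[OF k]]]])
      also have "\<dots> \<le> ennreal (e / 2)"
      proof (rule ennreal_leI)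
        have "4 * t\<^sup>2 * sqnorm (weak_laplacian (v k)) / d\<^sup>2 \<le> 4 * t\<^sup>2 * (D + 1) / d\<^sup>2"
          using Dle by (intro divide_right_mono mult_left_mono) auto
        also have "\<dots> = e / 2"
        proof -
          have "4 * (e * d\<^sup>2 / (8 * M)) * M / d\<^sup>2 = e / 2" if "M > 0" for M using d that by simp
          then show ?thesis unfolding t(2) using D1 by blast
        qed
        finally show "4 * t\<^sup>2 * sqnorm (weak_laplacian (v k)) / d\<^sup>2 \<le> e / 2" .
      qed
      finally have "measure lborel {x. \<bar>v k x\<bar> > d} \<le> e / 2"
        unfolding measure_def using e by (intro enn2real_leI) auto
      then show ?thesis using e by simp
    qed
    then show "\<exists>k0. \<forall>k\<ge>k0. norm (measure lborel {x. \<bar>v k x\<bar> > d} - 0) < e" by blast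
  qed
  define z where "z = 2 powr (q - crit_exp DIM('a))"
  have z: "0 < z" "z < 1" using q by (auto simp: z_def powr_less_one)
  define I where "I k = (LINT x|lborel. \<bar>v k x\<bar> powr q)" for k
  have I0: "I k \<ge> 0" for k by (simp add: I_def)
  have "I \<longlonglongrightarrow> 0"
  proof (rule LIMSEQ_I)
    fix e :: real assume e: "e > 0"
    \<comment> \<open>Solves d^(q - 2) (S + 1) = e / 4, which controls the low values for all
      \<open>k\<close>. After \<open>d\<close> the index \<open>J\<close> is fixed for the tail, and
      only then \<open>k\<close> grows for the middle range.\<close>
    define d where "d = (e / (4 * (S + 1))) powr (1 / (q - 2))"
    have d: "d > 0" using e S0 by (simp add: d_def)
    have "d powr (q - 2) = e / (4 * (S + 1))" unfolding d_def powr_powr using q e S0 by simp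
    then have 1: "d powr (q - 2) * sqnorm (v k) < e / 3" for k
    proof -
      have "e / (4 * (S + 1)) * sqnorm (v k) \<le> e / (4 * (S + 1)) * (S + 1)"
        using S[of k] e S0 by (intro mult_left_mono) auto
      also have "\<dots> = e / 4"
      proof -
        have "e / (4 * M) * M = e / 4" if "M > 0" for M using that by simp
        then show ?thesis using S0 by (simp only: add_nonneg_pos zero_less_one)
      qed
      finally show ?thesis using \<open>d powr (q - 2) = e / (4 * (S + 1))\<close> e by simp
    qed
    have "(\<lambda>J. K * 2 powr q * z ^ J / (1 - z)) \<longlonglongrightarrow> K * 2 powr q * 0 / (1 - z)"
      using z by (intro tendsto_intros LIMSEQ_power_zero) auto
    then have "\<forall>\<^sub>F J in sequentially. K * 2 powr q * z ^ J / (1 - z) < e / 3" by (rule order_tendstoD(2)) (use e in simp)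
    then obtain J where J: "K * 2 powr q * z ^ J / (1 - z) < e / 3" by (auto simp: eventually_sequentially)
    have "(\<lambda>k. (2 ^ J) powr q * measure lborel {x. \<bar>v k x\<bar> > d}) \<longlonglongrightarrow> (2 ^ J) powr q * 0" by (intro tendsto_intros small d)
    then have "\<forall>\<^sub>F k in sequentially. (2 ^ J) powr q * measure lborel {x. \<bar>v k x\<bar> > d} < e / 3" by (rule order_tendstoD(2)) (use e in simp)
    then obtain k0 where k0: "\<And>k. k \<ge> k0 \<Longrightarrow> (2 ^ J) powr q * measure lborel {x. \<bar>v k x\<bar> > d} < e / 3"
      by (auto simp: eventually_sequentially)
    have "norm (I k - 0) < e" if "k \<ge> k0" for k
      using B(2)[OF d, of k J] 1[of k] J k0[OF that] I0[of k] unfolding I_def[symmetric] z_def[symmetric] real_norm_def by linarith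
    then show "\<exists>k0. \<forall>k\<ge>k0. norm (I k - 0) < e" by blast
  qed
  then have "(\<lambda>k. I k powr (1 / q)) \<longlonglongrightarrow> 0 powr (1 / q)"
    by (rule tendsto_powr2) (use q I0 in auto)
  then show "(\<lambda>k. Lnorm q (v k)) \<longlonglongrightarrow> 0" by (simp add: Lnorm_def I_def[abs_def])
qed

section \<open>Radial profiles with Gaussian decay\<close>

lemma linear_exp_bound:
  fixes b s :: real
  assumes "b > 0" "s \<ge> 0"
  shows "(1 + s) * exp (- 2 * b * s) \<le> (1 + 1 / b) * exp (- b * s)"
proof -
  have "b * s \<le> exp (b * s)" using exp_ge_add_one_self[of "b * s"] by linarith
  then have "s \<le> exp (b * s) / b" using assms by (simp add: field_simps)
  moreover have "1 \<le> exp (b * s)" using assms by (simp only: one_le_exp_iff) simp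
  ultimately have "1 + s \<le> exp (b * s) + exp (b * s) / b" by linarith
  then have "1 + s \<le> (1 + 1 / b) * exp (b * s)" by (simp add: distrib_right)
  then have "(1 + s) * exp (- 2 * b * s) \<le> ((1 + 1 / b) * exp (b * s)) * exp (- 2 * b * s)" by (rule mult_right_mono) simp
  also have "\<dots> = (1 + 1 / b) * exp (- b * s)" by (simp add: mult.assoc flip: exp_add)
  finally show ?thesis .
qed

text \<open>The profile depends on s = |x|^2 rather than on |x|, so that the composition is
  classically twice differentiable across the origin. The weights 1 + s in the hypotheses absorb the
  factors x_i and x_i x_j that the chain rule produces.\<close>

lemma radial_profile_H2:
  fixes G G1 G2 :: "real \<Rightarrow> real"
  assumes d1: "\<And>s. s \<ge> 0 \<Longrightarrow> (G has_real_derivative G1 s) (at s)"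
    and d2: "\<And>s. s \<ge> 0 \<Longrightarrow> (G1 has_real_derivative G2 s) (at s)"
    and c2: "continuous_on {0..} G2"
    and b: "b > 0" "\<And>s. s \<ge> 0 \<Longrightarrow> \<bar>G s\<bar> \<le> B * exp (- b * s)"
      "\<And>s. s \<ge> 0 \<Longrightarrow> (1 + s) * \<bar>G1 s\<bar> \<le> B * exp (- b * s)" "\<And>s. s \<ge> 0 \<Longrightarrow> (1 + s) * \<bar>G2 s\<bar> \<le> B * exp (- b * s)"
  shows "(\<lambda>x::'a::euclidean_space. G (x \<bullet> x)) \<in> H2_rad"
    "AE x::'a in lborel. weak_laplacian (\<lambda>x. G (x \<bullet> x)) x = 4 * (x \<bullet> x) * G2 (x \<bullet> x) + 2 * real DIM('a) * G1 (x \<bullet> x)"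
proof -
  have sq: "((\<lambda>x::'a. x \<bullet> x) has_derivative (\<lambda>h. 2 * (x \<bullet> h))) (at x)" for x
    by (auto intro!: derivative_eq_intros simp: inner_commute)
  have D1: "((\<lambda>x. G (x \<bullet> x)) has_derivative (\<lambda>h. G1 (x \<bullet> x) * (2 * (x \<bullet> h)))) (at x)" for x :: 'a
    by (rule has_derivative_compose_real[OF sq d1]) simp
  have D2': "((\<lambda>x. G1 (x \<bullet> x)) has_derivative (\<lambda>h. G2 (x \<bullet> x) * (2 * (x \<bullet> h)))) (at x)" for x :: 'a
    by (rule has_derivative_compose_real[OF sq d2]) simp
  have li: "((\<lambda>x::'a. 2 * (x \<bullet> i)) has_derivative (\<lambda>h. 2 * (h \<bullet> i))) (at x)" for i x
    by (auto intro!: derivative_eq_intros)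
  have D2: "((\<lambda>x. G1 (x \<bullet> x) * (2 * (x \<bullet> i))) has_derivative
     (\<lambda>h. G1 (x \<bullet> x) * (2 * (h \<bullet> i)) + G2 (x \<bullet> x) * (2 * (x \<bullet> h)) * (2 * (x \<bullet> i)))) (at x)" for x i :: 'a
    by (rule has_derivative_mult[OF D2' li])
  have cx: "continuous_on UNIV (\<lambda>x::'a. x \<bullet> x)" by (intro continuous_intros)
  have cG: "continuous_on UNIV (\<lambda>x::'a. G (x \<bullet> x))"
    using D1 by (auto intro!: continuous_at_imp_continuous_on has_derivative_continuous)
  have cG1: "continuous_on UNIV (\<lambda>x::'a. G1 (x \<bullet> x))"
    using D2' by (auto intro!: continuous_at_imp_continuous_on has_derivative_continuous)
  have cG2: "continuous_on UNIV (\<lambda>x::'a. G2 (x \<bullet> x))"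
    by (rule continuous_on_compose2[OF c2 cx]) auto
  have B: "B \<ge> 0" using order_trans[OF abs_ge_zero b(2)[of 0]] by simp
  have dom: "sq_integrable f" if "continuous_on UNIV f" "\<And>x. \<bar>f x\<bar> \<le> C * (B * exp (- b * (x \<bullet> x)))" for f :: "'a \<Rightarrow> real" and C
  proof (rule sq_integrable_dominated[OF sq_integrable_cmult[OF sq_integrable_gaussian[OF b(1)], of "C * B"]])
    show "f \<in> borel_measurable borel" using that(1) by (rule borel_measurable_continuous_onI)
    show "AE x in lborel. norm (f x) \<le> norm (C * B * exp (- b * (x \<bullet> x)))"
      using order_trans[OF that(2) abs_ge_self] by (intro AE_I2) (simp only: real_norm_def mult.assoc)
  qed
  have s1: "\<bar>x \<bullet> i\<bar> \<le> 1 + x \<bullet> x" "\<bar>(x \<bullet> j) * (x \<bullet> i)\<bar> \<le> 1 + x \<bullet> x" if "i \<in> Basis" "j \<in> Basis" for x i j :: 'a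
  proof -
    have n: "\<bar>x \<bullet> i\<bar> \<le> norm x" "\<bar>x \<bullet> j\<bar> \<le> norm x" using that by (auto intro: Basis_le_norm)
    have "norm x \<le> 1 + (norm x)\<^sup>2" using sum_squares_bound[of "norm x" 1] norm_ge_zero[of x] unfolding power_one mult_1_right by linarith
    then show "\<bar>x \<bullet> i\<bar> \<le> 1 + x \<bullet> x" using n by (simp add: power2_norm_eq_inner)
    have "\<bar>(x \<bullet> j) * (x \<bullet> i)\<bar> \<le> norm x * norm x" unfolding abs_mult using n by (intro mult_mono) auto
    then show "\<bar>(x \<bullet> j) * (x \<bullet> i)\<bar> \<le> 1 + x \<bullet> x" by (simp add: power2_norm_eq_inner[symmetric] power2_eq_square)
  qed
  note hw = has_weak_partial_classical
  have p1: "has_weak_partial (\<lambda>x. G (x \<bullet> x)) i (\<lambda>x. G1 (x \<bullet> x) * (2 * (x \<bullet> i)))" if "i \<in> Basis" for i :: 'a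
    by (rule hw[OF that D1]) (intro continuous_intros cG1)
  have p2: "has_weak_partial (\<lambda>x. G1 (x \<bullet> x) * (2 * (x \<bullet> i))) j (\<lambda>x. G1 (x \<bullet> x) * (2 * (j \<bullet> i)) + G2 (x \<bullet> x) * (2 * (x \<bullet> j)) * (2 * (x \<bullet> i)))"
    if "j \<in> Basis" for i j :: 'a
    by (rule hw[OF that D2]) (intro continuous_intros cG1 cG2)
  have q0: "sq_integrable (\<lambda>x::'a. G (x \<bullet> x))" by (rule dom[OF cG, of 1]) (use b(2) in simp)
  have q1: "sq_integrable (\<lambda>x. G1 (x \<bullet> x) * (2 * (x \<bullet> i)))" if i: "i \<in> Basis" for i :: 'a
  proof (rule dom[of _ 2])
    show "continuous_on UNIV (\<lambda>x. G1 (x \<bullet> x) * (2 * (x \<bullet> i)))" by (intro continuous_intros cG1)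
    fix x :: 'a
    have "\<bar>G1 (x \<bullet> x)\<bar> * \<bar>x \<bullet> i\<bar> \<le> \<bar>G1 (x \<bullet> x)\<bar> * (1 + x \<bullet> x)" by (rule mult_left_mono[OF s1(1)[OF i i]]) simp
    with b(3)[of "x \<bullet> x"] show "\<bar>G1 (x \<bullet> x) * (2 * (x \<bullet> i))\<bar> \<le> 2 * (B * exp (- b * (x \<bullet> x)))"
      by (simp add: abs_mult mult.commute)
  qed
  have q2: "sq_integrable (\<lambda>x. G1 (x \<bullet> x) * (2 * (j \<bullet> i)) + G2 (x \<bullet> x) * (2 * (x \<bullet> j)) * (2 * (x \<bullet> i)))"
    if i: "i \<in> Basis" and j: "j \<in> Basis" for i j :: 'a
  proof (rule dom[of _ 6])
    show "continuous_on UNIV (\<lambda>x. G1 (x \<bullet> x) * (2 * (j \<bullet> i)) + G2 (x \<bullet> x) * (2 * (x \<bullet> j)) * (2 * (x \<bullet> i)))"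
      by (intro continuous_intros cG1 cG2)
    fix x :: 'a
    have "\<bar>j \<bullet> i\<bar> \<le> 1" using i j by (simp add: inner_Basis)
    then have "\<bar>G1 (x \<bullet> x)\<bar> * \<bar>j \<bullet> i\<bar> \<le> \<bar>G1 (x \<bullet> x)\<bar> * (1 + x \<bullet> x)"
      by (intro mult_left_mono) (auto intro: order_trans)
    then have 1: "\<bar>G1 (x \<bullet> x) * (j \<bullet> i)\<bar> \<le> B * exp (- b * (x \<bullet> x))"
      using b(3)[of "x \<bullet> x"] by (simp add: abs_mult mult.commute)
    have "\<bar>G2 (x \<bullet> x)\<bar> * \<bar>(x \<bullet> j) * (x \<bullet> i)\<bar> \<le> \<bar>G2 (x \<bullet> x)\<bar> * (1 + x \<bullet> x)" by (rule mult_left_mono[OF s1(2)[OF i j]]) simp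
    then have 2: "\<bar>G2 (x \<bullet> x) * ((x \<bullet> j) * (x \<bullet> i))\<bar> \<le> B * exp (- b * (x \<bullet> x))"
      using b(4)[of "x \<bullet> x"] by (simp add: abs_mult mult.commute)
    have "G1 (x \<bullet> x) * (2 * (j \<bullet> i)) + G2 (x \<bullet> x) * (2 * (x \<bullet> j)) * (2 * (x \<bullet> i))
       = 2 * (G1 (x \<bullet> x) * (j \<bullet> i)) + 4 * (G2 (x \<bullet> x) * ((x \<bullet> j) * (x \<bullet> i)))" by simp
    with 1 2 show "\<bar>G1 (x \<bullet> x) * (2 * (j \<bullet> i)) + G2 (x \<bullet> x) * (2 * (x \<bullet> j)) * (2 * (x \<bullet> i))\<bar> \<le> 6 * (B * exp (- b * (x \<bullet> x)))"
      by linarith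
  qed
  have "(\<lambda>x::'a. G (x \<bullet> x)) \<in> H2" by (rule H2I[OF q0 q1 p1 q2 p2])
  moreover have "\<exists>f. AE x::'a in lborel. G (x \<bullet> x) = f (norm x)"
    by (rule exI[of _ "\<lambda>r. G (r\<^sup>2)"]) (simp add: power2_norm_eq_inner)
  ultimately show "(\<lambda>x::'a. G (x \<bullet> x)) \<in> H2_rad" by (simp add: H2_rad_def)
  have "AE x::'a in lborel. weak_laplacian (\<lambda>x. G (x \<bullet> x)) x
      = (\<Sum>i\<in>Basis. G1 (x \<bullet> x) * (2 * (i \<bullet> i)) + G2 (x \<bullet> x) * (2 * (x \<bullet> i)) * (2 * (x \<bullet> i)))"
    by (rule weak_laplacian_eq_AE(2)[OF p1 p2])
  moreover have "(\<Sum>i\<in>Basis. G1 (x \<bullet> x) * (2 * (i \<bullet> i)) + G2 (x \<bullet> x) * (2 * (x \<bullet> i)) * (2 * (x \<bullet> i)))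
     = 4 * (x \<bullet> x) * G2 (x \<bullet> x) + 2 * real DIM('a) * G1 (x \<bullet> x)" for x :: 'a
  proof -
    have "(\<Sum>i\<in>Basis. G1 (x \<bullet> x) * (2 * (i \<bullet> i)) + G2 (x \<bullet> x) * (2 * (x \<bullet> i)) * (2 * (x \<bullet> i)))
      = (\<Sum>i\<in>(Basis::'a set). 2 * G1 (x \<bullet> x)) + 4 * G2 (x \<bullet> x) * (\<Sum>i\<in>Basis. (x \<bullet> i) * (x \<bullet> i))"
      unfolding sum_distrib_left sum.distrib[symmetric] by (intro sum.cong refl) (simp add: inner_Basis)
    also have "(\<Sum>i\<in>Basis. (x \<bullet> i) * (x \<bullet> i)) = x \<bullet> x" by (rule euclidean_inner[symmetric])
    finally show ?thesis by simp
  qed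
  ultimately show "AE x::'a in lborel. weak_laplacian (\<lambda>x. G (x \<bullet> x)) x = 4 * (x \<bullet> x) * G2 (x \<bullet> x) + 2 * real DIM('a) * G1 (x \<bullet> x)"
    by simp
qed

text \<open>The classical Laplacian of the heat kernel as an everywhere defined function. The
  representative \<open>weak_laplacian (heat t)\<close> agrees with it only a.e. and could not serve
  as a convolution kernel that is bounded and rotation invariant at every point.\<close>

definition heat_laplacian :: "real \<Rightarrow> 'a::euclidean_space \<Rightarrow> real" where
  "heat_laplacian t x = ((x \<bullet> x) / (4 * t\<^sup>2) - real DIM('a) / (2 * t)) * heat t x"

lemma heat_H2:
  assumes t: "t > 0"
  shows "(heat t :: 'a::euclidean_space \<Rightarrow> real) \<in> H2"
    "AE x::'a in lborel. weak_laplacian (heat t) x = heat_laplacian t x" "kernel (heat_laplacian t :: 'a \<Rightarrow> real)"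
proof -
  define k where "k = 1 / (4 * t)"
  define A where "A = (4 * pi * t) powr (- real DIM('a) / 2)"
  have k: "k > 0" and A: "A > 0" using t by (auto simp: k_def A_def)
  have h: "heat t = (\<lambda>x::'a. A * exp (- k * (x \<bullet> x)))" unfolding heat_def k_def A_def ..
  \<comment> \<open>The derivatives of the profile in \<open>s\<close> carry the factors
    \<open>k\<close> and k^2; 1 + 2 / k is the price of absorbing 1 + s into half of the
    exponent.\<close>
  define B where "B = A * (1 + k + k\<^sup>2) * (1 + 2 / k)"
  have le1: "(1 + s) * exp (- k * s) \<le> (1 + 2 / k) * exp (- (k / 2) * s)" if "s \<ge> 0" for s
    using linear_exp_bound[of "k / 2" s] k that by simp
  have bnd: "(1 + s) * \<bar>c * A * exp (- k * s)\<bar> \<le> B * exp (- (k / 2) * s)" if s: "s \<ge> 0" and c: "\<bar>c\<bar> \<le> 1 + k + k\<^sup>2" for s c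
  proof -
    have "(1 + s) * \<bar>c * A * exp (- k * s)\<bar> = \<bar>c\<bar> * (A * ((1 + s) * exp (- k * s)))" using A by (simp add: abs_mult)
    also have "\<dots> \<le> (1 + k + k\<^sup>2) * (A * ((1 + 2 / k) * exp (- (k / 2) * s)))"
      using c A s k by (intro mult_mono mult_left_mono le1 order_refl) auto
    finally show ?thesis by (simp add: B_def mult_ac)
  qed
  note R = radial_profile_H2[where G = "\<lambda>s. A * exp (- k * s)" and ?G1.0 = "\<lambda>s. - k * A * exp (- k * s)" and ?G2.0 = "\<lambda>s. k\<^sup>2 * A * exp (- k * s)" and b = "k / 2" and B = B]
  have d1: "((\<lambda>s. A * exp (- k * s)) has_real_derivative - k * A * exp (- k * s)) (at s)" for s
    by (auto intro!: derivative_eq_intros)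
  have d2: "((\<lambda>s. - k * A * exp (- k * s)) has_real_derivative k\<^sup>2 * A * exp (- k * s)) (at s)" for s
    by (auto intro!: derivative_eq_intros simp: power2_eq_square)
  have b0: "\<bar>A * exp (- k * s)\<bar> \<le> B * exp (- (k / 2) * s)" if s: "s \<ge> 0" for s
  proof -
    have "1 * \<bar>A * exp (- k * s)\<bar> \<le> (1 + s) * \<bar>A * exp (- k * s)\<bar>" using s by (intro mult_right_mono) auto
    also have "\<dots> \<le> B * exp (- (k / 2) * s)" using bnd[OF s, of 1] k by simp
    finally show ?thesis by simp
  qed
  have b1: "(1 + s) * \<bar>- k * A * exp (- k * s)\<bar> \<le> B * exp (- (k / 2) * s)" if "s \<ge> 0" for s
    by (rule bnd[OF that]) (use k in simp)
  have b2: "(1 + s) * \<bar>k\<^sup>2 * A * exp (- k * s)\<bar> \<le> B * exp (- (k / 2) * s)" if "s \<ge> 0" for s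
    by (rule bnd[OF that]) (use k in simp)
  note R' = R[OF d1 d2 _ _ b0 b1 b2, where 'a='a]
  have c: "continuous_on {0..} (\<lambda>s. k\<^sup>2 * A * exp (- k * s))" by (intro continuous_intros)
  show "(heat t :: 'a \<Rightarrow> real) \<in> H2" using R'(1)[OF c] k unfolding h H2_rad_def by simp
  have e: "4 * (x \<bullet> x) * (k\<^sup>2 * A * exp (- k * (x \<bullet> x))) + 2 * real DIM('a) * (- k * A * exp (- k * (x \<bullet> x))) = heat_laplacian t x" for x :: 'a
    unfolding heat_laplacian_def h k_def using t by (simp add: field_simps power2_eq_square)
  show "AE x::'a in lborel. weak_laplacian (heat t) x = heat_laplacian t x"
    using R'(2)[OF c] k unfolding e h by simp
  have [measurable]: "heat_laplacian t \<in> borel_measurable (borel :: 'a measure)" unfolding heat_laplacian_def by measurable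
  have hb: "\<bar>heat_laplacian t x\<bar> \<le> (4 + 2 * real DIM('a)) * B * exp (- (k / 2) * (x \<bullet> x))" for x :: 'a
  proof -
    have x: "x \<bullet> x \<ge> 0" by simp
    have E1: "(x \<bullet> x) * \<bar>k\<^sup>2 * A * exp (- k * (x \<bullet> x))\<bar> \<le> (1 + x \<bullet> x) * \<bar>k\<^sup>2 * A * exp (- k * (x \<bullet> x))\<bar>"
      by (intro mult_right_mono) auto
    have E2: "1 * \<bar>- k * A * exp (- k * (x \<bullet> x))\<bar> \<le> (1 + x \<bullet> x) * \<bar>- k * A * exp (- k * (x \<bullet> x))\<bar>"
      by (intro mult_right_mono) auto
    have "\<bar>heat_laplacian t x\<bar> \<le> 4 * ((x \<bullet> x) * \<bar>k\<^sup>2 * A * exp (- k * (x \<bullet> x))\<bar>) + 2 * real DIM('a) * \<bar>- k * A * exp (- k * (x \<bullet> x))\<bar>"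
      unfolding e[symmetric] by (rule order_trans[OF abs_triangle_ineq]) (simp add: abs_mult)
    also have "\<dots> \<le> 4 * (B * exp (- (k / 2) * (x \<bullet> x))) + 2 * real DIM('a) * (B * exp (- (k / 2) * (x \<bullet> x)))"
      using order_trans[OF E1 b2[OF x]] order_trans[OF E2 b1[OF x]] by (intro add_mono mult_left_mono) auto
    finally show ?thesis by (simp add: algebra_simps)
  qed
  have B: "B \<ge> 0" using A k by (simp add: B_def)
  have "integrable lborel (heat_laplacian t :: 'a \<Rightarrow> real)"
  proof (rule Bochner_Integration.integrable_bound)
    show "integrable lborel (\<lambda>x::'a. (4 + 2 * real DIM('a)) * B * exp (- (k / 2) * (x \<bullet> x)))"
      by (rule integrable_mult_right[OF gaussian_fourier(1)]) (use k in simp)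
    show "AE x::'a in lborel. norm (heat_laplacian t x) \<le> norm ((4 + 2 * real DIM('a)) * B * exp (- (k / 2) * (x \<bullet> x)))"
      using order_trans[OF hb abs_ge_self] by (intro AE_I2) (simp only: real_norm_def)
  qed measurable
  moreover have "\<bar>heat_laplacian t x\<bar> \<le> (4 + 2 * real DIM('a)) * B" for x :: 'a
  proof -
    have "exp (- (k / 2) * (x \<bullet> x)) \<le> 1" using k by simp
    then have "(4 + 2 * real DIM('a)) * B * exp (- (k / 2) * (x \<bullet> x)) \<le> (4 + 2 * real DIM('a)) * B * 1"
      using B by (intro mult_left_mono) auto
    with hb[of x] show ?thesis by linarith
  qed
  ultimately show "kernel (heat_laplacian t :: 'a \<Rightarrow> real)" unfolding kernel_def by blast
qed

section \<open>Radial functions concentrating on a frequency sphere\<close>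

text \<open>Far from the origin cos (r |x| + \<theta>) is an eigenfunction of the negative Laplacian
  with eigenvalue r^2 up to O(1 / |x|), and a Gaussian envelope of width \<open>R\<close> adds
  errors of size O(1 / R). Replacing |x| by sqrt (1 + |x|^2) keeps the profile smooth at 0. The
  pointwise bound displays these two kinds of error, with one constant that adds up all
  coefficients.\<close>

lemma oscillating_profile:
  fixes R r \<theta> :: real
  assumes R: "R \<ge> 1" and r: "r > 0"
  defines "u \<equiv> \<lambda>x::'a::euclidean_space. exp (- (x \<bullet> x) / R\<^sup>2) * cos (r * sqrt (1 + x \<bullet> x) + \<theta>)"
  shows "u \<in> H2_rad"
    "AE x in lborel. \<bar>weak_laplacian u x + r\<^sup>2 * u x\<bar> \<le> (4 + 4 * r + 2 * real DIM('a) + r\<^sup>2 + r + real DIM('a) * r) *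
        (exp (- (x \<bullet> x) / R\<^sup>2) * (((x \<bullet> x) / R\<^sup>2 + sqrt (x \<bullet> x) / R + 1) / R + 1 / sqrt (1 + x \<bullet> x)))"
proof -
  define E where "E s = exp (- s / R\<^sup>2)" for s
  define q where "q s = sqrt (1 + s)" for s :: real
  define c where "c s = cos (r * q s + \<theta>)" for s
  define sn where "sn s = sin (r * q s + \<theta>)" for s
  define G1 where "G1 s = E s * (- c s / R\<^sup>2 - sn s * r / (2 * q s))" for s
  define G2 where "G2 s = E s * (c s / R ^ 4 + sn s * r / (q s * R\<^sup>2) - c s * r\<^sup>2 / (4 * (q s)\<^sup>2) + sn s * r / (4 * q s ^ 3))" for s
  have q: "q s \<ge> 1" "(q s)\<^sup>2 = 1 + s" if "s \<ge> 0" for s using that by (auto simp: q_def)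
  have dq: "(q has_real_derivative 1 / (2 * q s)) (at s)" if "s \<ge> 0" for s
    unfolding q_def[abs_def] using that by (auto intro!: derivative_eq_intros simp: field_simps)
  have dE: "(E has_real_derivative - E s / R\<^sup>2) (at s)" for s
    unfolding E_def[abs_def]
    by (rule DERIV_cong[OF DERIV_fun_exp[OF DERIV_cdivide[OF DERIV_minus[OF DERIV_ident]]]]) simp
  have dc: "(c has_real_derivative - sn s * r / (2 * q s)) (at s)" if "s \<ge> 0" for s
    unfolding c_def[abs_def] sn_def using dq[OF that] by (auto intro!: derivative_eq_intros)
  have dsn: "(sn has_real_derivative c s * r / (2 * q s)) (at s)" if "s \<ge> 0" for s
    unfolding sn_def[abs_def] c_def using dq[OF that] by (auto intro!: derivative_eq_intros)
  have d1: "((\<lambda>s. E s * c s) has_real_derivative G1 s) (at s)" if s: "s \<ge> 0" for s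
    by (rule DERIV_cong[OF DERIV_mult[OF dE dc[OF s]]]) (simp add: G1_def algebra_simps)
  have d2: "(G1 has_real_derivative G2 s) (at s)" if s: "s \<ge> 0" for s
  proof -
    have q0: "q s \<noteq> 0" "2 * q s \<noteq> 0" using q(1)[OF s] by auto
    have a: "((\<lambda>s. - c s / R\<^sup>2) has_real_derivative sn s * r / (2 * q s) / R\<^sup>2) (at s)"
      by (rule DERIV_cong[OF DERIV_cdivide[OF DERIV_minus[OF dc[OF s]]]]) simp
    have b: "((\<lambda>s. sn s * r / (2 * q s)) has_real_derivative c s * r\<^sup>2 / (4 * (q s)\<^sup>2) - sn s * r / (4 * q s ^ 3)) (at s)"
      by (rule DERIV_cong[OF DERIV_divide[OF DERIV_cmult_right[OF dsn[OF s]] DERIV_cmult[OF dq[OF s]] q0(2)]])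
         (use q0 in \<open>simp add: field_simps eval_nat_numeral\<close>)
    show ?thesis unfolding G1_def[abs_def]
      by (rule DERIV_cong[OF DERIV_mult[OF dE DERIV_diff[OF a b]]])
         (use q0 R in \<open>simp add: G2_def field_simps eval_nat_numeral\<close>)
  qed
  have contG2: "continuous_on {0..} G2"
  proof -
    have "continuous_on {0..} q" "continuous_on {0..} E" "continuous_on {0..} c" "continuous_on {0..} sn"
      unfolding q_def[abs_def] E_def[abs_def] c_def[abs_def] sn_def[abs_def] using R by (auto intro!: continuous_intros)
    then show ?thesis unfolding G2_def[abs_def] using q(1) R by (intro continuous_intros) (auto, force+)
  qed
  have cs: "\<bar>c s\<bar> \<le> 1" "\<bar>sn s\<bar> \<le> 1" for s by (auto simp: c_def sn_def)
  have E0: "E s > 0" for s by (simp add: E_def)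
  have R1: "R\<^sup>2 \<ge> 1" "R ^ 4 \<ge> 1" using R by (auto intro: one_le_power)
  have div1: "\<bar>x / y\<bar> \<le> \<bar>x\<bar>" if "y \<ge> 1" for x y :: real
    using that by (simp add: abs_divide divide_le_eq mult_le_cancel_left1)
  have sr: "\<bar>sn s * r\<bar> \<le> r" and cr: "\<bar>c s * r\<^sup>2\<bar> \<le> r\<^sup>2" for s
    using cs[of s] r by (auto simp: abs_mult mult_left_le_one_le)
  define M where "M = 1 + 2 * r + r\<^sup>2"
  have M: "M \<ge> 1" using r by (simp add: M_def)
  have bb1: "\<bar>- c s / R\<^sup>2 - sn s * r / (2 * q s)\<bar> \<le> M" if s: "s \<ge> 0" for s
  proof -
    have "\<bar>- c s / R\<^sup>2\<bar> \<le> 1" using div1[OF R1(1), of "- c s"] cs(1)[of s] by simp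
    moreover have "\<bar>sn s * r / (2 * q s)\<bar> \<le> r"
      by (rule order_trans[OF div1 sr]) (use q(1)[OF s] in simp)
    ultimately show ?thesis using r zero_le_power2[of r] unfolding M_def by linarith
  qed
  have bb2: "\<bar>c s / R ^ 4 + sn s * r / (q s * R\<^sup>2) - c s * r\<^sup>2 / (4 * (q s)\<^sup>2) + sn s * r / (4 * q s ^ 3)\<bar> \<le> M" if s: "s \<ge> 0" for s
  proof -
    note q1 = q(1)[OF s]
    have 1: "\<bar>c s / R ^ 4\<bar> \<le> 1" using div1[OF R1(2), of "c s"] cs(1)[of s] by simp
    have "1 \<le> q s * R\<^sup>2" using mult_mono[OF q1 R1(1)] q1 by simp
    from order_trans[OF div1[OF this] sr] have 2: "\<bar>sn s * r / (q s * R\<^sup>2)\<bar> \<le> r" .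
    have "1 \<le> 4 * (q s)\<^sup>2" using one_le_power[OF q1, of 2] by simp
    from order_trans[OF div1[OF this] cr] have 3: "\<bar>c s * r\<^sup>2 / (4 * (q s)\<^sup>2)\<bar> \<le> r\<^sup>2" .
    have "1 \<le> 4 * q s ^ 3" using one_le_power[OF q1, of 3] by simp
    from order_trans[OF div1[OF this] sr] have 4: "\<bar>sn s * r / (4 * q s ^ 3)\<bar> \<le> r" .
    from 1 2 3 4 show ?thesis unfolding M_def by linarith
  qed
  \<comment> \<open>Half of the Gaussian rate 1 / R^2; the other half absorbs the factor 1 +
    s.\<close>
  define b where "b = 1 / (2 * R\<^sup>2)"
  have b: "b > 0" using R by (simp add: b_def)
  have Eb: "E s = exp (- 2 * b * s)" for s using R by (simp add: E_def b_def)
  have bnd: "(1 + s) * \<bar>E s * y\<bar> \<le> (M * (1 + 1 / b)) * exp (- b * s)" if s: "s \<ge> 0" and y: "\<bar>y\<bar> \<le> M" for s y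
  proof -
    have "(1 + s) * \<bar>E s * y\<bar> = ((1 + s) * E s) * \<bar>y\<bar>" using E0[of s] by (simp add: abs_mult)
    also have "\<dots> \<le> ((1 + 1 / b) * exp (- b * s)) * M"
      unfolding Eb using y M b s by (intro mult_mono linear_exp_bound) auto
    finally show ?thesis by (simp only: mult_ac)
  qed
  have b0: "\<bar>E s * c s\<bar> \<le> (M * (1 + 1 / b)) * exp (- b * s)" if s: "s \<ge> 0" for s
  proof -
    have "1 * \<bar>E s * c s\<bar> \<le> (1 + s) * \<bar>E s * c s\<bar>" using s by (intro mult_right_mono) auto
    also have "\<dots> \<le> (M * (1 + 1 / b)) * exp (- b * s)" using cs(1)[of s] M by (intro bnd s) linarith
    finally show ?thesis by simp
  qed
  have b1: "(1 + s) * \<bar>G1 s\<bar> \<le> (M * (1 + 1 / b)) * exp (- b * s)" if "s \<ge> 0" for s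
    unfolding G1_def by (intro bnd bb1 that)
  have b2: "(1 + s) * \<bar>G2 s\<bar> \<le> (M * (1 + 1 / b)) * exp (- b * s)" if "s \<ge> 0" for s
    unfolding G2_def by (intro bnd bb2 that)
  have u: "u = (\<lambda>x. E (x \<bullet> x) * c (x \<bullet> x))" unfolding u_def E_def c_def q_def by simp
  note P = radial_profile_H2[OF d1 d2 contG2 b b0 b1 b2, where 'a='a]
  show "u \<in> H2_rad" unfolding u by (rule P(1))
  let ?n = "real DIM('a)"
  let ?K = "4 + 4 * r + 2 * ?n + r\<^sup>2 + r + ?n * r"
  have main: "\<bar>4 * s * G2 s + 2 * ?n * G1 s + r\<^sup>2 * (E s * c s)\<bar> \<le> ?K * (E s * ((s / R\<^sup>2 + sqrt s / R + 1) / R + 1 / q s))"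
    if s: "s \<ge> 0" for s
  proof -
    note q1 = q(1)[OF s]
    have q0: "q s > 0" using q1 by simp
    define T where "T = 4 * s * c s / R ^ 4 + 4 * s * sn s * r / (q s * R\<^sup>2) + r\<^sup>2 * c s / (q s)\<^sup>2 + s * sn s * r / q s ^ 3 - 2 * ?n * c s / R\<^sup>2 - ?n * sn s * r / q s"
    \<comment> \<open>The one contribution of order 1: as q^2 = 1 + s, the second derivative of the
      cosine cancels r^2 c up to r^2 c / q^2. What is left over, \<open>T\<close>, consists of small
      terms only.\<close>
    have "r\<^sup>2 * c s - 4 * s * (c s * r\<^sup>2 / (4 * (q s)\<^sup>2)) = r\<^sup>2 * c s / (q s)\<^sup>2"
    proof -
      have "r\<^sup>2 * C - 4 * s * (C * r\<^sup>2 / (4 * (1 + s))) = r\<^sup>2 * C / (1 + s)" for C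
        using s by (simp add: field_simps)
      then show ?thesis unfolding q(2)[OF s] .
    qed
    then have "r\<^sup>2 * c s = r\<^sup>2 * c s / (q s)\<^sup>2 + 4 * s * (c s * r\<^sup>2 / (4 * (q s)\<^sup>2))" by linarith
    then have "4 * s * (c s / R ^ 4 + sn s * r / (q s * R\<^sup>2) - c s * r\<^sup>2 / (4 * (q s)\<^sup>2) + sn s * r / (4 * q s ^ 3))
        + 2 * ?n * (- c s / R\<^sup>2 - sn s * r / (2 * q s)) + r\<^sup>2 * c s = T"
      unfolding T_def by (simp add: algebra_simps)
    moreover have "4 * s * (E s * X) + 2 * ?n * (E s * Y) + r\<^sup>2 * (E s * c s) = E s * (4 * s * X + 2 * ?n * Y + r\<^sup>2 * c s)" for X Y
      by (simp add: algebra_simps)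
    ultimately have eq: "4 * s * G2 s + 2 * ?n * G1 s + r\<^sup>2 * (E s * c s) = E s * T"
      unfolding G1_def G2_def by simp
    have sq: "sqrt s \<le> q s" "s = (sqrt s)\<^sup>2" using s by (auto simp: q_def)
    have bd: "\<bar>x * y\<bar> \<le> x" if "\<bar>y\<bar> \<le> 1" "x \<ge> 0" for x y :: real
      using mult_left_mono[OF that] that(2) by (simp add: abs_mult)
    define X where "X = s / R\<^sup>2" define Y where "Y = sqrt s / R"
    have XY: "X \<ge> 0" "Y \<ge> 0" using s R by (auto simp: X_def Y_def)
    have R2: "R \<le> R\<^sup>2" using R by (simp add: power2_eq_square)
    have t1: "\<bar>4 * s * c s / R ^ 4\<bar> \<le> 4 * (X / R)"
    proof -
      have "\<bar>4 * s * c s / R ^ 4\<bar> = \<bar>(4 * s / R ^ 4) * c s\<bar>" by simp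
      also have "\<dots> \<le> 4 * s / R ^ 4" using s cs by (intro bd) auto
      also have "\<dots> = 4 * (X / R\<^sup>2)" by (simp add: X_def eval_nat_numeral)
      also have "\<dots> \<le> 4 * (X / R)" using R2 R XY by (intro mult_left_mono divide_left_mono) auto
      finally show ?thesis .
    qed
    have t2: "\<bar>4 * s * sn s * r / (q s * R\<^sup>2)\<bar> \<le> 4 * r * (Y / R)"
    proof -
      have "\<bar>4 * s * sn s * r / (q s * R\<^sup>2)\<bar> = \<bar>(4 * s * r / (q s * R\<^sup>2)) * sn s\<bar>" by (simp add: mult_ac)
      also have "\<dots> \<le> 4 * s * r / (q s * R\<^sup>2)" using s r q0 cs by (intro bd) auto
      also have "\<dots> = 4 * r * ((s / q s) / R\<^sup>2)" by simp
      also have "\<dots> \<le> 4 * r * (sqrt s / R\<^sup>2)"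
      proof (intro mult_left_mono divide_right_mono)
        have "s = sqrt s * sqrt s" using s by simp
        also have "\<dots> \<le> sqrt s * q s" using sq s by (intro mult_left_mono) auto
        finally show "s / q s \<le> sqrt s" using q0 by (simp add: divide_le_eq)
      qed (use r in auto)
      finally show ?thesis by (simp add: Y_def power2_eq_square)
    qed
    have t3: "\<bar>r\<^sup>2 * c s / (q s)\<^sup>2\<bar> \<le> r\<^sup>2 * (1 / q s)"
    proof -
      have "\<bar>r\<^sup>2 * c s / (q s)\<^sup>2\<bar> = \<bar>(r\<^sup>2 / (q s)\<^sup>2) * c s\<bar>" by (simp add: mult_ac)
      also have "\<dots> \<le> r\<^sup>2 / (q s)\<^sup>2" using cs by (intro bd) auto
      also have "\<dots> \<le> r\<^sup>2 / q s" using q1 by (intro divide_left_mono) (auto simp: power2_eq_square)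
      finally show ?thesis by simp
    qed
    have t4: "\<bar>s * sn s * r / q s ^ 3\<bar> \<le> r * (1 / q s)"
    proof -
      have "\<bar>s * sn s * r / q s ^ 3\<bar> = \<bar>(s * r / q s ^ 3) * sn s\<bar>" by (simp add: mult_ac)
      also have "\<dots> \<le> s * r / q s ^ 3" using s r q0 cs by (intro bd) auto
      also have "\<dots> \<le> (q s)\<^sup>2 * r / q s ^ 3" using q(2)[OF s] r q0 by (intro divide_right_mono mult_right_mono) auto
      also have "\<dots> = r * (1 / q s)" using q0 by (simp add: eval_nat_numeral)
      finally show ?thesis .
    qed
    have t5: "\<bar>2 * ?n * c s / R\<^sup>2\<bar> \<le> 2 * ?n * (1 / R)"
    proof -
      have "\<bar>2 * ?n * c s / R\<^sup>2\<bar> = \<bar>(2 * ?n / R\<^sup>2) * c s\<bar>" by simp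
      also have "\<dots> \<le> 2 * ?n / R\<^sup>2" using cs by (intro bd) auto
      also have "\<dots> \<le> 2 * ?n / R" using R2 R by (intro divide_left_mono) auto
      finally show ?thesis by simp
    qed
    have t6: "\<bar>?n * sn s * r / q s\<bar> \<le> ?n * r * (1 / q s)"
    proof -
      have "\<bar>?n * sn s * r / q s\<bar> = \<bar>(?n * r / q s) * sn s\<bar>" by (simp add: mult_ac)
      also have "\<dots> \<le> ?n * r / q s" using r q0 cs by (intro bd) auto
      finally show ?thesis by simp
    qed
    have "\<bar>T\<bar> \<le> 4 * (X / R) + 4 * r * (Y / R) + r\<^sup>2 * (1 / q s) + r * (1 / q s) + 2 * ?n * (1 / R) + ?n * r * (1 / q s)"
      unfolding T_def using t1 t2 t3 t4 t5 t6 by linarith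
    also have "\<dots> \<le> ?K * (X / R) + ?K * (Y / R) + ?K * (1 / R) + ?K * (1 / q s)"
    proof -
      have *: "4 * (X / R) \<le> ?K * (X / R)" "4 * r * (Y / R) \<le> ?K * (Y / R)" "2 * ?n * (1 / R) \<le> ?K * (1 / R)"
        "(r\<^sup>2 + r + ?n * r) * (1 / q s) \<le> ?K * (1 / q s)"
        using XY R q0 r by (intro mult_right_mono; simp add: add_nonneg_nonneg)+
      then show ?thesis by (simp only: distrib_right[of "r\<^sup>2 + r"] distrib_right[of "r\<^sup>2" r])
    qed
    also have "\<dots> = ?K * ((X + Y + 1) / R + 1 / q s)" by (simp only: add_divide_distrib distrib_left)
    finally have T: "\<bar>T\<bar> \<le> ?K * ((X + Y + 1) / R + 1 / q s)" .
    have "\<bar>E s * T\<bar> = E s * \<bar>T\<bar>" using E0[of s] by (simp add: abs_mult)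
    also have "\<dots> \<le> E s * (?K * ((X + Y + 1) / R + 1 / q s))" using E0[of s] T by (intro mult_left_mono) auto
    finally show ?thesis unfolding eq X_def Y_def by (simp only: mult.left_commute)
  qed
  show "AE x in lborel. \<bar>weak_laplacian u x + r\<^sup>2 * u x\<bar> \<le> ?K *
        (exp (- (x \<bullet> x) / R\<^sup>2) * (((x \<bullet> x) / R\<^sup>2 + sqrt (x \<bullet> x) / R + 1) / R + 1 / sqrt (1 + x \<bullet> x)))"
  proof -
    have "AE x::'a in lborel. weak_laplacian (\<lambda>x. E (x \<bullet> x) * c (x \<bullet> x)) x = 4 * (x \<bullet> x) * G2 (x \<bullet> x) + 2 * ?n * G1 (x \<bullet> x)"
      by (rule P(2))
    then show ?thesis unfolding u
  proof eventually_elim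
    case (elim x)
    have "\<bar>weak_laplacian (\<lambda>x. E (x \<bullet> x) * c (x \<bullet> x)) x + r\<^sup>2 * (E (x \<bullet> x) * c (x \<bullet> x))\<bar>
        \<le> ?K * (E (x \<bullet> x) * (((x \<bullet> x) / R\<^sup>2 + sqrt (x \<bullet> x) / R + 1) / R + 1 / q (x \<bullet> x)))"
      using main[OF inner_ge_zero, of x] unfolding elim .
    then show ?case by (simp only: E_def q_def)
  qed
  qed
qed

text \<open>Of the two phases \<open>0\<close> and \<open>- pi / 2\<close> of the oscillating profile at least one carries half of the mass
  of the Gaussian envelope, which grows like \<open>R ^ DIM('a)\<close>, whereas the error is \<open>o(R ^ DIM('a))\<close>.\<close>

lemma near_eigenfunction:
  assumes m: "m > 0" and e: "e > 0"
  shows "\<exists>u::'a::euclidean_space \<Rightarrow> real. u \<in> H2_rad \<and> sqnorm u > 0 \<and> sqnorm (\<lambda>x. weak_laplacian u x + m * u x) \<le> e * sqnorm u"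
proof -
  define r where "r = sqrt m"
  have r: "r > 0" "r\<^sup>2 = m" using m by (auto simp: r_def)
  define K where "K = 4 + 4 * r + 2 * real DIM('a) + r\<^sup>2 + r + real DIM('a) * r"
  define Z where "Z = (LINT y|lborel. exp (- 2 * ((y::'a) \<bullet> y)))"
  have Z: "Z > 0" unfolding Z_def by (subst gaussian_integral) auto
  \<comment> \<open>The error envelope of the oscillating profile in the rescaled variable x = R y.
    Its Gaussian no longer depends on \<open>R\<close>, which provides a dominating function for the
    limit of large \<open>R\<close>.\<close>
  define w where "w R y = exp (- (y \<bullet> y)) * (((y \<bullet> y) + sqrt (y \<bullet> y) + 1) / R + 1 / sqrt (1 + R\<^sup>2 * (y \<bullet> y)))" for R and y :: 'a
  have [measurable]: "w R \<in> borel_measurable borel" for R unfolding w_def by measurable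
  have wb: "\<bar>w R y\<bar> \<le> 6 * exp (- (1/2) * (y \<bullet> y))" "w R y \<ge> 0" if R: "R \<ge> 1" for R y
  proof -
    have s: "y \<bullet> y \<ge> 0" by simp
    show w0: "w R y \<ge> 0" unfolding w_def using R by (intro mult_nonneg_nonneg add_nonneg_nonneg divide_nonneg_nonneg) auto
    have "sqrt (y \<bullet> y) \<le> 1 + y \<bullet> y"
      using sum_squares_bound[of "sqrt (y \<bullet> y)" 1] real_sqrt_ge_zero[OF s]
      unfolding real_sqrt_pow2[OF s] power_one mult_1_right by linarith
    then have "((y \<bullet> y) + sqrt (y \<bullet> y) + 1) / R \<le> 2 * (1 + y \<bullet> y)"
      using R mult_left_mono[of 1 R "2 * (1 + y \<bullet> y)"] by (simp add: divide_le_eq add_nonneg_nonneg)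
    moreover have "1 / sqrt (1 + R\<^sup>2 * (y \<bullet> y)) \<le> 1"
    proof -
      have "1 / X \<le> 1" if "1 \<le> X" for X :: real using that by (simp add: divide_le_eq)
      moreover have "1 \<le> sqrt (1 + R\<^sup>2 * (y \<bullet> y))" by simp
      ultimately show ?thesis by blast
    qed
    ultimately have "((y \<bullet> y) + sqrt (y \<bullet> y) + 1) / R + 1 / sqrt (1 + R\<^sup>2 * (y \<bullet> y)) \<le> 2 * (1 + y \<bullet> y) + 1" by (rule add_mono)
    also have "\<dots> \<le> 3 * (2 * exp (1/2 * (y \<bullet> y)))"
    proof -
      have "2 * (1 + x) + 1 \<le> 3 * (2 * E)" if "1 + 1/2 * x \<le> E" "0 \<le> x" for x E :: real
      proof -
        have "2 + x \<le> 2 * E" using that by simp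
        with that(2) show ?thesis by simp
      qed
      from this[OF exp_ge_add_one_self s] show ?thesis .
    qed
    finally have "w R y \<le> exp (- (y \<bullet> y)) * (3 * (2 * exp (1/2 * (y \<bullet> y))))"
      unfolding w_def by (intro mult_left_mono) auto
    also have "\<dots> = 6 * exp (- (1/2) * (y \<bullet> y))" by (simp flip: exp_add)
    finally show "\<bar>w R y\<bar> \<le> 6 * exp (- (1/2) * (y \<bullet> y))" using w0 by simp
  qed
  have dom: "sq_integrable (\<lambda>y::'a. 6 * exp (- (1/2) * (y \<bullet> y)))"
    by (intro sq_integrable_cmult sq_integrable_gaussian) simp
  have wsq: "sq_integrable (w R)" if "R \<ge> 1" for R
    by (rule sq_integrable_dominated[OF dom]) (use wb(1)[OF that] in auto)
  have "(\<lambda>n. sqnorm (\<lambda>y. w (real (Suc n)) y - 0)) \<longlonglongrightarrow> 0"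
  proof (rule sqnorm_dominated_convergence(3)[OF _ _ dom])
    show "AE y in lborel. norm (w (real (Suc n)) y) \<le> norm (6 * exp (- (1/2) * (y \<bullet> y)))" for n
      using wb(1)[of "real (Suc n)"] by (intro AE_I2) simp
    have ae: "AE y in lborel. y \<noteq> (0::'a)" by (rule AE_lborel_singleton)
    show "AE y in lborel. (\<lambda>n. w (real (Suc n)) y) \<longlonglongrightarrow> 0"
      using ae
    proof eventually_elim
      case (elim y)
      \<comment> \<open>Away from the origin this term is at most 1 / (R |y|); at the origin it
        stays 1, but a point is a null set.\<close>
      have "(\<lambda>n. 1 / sqrt (1 + (real (Suc n))\<^sup>2 * (y \<bullet> y))) \<longlonglongrightarrow> 0"
      proof (rule Lim_null_comparison)
        show "\<forall>\<^sub>F n in sequentially. norm (1 / sqrt (1 + (real (Suc n))\<^sup>2 * (y \<bullet> y))) \<le> (1 / norm y) * (1 / real (Suc n))"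
        proof (intro always_eventually allI)
          fix n
          have "real (Suc n) * norm y = sqrt ((real (Suc n))\<^sup>2 * (y \<bullet> y))" by (simp add: real_sqrt_mult norm_eq_sqrt_inner)
          also have "\<dots> \<le> sqrt (1 + (real (Suc n))\<^sup>2 * (y \<bullet> y))" by simp
          finally have "1 / sqrt (1 + (real (Suc n))\<^sup>2 * (y \<bullet> y)) \<le> 1 / (real (Suc n) * norm y)"
            using elim by (intro divide_left_mono mult_pos_pos) (auto intro: add_pos_nonneg)
          then show "norm (1 / sqrt (1 + (real (Suc n))\<^sup>2 * (y \<bullet> y))) \<le> (1 / norm y) * (1 / real (Suc n))"
            by (simp add: mult.commute)
        qed
        show "(\<lambda>n. (1 / norm y) * (1 / real (Suc n))) \<longlonglongrightarrow> 0"
          using tendsto_mult_left[OF LIMSEQ_Suc[OF lim_1_over_n], of "1 / norm y"] by simp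
      qed
      note L1 = this
      have L2: "(\<lambda>n. ((y \<bullet> y) + sqrt (y \<bullet> y) + 1) * (1 / real (Suc n))) \<longlonglongrightarrow> ((y \<bullet> y) + sqrt (y \<bullet> y) + 1) * 0"
        by (intro tendsto_intros LIMSEQ_Suc[OF lim_1_over_n])
      have "(\<lambda>n. exp (- (y \<bullet> y)) * (((y \<bullet> y) + sqrt (y \<bullet> y) + 1) * (1 / real (Suc n)) + 1 / sqrt (1 + (real (Suc n))\<^sup>2 * (y \<bullet> y)))) \<longlonglongrightarrow> exp (- (y \<bullet> y)) * (((y \<bullet> y) + sqrt (y \<bullet> y) + 1) * 0 + 0)"
        by (rule tendsto_mult_left[OF tendsto_add[OF L2 L1]])
      then show ?case by (simp add: w_def)
    qed
  qed auto
  then have "(\<lambda>n. sqnorm (w (real (Suc n)))) \<longlonglongrightarrow> 0" by simp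
  then have "\<forall>\<^sub>F n in sequentially. sqnorm (w (real (Suc n))) < e * Z / (2 * (K\<^sup>2 + 1))"
    by (rule order_tendstoD(2)) (use e Z in \<open>auto intro!: divide_pos_pos add_nonneg_pos\<close>)
  then obtain n where n: "sqnorm (w (real (Suc n))) < e * Z / (2 * (K\<^sup>2 + 1))" by (auto simp: eventually_sequentially)
  define R where "R = real (Suc n)"
  have R: "R \<ge> 1" by (simp add: R_def)
  have wR: "K\<^sup>2 * sqnorm (w R) \<le> e * (Z / 2)"
  proof -
    have "K\<^sup>2 * sqnorm (w R) \<le> (K\<^sup>2 + 1) * (e * Z / (2 * (K\<^sup>2 + 1)))"
      using n unfolding R_def[symmetric] by (intro mult_mono) auto
    also have "\<dots> = e * (Z / 2)"
    proof -
      have "k * (e * Z / (2 * k)) = e * (Z / 2)" if "k > 0" for k using that by simp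
      then show ?thesis by (simp only: add_nonneg_pos zero_le_power2 zero_less_one)
    qed
    finally show ?thesis .
  qed
  define U where "U \<theta> x = exp (- (x \<bullet> x) / R\<^sup>2) * cos (r * sqrt (1 + x \<bullet> x) + \<theta>)" for \<theta> and x :: 'a
  define err where "err x = exp (- (x \<bullet> x) / R\<^sup>2) * (((x \<bullet> x) / R\<^sup>2 + sqrt (x \<bullet> x) / R + 1) / R + 1 / sqrt (1 + x \<bullet> x))" for x :: 'a
  have UH: "U \<theta> \<in> H2_rad" for \<theta> unfolding U_def[abs_def] by (rule oscillating_profile(1)[OF R r(1)])
  then have UH2: "U \<theta> \<in> H2" for \<theta> by (simp add: H2_rad_def)
  have UE: "AE x in lborel. \<bar>weak_laplacian (U \<theta>) x + m * U \<theta> x\<bar> \<le> K * err x" for \<theta>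
    using oscillating_profile(2)[OF R r(1), of \<theta>, where 'a='a] unfolding U_def[abs_def] err_def K_def r(2) .
  have scale: "R *\<^sub>R y \<bullet> R *\<^sub>R y = R\<^sup>2 * (y \<bullet> y)" for y :: 'a by (simp add: power2_eq_square)
  have errw: "err (0 + R *\<^sub>R y) = w R y" for y
    unfolding err_def w_def add_0 scale using R by (simp add: real_sqrt_mult)
  have [measurable]: "err \<in> borel_measurable borel" unfolding err_def by measurable
  have err_sq: "sqnorm err = R ^ DIM('a) * sqnorm (w R)"
    unfolding sqnorm_def using R by (subst lborel_integral_affine[of _ R 0]) (auto simp only: errw, auto)
  have err_int: "sq_integrable err"
  proof -
    have "integrable lborel (\<lambda>y. (norm (err (0 + R *\<^sub>R y)))\<^sup>2)" unfolding errw using wsq[OF R] by (simp add: sq_integrable_def)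
    then have "integrable lborel (\<lambda>x. (norm (err x))\<^sup>2)" by (subst (asm) lborel_integrable_affine) (use R in auto)
    then show ?thesis by (simp add: sq_integrable_def)
  qed
  have E: "sqnorm (\<lambda>x. weak_laplacian (U \<theta>) x + m * U \<theta> x) \<le> R ^ DIM('a) * (e * (Z / 2))" for \<theta>
  proof -
    have "sqnorm (\<lambda>x. weak_laplacian (U \<theta>) x + m * U \<theta> x) \<le> sqnorm (\<lambda>x. K * err x)"
    proof (rule sqnorm_mono[OF sq_integrable_cmult[OF err_int] sq_integrableD[OF shifted_laplacian_sq_integrable[OF UH2]]])
      show "AE x in lborel. norm (weak_laplacian (U \<theta>) x + m * U \<theta> x) \<le> norm (K * err x)"
        using UE[of \<theta>] by eventually_elim simp
    qed
    also have "\<dots> = R ^ DIM('a) * (K\<^sup>2 * sqnorm (w R))" unfolding sqnorm_cmult err_sq by simp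
    also have "\<dots> \<le> R ^ DIM('a) * (e * (Z / 2))" using R wR by (intro mult_left_mono) auto
    finally show ?thesis .
  qed
  have "sqnorm (U 0) + sqnorm (U (- pi / 2)) = R ^ DIM('a) * Z"
  proof -
    have "(U 0 x)\<^sup>2 + (U (- pi / 2) x)\<^sup>2 = exp (- (2 / R\<^sup>2) * (x \<bullet> x))" for x
    proof -
      have "cos (r * sqrt (1 + x \<bullet> x) + - pi / 2) = sin (r * sqrt (1 + x \<bullet> x))" by (simp add: cos_diff)
      then have "(U 0 x)\<^sup>2 + (U (- pi / 2) x)\<^sup>2 = (exp (- (x \<bullet> x) / R\<^sup>2))\<^sup>2 * ((cos (r * sqrt (1 + x \<bullet> x)))\<^sup>2 + (sin (r * sqrt (1 + x \<bullet> x)))\<^sup>2)"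
        unfolding U_def by (simp only: power_mult_distrib distrib_left add_0_right)
      also have "\<dots> = (exp (- (x \<bullet> x) / R\<^sup>2))\<^sup>2" by simp
      also have "\<dots> = exp (- (2 / R\<^sup>2) * (x \<bullet> x))" by (simp flip: exp_double)
      finally show ?thesis .
    qed
    then have "sqnorm (U 0) + sqnorm (U (- pi / 2)) = (LINT x|lborel. exp (- (2 / R\<^sup>2) * ((x::'a) \<bullet> x)))"
      using H2_sq_integrable[OF UH2] by (simp add: sqnorm_def sq_integrable_def flip: Bochner_Integration.integral_add)
    also have "\<dots> = R ^ DIM('a) * (LINT y|lborel. exp (- (2 / R\<^sup>2) * ((0 + R *\<^sub>R y) \<bullet> (0 + R *\<^sub>R (y::'a)))))"
      using R by (subst lborel_integral_affine[of _ R 0]) auto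
    also have "\<dots> = R ^ DIM('a) * Z" unfolding add_0 scale Z_def using R by simp
    finally show ?thesis .
  qed
  then have "sqnorm (U 0) \<ge> R ^ DIM('a) * Z / 2 \<or> sqnorm (U (- pi / 2)) \<ge> R ^ DIM('a) * Z / 2" by linarith
  then obtain \<theta> where \<theta>: "sqnorm (U \<theta>) \<ge> R ^ DIM('a) * Z / 2" by blast
  have "sqnorm (U \<theta>) > 0" using \<theta> Z R by (intro less_le_trans[OF _ \<theta>]) auto
  moreover have "sqnorm (\<lambda>x. weak_laplacian (U \<theta>) x + m * U \<theta> x) \<le> e * sqnorm (U \<theta>)"
  proof -
    have "R ^ DIM('a) * (e * (Z / 2)) = e * (R ^ DIM('a) * Z / 2)" by simp
    also have "\<dots> \<le> e * sqnorm (U \<theta>)" using \<theta> e by (intro mult_left_mono) auto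
    finally show ?thesis using E[of \<theta>] by linarith
  qed
  ultimately show ?thesis using UH by blast
qed

text \<open>Factor h = t g. Up to \<mu> a the linear part of \<open>g\<close> is not positive, so g
  < 0 there. At t0 = \<mu> a (s - 1) / (s - 2) the smallness condition, written out, says exactly g
  > 0, and for large \<open>t\<close> the power wins and g < 0 again. So zeros lie on both sides of
  \<open>t0\<close>, and g', strictly decreasing because s > 2, excludes a third one; the smaller
  zero is between \<mu> a and \<open>t0\<close>.\<close>

lemma R0_bounds:
  fixes N :: nat and p C a \<mu> :: real
  defines "s \<equiv> p * gamma_exp N p"
  assumes s: "s > 2" and p: "p > 0" and C: "C > 0" and a: "a > 0" and \<mu>: "\<mu> > 0"
    and cond: "\<mu> powr (s - 2) * a powr (p - 2) < C_tilde N p C"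
  shows "\<mu> * a < R0 N p C a \<mu>" "R0 N p C a \<mu> < \<mu> * (s - 1) / (s - 2) * a"
proof -
  define c where "c = C powr p / p * a powr (p * (1 - gamma_exp N p))"
  have c: "c > 0" using C p a by (simp add: c_def)
  define g where "g t = t / 2 - \<mu> * a / 2 - c * t powr (s - 1)" for t
  define h where "h = h_fun N p C a \<mu>"
  have hg: "h t = t * g t" if "t > 0" for t
  proof -
    have "t powr s = t * t powr (s - 1)" using that by (simp add: powr_diff)
    then show ?thesis unfolding h_def h_fun_def g_def c_def s_def by (simp add: algebra_simps power2_eq_square)
  qed
  define t0 where "t0 = \<mu> * (s - 1) / (s - 2) * a"
  have t0: "t0 > \<mu> * a" "t0 > 0"
  proof -
    have "(s - 1) / (s - 2) > 1" using s by simp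
    then have "\<mu> * a * 1 < \<mu> * a * ((s - 1) / (s - 2))" using a \<mu> by (intro mult_strict_left_mono) auto
    then show "t0 > \<mu> * a" by (simp add: t0_def mult_ac)
    with a \<mu> show "t0 > 0" by (meson less_trans mult_pos_pos)
  qed
  have gt0: "g t0 > 0"
  proof -
    have ps: "p * (1 - gamma_exp N p) = p - s" by (simp add: s_def algebra_simps)
    have "t0 powr (s - 2) = \<mu> powr (s - 2) * ((s - 1) / (s - 2)) powr (s - 2) * a powr (s - 2)"
      unfolding t0_def using s a \<mu> by (simp add: powr_mult powr_divide)
    then have "c * t0 powr (s - 2) = C powr p / p * ((s - 1) / (s - 2)) powr (s - 2) * (\<mu> powr (s - 2) * (a powr (p - s) * a powr (s - 2)))"
      unfolding c_def ps by simp
    also have "a powr (p - s) * a powr (s - 2) = a powr (p - 2)" using a by (simp flip: powr_add)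
    also have "C powr p / p * ((s - 1) / (s - 2)) powr (s - 2) * (\<mu> powr (s - 2) * a powr (p - 2))
        < C powr p / p * ((s - 1) / (s - 2)) powr (s - 2) * C_tilde N p C"
      using cond C p s by (intro mult_strict_left_mono) auto
    also have "\<dots> = 1 / (2 * (s - 1))"
    proof -
      have "((s - 1) / (s - 2)) powr (s - 2) * ((s - 2) / (s - 1)) powr (s - 2) = 1"
        using s by (simp add: powr_divide)
      moreover have "C powr p / p * (p / (2 * (s - 1) * C powr p)) = 1 / (2 * (s - 1))" using C p by simp
      moreover have "A * X * (B * Y) = (A * B) * (X * Y)" for A X B Y :: real by simp
      ultimately show ?thesis unfolding C_tilde_def Let_def s_def[symmetric] by (simp only: mult_1_right)
    qed
    finally have lt: "c * t0 powr (s - 2) < 1 / (2 * (s - 1))" .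
    have "t0 powr (s - 1) = t0 * t0 powr (s - 2)" using t0(2) by (simp add: powr_diff power2_eq_square)
    moreover have "\<mu> * a = t0 * ((s - 2) / (s - 1))" unfolding t0_def using s by simp
    ultimately have "g t0 = t0 * (1 / 2 - (s - 2) / (s - 1) / 2 - c * t0 powr (s - 2))"
      unfolding g_def by (simp add: algebra_simps)
    also have "1 / 2 - (s - 2) / (s - 1) / 2 = 1 / (2 * (s - 1))" using s by (simp add: field_simps)
    finally show ?thesis using lt t0(2) by simp
  qed
  have neg: "g t < 0" if "0 < t" "t \<le> \<mu> * a" for t
  proof -
    have "c * t powr (s - 1) > 0" using c that by simp
    with that show ?thesis unfolding g_def by linarith
  qed
  have dg: "(g has_real_derivative 1 / 2 - c * ((s - 1) * t powr (s - 2))) (at t)" if "t > 0" for t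
    unfolding g_def[abs_def]
    by (rule DERIV_cong[OF DERIV_diff[OF DERIV_diff[OF DERIV_cdivide[OF DERIV_ident] DERIV_const] DERIV_cmult[OF has_real_derivative_powr[OF that]]]])
       (simp add: algebra_simps)
  have cont: "continuous_on {x..y} g" if "x > 0" for x y
    using that by (intro continuous_at_imp_continuous_on) (auto intro!: DERIV_isCont[OF dg])
  have ma: "\<mu> * a > 0" using a \<mu> by simp
  obtain r where r: "\<mu> * a \<le> r" "r \<le> t0" "g r = 0"
    using IVT'[of g "\<mu> * a" 0 t0] neg[OF ma] gt0 t0 cont[OF ma] by auto
  have r': "\<mu> * a < r" "r < t0" using r neg[OF ma] gt0 by (auto simp: less_le)
  \<comment> \<open>The second argument solves c t^(s - 2) = 1. From there on the power term is at
    least \<open>t\<close> and exceeds the linear part t / 2.\<close>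
  define T where "T = max t0 ((1 / c) powr (1 / (s - 2)))"
  have T: "T \<ge> t0" "T > 0" using t0(2) by (auto simp: T_def)
  have "g T < 0"
  proof -
    have "1 / c = ((1 / c) powr (1 / (s - 2))) powr (s - 2)" unfolding powr_powr using s c by simp
    also have "\<dots> \<le> T powr (s - 2)" using s c by (intro powr_mono2) (auto simp: T_def)
    finally have "1 \<le> c * T powr (s - 2)" using c by (simp add: field_simps)
    moreover have "c * T powr (s - 1) = T * (c * T powr (s - 2))" using T(2) by (simp add: powr_diff power2_eq_square)
    moreover have "T * 1 \<le> T * (c * T powr (s - 2))" using calculation(1) T(2) by (intro mult_left_mono) auto
    ultimately have "c * T powr (s - 1) \<ge> T" by (simp only: mult_1_right)
    with ma T(2) show ?thesis unfolding g_def by linarith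
  qed
  then obtain z where z: "t0 \<le> z" "g z = 0"
    using IVT2'[of g T 0 t0] gt0 T cont[OF t0(2)] by auto
  have z': "t0 < z" using z gt0 by (auto simp: less_le)
  \<comment> \<open>The mean value theorem on the two gaps gives two zeros of g', contradicting its
    strict monotonicity.\<close>
  have no3: False if xyz: "0 < x" "x < y" "y < w" "g x = 0" "g y = 0" "g w = 0" for x y w
  proof -
    obtain \<xi> where \<xi>: "x < \<xi>" "\<xi> < y" "g y - g x = (y - x) * (1 / 2 - c * ((s - 1) * \<xi> powr (s - 2)))"
      using MVT2[OF xyz(2), of g "\<lambda>t. 1 / 2 - c * ((s - 1) * t powr (s - 2))"] dg xyz by auto
    obtain \<zeta> where \<zeta>: "y < \<zeta>" "\<zeta> < w" "g w - g y = (w - y) * (1 / 2 - c * ((s - 1) * \<zeta> powr (s - 2)))"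
      using MVT2[OF xyz(3), of g "\<lambda>t. 1 / 2 - c * ((s - 1) * t powr (s - 2))"] dg xyz by auto
    have "1 / 2 - c * ((s - 1) * \<xi> powr (s - 2)) = 0" "1 / 2 - c * ((s - 1) * \<zeta> powr (s - 2)) = 0"
      using \<xi>(3) \<zeta>(3) xyz by simp_all
    then have "c * ((s - 1) * \<xi> powr (s - 2)) = c * ((s - 1) * \<zeta> powr (s - 2))" by linarith
    moreover have "\<xi> powr (s - 2) < \<zeta> powr (s - 2)" using \<xi> \<zeta> xyz s by (intro powr_less_mono2) auto
    ultimately show False using c s by simp
  qed
  have Z: "{t. t > 0 \<and> h t = 0} = {r, z}"
  proof -
    have "t = r \<or> t = z" if "t > 0" "g t = 0" for t
      using no3[of t r z] no3[of r t z] no3[of r z t] that r r' z z' ma t0 by (cases t r rule: linorder_cases; cases t z rule: linorder_cases) auto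
    moreover have "r > 0" "z > 0" using r' z' ma t0 by auto
    ultimately show ?thesis using hg r(3) z(2) by (intro set_eqI iffI) (force simp: less_imp_neq)+
  qed
  have "R0 N p C a \<mu> = r"
    unfolding R0_def
  proof (rule the_equality)
    show "\<exists>r'. r < r' \<and> {t. t > 0 \<and> h_fun N p C a \<mu> t = 0} = {r, r'}" using Z r' z' unfolding h_def by (intro exI[of _ z]) auto
    fix \<rho> assume "\<exists>r'. \<rho> < r' \<and> {t. t > 0 \<and> h_fun N p C a \<mu> t = 0} = {\<rho>, r'}"
    then obtain r1 where r1: "\<rho> < r1" "{r, z} = {\<rho>, r1}" using Z unfolding h_def by auto
    then show "\<rho> = r" using r' z' unfolding doubleton_eq_iff by linarith
  qed
  then show "\<mu> * a < R0 N p C a \<mu>" "R0 N p C a \<mu> < \<mu> * (s - 1) / (s - 2) * a" using r' by (auto simp: t0_def)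
qed

section \<open>Rotation invariance and symmetric criticality\<close>

lemma orthogonal_measurable:
  fixes R :: "'a::euclidean_space \<Rightarrow> 'a"
  assumes "orthogonal_transformation R"
  shows "R \<in> borel_measurable borel"
  using orthogonal_transformation_linear[OF assms]
  by (intro borel_measurable_continuous_onI linear_continuous_on) (simp add: linear_conv_bounded_linear)

text \<open>Evaluate \<open>\<integral>\<integral> f (R x) G (R x - y) dx dy\<close> in both orders for the rotation-invariant Gaussian \<open>G\<close>,
  using only translation invariance.\<close>

lemma lborel_distr_orthogonal:
  fixes R :: "'a::euclidean_space \<Rightarrow> 'a"
  assumes R: "orthogonal_transformation R"
  shows "distr lborel borel R = lborel"
proof (rule measure_eqI)
  have [measurable]: "R \<in> borel_measurable borel" by (rule orthogonal_measurable[OF R])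
  have lin: "linear R" using R by (simp add: orthogonal_transformation_linear)
  define G where "G x = ennreal (exp (- 1 * (x \<bullet> x)))" for x :: 'a
  have [measurable]: "G \<in> borel_measurable borel" unfolding G_def by measurable
  define Z where "Z = (\<integral>\<^sup>+x. G x \<partial>lborel)"
  have Z: "Z = ennreal (LINT x|lborel. exp (- 1 * ((x::'a) \<bullet> x)))"
    unfolding Z_def G_def by (rule nn_integral_eq_integral[OF gaussian_fourier(1)]) auto
  \<comment> \<open>The Gaussian mass is neither 0 nor infinite, which permits cancelling it in the
    extended reals at the end.\<close>
  then have Z0: "Z \<noteq> 0" "Z \<noteq> \<top>" unfolding gaussian_integral[OF zero_less_one] by auto
  have GR: "G (R x) = G x" for x using R by (simp add: G_def orthogonal_transformation_def)
  have tr: "(\<integral>\<^sup>+x. f (t + x) \<partial>lborel) = (\<integral>\<^sup>+x. f x \<partial>lborel)" "(\<integral>\<^sup>+x. f (t - x) \<partial>lborel) = (\<integral>\<^sup>+x. f x \<partial>lborel)"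
    if [measurable]: "f \<in> borel_measurable borel" for f :: "'a \<Rightarrow> ennreal" and t
    using lborel_nn_integral_affine[of f 1 t] lborel_nn_integral_affine[of f "-1" t] by simp_all
  fix A assume "A \<in> sets (distr lborel borel R)"
  then have [measurable]: "A \<in> sets borel" by simp
  define f where "f = (indicator A :: 'a \<Rightarrow> ennreal)"
  have [measurable]: "f \<in> borel_measurable borel" unfolding f_def by measurable
  have "(\<integral>\<^sup>+x. f (R x) \<partial>lborel) * Z = (\<integral>\<^sup>+x. f (R x) * (\<integral>\<^sup>+y. G (R x - y) \<partial>lborel) \<partial>lborel)"
    by (subst tr(2)) (simp_all add: Z_def nn_integral_multc)
  also have "\<dots> = (\<integral>\<^sup>+x. (\<integral>\<^sup>+y. f (R x) * G (R x - y) \<partial>lborel) \<partial>lborel)" by (simp add: nn_integral_cmult)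
  also have "\<dots> = (\<integral>\<^sup>+y. (\<integral>\<^sup>+x. f (R x) * G (R x - y) \<partial>lborel) \<partial>lborel)"
    by (rule lborel_pair.Fubini'[symmetric]) measurable
  also have "\<dots> = (\<integral>\<^sup>+y. (\<integral>\<^sup>+x. f (y + R x) * G x \<partial>lborel) \<partial>lborel)"
  proof (rule nn_integral_cong)
    fix y :: 'a
    \<comment> \<open>Translating \<open>x\<close> by the preimage of \<open>y\<close> moves
      \<open>y\<close> from the argument of \<open>G\<close> to that of \<open>f\<close>; there
      \<open>R\<close> drops out of \<open>G\<close> by invariance.\<close>
    obtain z where z: "R z = y" using orthogonal_transformation_surj[OF R] by (metis surjD)
    have "(\<integral>\<^sup>+x. f (R x) * G (R x - y) \<partial>lborel) = (\<integral>\<^sup>+x. f (R (z + x)) * G (R (z + x) - y) \<partial>lborel)"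
      by (rule tr(1)[of "\<lambda>x. f (R x) * G (R x - y)", symmetric]) measurable
    then show "(\<integral>\<^sup>+x. f (R x) * G (R x - y) \<partial>lborel) = (\<integral>\<^sup>+x. f (y + R x) * G x \<partial>lborel)"
      by (simp add: linear_add[OF lin] z GR)
  qed
  also have "\<dots> = (\<integral>\<^sup>+x. (\<integral>\<^sup>+y. f (y + R x) * G x \<partial>lborel) \<partial>lborel)"
    by (rule lborel_pair.Fubini') measurable
  also have "\<dots> = (\<integral>\<^sup>+x. (\<integral>\<^sup>+y. f y \<partial>lborel) * G x \<partial>lborel)"
  proof -
    have "(\<integral>\<^sup>+y. f (y + R x) \<partial>lborel) = (\<integral>\<^sup>+y. f y \<partial>lborel)" for x
      using tr(1)[of f "R x"] by (simp add: add.commute)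
    then show ?thesis by (simp add: nn_integral_multc)
  qed
  also have "\<dots> = (\<integral>\<^sup>+y. f y \<partial>lborel) * Z" by (simp add: nn_integral_cmult Z_def)
  finally have eq: "(\<integral>\<^sup>+x. f (R x) \<partial>lborel) = (\<integral>\<^sup>+y. f y \<partial>lborel)"
    using Z0 by (simp add: mult.commute[of _ Z] ennreal_mult_cancel_left)
  have "emeasure (distr lborel borel R) A = (\<integral>\<^sup>+x. f x \<partial>distr lborel borel R)"
    unfolding f_def by (rule nn_integral_indicator[symmetric]) simp
  also have "\<dots> = (\<integral>\<^sup>+x. f (R x) \<partial>lborel)" by (rule nn_integral_distr) measurable
  also have "\<dots> = emeasure lborel A" unfolding eq by (simp add: f_def)
  finally show "emeasure (distr lborel borel R) A = emeasure lborel A" .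
qed simp

section \<open>Rotations acting on integrals, transforms and convolutions\<close>

lemma orthogonal_integral:
  fixes R :: "'a::euclidean_space \<Rightarrow> 'a" and f :: "'a::euclidean_space \<Rightarrow> 'b::{banach, second_countable_topology}"
  assumes R: "orthogonal_transformation R" and [measurable]: "f \<in> borel_measurable borel"
  shows "(LINT x|lborel. f (R x)) = (LINT x|lborel. f x)" "integrable lborel (\<lambda>x. f (R x)) \<longleftrightarrow> integrable lborel f"
proof -
  have [measurable]: "R \<in> borel_measurable borel" by (rule orthogonal_measurable[OF R])
  have "(LINT x|lborel. f x) = (LINT x|distr lborel borel R. f x)" by (simp add: lborel_distr_orthogonal[OF R])
  then show "(LINT x|lborel. f (R x)) = (LINT x|lborel. f x)" by (simp add: integral_distr)
  have "integrable lborel f \<longleftrightarrow> integrable (distr lborel borel R) f" by (simp add: lborel_distr_orthogonal[OF R])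
  then show "integrable lborel (\<lambda>x. f (R x)) \<longleftrightarrow> integrable lborel f" by (simp add: integrable_distr_eq)
qed

lemma orthogonal_AE:
  fixes R :: "'a::euclidean_space \<Rightarrow> 'a"
  assumes R: "orthogonal_transformation R" and P: "AE x in lborel. P x"
  shows "AE x in lborel. P (R x)"
proof (rule AE_distrD[where P = P and f = R])
  show "R \<in> lborel \<rightarrow>\<^sub>M borel" using orthogonal_measurable[OF R] by simp
  show "AE x in distr lborel borel R. P x" by (subst lborel_distr_orthogonal[OF R]) (rule P)
qed

lemma orthogonal_sq:
  fixes R :: "'a::euclidean_space \<Rightarrow> 'a" and f :: "'a::euclidean_space \<Rightarrow> 'b::euclidean_space"
  assumes R: "orthogonal_transformation R" and f: "sq_integrable f"
  shows "sq_integrable (\<lambda>x. f (R x))" "sqnorm (\<lambda>x. f (R x)) = sqnorm f"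
proof -
  have [measurable]: "R \<in> borel_measurable borel" "f \<in> borel_measurable borel"
    using orthogonal_measurable[OF R] f by measurable
  show "sq_integrable (\<lambda>x. f (R x))"
    using f orthogonal_integral(2)[OF R, of "\<lambda>x. (norm (f x))\<^sup>2"] by (simp add: sq_integrable_def)
  show "sqnorm (\<lambda>x. f (R x)) = sqnorm f"
    using orthogonal_integral(1)[OF R, of "\<lambda>x. (norm (f x))\<^sup>2"] by (simp add: sqnorm_def)
qed

lemma is_fourier_orthogonal:
  fixes R :: "'a::euclidean_space \<Rightarrow> 'a"
  assumes R: "orthogonal_transformation R" and F: "is_fourier u U"
  shows "is_fourier (\<lambda>x. u (R x)) (\<lambda>\<xi>. U (R \<xi>))"
proof -
  have [measurable]: "R \<in> borel_measurable borel" by (rule orthogonal_measurable[OF R])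
  note D = is_fourierD[OF F]
  from F obtain w where w: "\<And>n::nat. integrable lborel (w n)" "\<And>n. sq_integrable (w n)"
    "(\<lambda>n. sqnorm (\<lambda>x. w n x - u x)) \<longlonglongrightarrow> 0" "(\<lambda>n. sqnorm (\<lambda>\<xi>. fourier_L1 (w n) \<xi> - U \<xi>)) \<longlonglongrightarrow> 0"
    by (rule is_fourierE) blast
  have [measurable]: "w n \<in> borel_measurable borel" for n using w(2) by measurable
  have rot: "fourier_L1 (\<lambda>x. w n (R x)) \<xi> = fourier_L1 (w n) (R \<xi>)" for n \<xi>
  proof -
    have "fourier_L1 (\<lambda>x. w n (R x)) \<xi> = (LINT x|lborel. complex_of_real (w n (R x)) * cis (- (R x \<bullet> R \<xi>)))"
      using R by (simp add: fourier_L1_def orthogonal_transformation_def)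
    also have "\<dots> = fourier_L1 (w n) (R \<xi>)"
      unfolding fourier_L1_def by (rule orthogonal_integral(1)[OF R]) measurable
    finally show ?thesis .
  qed
  show ?thesis
  proof (rule is_fourierI[where w = "\<lambda>n x. w n (R x)"])
    show "integrable lborel (\<lambda>x. w n (R x))" for n using orthogonal_integral(2)[OF R, of "w n"] w(1)[of n] by simp
    show "(\<lambda>n. sqnorm (\<lambda>x. w n (R x) - u (R x))) \<longlonglongrightarrow> 0"
      using w(3) orthogonal_sq(2)[OF R sq_integrable_diff[OF w(2) D(1)]] by simp
    show "(\<lambda>n. sqnorm (\<lambda>\<xi>. fourier_L1 (\<lambda>x. w n (R x)) \<xi> - U (R \<xi>))) \<longlonglongrightarrow> 0"
      unfolding rot using w(4) orthogonal_sq(2)[OF R sq_integrable_diff[OF Plancherel_L1(1)[OF w(1,2)] D(2)]] by simp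
  qed (use orthogonal_sq(1)[OF R] D w(2) in auto)
qed

text \<open>The Laplacian is treated in frequency: the transform of \<open>u\<close> is rotation
  invariant a.e. by uniqueness, the symbol |\<xi>|^2 is invariant, and injectivity brings the
  identity back. This bypasses a chain rule for weak derivatives.\<close>

lemma H2_rad_invariant:
  fixes u :: "'a::euclidean_space \<Rightarrow> real"
  assumes u: "u \<in> H2_rad" and R: "orthogonal_transformation R"
  shows "AE x in lborel. u (R x) = u x" "AE x in lborel. weak_laplacian u (R x) = weak_laplacian u x"
proof -
  have u2: "u \<in> H2" using u by (simp add: H2_rad_def)
  obtain f where f: "AE x in lborel. u x = f (norm x)" using u by (auto simp: H2_rad_def)
  show inv: "AE x in lborel. u (R x) = u x"
    using f orthogonal_AE[OF R f] by eventually_elim (simp add: orthogonal_transformation_norm[OF R])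
  have F: "is_fourier u (fourier u)" by (rule is_fourier_fourier[OF H2_sq_integrable[OF u2]])
  note FR = is_fourier_orthogonal[OF R F]
  note sR = is_fourierD[OF FR]
  have "is_fourier u (\<lambda>\<xi>. fourier u (R \<xi>))"
    by (rule is_fourier_cong_AE[OF FR]) (use H2_sq_integrable[OF u2] sR inv in \<open>auto intro: sq_integrableD\<close>)
  then have UR: "AE \<xi> in lborel. fourier u (R \<xi>) = fourier u \<xi>" by (rule is_fourier_unique[OF _ F])
  note L = is_fourier_laplacian[OF u2 F]
  show "AE x in lborel. weak_laplacian u (R x) = weak_laplacian u x"
  proof (rule is_fourier_inj_AE[OF is_fourier_orthogonal[OF R L] L])
    have "R \<xi> \<bullet> R \<xi> = \<xi> \<bullet> \<xi>" for \<xi> using R by (simp add: orthogonal_transformation_def)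
    then show "AE \<xi> in lborel. - complex_of_real (R \<xi> \<bullet> R \<xi>) * fourier u (R \<xi>) = - complex_of_real (\<xi> \<bullet> \<xi>) * fourier u \<xi>"
      using UR by (auto elim: eventually_mono)
  qed
qed

text \<open>Invariance of \<open>f\<close> is known only a.e., but integrating it against an
  invariant kernel gives a function that is invariant at every point, hence a genuine function of
  the norm.\<close>

lemma conv_orthogonal:
  fixes f :: "'a::euclidean_space \<Rightarrow> real"
  assumes R: "orthogonal_transformation R" and [measurable]: "f \<in> borel_measurable borel" "k \<in> borel_measurable borel"
    and f: "AE x in lborel. f (R x) = f x" and k: "\<And>x. k (R x) = k x"
  shows "conv f k (R y) = conv f k y"
proof -
  have [measurable]: "R \<in> borel_measurable borel" by (rule orthogonal_measurable[OF R])
  have lin: "R y - R x = R (y - x)" for x using linear_diff[OF orthogonal_transformation_linear[OF R]] by simp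
  have "conv f k (R y) = (LINT x|lborel. f (R x) * k (R y - R x))"
    unfolding conv_def by (rule orthogonal_integral(1)[OF R, symmetric]) measurable
  also have "\<dots> = (LINT x|lborel. f x * k (y - x))"
    unfolding lin k by (rule integral_cong_AE) (use f in \<open>auto elim: eventually_mono\<close>)
  finally show ?thesis by (simp add: conv_def)
qed

text \<open>Rotations act transitively on spheres, so the profile can be read off along one fixed
  unit vector.\<close>

lemma invariant_imp_radial:
  fixes g :: "real ^ 'n \<Rightarrow> real"
  assumes "\<And>R x. orthogonal_transformation R \<Longrightarrow> g (R x) = g x"
  shows "\<exists>f. \<forall>x. g x = f (norm x)"
proof (intro exI allI)
  fix x :: "real ^ 'n"
  let ?e = "axis undefined 1 :: real ^ 'n"
  obtain R where "orthogonal_transformation R" "R (norm x *\<^sub>R ?e) = x"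
    using orthogonal_transformation_exists[of "norm x *\<^sub>R ?e" x] by auto
  then show "g x = (\<lambda>r. g (r *\<^sub>R ?e)) (norm x)" using assms by metis
qed

section \<open>Heat kernels as test functions\<close>

lemma H2_translate:
  fixes w :: "'a::euclidean_space \<Rightarrow> real"
  assumes w: "w \<in> H2"
  shows "(\<lambda>x. w (x + z)) \<in> H2" "AE x in lborel. weak_laplacian (\<lambda>x. w (x + z)) x = weak_laplacian w (x + z)"
proof -
  have sq: "sq_integrable (\<lambda>x. f (x + z))" if "sq_integrable f" for f :: "'a \<Rightarrow> real"
  proof -
    have [measurable]: "f \<in> borel_measurable borel" using that by measurable
    show ?thesis using that lborel_integral_translate(2)[of "\<lambda>x. (norm (f x))\<^sup>2" z] by (simp add: sq_integrable_def)
  qed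
  have hw: "has_weak_partial (\<lambda>x. f (x + z)) i (\<lambda>x. g (x + z))"
    if f: "sq_integrable f" "sq_integrable g" "has_weak_partial f i g" and i: "i \<in> Basis" for f g :: "'a \<Rightarrow> real" and i
    unfolding has_weak_partial_def
  proof (intro conjI allI impI sq_integrable_locally_integrable sq f)
    fix \<phi> :: "'a \<Rightarrow> real" assume t: "test_fun \<phi>"
    have [measurable]: "f \<in> borel_measurable borel" "g \<in> borel_measurable borel" using f by measurable
    have [measurable]: "\<phi> \<in> borel_measurable borel" "partial_deriv i \<phi> \<in> borel_measurable borel"
      using test_fun_kernel[OF t] i by (auto intro: kernel_measurable)
    have "(LINT x|lborel. f (x + z) * partial_deriv i \<phi> x) = (LINT x|lborel. f x * partial_deriv i \<phi> (x + - z))"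
      using lborel_integral_translate(1)[of "\<lambda>x. f x * partial_deriv i \<phi> (x + - z)" z] by simp
    also have "\<dots> = - (LINT x|lborel. g x * \<phi> (x + - z))"
      using f(3) test_fun_translate(1)[OF t, of "- z"] unfolding has_weak_partial_def test_fun_translate(2)[OF t, symmetric] by blast
    also have "(LINT x|lborel. g x * \<phi> (x + - z)) = (LINT x|lborel. g (x + z) * \<phi> x)"
      using lborel_integral_translate(1)[of "\<lambda>x. g x * \<phi> (x + - z)" z] by simp
    finally show "(LINT x|lborel. f (x + z) * partial_deriv i \<phi> x) = - (LINT x|lborel. g (x + z) * \<phi> x)" .
  qed
  from H2E[OF w] obtain g h where g: "sq_integrable w" "\<And>i. i \<in> Basis \<Longrightarrow> sq_integrable (g i)" "\<And>i. i \<in> Basis \<Longrightarrow> has_weak_partial w i (g i)"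
    "\<And>i j. i \<in> Basis \<Longrightarrow> j \<in> Basis \<Longrightarrow> sq_integrable (h i j)"
    "\<And>i j. i \<in> Basis \<Longrightarrow> j \<in> Basis \<Longrightarrow> has_weak_partial (g i) j (h i j)" by metis
  show "(\<lambda>x. w (x + z)) \<in> H2"
    by (rule H2I[where g = "\<lambda>i x. g i (x + z)" and h = "\<lambda>i j x. h i j (x + z)"])
       (intro sq hw g; assumption)+
  have "AE x in lborel. weak_laplacian (\<lambda>x. w (x + z)) x = (\<Sum>i\<in>Basis. weak_partial i (weak_partial i w) (x + z))"
    by (rule weak_laplacian_eq_AE(2)[where g = "\<lambda>i x. weak_partial i w (x + z)"])
       (intro hw H2_weak_partial[OF w] H2_sq_integrable[OF w]; assumption)+
  then show "AE x in lborel. weak_laplacian (\<lambda>x. w (x + z)) x = weak_laplacian w (x + z)"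
    by (simp add: weak_laplacian_def)
qed

text \<open>Integration by parts against a translated heat kernel moves the Laplacian onto the
  kernel, where the explicit formula replaces the chosen representative. The identity holds at every
  point because both sides are integrals.\<close>

lemma conv_laplacian_heat:
  fixes \<phi> :: "'a::euclidean_space \<Rightarrow> real"
  assumes \<phi>: "\<phi> \<in> H2" and t: "t > 0"
  shows "conv (weak_laplacian \<phi>) (heat t) x = conv \<phi> (heat_laplacian t) x"
proof -
  note H = heat_H2[OF t, where 'a='a]
  note T = H2_translate[OF H(1), of "- x"]
  have hl: "heat_laplacian t (- y) = heat_laplacian t y" for y :: 'a by (simp add: heat_laplacian_def)
  have [measurable]: "\<phi> \<in> borel_measurable borel" "(heat_laplacian t :: 'a \<Rightarrow> real) \<in> borel_measurable borel"
    using H2_sq_integrable[OF \<phi>] H(3) by measurable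
  have [measurable]: "weak_laplacian (\<lambda>y. heat t (y + - x)) \<in> borel_measurable borel"
    using H2_laplacian_sq_integrable[OF T(1)] by measurable
  have A: "AE y in lborel. weak_laplacian (heat t) (y + - x) = heat_laplacian t (y + - x)"
  proof (rule AE_distrD[where P = "\<lambda>y. weak_laplacian (heat t) y = heat_laplacian t y" and f = "\<lambda>y. y + - x"])
    show "(\<lambda>y. y + - x) \<in> lborel \<rightarrow>\<^sub>M (borel :: 'a measure)" by measurable
    show "AE y in distr lborel borel (\<lambda>y. y + - x). weak_laplacian (heat t) y = heat_laplacian t y"
      using H(2) lborel_distr_plus[of "- x"] by (simp only: add.commute[of _ "- x"])
  qed
  have "conv (weak_laplacian \<phi>) (heat t) x = (LINT y|lborel. weak_laplacian \<phi> y * heat t (y + - x))"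
    unfolding conv_def by (subst heat_commute) simp
  also have "\<dots> = (LINT y|lborel. \<phi> y * weak_laplacian (\<lambda>y. heat t (y + - x)) y)"
    by (rule H2_integral_by_parts(2)[OF \<phi> T(1)])
  also have "\<dots> = (LINT y|lborel. \<phi> y * heat_laplacian t (y + - x))"
  proof (rule integral_cong_AE)
    show "AE y in lborel. \<phi> y * weak_laplacian (\<lambda>y. heat t (y + - x)) y = \<phi> y * heat_laplacian t (y + - x)"
      using A T(2) by eventually_elim simp
  qed measurable
  also have "\<dots> = conv \<phi> (heat_laplacian t) x"
    unfolding conv_def using hl[of "x - _"] by (intro Bochner_Integration.integral_cong refl) simp
  finally show ?thesis .
qed

lemma conv_pairing_symmetric:
  fixes f g :: "'a::euclidean_space \<Rightarrow> real"
  assumes f: "sq_integrable f" and g: "sq_integrable g" and k: "kernel k" and even: "\<And>x. k (- x) = k x"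
  shows "(LINT x|lborel. g x * conv f k x) = (LINT y|lborel. f y * conv g k y)"
proof -
  have "k (x - y) = k (y - x)" for x y using even[of "x - y"] by simp
  then show ?thesis unfolding conv_Fubini_L2[OF f k g] by (simp add: conv_def)
qed

section \<open>Pairing with the power nonlinearity\<close>

lemma sq_integrable_bounded_Lspace:
  fixes w :: "'a::euclidean_space \<Rightarrow> real"
  assumes w: "sq_integrable w" and b: "\<And>x. \<bar>w x\<bar> \<le> M" and p: "p \<ge> 2"
  shows "integrable lborel (\<lambda>x. \<bar>w x\<bar> powr p)"
proof (rule Bochner_Integration.integrable_bound)
  have [measurable]: "w \<in> borel_measurable borel" using w by measurable
  show "integrable lborel (\<lambda>x. M powr (p - 2) * (norm (w x))\<^sup>2)" using w by (simp add: sq_integrable_def)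
  show "(\<lambda>x. \<bar>w x\<bar> powr p) \<in> borel_measurable lborel" by measurable
  have "\<bar>w x\<bar> powr p \<le> M powr (p - 2) * (norm (w x))\<^sup>2" for x
  proof (cases "w x = 0")
    case False
    have "\<bar>w x\<bar> powr p = \<bar>w x\<bar> powr (p - 2) * \<bar>w x\<bar> powr 2" by (simp only: powr_add[symmetric]) simp
    also have "\<dots> \<le> M powr (p - 2) * \<bar>w x\<bar> powr 2"
      using b p by (intro mult_right_mono powr_mono2) auto
    finally show ?thesis by simp
  qed simp
  then show "AE x in lborel. norm (\<bar>w x\<bar> powr p) \<le> norm (M powr (p - 2) * (norm (w x))\<^sup>2)"
    by (intro AE_I2) simp
qed

text \<open>A form of Young's inequality with a free parameter, proved by comparing |y| with d |x|.
  A small \<open>d\<close> makes the part depending on \<open>x\<close> small; the part depending on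
  \<open>y\<close> then has a large but fixed factor.\<close>

lemma power_product_split:
  fixes x y d p :: real
  assumes "p > 1" "d > 0"
  shows "\<bar>\<bar>x\<bar> powr (p - 2) * x * y\<bar> \<le> d * \<bar>x\<bar> powr p + d powr (1 - p) * \<bar>y\<bar> powr p"
proof (cases "x = 0 \<or> y = 0")
  case False
  have "\<bar>x\<bar> powr (p - 1) = \<bar>x\<bar> powr (p - 2) * \<bar>x\<bar> powr 1" by (simp only: powr_add[symmetric]) simp
  then have x1: "\<bar>\<bar>x\<bar> powr (p - 2) * x * y\<bar> = \<bar>x\<bar> powr (p - 1) * \<bar>y\<bar>" by (simp add: abs_mult)
  have y1: "\<bar>y\<bar> powr p = \<bar>y\<bar> powr (p - 1) * \<bar>y\<bar>" for y :: real
    by (cases "y = 0") (use assms in \<open>auto simp: powr_diff\<close>)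
  show ?thesis
  proof (cases "\<bar>y\<bar> \<le> d * \<bar>x\<bar>")
    case True
    then have "\<bar>x\<bar> powr (p - 1) * \<bar>y\<bar> \<le> \<bar>x\<bar> powr (p - 1) * (d * \<bar>x\<bar>)" by (intro mult_left_mono) auto
    also have "\<dots> = d * \<bar>x\<bar> powr p" by (simp add: y1[of x])
    finally show ?thesis unfolding x1 by (rule order_trans) simp
  next
    case F: False
    then have "\<bar>x\<bar> \<le> \<bar>y\<bar> / d" using assms by (simp add: field_simps)
    then have "\<bar>x\<bar> powr (p - 1) * \<bar>y\<bar> \<le> (\<bar>y\<bar> / d) powr (p - 1) * \<bar>y\<bar>"
      using assms by (intro mult_right_mono powr_mono2) auto
    also have "\<dots> = d powr (1 - p) * \<bar>y\<bar> powr p"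
      using assms False powr_minus_divide[of d "p - 1"] by (simp add: y1[of y] powr_divide)
    finally show ?thesis unfolding x1 using assms by (simp add: add_increasing)
  qed
qed (use assms in auto)

lemma power_pairing_integrable:
  fixes u w :: "'a::euclidean_space \<Rightarrow> real"
  assumes p: "p > 1" and [measurable]: "u \<in> borel_measurable borel" "w \<in> borel_measurable borel"
    and u: "integrable lborel (\<lambda>x. \<bar>u x\<bar> powr p)" and w: "integrable lborel (\<lambda>x. \<bar>w x\<bar> powr p)"
  shows "integrable lborel (\<lambda>x. \<bar>u x\<bar> powr (p - 2) * u x * w x)"
    "d > 0 \<Longrightarrow> \<bar>LINT x|lborel. \<bar>u x\<bar> powr (p - 2) * u x * w x\<bar>
        \<le> d * (LINT x|lborel. \<bar>u x\<bar> powr p) + d powr (1 - p) * (LINT x|lborel. \<bar>w x\<bar> powr p)"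
proof -
  have g: "integrable lborel (\<lambda>x. d * \<bar>u x\<bar> powr p + d powr (1 - p) * \<bar>w x\<bar> powr p)" for d :: real using u w by simp
  show i: "integrable lborel (\<lambda>x. \<bar>u x\<bar> powr (p - 2) * u x * w x)"
  proof (rule Bochner_Integration.integrable_bound[OF g[of 1]])
    show "AE x in lborel. norm (\<bar>u x\<bar> powr (p - 2) * u x * w x) \<le> norm (1 * \<bar>u x\<bar> powr p + 1 powr (1 - p) * \<bar>w x\<bar> powr p)"
      using power_product_split[OF p, of 1] by (intro AE_I2) (simp only: real_norm_def order_trans[OF _ abs_ge_self] zero_less_one)
  qed measurable
  assume d: "d > 0"
  have "\<bar>LINT x|lborel. \<bar>u x\<bar> powr (p - 2) * u x * w x\<bar> \<le> (LINT x|lborel. \<bar>\<bar>u x\<bar> powr (p - 2) * u x * w x\<bar>)"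
    by (rule integral_abs_bound)
  also have "\<dots> \<le> (LINT x|lborel. d * \<bar>u x\<bar> powr p + d powr (1 - p) * \<bar>w x\<bar> powr p)"
    by (rule integral_mono[OF integrable_abs[OF i] g]) (rule power_product_split[OF p d])
  also have "\<dots> = d * (LINT x|lborel. \<bar>u x\<bar> powr p) + d powr (1 - p) * (LINT x|lborel. \<bar>w x\<bar> powr p)" using u w by simp
  finally show "\<bar>LINT x|lborel. \<bar>u x\<bar> powr (p - 2) * u x * w x\<bar>
        \<le> d * (LINT x|lborel. \<bar>u x\<bar> powr p) + d powr (1 - p) * (LINT x|lborel. \<bar>w x\<bar> powr p)" .
qed

lemma Lnorm_powr:
  assumes "p > 0"
  shows "Lnorm p f powr p = (LINT x|lborel. norm (f x) powr p)"
  using assms by (simp add: Lnorm_def powr_powr)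

text \<open>Integration by parts trades the gradient term for the Laplacian of \<open>u\<close>, so
  that the test function enters only through itself and its own Laplacian.\<close>

lemma solves_EL_iff:
  fixes u :: "'a::euclidean_space \<Rightarrow> real"
  assumes u: "u \<in> H2"
  shows "solves_EL p \<mu> l u \<longleftrightarrow> (\<forall>\<phi>\<in>H2. (LINT x|lborel. weak_laplacian u x * weak_laplacian \<phi> x) + \<mu> * (LINT x|lborel. weak_laplacian u x * \<phi> x)
      - l * (LINT x|lborel. u x * \<phi> x) = (LINT x|lborel. \<bar>u x\<bar> powr (p - 2) * u x * \<phi> x))"
  unfolding solves_EL_def
  by (intro ball_cong refl) (simp add: H2_integral_by_parts(1)[OF u] H2_integral_by_parts(2)[OF u])

text \<open>Principle of symmetric criticality. The function \<open>L\<close> obtained by testing the equation with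
  translated heat kernels is bounded and rotation invariant; testing with the radial function
  \<open>conv heat (L * Gaussian)\<close> forces \<open>L = 0\<close>, so the equation holds for all heat-smoothed test functions.\<close>

lemma symmetric_criticality:
  fixes u :: "real ^ 'n \<Rightarrow> real"
  assumes u: "u \<in> H2_rad" and p: "p \<ge> 2" and Lp: "\<And>w :: real ^ 'n \<Rightarrow> real. w \<in> H2 \<Longrightarrow> integrable lborel (\<lambda>x. \<bar>w x\<bar> powr p)"
    and GN: "\<And>w :: nat \<Rightarrow> real ^ 'n \<Rightarrow> real. (\<And>n. w n \<in> H2) \<Longrightarrow> (\<lambda>n. sqnorm (w n)) \<longlonglongrightarrow> 0 \<Longrightarrow> (\<lambda>n. sqnorm (weak_laplacian (w n))) \<longlonglongrightarrow> 0
      \<Longrightarrow> (\<lambda>n. LINT x|lborel. \<bar>w n x\<bar> powr p) \<longlonglongrightarrow> 0"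
    and rad: "\<And>\<phi>. \<phi> \<in> H2_rad \<Longrightarrow> (LINT x|lborel. weak_laplacian u x * weak_laplacian \<phi> x) + \<mu> * (LINT x|lborel. weak_laplacian u x * \<phi> x)
      - l * (LINT x|lborel. u x * \<phi> x) = (LINT x|lborel. \<bar>u x\<bar> powr (p - 2) * u x * \<phi> x)"
  shows "solves_EL p \<mu> l u"
proof -
  have u2: "u \<in> H2" using u by (simp add: H2_rad_def)
  note su = H2_sq_integrable[OF u2] and sD = H2_laplacian_sq_integrable[OF u2]
  have [measurable]: "u \<in> borel_measurable borel" "weak_laplacian u \<in> borel_measurable borel" using su sD by measurable
  define B where "B x = \<bar>u x\<bar> powr (p - 2) * u x" for x
  have [measurable]: "B \<in> borel_measurable borel" unfolding B_def by measurable
  define ell where "ell \<phi> = (LINT x|lborel. weak_laplacian u x * weak_laplacian \<phi> x) + \<mu> * (LINT x|lborel. weak_laplacian u x * \<phi> x)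
      - l * (LINT x|lborel. u x * \<phi> x) - (LINT x|lborel. B x * \<phi> x)" for \<phi>
  have p1: "p > 1" using p by simp
  have Bint: "integrable lborel (\<lambda>x. B x * w x)" if "w \<in> borel_measurable borel" "integrable lborel (\<lambda>x. \<bar>w x\<bar> powr p)" for w
    unfolding B_def using power_pairing_integrable(1)[OF p1 _ that(1) Lp[OF u2] that(2)] by simp
  have smooth: "ell (conv \<phi> (heat t)) = 0" if \<phi>: "\<phi> \<in> H2" and t: "t > 0" for \<phi> t
  proof -
    note K = kernel_heat[OF t, where 'a="real ^ 'n"] and H = heat_H2[OF t, where 'a="real ^ 'n"]
    have heven: "heat_laplacian t (- x) = heat_laplacian t x" for x :: "real ^ 'n" by (simp add: heat_laplacian_def)
    have [measurable]: "(heat_laplacian t :: real ^ 'n \<Rightarrow> real) \<in> borel_measurable borel" using H(3) by measurable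
    define L where "L y = conv (weak_laplacian u) (heat_laplacian t) y + \<mu> * conv (weak_laplacian u) (heat t) y - l * conv u (heat t) y - conv B (heat t) y" for y
    have [measurable]: "L \<in> borel_measurable borel" unfolding L_def by measurable
    have heat_p: "integrable lborel (\<lambda>x::real ^ 'n. \<bar>heat t x\<bar> powr p)" by (rule Lp[OF H(1)])
    have LB: "\<exists>M. \<forall>y. \<bar>L y\<bar> \<le> M"
    proof -
      have cB: "\<bar>conv B (heat t) y\<bar> \<le> (LINT x|lborel. \<bar>u x\<bar> powr p) + (LINT x|lborel. \<bar>heat t (x::real ^ 'n)\<bar> powr p)" for y
      proof -
        have i: "integrable lborel (\<lambda>x. \<bar>heat t (y - x)\<bar> powr p)" "(LINT x|lborel. \<bar>heat t (y - x)\<bar> powr p) = (LINT x|lborel. \<bar>heat t (x::real ^ 'n)\<bar> powr p)"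
          using lborel_integral_reflect[of "\<lambda>x. \<bar>heat t x\<bar> powr p" y] heat_p by simp_all
        show ?thesis using power_pairing_integrable(2)[OF p1 _ _ Lp[OF u2] i(1), of 1] i(2) by (simp add: conv_def B_def)
      qed
      show ?thesis
      proof (intro exI allI)
        fix y
        have "\<bar>L y\<bar> \<le> \<bar>conv (weak_laplacian u) (heat_laplacian t) y\<bar> + \<bar>\<mu>\<bar> * \<bar>conv (weak_laplacian u) (heat t) y\<bar> + \<bar>l\<bar> * \<bar>conv u (heat t) y\<bar> + \<bar>conv B (heat t) y\<bar>"
          unfolding L_def abs_mult[symmetric] by linarith
        also have "\<dots> \<le> sqrt (sqnorm (weak_laplacian u)) * sqrt (sqnorm (heat_laplacian t :: real ^ 'n \<Rightarrow> real))
            + \<bar>\<mu>\<bar> * (sqrt (sqnorm (weak_laplacian u)) * sqrt (sqnorm (heat t :: real ^ 'n \<Rightarrow> real)))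
            + \<bar>l\<bar> * (sqrt (sqnorm u) * sqrt (sqnorm (heat t :: real ^ 'n \<Rightarrow> real)))
            + ((LINT x|lborel. \<bar>u x\<bar> powr p) + (LINT x|lborel. \<bar>heat t (x::real ^ 'n)\<bar> powr p))"
          by (intro add_mono mult_left_mono conv_bound sD su K H(3) cB) auto
        finally show "\<bar>L y\<bar> \<le> sqrt (sqnorm (weak_laplacian u)) * sqrt (sqnorm (heat_laplacian t :: real ^ 'n \<Rightarrow> real))
            + \<bar>\<mu>\<bar> * (sqrt (sqnorm (weak_laplacian u)) * sqrt (sqnorm (heat t :: real ^ 'n \<Rightarrow> real)))
            + \<bar>l\<bar> * (sqrt (sqnorm u) * sqrt (sqnorm (heat t :: real ^ 'n \<Rightarrow> real)))
            + ((LINT x|lborel. \<bar>u x\<bar> powr p) + (LINT x|lborel. \<bar>heat t (x::real ^ 'n)\<bar> powr p))" .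
      qed
    qed
    then obtain M where M: "\<And>y. \<bar>L y\<bar> \<le> M" by blast
    have M0: "M \<ge> 0" using M[of 0] by (rule order_trans[OF abs_ge_zero])
    \<comment> \<open>For test functions smoothed by the heat kernel the functional becomes
      integration against \<open>L\<close>. The nonlinearity \<open>B\<close> is paired only with
      L^p functions, so exchanging its integrals uses that the smoothed |w|, being bounded and in
      L2, lies in L^p.\<close>
    have pair: "(LINT x|lborel. weak_laplacian u x * conv w (heat_laplacian t) x) + \<mu> * (LINT x|lborel. weak_laplacian u x * conv w (heat t) x)
        - l * (LINT x|lborel. u x * conv w (heat t) x) - (LINT x|lborel. B x * conv w (heat t) x) = (LINT y|lborel. w y * L y)"
      "integrable lborel (\<lambda>y. w y * conv B (heat t) y)"
      if w: "sq_integrable w" "integrable lborel (\<lambda>y. w y * L y)" for w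
    proof -
      have [measurable]: "w \<in> borel_measurable borel" using w by measurable
      have wabs: "sq_integrable (\<lambda>x. \<bar>w x\<bar>)" using w(1) by (simp add: sq_integrable_def)
      have cw: "sq_integrable (conv (\<lambda>x. \<bar>w x\<bar>) (\<lambda>x. \<bar>heat t x\<bar>))" by (rule Young_L2(1)[OF wabs kernel_abs[OF K]])
      have cwb: "\<bar>conv (\<lambda>x. \<bar>w x\<bar>) (\<lambda>x. \<bar>heat t x\<bar>) x\<bar> \<le> sqrt (sqnorm (\<lambda>x. \<bar>w x\<bar>)) * sqrt (sqnorm (\<lambda>x::real^'n. \<bar>heat t x\<bar>))" for x
        by (rule conv_bound[OF wabs kernel_abs[OF K]])
      have Fub: "(LINT x|lborel. B x * conv w (heat t) x) = (LINT y|lborel. w y * conv B (heat t) y)"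
      proof -
        have "integrable lborel (\<lambda>x. \<bar>B x * conv (\<lambda>x. \<bar>w x\<bar>) (\<lambda>x. \<bar>heat t x\<bar>) x\<bar>)"
          by (intro integrable_abs Bint sq_integrable_bounded_Lspace[OF cw cwb p]) measurable
        moreover have "conv (\<lambda>x. \<bar>w x\<bar>) (\<lambda>x. \<bar>heat t x\<bar>) x \<ge> 0" for x unfolding conv_def by simp
        ultimately have "integrable lborel (\<lambda>x. \<bar>B x\<bar> * conv (\<lambda>x. \<bar>w x\<bar>) (\<lambda>x. \<bar>heat t x\<bar>) x)" by (simp add: abs_mult)
        from conv_Fubini[OF w(1) K _ this] show ?thesis by (simp add: conv_def heat_commute)
      qed
      have i: "integrable lborel (\<lambda>y. w y * conv (weak_laplacian u) (heat_laplacian t) y)" "integrable lborel (\<lambda>y. w y * conv (weak_laplacian u) (heat t) y)"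
        "integrable lborel (\<lambda>y. w y * conv u (heat t) y)"
        by (intro sq_integrable_mult w Young_L2(1) sD su K H(3))+
      have "(\<lambda>y. w y * conv B (heat t) y) = (\<lambda>y. w y * conv (weak_laplacian u) (heat_laplacian t) y + \<mu> * (w y * conv (weak_laplacian u) (heat t) y)
          - l * (w y * conv u (heat t) y) - w y * L y)"
        by (rule ext) (simp add: L_def algebra_simps)
      then show j: "integrable lborel (\<lambda>y. w y * conv B (heat t) y)" using i w(2) by simp
      have "(\<lambda>y. w y * L y) = (\<lambda>y. w y * conv (weak_laplacian u) (heat_laplacian t) y + \<mu> * (w y * conv (weak_laplacian u) (heat t) y)
          - l * (w y * conv u (heat t) y) - w y * conv B (heat t) y)"
        by (rule ext) (simp add: L_def algebra_simps)
      then have "(LINT y|lborel. w y * L y) = (LINT y|lborel. w y * conv (weak_laplacian u) (heat_laplacian t) y) + \<mu> * (LINT y|lborel. w y * conv (weak_laplacian u) (heat t) y)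
          - l * (LINT y|lborel. w y * conv u (heat t) y) - (LINT y|lborel. w y * conv B (heat t) y)"
        using i j by simp
      then show "(LINT x|lborel. weak_laplacian u x * conv w (heat_laplacian t) x) + \<mu> * (LINT x|lborel. weak_laplacian u x * conv w (heat t) x)
        - l * (LINT x|lborel. u x * conv w (heat t) x) - (LINT x|lborel. B x * conv w (heat t) x) = (LINT y|lborel. w y * L y)"
        unfolding Fub conv_pairing_symmetric[OF w(1) sD H(3) heven] conv_pairing_symmetric[OF w(1) sD K heat_minus] conv_pairing_symmetric[OF w(1) su K heat_minus] by simp
    qed
    \<comment> \<open>The Gaussian factor turns the bounded function \<open>L\<close> into an
      integrable kernel without spoiling its rotation invariance, and rho times \<open>L\<close> is
      a nonnegative multiple of L^2.\<close>
    define rho where "rho y = L y * exp (- 1 * (y \<bullet> y))" for y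
    have [measurable]: "rho \<in> borel_measurable borel" unfolding rho_def by measurable
    have rb: "\<bar>rho y\<bar> \<le> M * exp (- 1 * (y \<bullet> y))" for y unfolding rho_def abs_mult using M by (simp add: mult_right_mono)
    have gi: "integrable lborel (\<lambda>y::real ^ 'n. M * exp (- 1 * (y \<bullet> y)))" by (rule integrable_mult_right[OF gaussian_fourier(1)]) simp
    have rk: "kernel rho"
      unfolding kernel_def
    proof (intro conjI exI allI)
      show "integrable lborel rho"
        by (rule Bochner_Integration.integrable_bound[OF gi]) (use order_trans[OF rb abs_ge_self] in \<open>auto simp only: real_norm_def intro!: AE_I2\<close>, measurable)
      show "\<bar>rho y\<bar> \<le> M * 1" for y by (rule order_trans[OF rb]) (use M0 in \<open>intro mult_left_mono, auto\<close>)
    qed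
    have rL: "integrable lborel (\<lambda>y. rho y * L y)"
    proof (rule Bochner_Integration.integrable_bound[OF integrable_mult_left[OF gi, of M]])
      have "\<bar>rho y * L y\<bar> \<le> M * exp (- 1 * (y \<bullet> y)) * M" for y
        unfolding abs_mult by (intro mult_mono rb M) (use M0 in auto)
      from order_trans[OF this abs_ge_self]
      show "AE y in lborel. norm (rho y * L y) \<le> norm (M * exp (- 1 * (y \<bullet> y)) * M)"
        unfolding real_norm_def by (intro AE_I2)
    qed measurable
    have Linv: "L (R y) = L y" if R: "orthogonal_transformation R" for R y
    proof -
      have n: "R x \<bullet> R x = x \<bullet> x" for x using R by (simp add: orthogonal_transformation_def)
      have k: "heat t (R x) = heat t x" "heat_laplacian t (R x) = heat_laplacian t x" for x by (simp_all add: heat_def heat_laplacian_def n)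
      note I = H2_rad_invariant[OF u R]
      have BI: "AE x in lborel. B (R x) = B x" using I(1) unfolding B_def by eventually_elim simp
      note C = conv_orthogonal[OF R]
      have "conv (weak_laplacian u) (heat_laplacian t) (R y) = conv (weak_laplacian u) (heat_laplacian t) y"
        "conv (weak_laplacian u) (heat t) (R y) = conv (weak_laplacian u) (heat t) y"
        "conv u (heat t) (R y) = conv u (heat t) y" "conv B (heat t) (R y) = conv B (heat t) y"
        by (intro C I k BI; measurable)+
      then show ?thesis unfolding L_def by simp
    qed
    \<comment> \<open>Convolution in this order places it in \<open>H2\<close>: the heat kernel is
      the smooth factor and \<open>rho\<close> merely a kernel. The pairing formula uses the
      opposite order, reached by commuting.\<close>
    define \<Phi> where "\<Phi> = conv (heat t) rho"
    have \<Phi>2: "\<Phi> \<in> H2" "AE x in lborel. weak_laplacian \<Phi> x = conv rho (heat_laplacian t) x"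
    proof -
      show "\<Phi> \<in> H2" unfolding \<Phi>_def by (rule H2_conv(1)[OF H(1) rk])
      have [measurable]: "weak_laplacian (heat t :: real ^ 'n \<Rightarrow> real) \<in> borel_measurable borel"
        using H2_laplacian_sq_integrable[OF H(1)] by measurable
      have "conv (weak_laplacian (heat t)) rho x = conv rho (heat_laplacian t) x" for x
      proof -
        have ae: "AE y in lborel. weak_laplacian (heat t) y * rho (x - y) = heat_laplacian t y * rho (x - y)"
          using H(2) by eventually_elim simp
        have "conv (weak_laplacian (heat t)) rho x = conv (heat_laplacian t) rho x"
          unfolding conv_def by (rule integral_cong_AE[OF _ _ ae]) measurable
        also have "\<dots> = conv rho (heat_laplacian t) x" by (rule conv_commute) measurable
        finally show ?thesis .
      qed
      then show "AE x in lborel. weak_laplacian \<Phi> x = conv rho (heat_laplacian t) x"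
        unfolding \<Phi>_def using H2_conv(2)[OF H(1) rk] by simp
    qed
    have \<Phi>c: "\<Phi> x = conv rho (heat t) x" for x unfolding \<Phi>_def by (rule conv_commute) measurable
    have "\<Phi> (R x) = \<Phi> x" if R: "orthogonal_transformation R" for R x
      unfolding \<Phi>c
    proof (rule conv_orthogonal[OF R])
      have n: "R x \<bullet> R x = x \<bullet> x" for x using R by (simp add: orthogonal_transformation_def)
      show "heat t (R x) = heat t x" for x by (simp add: heat_def n)
      show "AE x in lborel. rho (R x) = rho x" unfolding rho_def by (simp add: Linv[OF R] n)
    qed measurable
    then have "\<exists>f. \<forall>x. \<Phi> x = f (norm x)" by (rule invariant_imp_radial)
    then have "\<Phi> \<in> H2_rad" using \<Phi>2(1) by (auto simp: H2_rad_def)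
    from rad[OF this] have "ell \<Phi> = 0" by (simp add: ell_def B_def)
    moreover have "(LINT x|lborel. weak_laplacian u x * weak_laplacian \<Phi> x) = (LINT x|lborel. weak_laplacian u x * conv rho (heat_laplacian t) x)"
    proof (rule integral_cong_AE)
      have "weak_laplacian \<Phi> \<in> borel_measurable borel" using H2_laplacian_sq_integrable[OF \<Phi>2(1)] by measurable
      then show "(\<lambda>x. weak_laplacian u x * weak_laplacian \<Phi> x) \<in> borel_measurable lborel" by measurable
      show "AE x in lborel. weak_laplacian u x * weak_laplacian \<Phi> x = weak_laplacian u x * conv rho (heat_laplacian t) x"
        using \<Phi>2(2) by eventually_elim simp
    qed measurable
    ultimately have "(LINT y|lborel. rho y * L y) = 0"
      using pair(1)[OF kernel_sq_integrable[OF rk] rL] unfolding ell_def \<Phi>c by simp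
    moreover have nn: "rho y * L y \<ge> 0" for y
    proof -
      have "rho y * L y = (L y)\<^sup>2 * exp (- 1 * (y \<bullet> y))" by (simp add: rho_def power2_eq_square)
      then show ?thesis by simp
    qed
    ultimately have "AE y in lborel. rho y * L y = 0"
      using integral_nonneg_eq_0_iff_AE[OF rL] by simp
    then have L0: "AE y in lborel. L y = 0" by eventually_elim (simp add: rho_def)
    have s\<phi>: "sq_integrable \<phi>" by (rule H2_sq_integrable[OF \<phi>])
    have [measurable]: "\<phi> \<in> borel_measurable borel" using s\<phi> by measurable
    have z: "AE y in lborel. \<phi> y * L y = 0" using L0 by eventually_elim simp
    have \<phi>L: "integrable lborel (\<lambda>y. \<phi> y * L y)" "(LINT y|lborel. \<phi> y * L y) = 0"
      using integrable_cong_AE[of "\<lambda>y. \<phi> y * L y" lborel "\<lambda>y. 0"] integral_cong_AE[of "\<lambda>y. \<phi> y * L y" lborel "\<lambda>y. 0"] z by auto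
    have c2: "conv \<phi> (heat t) \<in> H2" "AE x in lborel. weak_laplacian (conv \<phi> (heat t)) x = conv \<phi> (heat_laplacian t) x"
      using H2_conv[OF \<phi> K] conv_laplacian_heat[OF \<phi> t] by auto
    have "(LINT x|lborel. weak_laplacian u x * weak_laplacian (conv \<phi> (heat t)) x) = (LINT x|lborel. weak_laplacian u x * conv \<phi> (heat_laplacian t) x)"
    proof (rule integral_cong_AE)
      have "weak_laplacian (conv \<phi> (heat t)) \<in> borel_measurable borel" using H2_laplacian_sq_integrable[OF c2(1)] by measurable
      then show "(\<lambda>x. weak_laplacian u x * weak_laplacian (conv \<phi> (heat t)) x) \<in> borel_measurable lborel" by measurable
      show "AE x in lborel. weak_laplacian u x * weak_laplacian (conv \<phi> (heat t)) x = weak_laplacian u x * conv \<phi> (heat_laplacian t) x"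
        using c2(2) by eventually_elim simp
    qed measurable
    then show ?thesis using pair(1)[OF s\<phi> \<phi>L(1)] \<phi>L(2) unfolding ell_def by simp
  qed
  \<comment> \<open>Removal of the smoothing: heat evolutions of a test function converge to it
    together with their Laplacians, and by the hypothesis \<open>GN\<close> also in L^p, so the
    continuous functional vanishes on the limit.\<close>
  have "ell \<phi> = 0" if \<phi>: "\<phi> \<in> H2" for \<phi>
  proof -
    define t where "t n = 1 / real (Suc n)" for n
    have t: "t n > 0" for n by (simp add: t_def)
    define g where "g n x = conv \<phi> (heat (t n)) x - \<phi> x" for n x
    note K = kernel_heat[OF t, where 'a="real ^ 'n"]
    note c = H2_conv[OF \<phi> K]
    have g2: "g n \<in> H2" "AE x in lborel. weak_laplacian (g n) x = conv (weak_laplacian \<phi>) (heat (t n)) x - weak_laplacian \<phi> x" for n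
    proof -
      show "g n \<in> H2" unfolding g_def by (rule H2_diff(1)[OF c(1) \<phi>])
      show "AE x in lborel. weak_laplacian (g n) x = conv (weak_laplacian \<phi>) (heat (t n)) x - weak_laplacian \<phi> x"
        unfolding g_def using H2_diff(2)[OF c(1) \<phi>, of n] c(2)[of n] by eventually_elim simp
    qed
    note sg = H2_sq_integrable[OF g2(1)] H2_laplacian_sq_integrable[OF g2(1)]
    note s\<phi> = H2_sq_integrable[OF \<phi>] H2_laplacian_sq_integrable[OF \<phi>]
    have [measurable]: "g n \<in> borel_measurable borel" for n using sg(1) by measurable
    have g0: "(\<lambda>n. sqnorm (g n)) \<longlonglongrightarrow> 0" unfolding g_def t_def by (rule heat_approx_tendsto[OF s\<phi>(1)])
    have gD: "(\<lambda>n. sqnorm (weak_laplacian (g n))) \<longlonglongrightarrow> 0"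
    proof -
      have "sqnorm (weak_laplacian (g n)) = sqnorm (\<lambda>x. conv (weak_laplacian \<phi>) (heat (t n)) x - weak_laplacian \<phi> x)" for n
        by (rule sqnorm_cong_AE[OF sq_integrableD[OF sg(2)] sq_integrableD[OF sq_integrable_diff[OF Young_L2(1)[OF s\<phi>(2) K] s\<phi>(2)]] g2(2)])
      then show ?thesis unfolding t_def using heat_approx_tendsto[OF s\<phi>(2)] by simp
    qed
    have gP: "(\<lambda>n. LINT x|lborel. \<bar>g n x\<bar> powr p) \<longlonglongrightarrow> 0" by (rule GN[OF g2(1) g0 gD])
    have Bg: "(\<lambda>n. LINT x|lborel. B x * g n x) \<longlonglongrightarrow> 0"
    proof (rule LIMSEQ_I)
      fix e :: real assume e: "e > 0"
      define P where "P = (LINT x|lborel. \<bar>u x\<bar> powr p)"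
      have P: "P \<ge> 0" by (simp add: P_def)
      \<comment> \<open>Fixed so that the part of the split involving \<open>u\<close> is at most e
        / 2; the other part then has a fixed factor and tends to 0.\<close>
      define d where "d = e / (2 * (P + 1))"
      have d: "d > 0" using e P by (simp add: d_def)
      have dP: "d * P < e / 2 + e / 4"
      proof -
        have "d * P \<le> d * (P + 1)" using d by simp
        also have "\<dots> = e / 2"
        proof -
          have k: "e / (2 * k) * k = e / 2" if "k > 0" for k using that by simp
          show ?thesis unfolding d_def by (rule k) (use P in simp)
        qed
        finally show ?thesis using e by linarith
      qed
      have "(\<lambda>n. d powr (1 - p) * (LINT x|lborel. \<bar>g n x\<bar> powr p)) \<longlonglongrightarrow> d powr (1 - p) * 0" by (intro tendsto_intros gP)
      then have "\<forall>\<^sub>F n in sequentially. d powr (1 - p) * (LINT x|lborel. \<bar>g n x\<bar> powr p) < e / 4" by (rule order_tendstoD(2)) (use e in simp)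
      then obtain n0 where n0: "\<And>n. n \<ge> n0 \<Longrightarrow> d powr (1 - p) * (LINT x|lborel. \<bar>g n x\<bar> powr p) < e / 4" by (auto simp: eventually_sequentially)
      have "norm ((LINT x|lborel. B x * g n x) - 0) < e" if "n \<ge> n0" for n
        using power_pairing_integrable(2)[OF p1 _ _ Lp[OF u2] Lp[OF g2(1)[of n]], where d=d] d dP n0[OF that] unfolding B_def P_def by simp
      then show "\<exists>n0. \<forall>n\<ge>n0. norm ((LINT x|lborel. B x * g n x) - 0) < e" by blast
    qed
    have CS: "(\<lambda>n. LINT x|lborel. f x * w n x) \<longlonglongrightarrow> 0"
      if f: "sq_integrable f" and w: "\<And>n. sq_integrable (w n)" "(\<lambda>n. sqnorm (w n)) \<longlonglongrightarrow> 0" for f :: "real ^ 'n \<Rightarrow> real" and w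
    proof (rule Lim_null_comparison)
      show "\<forall>\<^sub>F n in sequentially. norm (LINT x|lborel. f x * w n x) \<le> sqrt (sqnorm f) * sqrt (sqnorm (w n))"
        using Cauchy_Schwarz_real[OF f w(1)] by simp
      show "(\<lambda>n. sqrt (sqnorm f) * sqrt (sqnorm (w n))) \<longlonglongrightarrow> 0" using tendsto_mult_left[OF tendsto_real_sqrt[OF w(2)]] by simp
    qed
    have ellg: "ell (g n) = - ell \<phi>" for n
    proof -
      define w where "w = conv \<phi> (heat (t n))"
      note cw = H2_sq_integrable[OF c(1)[of n], folded w_def] H2_laplacian_sq_integrable[OF c(1)[of n], folded w_def]
      have g: "g n = (\<lambda>x. w x - \<phi> x)" unfolding g_def w_def ..
      have [measurable]: "w \<in> borel_measurable borel" "\<phi> \<in> borel_measurable borel" using cw s\<phi> by measurable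
      have l: "(LINT x|lborel. weak_laplacian u x * weak_laplacian (g n) x) = (LINT x|lborel. weak_laplacian u x * (weak_laplacian w x - weak_laplacian \<phi> x))"
      proof (rule integral_cong_AE)
        have [measurable]: "weak_laplacian (g n) \<in> borel_measurable borel" "weak_laplacian w \<in> borel_measurable borel" "weak_laplacian \<phi> \<in> borel_measurable borel"
          using sg(2) cw(2) s\<phi>(2) by measurable
        show "(\<lambda>x. weak_laplacian u x * weak_laplacian (g n) x) \<in> borel_measurable lborel" "(\<lambda>x. weak_laplacian u x * (weak_laplacian w x - weak_laplacian \<phi> x)) \<in> borel_measurable lborel"
          by measurable
        show "AE x in lborel. weak_laplacian u x * weak_laplacian (g n) x = weak_laplacian u x * (weak_laplacian w x - weak_laplacian \<phi> x)"
          using H2_diff(2)[OF c(1) \<phi>, of n] unfolding g w_def by eventually_elim simp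
      qed
      have "ell (g n) = ell w - ell \<phi>"
        unfolding ell_def l unfolding g right_diff_distrib
        using sq_integrable_mult[OF sD cw(2)] sq_integrable_mult[OF sD s\<phi>(2)] sq_integrable_mult[OF sD cw(1)] sq_integrable_mult[OF sD s\<phi>(1)]
          sq_integrable_mult[OF su cw(1)] sq_integrable_mult[OF su s\<phi>(1)] Bint[OF _ Lp[OF c(1)[of n], folded w_def]] Bint[OF _ Lp[OF \<phi>]]
        by (simp add: right_diff_distrib)
      then show ?thesis using smooth[OF \<phi> t, of n] by (simp add: w_def)
    qed
    have "(\<lambda>n. ell (g n)) \<longlonglongrightarrow> 0 + \<mu> * 0 - l * 0 - 0"
      unfolding ell_def by (intro tendsto_intros CS Bg sD su sg g0 gD)
    then show ?thesis unfolding ellg by (simp add: LIMSEQ_const_iff)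
  qed
  then show ?thesis unfolding solves_EL_iff[OF u2] ell_def B_def by simp
qed

section \<open>Minimizers\<close>

lemma H2_line:
  fixes u \<phi> :: "'a::euclidean_space \<Rightarrow> real"
  assumes u: "u \<in> H2" and \<phi>: "\<phi> \<in> H2"
  defines "D \<equiv> weak_laplacian u" and "E \<equiv> weak_laplacian \<phi>"
  shows "sqnorm (\<lambda>x. u x + t * \<phi> x) = sqnorm u + 2 * t * (LINT x|lborel. u x * \<phi> x) + t\<^sup>2 * sqnorm \<phi>"
    "sqnorm (weak_laplacian (\<lambda>x. u x + t * \<phi> x)) = sqnorm D + 2 * t * (LINT x|lborel. D x * E x) + t\<^sup>2 * sqnorm E"
    "sqnorm (weak_grad (\<lambda>x. u x + t * \<phi> x)) = sqnorm (weak_grad u) - 2 * t * (LINT x|lborel. D x * \<phi> x) + t\<^sup>2 * sqnorm (weak_grad \<phi>)"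
proof -
  note t\<phi> = H2_cmult[OF \<phi>, of t]
  note w = H2_add[OF u t\<phi>(1)]
  note s = H2_sq_integrable[OF u] H2_sq_integrable[OF \<phi>] H2_laplacian_sq_integrable[OF u, folded D_def] H2_laplacian_sq_integrable[OF \<phi>, folded E_def]
  have [measurable]: "u \<in> borel_measurable borel" "\<phi> \<in> borel_measurable borel" "D \<in> borel_measurable borel" "E \<in> borel_measurable borel"
    "weak_laplacian (\<lambda>x. u x + t * \<phi> x) \<in> borel_measurable borel"
    using s H2_laplacian_sq_integrable[OF w(1)] by measurable
  have L: "AE x in lborel. weak_laplacian (\<lambda>x. u x + t * \<phi> x) x = D x + t * E x"
    using w(2) t\<phi>(2) unfolding D_def E_def by eventually_elim simp
  have ex: "sqnorm (\<lambda>x. f x + t * g x) = sqnorm f + 2 * t * (LINT x|lborel. f x * g x) + t\<^sup>2 * sqnorm g"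
    if fg: "sq_integrable f" "sq_integrable g" for f g :: "'a \<Rightarrow> real"
  proof -
    have "sqnorm (\<lambda>x. f x + t * g x) = (LINT x|lborel. (f x)\<^sup>2 + 2 * t * (f x * g x) + t\<^sup>2 * (g x)\<^sup>2)"
      unfolding sqnorm_def by (simp add: power2_sum power_mult_distrib algebra_simps)
    then show ?thesis using fg sq_integrable_mult[OF fg] by (simp add: sq_integrable_def sqnorm_def)
  qed
  show "sqnorm (\<lambda>x. u x + t * \<phi> x) = sqnorm u + 2 * t * (LINT x|lborel. u x * \<phi> x) + t\<^sup>2 * sqnorm \<phi>" by (rule ex[OF s(1,2)])
  have "sqnorm (weak_laplacian (\<lambda>x. u x + t * \<phi> x)) = sqnorm (\<lambda>x. D x + t * E x)" by (rule sqnorm_cong_AE[OF _ _ L]) measurable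
  then show "sqnorm (weak_laplacian (\<lambda>x. u x + t * \<phi> x)) = sqnorm D + 2 * t * (LINT x|lborel. D x * E x) + t\<^sup>2 * sqnorm E"
    using ex[OF s(3,4)] by simp
  have i: "integrable lborel (\<lambda>x. u x * D x)" "integrable lborel (\<lambda>x. u x * E x)" "integrable lborel (\<lambda>x. D x * \<phi> x)" "integrable lborel (\<lambda>x. \<phi> x * E x)"
    by (intro sq_integrable_mult s)+
  have "sqnorm (weak_grad (\<lambda>x. u x + t * \<phi> x)) = - (LINT x|lborel. (u x + t * \<phi> x) * weak_laplacian (\<lambda>x. u x + t * \<phi> x) x)"
    by (rule sqnorm_weak_grad[OF w(1)])
  also have "(LINT x|lborel. (u x + t * \<phi> x) * weak_laplacian (\<lambda>x. u x + t * \<phi> x) x) = (LINT x|lborel. u x * D x + t * (u x * E x) + t * (D x * \<phi> x) + t\<^sup>2 * (\<phi> x * E x))"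
  proof (rule integral_cong_AE)
    show "AE x in lborel. (u x + t * \<phi> x) * weak_laplacian (\<lambda>x. u x + t * \<phi> x) x = u x * D x + t * (u x * E x) + t * (D x * \<phi> x) + t\<^sup>2 * (\<phi> x * E x)"
      using L by eventually_elim (simp add: algebra_simps power2_eq_square)
  qed measurable
  also have "\<dots> = (LINT x|lborel. u x * D x) + t * (LINT x|lborel. u x * E x) + t * (LINT x|lborel. D x * \<phi> x) + t\<^sup>2 * (LINT x|lborel. \<phi> x * E x)"
    using i by simp
  also have "(LINT x|lborel. u x * E x) = (LINT x|lborel. D x * \<phi> x)"
    unfolding D_def E_def by (rule H2_integral_by_parts(2)[OF u \<phi>, symmetric])
  finally show "sqnorm (weak_grad (\<lambda>x. u x + t * \<phi> x)) = sqnorm (weak_grad u) - 2 * t * (LINT x|lborel. D x * \<phi> x) + t\<^sup>2 * sqnorm (weak_grad \<phi>)"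
    unfolding sqnorm_weak_grad[OF u] sqnorm_weak_grad[OF \<phi>] D_def E_def by (simp add: algebra_simps)
qed

lemma H2_scale:
  fixes u :: "'a::euclidean_space \<Rightarrow> real"
  assumes u: "u \<in> H2" and p: "p > 0" and c: "c \<ge> 0"
  shows "sqnorm (weak_laplacian (\<lambda>x. c * u x)) = c\<^sup>2 * sqnorm (weak_laplacian u)"
    "sqnorm (weak_grad (\<lambda>x. c * u x)) = c\<^sup>2 * sqnorm (weak_grad u)"
    "Lnorm p (\<lambda>x. c * u x) powr p = c powr p * Lnorm p u powr p"
    "sqnorm (\<lambda>x. weak_laplacian (\<lambda>x. c * u x) x + m * (c * u x)) = c\<^sup>2 * sqnorm (\<lambda>x. weak_laplacian u x + m * u x)"
proof -
  note cu = H2_cmult[OF u, of c]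
  have [measurable]: "u \<in> borel_measurable borel" "weak_laplacian u \<in> borel_measurable borel" "weak_laplacian (\<lambda>x. c * u x) \<in> borel_measurable borel"
    using H2_sq_integrable[OF u] H2_laplacian_sq_integrable[OF u] H2_laplacian_sq_integrable[OF cu(1)] by measurable
  have "sqnorm (weak_laplacian (\<lambda>x. c * u x)) = sqnorm (\<lambda>x. c * weak_laplacian u x)"
    by (rule sqnorm_cong_AE[OF _ _ cu(2)]) measurable
  then show 1: "sqnorm (weak_laplacian (\<lambda>x. c * u x)) = c\<^sup>2 * sqnorm (weak_laplacian u)" by (simp add: sqnorm_cmult)
  have "sqnorm (\<lambda>x. weak_laplacian (\<lambda>x. c * u x) x + m * (c * u x)) = sqnorm (\<lambda>x. c * (weak_laplacian u x + m * u x))"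
    by (rule sqnorm_cong_AE) (measurable, use cu(2) in \<open>eventually_elim, simp add: algebra_simps\<close>)
  then show "sqnorm (\<lambda>x. weak_laplacian (\<lambda>x. c * u x) x + m * (c * u x)) = c\<^sup>2 * sqnorm (\<lambda>x. weak_laplacian u x + m * u x)"
    by (simp add: sqnorm_cmult)
  have "(LINT x|lborel. c * u x * weak_laplacian (\<lambda>x. c * u x) x) = (LINT x|lborel. c\<^sup>2 * (u x * weak_laplacian u x))"
    by (rule integral_cong_AE) (measurable, use cu(2) in \<open>eventually_elim, simp add: power2_eq_square\<close>)
  then show "sqnorm (weak_grad (\<lambda>x. c * u x)) = c\<^sup>2 * sqnorm (weak_grad u)"
    unfolding sqnorm_weak_grad[OF cu(1)] sqnorm_weak_grad[OF u] by simp
  show "Lnorm p (\<lambda>x. c * u x) powr p = c powr p * Lnorm p u powr p"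
    unfolding Lnorm_powr[OF p] using c by (simp add: abs_mult powr_mult)
qed

lemma H2_rad_line:
  assumes u: "u \<in> H2_rad" and \<phi>: "\<phi> \<in> H2_rad"
  shows "(\<lambda>x. c * (u x + t * \<phi> x)) \<in> H2_rad"
proof -
  have h: "u \<in> H2" "\<phi> \<in> H2" using u \<phi> by (auto simp: H2_rad_def)
  obtain f g where f: "AE x in lborel. u x = f (norm x)" "AE x in lborel. \<phi> x = g (norm x)" using u \<phi> by (auto simp: H2_rad_def)
  have "AE x in lborel. c * (u x + t * \<phi> x) = (\<lambda>r. c * (f r + t * g r)) (norm x)" using f by eventually_elim simp
  moreover have "(\<lambda>x. c * (u x + t * \<phi> x)) \<in> H2" by (intro H2_cmult(1) H2_add(1) h)
  ultimately show ?thesis unfolding H2_rad_def by (intro CollectI conjI exI[of _ "\<lambda>r. c * (f r + t * g r)"])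
qed

text \<open>The graph of the convex function |.|^p lies above its tangent at \<open>x\<close>.
  Integrated, it gives the one-sided bound on the p-norm that a minimality argument needs, in place
  of differentiating under the integral.\<close>

lemma powr_convex_tangent:
  fixes x y p :: real
  assumes p: "p > 2"
  shows "\<bar>x + y\<bar> powr p \<ge> \<bar>x\<bar> powr p + p * (\<bar>x\<bar> powr (p - 2) * x * y)"
proof -
  \<comment> \<open>Young's inequality for the exponents p and p / (p - 1), from Bernoulli's
    inequality for s / r: the function t^p - p t decreases up to its minimum at 1 and increases
    after it.\<close>
  have Y: "s powr p + (p - 1) * r powr p \<ge> p * (r powr (p - 1) * s)" if s: "s \<ge> 0" and r: "r \<ge> 0" for s r :: real
  proof (cases "r = 0")
    case False
    then have r: "r > 0" using r by simp
    have "1 + p * (s / r - 1) \<le> (s / r) powr p"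
    proof -
      define f where "f t = t powr p - p * t" for t :: real
      have "f 1 \<le> f (s / r)"
      proof (cases "s / r \<ge> 1")
        case True
        show ?thesis
        proof (rule DERIV_nonneg_imp_nondecreasing[OF True])
          fix t :: real assume t: "1 \<le> t" "t \<le> s / r"
          have "(f has_real_derivative p * t powr (p - 1) - p) (at t)" unfolding f_def[abs_def] using t
            by (intro DERIV_cong[OF DERIV_diff[OF has_real_derivative_powr DERIV_cmult_Id]]) auto
          moreover have "p * t powr (p - 1) - p \<ge> 0" using t p ge_one_powr_ge_zero[of t "p - 1"] by simp
          ultimately show "\<exists>y. (f has_real_derivative y) (at t) \<and> 0 \<le> y" by blast
        qed
      next
        case F: False
        show ?thesis
        proof (cases "s = 0")
          case True
          then show ?thesis using p by (simp add: f_def)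
        next
          case False
          then have s0: "0 < s / r" using s r by simp
          have le: "s / r \<le> 1" using F by simp
          show ?thesis
          proof (rule DERIV_nonpos_imp_nonincreasing[OF le])
            fix t :: real assume t: "s / r \<le> t" "t \<le> 1"
            have t0: "t > 0" using t s0 by linarith
            have "(f has_real_derivative p * t powr (p - 1) - p) (at t)" unfolding f_def[abs_def]
              by (intro DERIV_cong[OF DERIV_diff[OF has_real_derivative_powr[OF t0] DERIV_cmult_Id]]) auto
            moreover have "t powr (p - 1) \<le> 1" using t t0 p by (intro powr_le1) auto
            ultimately show "\<exists>y. (f has_real_derivative y) (at t) \<and> y \<le> 0" using p by (intro exI[of _ "p * t powr (p - 1) - p"]) (auto simp: mult_left_le)
          qed
        qed
      qed
      then show ?thesis by (simp add: f_def algebra_simps)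
    qed
    from mult_left_mono[OF this, of "r powr p"] have "r powr p * (1 + p * (s / r - 1)) \<le> s powr p"
      using r s by (simp add: powr_divide)
    moreover have "r powr p = r powr (p - 1) * r" using r by (simp add: powr_diff)
    then have "r powr p * (1 + p * (s / r - 1)) = p * (r powr (p - 1) * s) - (p - 1) * r powr p"
      using r by (simp add: field_simps)
    ultimately show ?thesis by linarith
  qed (use p in simp)
  show ?thesis
  proof (cases "x = 0")
    case False
    have e1: "\<bar>x\<bar> powr (p - 1) = \<bar>x\<bar> powr (p - 2) * \<bar>x\<bar>" "\<bar>x\<bar> powr p = \<bar>x\<bar> powr (p - 2) * \<bar>x\<bar> * \<bar>x\<bar>"
    proof -
      have "y powr (p - 1) = y powr (p - 2) * y" "y powr p = y powr (p - 2) * y * y" if "y > 0" for y :: real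
        using that by (simp_all add: powr_diff power2_eq_square)
      then show "\<bar>x\<bar> powr (p - 1) = \<bar>x\<bar> powr (p - 2) * \<bar>x\<bar>" "\<bar>x\<bar> powr p = \<bar>x\<bar> powr (p - 2) * \<bar>x\<bar> * \<bar>x\<bar>"
        using False by simp_all
    qed
    have "x * (x + y) \<le> \<bar>x\<bar> * \<bar>x + y\<bar>" by (metis abs_ge_self abs_mult)
    then have "\<bar>x\<bar> powr (p - 2) * (x * (x + y)) \<le> \<bar>x\<bar> powr (p - 2) * (\<bar>x\<bar> * \<bar>x + y\<bar>)" by (intro mult_left_mono) auto
    then have "p * (\<bar>x\<bar> powr (p - 2) * (x * (x + y))) \<le> p * (\<bar>x\<bar> powr (p - 1) * \<bar>x + y\<bar>)"
      using p unfolding e1(1) by (intro mult_left_mono) (simp_all add: mult.assoc)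
    also have "\<dots> \<le> \<bar>x + y\<bar> powr p + (p - 1) * \<bar>x\<bar> powr p" by (rule Y) auto
    finally have F: "p * (\<bar>x\<bar> powr (p - 2) * (x * (x + y))) \<le> \<bar>x + y\<bar> powr p + (p - 1) * \<bar>x\<bar> powr p" .
    have "\<bar>x\<bar> powr (p - 2) * (x * x) = \<bar>x\<bar> powr p" unfolding e1(2) by (simp add: mult.assoc flip: abs_mult)
    then have "p * (\<bar>x\<bar> powr (p - 2) * (x * (x + y))) = p * \<bar>x\<bar> powr p + p * (\<bar>x\<bar> powr (p - 2) * x * y)"
      by (simp only: distrib_left mult.assoc)
    then show ?thesis using F unfolding left_diff_distrib by linarith
  qed (use p in simp)
qed

text \<open>Along the normalised line through \<open>u\<close> in direction \<open>\<phi>\<close> the energy is bounded above, by convexity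
  of \<open>s \<mapsto> \<bar>s\<bar> powr p\<close>, by an explicit function of \<open>t\<close> which touches it at \<open>t = 0\<close>; the derivative
  of that function vanishes there.\<close>

lemma radial_Euler_Lagrange:
  fixes u :: "'a::euclidean_space \<Rightarrow> real"
  assumes u: "u \<in> H2_rad" and a: "a > 0" "sqnorm u = a\<^sup>2" and p: "p > 2"
    and Lp: "\<And>w :: 'a \<Rightarrow> real. w \<in> H2 \<Longrightarrow> integrable lborel (\<lambda>x. \<bar>w x\<bar> powr p)"
    and R: "sqnorm (weak_laplacian u) < r"
    and min: "\<And>w :: 'a \<Rightarrow> real. w \<in> H2_rad \<Longrightarrow> sqnorm w = a\<^sup>2 \<Longrightarrow> sqnorm (weak_laplacian w) < r \<Longrightarrow> energy p \<mu> u \<le> energy p \<mu> w"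
    and \<phi>: "\<phi> \<in> H2_rad"
  shows "(LINT x|lborel. weak_laplacian u x * weak_laplacian \<phi> x) + \<mu> * (LINT x|lborel. weak_laplacian u x * \<phi> x)
      - (sqnorm (weak_laplacian u) - \<mu> * sqnorm (weak_grad u) - Lnorm p u powr p) / a\<^sup>2 * (LINT x|lborel. u x * \<phi> x)
      = (LINT x|lborel. \<bar>u x\<bar> powr (p - 2) * u x * \<phi> x)"
proof -
  have h: "u \<in> H2" "\<phi> \<in> H2" using u \<phi> by (auto simp: H2_rad_def)
  have [measurable]: "u \<in> borel_measurable borel" "\<phi> \<in> borel_measurable borel" using h H2_sq_integrable by (auto intro: sq_integrableD)
  define k where "k = (LINT x|lborel. u x * \<phi> x)"
  define d0 where "d0 = sqnorm (weak_laplacian u)"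
  define d1 where "d1 = (LINT x|lborel. weak_laplacian u x * weak_laplacian \<phi> x)"
  define d2 where "d2 = sqnorm (weak_laplacian \<phi>)"
  define g0 where "g0 = sqnorm (weak_grad u)"
  define g1 where "g1 = (LINT x|lborel. weak_laplacian u x * \<phi> x)"
  define g2 where "g2 = sqnorm (weak_grad \<phi>)"
  define P where "P = Lnorm p u powr p"
  define B where "B = (LINT x|lborel. \<bar>u x\<bar> powr (p - 2) * u x * \<phi> x)"
  define n where "n t = a\<^sup>2 + 2 * t * k + t\<^sup>2 * sqnorm \<phi>" for t
  define D where "D t = d0 + 2 * t * d1 + t\<^sup>2 * d2" for t
  define q where "q t = 1/2 * (d0 + 2 * t * d1 + t\<^sup>2 * d2) - \<mu>/2 * (g0 - 2 * t * g1 + t\<^sup>2 * g2)" for t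
  define S where "S t = a\<^sup>2 / n t" for t
  \<comment> \<open>\<open>S t\<close> is the square of the factor that returns the line to the mass
    sphere. In \<open>F\<close> the p-norm is replaced by its tangent bound, so \<open>F\<close>
    dominates the energy and is an explicit differentiable function of \<open>t\<close>.\<close>
  define F where "F t = S t * q t - S t powr (p / 2) * (P / p + t * B)" for t
  have a2: "a\<^sup>2 > 0" using a by simp
  have n0: "n 0 = a\<^sup>2" by (simp add: n_def)
  have S0: "S 0 = 1" using a2 by (simp add: S_def n0)
  have dn: "(n has_real_derivative 2 * k) (at 0)" unfolding n_def[abs_def] by (auto intro!: derivative_eq_intros)
  have dS: "(S has_real_derivative - (2 * k / a\<^sup>2)) (at 0)"
    unfolding S_def[abs_def] using a2
    by (intro DERIV_cong[OF DERIV_divide[OF DERIV_const dn]]) (auto simp: n0 power2_eq_square)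
  have dq: "(q has_real_derivative d1 + \<mu> * g1) (at 0)" unfolding q_def[abs_def] by (auto intro!: derivative_eq_intros)
  have dSp: "((\<lambda>t. S t powr (p / 2)) has_real_derivative (p / 2) * (- (2 * k / a\<^sup>2))) (at 0)"
    by (rule DERIV_cong[OF DERIV_fun_powr[OF dS]]) (simp_all add: S0)
  have dl: "((\<lambda>t. P / p + t * B) has_real_derivative B) (at 0)" by (auto intro!: derivative_eq_intros)
  have dF: "(F has_real_derivative (- (2 * k / a\<^sup>2) * q 0 + (d1 + \<mu> * g1)) - ((p / 2) * (- (2 * k / a\<^sup>2)) * (P / p) + B)) (at 0)"
    unfolding F_def[abs_def]
    by (rule DERIV_cong[OF DERIV_diff[OF DERIV_mult[OF dS dq] DERIV_mult[OF dSp dl]]]) (simp add: S0)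
  have cS: "isCont S 0" "isCont n 0" using dS dn by (auto intro: DERIV_isCont)
  have "isCont (\<lambda>t. S t * D t) 0" unfolding D_def by (intro continuous_intros cS)
  then have t1: "((\<lambda>t. S t * D t) \<longlongrightarrow> d0) (at 0)" unfolding isCont_def by (simp add: S0 D_def)
  have t2: "(n \<longlongrightarrow> a\<^sup>2) (at 0)" using cS(2) unfolding isCont_def n0 .
  \<comment> \<open>The bound on the Laplacian is an open condition and survives for small
    \<open>t\<close>, so the normalised line stays admissible.\<close>
  have "\<forall>\<^sub>F t in at 0. S t * D t < r" using order_tendstoD(2)[OF t1] R unfolding d0_def by blast
  moreover have "\<forall>\<^sub>F t in at 0. n t > 0" using order_tendstoD(1)[OF t2 a2] .
  ultimately have "\<forall>\<^sub>F t in at 0. S t * D t < r \<and> n t > 0" by eventually_elim simp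
  then obtain e where e: "e > 0" "\<And>t. t \<noteq> 0 \<Longrightarrow> \<bar>t\<bar> < e \<Longrightarrow> S t * D t < r \<and> n t > 0"
    unfolding eventually_at by (auto simp: dist_real_def)
  have E0: "energy p \<mu> u = F 0"
    unfolding energy_def Lnorm_2_squared F_def q_def S0 P_def d0_def g0_def by simp
  have "F 0 \<le> F t" if t: "\<bar>0 - t\<bar> < e" for t
  proof (cases "t = 0")
    case False
    with e(2)[of t] t have t: "S t * D t < r" "n t > 0" by auto
    define w where "w x = u x + t * \<phi> x" for x
    define c where "c = sqrt (S t)"
    have S: "S t > 0" using t(2) a2 by (simp add: S_def)
    have c: "c > 0" "c\<^sup>2 = S t" using S by (auto simp: c_def)
    have cp: "c powr p = S t powr (p / 2)" using S by (simp add: c_def powr_half_sqrt[symmetric] powr_powr)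
    have w2: "w \<in> H2" unfolding w_def by (intro H2_add(1) H2_cmult(1) h)
    note L = H2_line[OF h, of t, folded w_def]
    have wn: "sqnorm w = n t" unfolding L(1) n_def k_def a(2) ..
    have wD: "sqnorm (weak_laplacian w) = D t" unfolding L(2) D_def d0_def d1_def d2_def ..
    have wg: "sqnorm (weak_grad w) = g0 - 2 * t * g1 + t\<^sup>2 * g2" unfolding L(3) g0_def g1_def g2_def ..
    have z1: "(\<lambda>x. c * w x) \<in> H2_rad" unfolding w_def by (rule H2_rad_line[OF u \<phi>])
    have z2: "sqnorm (\<lambda>x. c * w x) = a\<^sup>2" unfolding sqnorm_cmult c(2) wn S_def using t(2) by simp
    have p0: "p > 0" and c0: "c \<ge> 0" using p c by auto
    note Z = H2_scale[OF w2 p0 c0]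
    have z3: "sqnorm (weak_laplacian (\<lambda>x. c * w x)) < r" unfolding Z(1) c(2) wD by (rule t(1))
    have Pw: "P + p * (t * B) \<le> Lnorm p w powr p"
    proof -
      note I = power_pairing_integrable(1)[OF _ _ _ Lp[OF h(1)] Lp[OF h(2)]]
      have "P + p * (t * B) = (LINT x|lborel. \<bar>u x\<bar> powr p + p * (\<bar>u x\<bar> powr (p - 2) * u x * (t * \<phi> x)))"
        using I Lp[OF h(1)] p by (simp add: P_def B_def Lnorm_powr[OF p0] mult.left_commute[of _ t])
      also have "\<dots> \<le> (LINT x|lborel. \<bar>w x\<bar> powr p)"
      proof (rule integral_mono)
        have "integrable lborel (\<lambda>x. (p * t) * (\<bar>u x\<bar> powr (p - 2) * u x * \<phi> x))" using I p by simp
        then have "integrable lborel (\<lambda>x. p * (\<bar>u x\<bar> powr (p - 2) * u x * (t * \<phi> x)))" by (simp add: mult_ac)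
        then show "integrable lborel (\<lambda>x. \<bar>u x\<bar> powr p + p * (\<bar>u x\<bar> powr (p - 2) * u x * (t * \<phi> x)))" using Lp[OF h(1)] by simp
        show "integrable lborel (\<lambda>x. \<bar>w x\<bar> powr p)" by (rule Lp[OF w2])
        show "\<bar>u x\<bar> powr p + p * (\<bar>u x\<bar> powr (p - 2) * u x * (t * \<phi> x)) \<le> \<bar>w x\<bar> powr p" for x
          unfolding w_def by (rule powr_convex_tangent[OF p])
      qed
      finally show ?thesis unfolding Lnorm_powr[OF p0] by simp
    qed
    have "F 0 \<le> energy p \<mu> (\<lambda>x. c * w x)" unfolding E0[symmetric] by (rule min[OF z1 z2 z3])
    also have "\<dots> = S t * q t - S t powr (p / 2) * (Lnorm p w powr p / p)"
      unfolding energy_def Lnorm_2_squared Z c(2) wD wg cp q_def D_def by (simp add: algebra_simps)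
    also have "\<dots> \<le> S t * q t - S t powr (p / 2) * ((P + p * (t * B)) / p)"
      using Pw p by (intro diff_left_mono mult_left_mono divide_right_mono) auto
    also have "\<dots> = F t" using p by (simp add: F_def add_divide_distrib)
    finally show ?thesis .
  qed simp
  then have "(- (2 * k / a\<^sup>2) * q 0 + (d1 + \<mu> * g1)) - ((p / 2) * (- (2 * k / a\<^sup>2)) * (P / p) + B) = 0"
    using DERIV_local_min[OF dF e(1)] by blast
  \<comment> \<open>The derivative of the normalising factor is what produces the multiplier: it
    multiplies twice \<open>q 0\<close> and subtracts \<open>P\<close>, that is, it yields d0 -
    \<mu> g0 - P over the mass.\<close>
  moreover have "(p / 2) * (- (2 * k / a\<^sup>2)) * (P / p) = - (k / a\<^sup>2 * P)" using p by simp
  moreover have "(d0 - \<mu> * g0 - P) / a\<^sup>2 * k = 2 * k / a\<^sup>2 * q 0 - k / a\<^sup>2 * P"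
    using a2 by (simp add: q_def field_simps)
  moreover have "Z - V = B" if "- (2 * k / a\<^sup>2) * Q + Z - (W + B) = 0" "W = - X" "V = 2 * k / a\<^sup>2 * Q - X" for Q W X V Z
    using that unfolding mult_minus_left by linarith
  ultimately have "d1 + \<mu> * g1 - (d0 - \<mu> * g0 - P) / a\<^sup>2 * k = B" by blast
  then show ?thesis unfolding d1_def g1_def d0_def g0_def P_def B_def k_def .
qed

text \<open>Everything is read off from p \<gamma>_p = N (p - 2) / 4: exceeding 2 means being above
  the mass-critical exponent, staying below \<open>p\<close> means being Sobolev
  subcritical.\<close>

lemma exponent_bounds:
  assumes N: "N \<ge> 5" and p: "p_bar N < p" "p < crit_exp N"
  shows "p > 2" "p * gamma_exp N p > 2" "p * gamma_exp N p < p"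
proof -
  have n: "real N \<ge> 5" using N by simp
  show p2: "p > 2"
  proof -
    have "8 / real N \<ge> 0" using n by simp
    then show ?thesis using p(1) unfolding p_bar_def by linarith
  qed
  have s: "p * gamma_exp N p = real N * (p - 2) / 4" using p2 by (simp add: gamma_exp_def)
  have "8 / real N < p - 2" using p(1) by (simp add: p_bar_def)
  then show "p * gamma_exp N p > 2" using n unfolding s by (simp add: field_simps)
  have "p * (real N - 4) < 2 * real N" using p(2) n by (simp add: crit_exp_def field_simps)
  then show "p * gamma_exp N p < p" unfolding s by (simp add: algebra_simps)
qed

section \<open>Gagliardo--Nirenberg bounds and the minimal energy\<close>

lemma Lspace_integrable: "u \<in> Lspace p \<Longrightarrow> integrable lborel (\<lambda>x. norm (u x) powr p)"
  by (simp add: Lspace_def)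

lemma GN_bound:
  fixes w :: "'a::euclidean_space \<Rightarrow> real"
  assumes GN: "GN_constant TYPE('a) p C" and p: "p > 0" and w: "w \<in> H2"
  defines "s \<equiv> p * gamma_exp DIM('a) p"
  shows "integrable lborel (\<lambda>x. \<bar>w x\<bar> powr p)"
    "Lnorm p w powr p \<le> C powr p * sqrt (sqnorm w) powr (p - s) * sqrt (sqnorm (weak_laplacian w)) powr s"
proof -
  have "w \<in> Lspace p \<and> Lnorm p w powr p \<le> C powr p * Lnorm 2 w powr (p * (1 - gamma_exp DIM('a) p)) * Lnorm 2 (weak_laplacian w) powr (p * gamma_exp DIM('a) p)"
    using GN w unfolding GN_constant_def by blast
  then have 1: "w \<in> Lspace p" and 2: "Lnorm p w powr p \<le> C powr p * Lnorm 2 w powr (p * (1 - gamma_exp DIM('a) p)) * Lnorm 2 (weak_laplacian w) powr (p * gamma_exp DIM('a) p)" by auto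
  show "integrable lborel (\<lambda>x. \<bar>w x\<bar> powr p)" using Lspace_integrable[OF 1] by simp
  show "Lnorm p w powr p \<le> C powr p * sqrt (sqnorm w) powr (p - s) * sqrt (sqnorm (weak_laplacian w)) powr s"
    using 2 unfolding Lnorm_2_eq s_def right_diff_distrib by simp
qed

lemma GN_tendsto_0:
  fixes w :: "nat \<Rightarrow> 'a::euclidean_space \<Rightarrow> real"
  assumes GN: "GN_constant TYPE('a) p C" and p: "p > 0" and s: "p * gamma_exp DIM('a) p > 0" "p * gamma_exp DIM('a) p < p"
    and w: "\<And>n. w n \<in> H2" and 0: "(\<lambda>n. sqnorm (w n)) \<longlonglongrightarrow> 0" "(\<lambda>n. sqnorm (weak_laplacian (w n))) \<longlonglongrightarrow> 0"
  shows "(\<lambda>n. LINT x|lborel. \<bar>w n x\<bar> powr p) \<longlonglongrightarrow> 0"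
proof (rule Lim_null_comparison)
  define s where "s = p * gamma_exp DIM('a) p"
  have "norm (LINT x|lborel. \<bar>w n x\<bar> powr p) \<le> C powr p * sqrt (sqnorm (w n)) powr (p - s) * sqrt (sqnorm (weak_laplacian (w n))) powr s" for n
    using GN_bound(2)[OF GN p w[of n]] unfolding Lnorm_powr[OF p] s_def by simp
  then show "\<forall>\<^sub>F n in sequentially. norm (LINT x|lborel. \<bar>w n x\<bar> powr p) \<le> C powr p * sqrt (sqnorm (w n)) powr (p - s) * sqrt (sqnorm (weak_laplacian (w n))) powr s"
    by simp
  have r: "(\<lambda>n. sqrt (sqnorm (w n))) \<longlonglongrightarrow> 0" "(\<lambda>n. sqrt (sqnorm (weak_laplacian (w n)))) \<longlonglongrightarrow> 0"
    using 0[THEN tendsto_real_sqrt] by simp_all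
  have ps: "p - s > 0" "s > 0" using s by (simp_all add: s_def)
  have "(\<lambda>n. C powr p * sqrt (sqnorm (w n)) powr (p - s) * sqrt (sqnorm (weak_laplacian (w n))) powr s) \<longlonglongrightarrow> C powr p * 0 * 0"
    by (intro tendsto_mult tendsto_const tendsto_zero_powrI[OF r(1) tendsto_const _ ps(1)] tendsto_zero_powrI[OF r(2) tendsto_const _ ps(2)]) simp_all
  then show "(\<lambda>n. C powr p * sqrt (sqnorm (w n)) powr (p - s) * sqrt (sqnorm (weak_laplacian (w n))) powr s) \<longlonglongrightarrow> 0" by simp
qed

text \<open>Reverse triangle inequality around -m u. It gives admissibility of near-eigenfunctions,
  and for minimizers the limit of the quotient of the two norms.\<close>

lemma laplacian_norm_near:
  fixes u :: "'a::euclidean_space \<Rightarrow> real"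
  assumes u: "u \<in> H2" and m: "m \<ge> 0"
  shows "\<bar>sqrt (sqnorm (weak_laplacian u)) - m * sqrt (sqnorm u)\<bar> \<le> sqrt (sqnorm (\<lambda>x. weak_laplacian u x + m * u x))"
proof -
  have "\<bar>sqrt (sqnorm (weak_laplacian u)) - sqrt (sqnorm (\<lambda>x. (- m) * u x))\<bar> \<le> sqrt (sqnorm (\<lambda>x. weak_laplacian u x - (- m) * u x))"
    by (intro sqnorm_triangle_diff sq_integrable_cmult H2_sq_integrable[OF u] H2_laplacian_sq_integrable[OF u])
  then show ?thesis using m unfolding sqnorm_cmult by (simp add: real_sqrt_mult)
qed

lemma A_rad_iff: "u \<in> A_rad p C a \<mu> \<longleftrightarrow> u \<in> H2_rad \<and> sqnorm u = a\<^sup>2 \<and> sqrt (sqnorm (weak_laplacian u)) < R0 DIM('a) p C a \<mu>"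
  for u :: "'a::euclidean_space \<Rightarrow> real"
  by (auto simp: A_rad_def mass_sphere_def Lnorm_2_eq H2_rad_def)

text \<open>The exponents p - s and s of the two norms add up to \<open>p\<close>, so bounds linear
  in \<open>a\<close> for both norms give a^p. It is stated for the whole admissible set because it
  also bounds the energy from below there.\<close>

lemma A_rad_power_bound:
  fixes w :: "'a::euclidean_space \<Rightarrow> real" and p C a \<mu> :: real
  defines "s \<equiv> p * gamma_exp DIM('a) p"
  assumes GN: "GN_constant TYPE('a) p C" and p: "p > 0" "s > 2" and a: "a > 0" and \<mu>: "\<mu> > 0"
    and cond: "\<mu> powr (s - 2) * a powr (p - 2) < C_tilde DIM('a) p C" and w: "w \<in> A_rad p C a \<mu>"
  shows "Lnorm p w powr p \<le> C powr p * (\<mu> * (s - 1) / (s - 2)) powr s * a powr p"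
proof -
  have C: "C > 0" using GN by (simp add: GN_constant_def)
  define t where "t = \<mu> * (s - 1) / (s - 2)"
  have t: "t > 0" using \<mu> p by (simp add: t_def)
  have w': "w \<in> H2" "sqrt (sqnorm w) = a" "sqrt (sqnorm (weak_laplacian w)) \<le> t * a"
    using w R0_bounds(2)[OF p(2)[unfolded s_def] p(1) C a \<mu> cond[unfolded s_def]] a
    by (auto simp: A_rad_iff H2_rad_def t_def s_def)
  have "Lnorm p w powr p \<le> C powr p * a powr (p - s) * sqrt (sqnorm (weak_laplacian w)) powr s"
    using GN_bound(2)[OF GN p(1) w'(1)] by (simp only: w'(2) s_def)
  also have "\<dots> \<le> C powr p * a powr (p - s) * (t * a) powr s"
    using w'(3) p by (intro mult_left_mono powr_mono2) auto
  also have "\<dots> = C powr p * t powr s * (a powr (p - s) * a powr s)" using t a by (simp add: powr_mult)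
  also have "a powr (p - s) * a powr s = a powr p" by (simp flip: powr_add)
  finally show ?thesis by (simp add: t_def)
qed

text \<open>The real-valued infimum is a lower bound only for sets that are bounded below.
  Boundedness comes from dropping the completed square and controlling the p-norm on the admissible
  set.\<close>

lemma m_rad_le:
  fixes w :: "'a::euclidean_space \<Rightarrow> real" and p C a \<mu> :: real
  defines "s \<equiv> p * gamma_exp DIM('a) p"
  assumes GN: "GN_constant TYPE('a) p C" and p: "p > 0" "s > 2" and a: "a > 0" and \<mu>: "\<mu> > 0"
    and cond: "\<mu> powr (s - 2) * a powr (p - 2) < C_tilde DIM('a) p C" and w: "w \<in> A_rad p C a \<mu>"
  shows "m_rad TYPE('a) p C a \<mu> \<le> energy p \<mu> w"
  unfolding m_rad_def
proof (rule cINF_lower[OF _ w])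
  define K where "K = C powr p * (\<mu> * (s - 1) / (s - 2)) powr s * a powr p"
  have "- (\<mu>\<^sup>2 / 8 * a\<^sup>2) - 1 / p * K \<le> energy p \<mu> z" if z: "z \<in> A_rad p C a \<mu>" for z :: "'a \<Rightarrow> real"
  proof -
    have "Lnorm p z powr p \<le> K"
      unfolding K_def s_def by (rule A_rad_power_bound[OF GN p(1) p(2)[unfolded s_def] a \<mu> cond[unfolded s_def] z])
    then have "1 / p * Lnorm p z powr p \<le> 1 / p * K" using p by (intro mult_left_mono) auto
    moreover have z': "z \<in> H2" "sqnorm z = a\<^sup>2" using z by (auto simp: A_rad_iff H2_rad_def)
    moreover have "sqnorm (\<lambda>x. weak_laplacian z x + \<mu>/2 * z x) \<ge> 0" by (rule sqnorm_nonneg)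
    ultimately show ?thesis using energy_eq[OF z'(1), of p \<mu>, unfolded z'(2)] by linarith
  qed
  then show "bdd_below (energy p \<mu> ` (A_rad p C a \<mu> :: ('a \<Rightarrow> real) set))" by (rule bdd_belowI2)
qed

lemma m_rad_upper_bound:
  fixes p C a \<mu> :: real
  defines "s \<equiv> p * gamma_exp DIM('a::euclidean_space) p"
  assumes GN: "GN_constant TYPE('a) p C" and p: "p > 0" "s > 2" and a: "a > 0" and \<mu>: "\<mu> > 0"
    and cond: "\<mu> powr (s - 2) * a powr (p - 2) < C_tilde DIM('a) p C"
  shows "m_rad TYPE('a) p C a \<mu> \<le> - (\<mu>\<^sup>2 * a\<^sup>2 / 8)"
proof (rule field_le_epsilon)
  fix d :: real assume d: "d > 0"
  \<comment> \<open>The first bound keeps the shifted Laplacian below \<mu> a / 2 in norm, so the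
    Laplacian itself is at most \<mu> a and the function is admissible; the second keeps the surplus
    energy e a^2 / 2 below \<open>d\<close>.\<close>
  define e where "e = min ((\<mu> / 2)\<^sup>2) (2 * d / a\<^sup>2)"
  have e: "e > 0" "e \<le> (\<mu> / 2)\<^sup>2" "e \<le> 2 * d / a\<^sup>2" using d a \<mu> by (auto simp: e_def)
  have C: "C > 0" using GN by (simp add: GN_constant_def)
  have m: "\<mu> / 2 > 0" using \<mu> by simp
  obtain w :: "'a \<Rightarrow> real" where w: "w \<in> H2_rad" "sqnorm w > 0" "sqnorm (\<lambda>x. weak_laplacian w x + \<mu> / 2 * w x) \<le> e * sqnorm w"
    using near_eigenfunction[OF m e(1), where 'a='a] by blast
  have w2: "w \<in> H2" using w by (simp add: H2_rad_def)
  define c where "c = a / sqrt (sqnorm w)"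
  have c: "c \<ge> 0" "c\<^sup>2 * sqnorm w = a\<^sup>2" using w(2) a by (auto simp: c_def power_divide)
  define u where "u x = c * w x" for x
  have ur: "u \<in> H2_rad" using H2_rad_line[OF w(1) w(1), of c 0] by (simp add: u_def[abs_def])
  then have u2: "u \<in> H2" by (simp add: H2_rad_def)
  have un: "sqnorm u = a\<^sup>2" using c(2) by (simp add: u_def[abs_def] sqnorm_cmult)
  have "sqnorm (\<lambda>x. weak_laplacian u x + \<mu> / 2 * u x) = c\<^sup>2 * sqnorm (\<lambda>x. weak_laplacian w x + \<mu> / 2 * w x)"
    unfolding u_def[abs_def] by (rule H2_scale(4)[OF w2 p(1) c(1)])
  also have "\<dots> \<le> c\<^sup>2 * (e * sqnorm w)" using w(3) by (intro mult_left_mono) auto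
  also have "\<dots> = e * (c\<^sup>2 * sqnorm w)" by simp
  finally have D: "sqnorm (\<lambda>x. weak_laplacian u x + \<mu> / 2 * u x) \<le> e * a\<^sup>2" by (simp only: c(2))
  also have "\<dots> \<le> (\<mu> / 2)\<^sup>2 * a\<^sup>2" using e by (intro mult_right_mono) auto
  also have "\<dots> = (\<mu> / 2 * a)\<^sup>2" by (rule power_mult_distrib[symmetric])
  finally have "sqrt (sqnorm (\<lambda>x. weak_laplacian u x + \<mu> / 2 * u x)) \<le> \<mu> / 2 * a" using \<mu> a by (intro real_le_lsqrt) auto
  moreover have "\<bar>sqrt (sqnorm (weak_laplacian u)) - \<mu> / 2 * a\<bar> \<le> sqrt (sqnorm (\<lambda>x. weak_laplacian u x + \<mu> / 2 * u x))"
    using laplacian_norm_near[OF u2, of "\<mu> / 2"] m a by (simp add: un)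
  ultimately have "sqrt (sqnorm (weak_laplacian u)) \<le> \<mu> * a" by linarith
  also have "\<dots> < R0 DIM('a) p C a \<mu>"
    by (rule R0_bounds(1)[OF p(2)[unfolded s_def] p(1) C a \<mu> cond[unfolded s_def]])
  finally have "u \<in> A_rad p C a \<mu>" using ur un by (simp add: A_rad_iff)
  then have "m_rad TYPE('a) p C a \<mu> \<le> energy p \<mu> u" by (rule m_rad_le[OF GN p(1) p(2)[unfolded s_def] a \<mu> cond[unfolded s_def]])
  moreover have "1 / p * Lnorm p u powr p \<ge> 0" using p by simp
  moreover have "e * a\<^sup>2 \<le> 2 * d" using e(3) a by (simp add: field_simps)
  moreover have "\<mu>\<^sup>2 / 8 * sqnorm u = \<mu>\<^sup>2 * a\<^sup>2 / 8" by (simp add: un)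
  ultimately show "m_rad TYPE('a) p C a \<mu> \<le> - (\<mu>\<^sup>2 * a\<^sup>2 / 8) + d" using energy_eq[OF u2, of p \<mu>] D by linarith
qed

text \<open>Strict positivity is what makes the \<epsilon> of the energy bound positive and puts the
  multiplier strictly below its limit. A vanishing p-norm would force the function to be 0 a.e.,
  against its mass.\<close>

lemma Lnorm_pos:
  fixes w :: "'a::euclidean_space \<Rightarrow> real"
  assumes w: "sq_integrable w" "sqnorm w > 0" and p: "p > 0" and i: "integrable lborel (\<lambda>x. \<bar>w x\<bar> powr p)"
  shows "Lnorm p w powr p > 0"
proof (rule ccontr)
  assume "\<not> ?thesis"
  moreover have "Lnorm p w powr p = (LINT x|lborel. \<bar>w x\<bar> powr p)" unfolding Lnorm_powr[OF p] by simp
  moreover have "(LINT x|lborel. \<bar>w x\<bar> powr p) \<ge> 0" by simp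
  ultimately have "(LINT x|lborel. \<bar>w x\<bar> powr p) = 0" by linarith
  then have "AE x in lborel. \<bar>w x\<bar> powr p = 0" using integral_nonneg_eq_0_iff_AE[OF i] by simp
  then have "AE x in lborel. w x = 0" by eventually_elim simp
  then have "sqnorm w = sqnorm (\<lambda>x::'a. 0 :: real)" using w by (intro sqnorm_cong_AE) auto
  then show False using w(2) by (simp add: sqnorm_def)
qed

text \<open>The energy identity is read in two ways: dropping the square bounds the minimum from
  below, and comparison with the upper bound for the minimum forces the square itself to be at most
  2 P / p. The last identity is twice the energy, whose p-norm term has coefficient 2 / p instead of
  1.\<close>

lemma minimizer_estimates:
  fixes u :: "'a::euclidean_space \<Rightarrow> real" and p C a \<mu> :: real
  defines "s \<equiv> p * gamma_exp DIM('a) p" and "P \<equiv> Lnorm p u powr p"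
  assumes GN: "GN_constant TYPE('a) p C" and p: "p > 0" "s > 2" and a: "a > 0" and \<mu>: "\<mu> > 0"
    and cond: "\<mu> powr (s - 2) * a powr (p - 2) < C_tilde DIM('a) p C"
    and u: "u \<in> A_rad p C a \<mu>" and E: "energy p \<mu> u = m_rad TYPE('a) p C a \<mu>"
  shows "P > 0" "- (\<mu>\<^sup>2 * a\<^sup>2 / 8) - P / p \<le> m_rad TYPE('a) p C a \<mu>"
    "sqnorm (\<lambda>x. weak_laplacian u x + \<mu> / 2 * u x) \<le> 2 * P / p"
    "sqnorm (weak_laplacian u) - \<mu> * sqnorm (weak_grad u) - P = 2 * m_rad TYPE('a) p C a \<mu> - (1 - 2 / p) * P"
proof -
  have u': "u \<in> H2" "sqnorm u = a\<^sup>2" using u by (auto simp: A_rad_iff H2_rad_def)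
  show P: "P > 0" unfolding P_def
    using u' a by (intro Lnorm_pos H2_sq_integrable p GN_bound(1)[OF GN p(1)]) auto
  have e: "m_rad TYPE('a) p C a \<mu> = 1/2 * sqnorm (\<lambda>x. weak_laplacian u x + \<mu>/2 * u x) - \<mu>\<^sup>2 * a\<^sup>2 / 8 - P / p"
    using energy_eq[OF u'(1), of p \<mu>] by (simp add: E u' P_def)
  moreover have "sqnorm (\<lambda>x. weak_laplacian u x + \<mu>/2 * u x) \<ge> 0" by (rule sqnorm_nonneg)
  ultimately show "- (\<mu>\<^sup>2 * a\<^sup>2 / 8) - P / p \<le> m_rad TYPE('a) p C a \<mu>" by linarith
  have "m_rad TYPE('a) p C a \<mu> \<le> - (\<mu>\<^sup>2 * a\<^sup>2 / 8)"
    by (rule m_rad_upper_bound[OF GN p(1) p(2)[unfolded s_def] a \<mu> cond[unfolded s_def]])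
  then show "sqnorm (\<lambda>x. weak_laplacian u x + \<mu> / 2 * u x) \<le> 2 * P / p" using e by linarith
  show "sqnorm (weak_laplacian u) - \<mu> * sqnorm (weak_grad u) - P = 2 * m_rad TYPE('a) p C a \<mu> - (1 - 2 / p) * P"
    unfolding E[symmetric] energy_def Lnorm_2_squared P_def using p by (simp add: algebra_simps)
qed

lemma minimizer_Euler_Lagrange:
  fixes u :: "real ^ 'n \<Rightarrow> real" and p C a \<mu> :: real
  defines "s \<equiv> p * gamma_exp DIM(real ^ 'n) p"
  assumes GN: "GN_constant TYPE(real ^ 'n) p C" and p: "p > 2" "s > 2" "s < p" and a: "a > 0" and \<mu>: "\<mu> > 0"
    and cond: "\<mu> powr (s - 2) * a powr (p - 2) < C_tilde DIM(real ^ 'n) p C"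
    and u: "u \<in> A_rad p C a \<mu>" and E: "energy p \<mu> u = m_rad TYPE(real ^ 'n) p C a \<mu>"
  shows "\<exists>!l. solves_EL p \<mu> l u"
    "lagrange_multiplier p \<mu> u = (sqnorm (weak_laplacian u) - \<mu> * sqnorm (weak_grad u) - Lnorm p u powr p) / a\<^sup>2"
proof -
  have p0: "p > 0" using p by simp
  have C: "C > 0" using GN by (simp add: GN_constant_def)
  have u': "u \<in> H2_rad" "u \<in> H2" "sqnorm u = a\<^sup>2" using u by (auto simp: A_rad_iff H2_rad_def)
  define R where "R = R0 DIM(real ^ 'n) p C a \<mu>"
  have "\<mu> * a < R" unfolding R_def by (rule R0_bounds(1)[OF p(2)[unfolded s_def] p0 C a \<mu> cond[unfolded s_def]])
  then have R: "R > 0" using mult_pos_pos[OF \<mu> a] by linarith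
  \<comment> \<open>The admissible set bounds the norm of the Laplacian, the variational lemma its
    square; positivity of \<open>R\<close> makes the two equivalent.\<close>
  have R_iff: "sqrt x < R \<longleftrightarrow> x < R\<^sup>2" for x using R by (metis less_eq_real_def real_sqrt_less_iff real_sqrt_unique)
  define l where "l = (sqnorm (weak_laplacian u) - \<mu> * sqnorm (weak_grad u) - Lnorm p u powr p) / a\<^sup>2"
  note Lp = GN_bound(1)[OF GN p0]
  have sol: "solves_EL p \<mu> l u"
  proof (rule symmetric_criticality[OF u'(1) _ Lp])
    show "p \<ge> 2" using p by simp
    show "(\<lambda>n. LINT x|lborel. \<bar>w n x\<bar> powr p) \<longlonglongrightarrow> 0"
      if "\<And>n. w n \<in> H2" "(\<lambda>n. sqnorm (w n)) \<longlonglongrightarrow> 0" "(\<lambda>n. sqnorm (weak_laplacian (w n))) \<longlonglongrightarrow> 0" for w :: "nat \<Rightarrow> real ^ 'n \<Rightarrow> real"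
      using p s_def by (intro GN_tendsto_0[OF GN p0 _ _ that]) auto
    show "(LINT x|lborel. weak_laplacian u x * weak_laplacian \<phi> x) + \<mu> * (LINT x|lborel. weak_laplacian u x * \<phi> x) - l * (LINT x|lborel. u x * \<phi> x)
        = (LINT x|lborel. \<bar>u x\<bar> powr (p - 2) * u x * \<phi> x)" if \<phi>: "\<phi> \<in> H2_rad" for \<phi>
      unfolding l_def
    proof (rule radial_Euler_Lagrange[OF u'(1) a u'(3) p(1) Lp _ _ \<phi>])
      show "sqnorm (weak_laplacian u) < R\<^sup>2" using u R_iff unfolding A_rad_iff R_def by blast
      show "energy p \<mu> u \<le> energy p \<mu> w" if "w \<in> H2_rad" "sqnorm w = a\<^sup>2" "sqnorm (weak_laplacian w) < R\<^sup>2" for w :: "real ^ 'n \<Rightarrow> real"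
      proof -
        have "w \<in> A_rad p C a \<mu>" using that R_iff unfolding A_rad_iff R_def by blast
        then show ?thesis unfolding E by (rule m_rad_le[OF GN p0 p(2)[unfolded s_def] a \<mu> cond[unfolded s_def]])
      qed
    qed
  qed
  \<comment> \<open>Testing both equations with \<open>u\<close> itself leaves the difference of the
    multipliers times the mass, and the mass is positive.\<close>
  have uniq: "l' = l" if "solves_EL p \<mu> l' u" for l'
  proof -
    have I: "(LINT x|lborel. u x * u x) = a\<^sup>2" using u'(3) by (simp add: sqnorm_def power2_eq_square)
    have "l' * a\<^sup>2 = l * a\<^sup>2"
      using bspec[OF that[unfolded solves_EL_def] u'(2)] bspec[OF sol[unfolded solves_EL_def] u'(2)] unfolding I by linarith
    then show ?thesis using a by simp
  qed
  show "\<exists>!l. solves_EL p \<mu> l u" using sol uniq by blast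
  show "lagrange_multiplier p \<mu> u = (sqnorm (weak_laplacian u) - \<mu> * sqnorm (weak_grad u) - Lnorm p u powr p) / a\<^sup>2"
    unfolding lagrange_multiplier_def l_def[symmetric] by (rule the_equality[where P="\<lambda>l. solves_EL p \<mu> l u", OF sol uniq])
qed

theorem theorem1p2:
  fixes N :: nat and p \<mu> C :: real
    and a :: "nat \<Rightarrow> real"
    and u v :: "nat \<Rightarrow> real ^ 'n \<Rightarrow> real"
  assumes "N = CARD('n)" and "N \<ge> 5"
    and "p_bar N < p" and "p < min 4 (crit_exp N)"
    and "\<mu> > 0"
    and "GN_constant TYPE(real ^ 'n) p C"
    and "\<And>k. a k > 0" and "a \<longlonglongrightarrow> 0"
    and "\<And>k. \<mu> powr (p * gamma_exp N p - 2) * a k powr (p - 2) < C_tilde N p C"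
    and "\<And>k. u k \<in> A_rad p C (a k) \<mu>"
    and "\<And>k. energy p \<mu> (u k) = m_rad TYPE(real ^ 'n) p C (a k) \<mu>"
    and v_def: "\<And>k. v k = (\<lambda>x. u k x / Lnorm 2 (u k))"
  shows "(\<exists>\<epsilon> :: nat \<Rightarrow> real. (\<forall>k. \<epsilon> k > 0) \<and> \<epsilon> \<longlonglongrightarrow> 0 \<and>
            (\<forall>k. - (\<mu>\<^sup>2 * (a k)\<^sup>2 / 8) * (1 + \<epsilon> k) \<le> m_rad TYPE(real ^ 'n) p C (a k) \<mu> \<and>
                 m_rad TYPE(real ^ 'n) p C (a k) \<mu> \<le> - (\<mu>\<^sup>2 * (a k)\<^sup>2 / 8)))
       \<and> (\<forall>k. \<exists>!l. solves_EL p \<mu> l (u k))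
       \<and> filterlim (\<lambda>k. lagrange_multiplier p \<mu> (u k)) (at_left (- (\<mu>\<^sup>2 / 4))) sequentially
       \<and> (\<lambda>k. (Lnorm 2 (weak_laplacian (u k)))\<^sup>2 / (Lnorm 2 (u k))\<^sup>2) \<longlonglongrightarrow> \<mu>\<^sup>2 / 4
       \<and> (\<lambda>k. (Lnorm 2 (weak_grad (u k)))\<^sup>2 / (Lnorm 2 (u k))\<^sup>2) \<longlonglongrightarrow> \<mu> / 2
       \<and> (\<forall>q. 2 < q \<and> q < crit_exp N \<longrightarrow>
            (\<forall>k. v k \<in> Lspace q) \<and> (\<lambda>k. Lnorm q (v k)) \<longlonglongrightarrow> 0)
       \<and> (\<forall>k. integrable lborel (\<lambda>\<xi>. ((norm \<xi>)\<^sup>2 - \<mu> / 2)\<^sup>2 * (cmod (fourier (v k) \<xi>))\<^sup>2))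
       \<and> (\<lambda>k. LINT \<xi>|lborel. ((norm \<xi>)\<^sup>2 - \<mu> / 2)\<^sup>2 * (cmod (fourier (v k) \<xi>))\<^sup>2) \<longlonglongrightarrow> 0"
proof -
  define s where "s = p * gamma_exp DIM(real ^ 'n) p"
  have dim: "DIM(real ^ 'n) = N" using assms(1) by simp
  have sN: "s = p * gamma_exp N p" unfolding s_def dim ..
  have "p < crit_exp N" using assms(4) by simp
  note ex = exponent_bounds[OF assms(2,3) this, folded sN]
  have p0: "p > 0" using ex by simp
  note GN = assms(6) and a = assms(7) and \<mu> = assms(5) and u = assms(10) and E = assms(11)
  have cond: "\<mu> powr (p * gamma_exp DIM(real ^ 'n) p - 2) * a k powr (p - 2) < C_tilde DIM(real ^ 'n) p C" for k
    using assms(9) unfolding dim .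
  note ex' = ex[unfolded s_def]
  have uk: "u k \<in> H2" "sqnorm (u k) = (a k)\<^sup>2" for k using u[of k] by (auto simp: A_rad_iff H2_rad_def)
  have ak: "(a k)\<^sup>2 > 0" for k using a[of k] by simp
  have Lu: "Lnorm 2 (u k) = a k" for k using a[of k] by (simp add: Lnorm_2_eq uk)
  define M where "M k = m_rad TYPE(real ^ 'n) p C (a k) \<mu>" for k
  \<comment> \<open>All quantities are normalised by the mass: \<open>Q\<close> measures the
    nonlinearity and \<open>Z\<close> the defect of \<open>u\<close> from being an eigenfunction.
    Then Q = O(a^(p-2)) and Z \<le> 2 Q / p, so both tend to 0, and each limit below is an
    expression in these two.\<close>
  define Q where "Q k = Lnorm p (u k) powr p / (a k)\<^sup>2" for k
  define Z where "Z k = sqnorm (\<lambda>x. weak_laplacian (u k) x + \<mu> / 2 * u k x) / (a k)\<^sup>2" for k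
  have PQ: "Lnorm p (u k) powr p = Q k * (a k)\<^sup>2" for k using a[of k] by (simp add: Q_def)
  note est = minimizer_estimates[OF GN p0 ex'(2) a \<mu> cond u E]
  have M_up: "M k \<le> - (\<mu>\<^sup>2 * (a k)\<^sup>2 / 8)" for k
    unfolding M_def by (rule m_rad_upper_bound[OF GN p0 ex'(2) a \<mu> cond])
  have Qpos: "Q k > 0" for k using est(1)[of k] ak[of k] unfolding Q_def by (rule divide_pos_pos)
  have M_low: "- (\<mu>\<^sup>2 * (a k)\<^sup>2 / 8) - Q k * (a k)\<^sup>2 / p \<le> M k" for k
    using est(2)[of k] unfolding M_def PQ .
  have Q0: "Q \<longlonglongrightarrow> 0"
  proof (rule Lim_null_comparison)
    define K where "K = C powr p * (\<mu> * (s - 1) / (s - 2)) powr s"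
    have "norm (Q k) \<le> K * a k powr (p - 2)" for k
    proof -
      have "Lnorm p (u k) powr p \<le> K * a k powr p"
        unfolding K_def s_def by (rule A_rad_power_bound[OF GN p0 ex'(2) a \<mu> cond u])
      also have "\<dots> = K * a k powr (p - 2) * (a k)\<^sup>2" using a[of k] by (simp add: powr_diff)
      finally have "Q k \<le> K * a k powr (p - 2)" using ak[of k] by (simp add: Q_def pos_divide_le_eq)
      then show ?thesis using Qpos[of k] by simp
    qed
    then show "\<forall>\<^sub>F k in sequentially. norm (Q k) \<le> K * a k powr (p - 2)" by simp
    have "(\<lambda>k. K * a k powr (p - 2)) \<longlonglongrightarrow> K * 0"
      using ex(1) less_imp_le[OF a] by (intro tendsto_mult tendsto_const tendsto_zero_powrI[OF assms(8) tendsto_const]) auto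
    then show "(\<lambda>k. K * a k powr (p - 2)) \<longlonglongrightarrow> 0" by simp
  qed
  have Z_nonneg: "Z k \<ge> 0" for k by (simp add: Z_def)
  have Z0: "Z \<longlonglongrightarrow> 0"
  proof (rule Lim_null_comparison)
    have "Z k \<le> 2 / p * Q k" for k
    proof -
      have "Z k \<le> 2 * Lnorm p (u k) powr p / p / (a k)\<^sup>2" unfolding Z_def by (intro divide_right_mono est(3)) simp
      then show ?thesis by (simp add: Q_def)
    qed
    then show "\<forall>\<^sub>F k in sequentially. norm (Z k) \<le> 2 / p * Q k" using Z_nonneg by simp
    show "(\<lambda>k. 2 / p * Q k) \<longlonglongrightarrow> 0" using tendsto_mult_left[OF Q0, of "2 / p"] by simp
  qed
  have c1: "\<exists>\<epsilon> :: nat \<Rightarrow> real. (\<forall>k. \<epsilon> k > 0) \<and> \<epsilon> \<longlonglongrightarrow> 0 \<and>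
      (\<forall>k. - (\<mu>\<^sup>2 * (a k)\<^sup>2 / 8) * (1 + \<epsilon> k) \<le> m_rad TYPE(real ^ 'n) p C (a k) \<mu> \<and>
        m_rad TYPE(real ^ 'n) p C (a k) \<mu> \<le> - (\<mu>\<^sup>2 * (a k)\<^sup>2 / 8))"
  \<comment> \<open>This choice makes the claimed lower bound coincide with \<open>M_low\<close>; it
    is positive because \<open>Q\<close> is.\<close>
  proof (intro exI[of _ "\<lambda>k. 8 / (p * \<mu>\<^sup>2) * Q k"] conjI allI)
    show "8 / (p * \<mu>\<^sup>2) * Q k > 0" for k using Qpos[of k] p0 \<mu> by simp
    show "(\<lambda>k. 8 / (p * \<mu>\<^sup>2) * Q k) \<longlonglongrightarrow> 0" using tendsto_mult_left[OF Q0, of "8 / (p * \<mu>\<^sup>2)"] by simp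
    have "- (\<mu>\<^sup>2 * (a k)\<^sup>2 / 8) * (1 + 8 / (p * \<mu>\<^sup>2) * Q k) = - (\<mu>\<^sup>2 * (a k)\<^sup>2 / 8) - Q k * (a k)\<^sup>2 / p" for k
      using p0 \<mu> by (simp add: field_simps)
    then show "- (\<mu>\<^sup>2 * (a k)\<^sup>2 / 8) * (1 + 8 / (p * \<mu>\<^sup>2) * Q k) \<le> m_rad TYPE(real ^ 'n) p C (a k) \<mu>" for k
      using M_low[of k] unfolding M_def by simp
    show "m_rad TYPE(real ^ 'n) p C (a k) \<mu> \<le> - (\<mu>\<^sup>2 * (a k)\<^sup>2 / 8)" for k using M_up unfolding M_def .
  qed
  note EL = minimizer_Euler_Lagrange[OF GN ex'(1,2,3) a \<mu> cond u E]
  have c3: "filterlim (\<lambda>k. lagrange_multiplier p \<mu> (u k)) (at_left (- (\<mu>\<^sup>2 / 4))) sequentially"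
  proof -
    define l where "l k = lagrange_multiplier p \<mu> (u k)" for k
    have l: "l k * (a k)\<^sup>2 = 2 * M k - (1 - 2 / p) * (Q k * (a k)\<^sup>2)" for k
      using est(4)[of k] a[of k] unfolding l_def EL(2) M_def PQ by simp
    have low: "- (\<mu>\<^sup>2 / 4) - Q k \<le> l k" for k
    proof -
      have "(- (\<mu>\<^sup>2 / 4) - Q k) * (a k)\<^sup>2 \<le> l k * (a k)\<^sup>2"
        unfolding l using M_low[of k] by (simp add: algebra_simps)
      then show ?thesis using ak[of k] by (simp only: mult_le_cancel_right_pos)
    qed
    \<comment> \<open>The filter \<open>at_left\<close> demands strict inequality for late
      \<open>k\<close>; it comes from the surplus (1 - 2/p) Q, which is positive because p >
      2.\<close>
    have up: "l k < - (\<mu>\<^sup>2 / 4)" for k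
    proof -
      have "(1 - 2 / p) * (Q k * (a k)\<^sup>2) > 0" using ex(1) Qpos[of k] ak[of k] by (intro mult_pos_pos) auto
      then have "l k * (a k)\<^sup>2 < - (\<mu>\<^sup>2 / 4) * (a k)\<^sup>2" unfolding l using M_up[of k] by simp
      then show ?thesis using ak[of k] by (simp only: mult_less_cancel_right_pos)
    qed
    have "l \<longlonglongrightarrow> - (\<mu>\<^sup>2 / 4)"
    proof (rule tendsto_sandwich)
      show "\<forall>\<^sub>F k in sequentially. - (\<mu>\<^sup>2 / 4) - Q k \<le> l k" using low by simp
      show "\<forall>\<^sub>F k in sequentially. l k \<le> - (\<mu>\<^sup>2 / 4)" using less_imp_le[OF up] by simp
      show "(\<lambda>k. - (\<mu>\<^sup>2 / 4) - Q k) \<longlonglongrightarrow> - (\<mu>\<^sup>2 / 4)" using tendsto_diff[OF tendsto_const Q0, of "- (\<mu>\<^sup>2 / 4)"] by simp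
    qed (rule tendsto_const)
    then show ?thesis unfolding filterlim_at l_def[symmetric] using up by (auto simp: less_imp_neq)
  qed
  have lap: "(\<lambda>k. sqnorm (weak_laplacian (u k)) / (a k)\<^sup>2) \<longlonglongrightarrow> \<mu>\<^sup>2 / 4"
  proof -
    have "(\<lambda>k. sqrt (sqnorm (weak_laplacian (u k))) / a k - \<mu> / 2) \<longlonglongrightarrow> 0"
    proof (rule Lim_null_comparison)
      have "norm (sqrt (sqnorm (weak_laplacian (u k))) / a k - \<mu> / 2) \<le> sqrt (Z k)" for k
      proof -
        have "sqrt (sqnorm (weak_laplacian (u k))) / a k - \<mu> / 2 = (sqrt (sqnorm (weak_laplacian (u k))) - \<mu> / 2 * sqrt (sqnorm (u k))) / a k"
          using a[of k] by (simp add: uk field_simps)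
        also have "norm \<dots> = \<bar>sqrt (sqnorm (weak_laplacian (u k))) - \<mu> / 2 * sqrt (sqnorm (u k))\<bar> / a k"
          using a[of k] by simp
        also have "\<dots> \<le> sqrt (sqnorm (\<lambda>x. weak_laplacian (u k) x + \<mu> / 2 * u k x)) / a k"
          using a[of k] \<mu> by (intro divide_right_mono laplacian_norm_near uk) auto
        also have "\<dots> = sqrt (Z k)" using a[of k] by (simp add: Z_def real_sqrt_divide)
        finally show ?thesis .
      qed
      then show "\<forall>\<^sub>F k in sequentially. norm (sqrt (sqnorm (weak_laplacian (u k))) / a k - \<mu> / 2) \<le> sqrt (Z k)" by simp
      show "(\<lambda>k. sqrt (Z k)) \<longlonglongrightarrow> 0" using tendsto_real_sqrt[OF Z0] by simp
    qed
    then have "(\<lambda>k. sqrt (sqnorm (weak_laplacian (u k))) / a k) \<longlonglongrightarrow> \<mu> / 2" by (rule LIM_zero_cancel)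
    from tendsto_power[OF this, of 2] show ?thesis by (simp add: power_divide)
  qed
  have grad: "(\<lambda>k. sqnorm (weak_grad (u k)) / (a k)\<^sup>2) \<longlonglongrightarrow> \<mu> / 2"
  proof -
    \<comment> \<open>Expanding the completed square expresses \<open>Z\<close> through the two
      quotients, and the gradient enters linearly with factor \<mu>; its limit follows from that of
      the Laplacian.\<close>
    have "sqnorm (weak_grad (u k)) / (a k)\<^sup>2 = (sqnorm (weak_laplacian (u k)) / (a k)\<^sup>2 + \<mu>\<^sup>2 / 4 - Z k) / \<mu>" for k
      unfolding Z_def sqnorm_shifted_laplacian[OF uk(1)] uk(2) using a[of k] \<mu> by (simp add: field_simps power2_eq_square)
    moreover have "(\<lambda>k. (sqnorm (weak_laplacian (u k)) / (a k)\<^sup>2 + \<mu>\<^sup>2 / 4 - Z k) / \<mu>) \<longlonglongrightarrow> (\<mu>\<^sup>2 / 4 + \<mu>\<^sup>2 / 4 - 0) / \<mu>"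
      using \<mu> by (intro tendsto_intros lap Z0) auto
    moreover have "(\<mu>\<^sup>2 / 4 + \<mu>\<^sup>2 / 4 - 0) / \<mu> = \<mu> / 2" using \<mu> by (simp add: power2_eq_square)
    ultimately show ?thesis by (simp only:)
  qed
  have v: "v k = (\<lambda>x. (1 / a k) * u k x)" for k unfolding v_def Lu by simp
  have ia: "1 / a k \<ge> 0" for k using a[of k] by simp
  have vH: "v k \<in> H2" for k unfolding v by (rule H2_cmult(1)[OF uk(1)])
  have vn: "sqnorm (v k) \<le> 1" for k unfolding v sqnorm_cmult uk using a[of k] by (simp add: power_divide)
  have vlap: "sqnorm (weak_laplacian (v k)) = sqnorm (weak_laplacian (u k)) / (a k)\<^sup>2" for k
    unfolding v H2_scale(1)[OF uk(1) p0 ia] by (simp add: power_divide)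
  have vshift: "sqnorm (\<lambda>x. weak_laplacian (v k) x + \<mu> / 2 * v k x) = Z k" for k
    unfolding v H2_scale(4)[OF uk(1) p0 ia] Z_def by (simp add: power_divide)
  obtain D where D: "\<And>k. sqnorm (weak_laplacian (v k)) \<le> D"
  proof -
    from lap have "Bseq (\<lambda>k. sqnorm (weak_laplacian (u k)) / (a k)\<^sup>2)" by (intro convergent_imp_Bseq convergentI)
    then obtain D where D: "\<forall>k. norm (sqnorm (weak_laplacian (u k)) / (a k)\<^sup>2) \<le> D" by (rule BseqE)
    show ?thesis
    proof (rule that)
      show "sqnorm (weak_laplacian (v k)) \<le> D" for k
        unfolding vlap using order_trans[OF abs_ge_self D[unfolded real_norm_def, rule_format]] .
    qed
  qed
  have lim: "(\<lambda>k. sqnorm (\<lambda>x. weak_laplacian (v k) x + \<mu> / 2 * v k x)) \<longlonglongrightarrow> 0" unfolding vshift by (rule Z0)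
  have m: "\<mu> / 2 > 0" using \<mu> by simp
  have "DIM(real ^ 'n) \<ge> 5" using assms(2) dim by simp
  note van = Lq_vanishing[OF this vH vn D m lim, unfolded dim]
  have "(\<lambda>k. (2 * pi) powr real DIM(real ^ 'n) * Z k) \<longlonglongrightarrow> 0"
    using tendsto_mult_left[OF Z0, of "(2 * pi) powr real DIM(real ^ 'n)"] by simp
  then have F: "(\<lambda>k. LINT \<xi>|lborel. ((norm \<xi>)\<^sup>2 - \<mu> / 2)\<^sup>2 * (cmod (fourier (v k) \<xi>))\<^sup>2) \<longlonglongrightarrow> 0"
    unfolding fourier_shifted_laplacian(2)[OF vH] vshift .
  show ?thesis
    unfolding Lnorm_2_squared uk(2) Lu
    using c1 EL(1) c3 lap grad van fourier_shifted_laplacian(1)[OF vH] F by blast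
qed

end
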